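(* Let $\sigma\in\{1,-1\}$, let $\Omega\Subset\mathbb{C}$ be a strictly convex open set with real analytic boundary, let $q=1_\Omega$, and let $\epsilon\in\,]0,1]$. For $k\in\mathbb{C}$ with $h=1/|k|$ small enough, let $(\phi_1,\phi_2)=(1+\phi_1^1,\phi_2^1)$ be the unique solution, with $\phi_1^1,\phi_2^1\in\langle\cdot\rangle^\epsilon L^2$, of the system $$\begin{cases}\overline\partial\phi_1=\frac12q\,e^{\overline{kz}-kz}\phi_2,\\ \partial\phi_2=\frac{\sigma}{2}\overline q\,e^{kz-\overline{kz}}\phi_1.\end{cases}$$ Then, as $h\to0$, $$\phi_2^1=\frac{\sigma}{2k}e^{i|k|\mathrm{Re}(\cdot\,\overline\omega)}1_\Omega+\mathcal{O}(1)h^{3/2}(\ln(1/h))^{1/2}\quad\text{in }\langle\cdot\rangle^\epsilon L^2,$$ $$\phi_1^1=\frac{\sigma h}{4k}E(1_\Omega)+\mathcal{O}(1)h^{3/2}(\ln(1/h))^{1/2}\quad\text{in }\langle\cdot\rangle^\epsilon L^2.$$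
   Context: Notation: $z=x+iy\in\mathbb{C}\simeq\mathbb{R}^2$, $\partial=\frac12(\partial_x-i\partial_y)$, $\overline\partial=\frac12(\partial_x+i\partial_y)$ (in the sense of distributions), $\langle z\rangle=(1+|z|^2)^{1/2}$. For $\theta\in\mathbb{R}$, $\langle\cdot\rangle^\theta L^2=\{\langle z\rangle^\theta u:\ u\in L^2(\mathbb{C})\}$ with norm $\|v\|_{\langle\cdot\rangle^\theta L^2}=\|\langle\cdot\rangle^{-\theta}v\|_{L^2}$. For $k\neq0$: $h=1/|k|$, $\omega=2i\overline k/|k|$, so that $kz-\overline{kz}=i|k|\mathrm{Re}(z\overline\omega)$. The operator $E$ is the inverse of $h\overline\partial$ given by $Ev(z)=\frac{1}{\pi h}\int\frac{v(w)}{z-w}L(dw)$ ($L(dw)$ Lebesgue measure), so $hE(1_\Omega)(z)=\frac1\pi\int_\Omega\frac{L(dw)}{z-w}$. $\Omega$ is nonempty and bounded, and "strictly convex" means that the boundary curve has nowhere vanishing curvature (for a positively oriented arclength parametrization $\gamma$ of $\partial\Omega$, $\ddot\gamma$ is everywhere a strictly positive multiple of the interior unit normal $i\dot\gamma$). For such $\Omega$ and each fixed $\epsilon\in\,]0,1]$, the system has, for $h$ small enough, exactly one solution of the form $(1+\phi_1^1,\phi_2^1)$ with $\phi_1^1,\phi_2^1\in\langle\cdot\rangle^\epsilon L^2$. "$R=\mathcal{O}(1)g(h)$ in $\langle\cdot\rangle^\epsilon L^2$" means $\|R\|_{\langle\cdot\rangle^\epsilon L^2}\le Cg(h)$ with $C$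 depending only on $\Omega,\epsilon$, uniformly in $k$ with $h=1/|k|$ small. *)

theory Defs
  imports "HOL-Analysis.Analysis"
begin

section \<open>Weighted \<open>L\<^sup>2\<close> spaces on the complex plane\<close>

definition L2 :: "(complex \<Rightarrow> complex) set" where
  "L2 = {u. u \<in> borel_measurable lebesgue \<and> integrable lebesgue (\<lambda>z. (cmod (u z))\<^sup>2)}"

definition L2_norm :: "(complex \<Rightarrow> complex) \<Rightarrow> real" where
  "L2_norm u = sqrt (LINT z|lebesgue. (cmod (u z))\<^sup>2)"

definition jap :: "complex \<Rightarrow> real" where
  "jap z = sqrt (1 + (cmod z)\<^sup>2)"

definition weighted_L2 :: "real \<Rightarrow> (complex \<Rightarrow> complex) set" where
  "weighted_L2 \<theta> = {(\<lambda>z. complex_of_real (jap z powr \<theta>) * u z) |u. u \<in> L2}"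

definition weighted_L2_norm :: "real \<Rightarrow> (complex \<Rightarrow> complex) \<Rightarrow> real" where
  "weighted_L2_norm \<theta> v = L2_norm (\<lambda>z. complex_of_real (jap z powr (- \<theta>)) * v z)"

section \<open>Wirtinger derivatives, classical and distributional\<close>

definition partial_x :: "(complex \<Rightarrow> complex) \<Rightarrow> complex \<Rightarrow> complex" where
  "partial_x f z = frechet_derivative f (at z) 1"

definition partial_y :: "(complex \<Rightarrow> complex) \<Rightarrow> complex \<Rightarrow> complex" where
  "partial_y f z = frechet_derivative f (at z) \<i>"

definition wirtinger :: "(complex \<Rightarrow> complex) \<Rightarrow> complex \<Rightarrow> complex" where
  "wirtinger f z = (partial_x f z - \<i> * partial_y f z) / 2"

definition wirtinger_bar :: "(complex \<Rightarrow> complex) \<Rightarrow> complex \<Rightarrow> complex" where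
  "wirtinger_bar f z = (partial_x f z + \<i> * partial_y f z) / 2"

text \<open>\<open>f differentiable_on UNIV\<close> is real (Frechet) differentiability, not holomorphy.\<close>

primrec C_k :: "nat \<Rightarrow> (complex \<Rightarrow> complex) \<Rightarrow> bool" where
  "C_k 0 f \<longleftrightarrow> continuous_on UNIV f"
| "C_k (Suc n) f \<longleftrightarrow> f differentiable_on UNIV \<and> C_k n (partial_x f) \<and> C_k n (partial_y f)"

definition test_function :: "(complex \<Rightarrow> complex) \<Rightarrow> bool" where
  "test_function \<psi> \<longleftrightarrow> (\<forall>n. C_k n \<psi>) \<and> compact (closure {z. \<psi> z \<noteq> 0})"

definition locally_integrable :: "(complex \<Rightarrow> complex) \<Rightarrow> bool" where
  "locally_integrable u \<longleftrightarrow> (\<forall>K. compact K \<longrightarrow> set_integrable lebesgue K u)"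

definition has_weak_wirtinger ::
  "(complex \<Rightarrow> complex) \<Rightarrow> (complex \<Rightarrow> complex) \<Rightarrow> bool" where
  "has_weak_wirtinger u f \<longleftrightarrow> locally_integrable u \<and> locally_integrable f \<and>
     (\<forall>\<psi>. test_function \<psi> \<longrightarrow>
        (LINT z|lebesgue. u z * wirtinger \<psi> z) = - (LINT z|lebesgue. f z * \<psi> z))"

definition has_weak_wirtinger_bar ::
  "(complex \<Rightarrow> complex) \<Rightarrow> (complex \<Rightarrow> complex) \<Rightarrow> bool" where
  "has_weak_wirtinger_bar u f \<longleftrightarrow> locally_integrable u \<and> locally_integrable f \<and>
     (\<forall>\<psi>. test_function \<psi> \<longrightarrow>
        (LINT z|lebesgue. u z * wirtinger_bar \<psi> z) = - (LINT z|lebesgue. f z * \<psi> z))"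

section \<open>The Dirac system and the operator \<open>E\<close>\<close>

definition dirac_system ::
  "complex \<Rightarrow> (complex \<Rightarrow> complex) \<Rightarrow> complex \<Rightarrow> (complex \<Rightarrow> complex) \<Rightarrow> (complex \<Rightarrow> complex) \<Rightarrow> bool" where
  "dirac_system \<sigma> q k \<phi>\<^sub>1 \<phi>\<^sub>2 \<longleftrightarrow>
     has_weak_wirtinger_bar \<phi>\<^sub>1 (\<lambda>z. 1 / 2 * q z * exp (cnj (k * z) - k * z) * \<phi>\<^sub>2 z) \<and>
     has_weak_wirtinger \<phi>\<^sub>2 (\<lambda>z. \<sigma> / 2 * cnj (q z) * exp (k * z - cnj (k * z)) * \<phi>\<^sub>1 z)"

definition E_op :: "real \<Rightarrow> (complex \<Rightarrow> complex) \<Rightarrow> complex \<Rightarrow> complex" where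
  "E_op h v z = 1 / complex_of_real (pi * h) * (LINT w|lebesgue. v w / (z - w))"

section \<open>Strictly convex domains with real analytic boundary\<close>

definition real_analytic :: "(real \<Rightarrow> complex) \<Rightarrow> bool" where
  "real_analytic \<gamma> \<longleftrightarrow>
     (\<forall>t\<^sub>0. \<exists>a r. 0 < r \<and>
        (\<forall>t. \<bar>t - t\<^sub>0\<bar> < r \<longrightarrow> (\<lambda>n. a n * complex_of_real (t - t\<^sub>0) ^ n) sums \<gamma> t))"

abbreviation velocity :: "(real \<Rightarrow> complex) \<Rightarrow> real \<Rightarrow> complex" where
  "velocity \<gamma> t \<equiv> vector_derivative \<gamma> (at t)"

text \<open>The last clause says that \<open>\<i> \<gamma>'\<close> points into \<open>\<Omega>\<close>, i.e. \<open>\<gamma>\<close> is positively oriented.\<close>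

definition arclength_boundary_param :: "complex set \<Rightarrow> real \<Rightarrow> (real \<Rightarrow> complex) \<Rightarrow> bool" where
  "arclength_boundary_param \<Omega> L \<gamma> \<longleftrightarrow>
     0 < L \<and> (\<forall>t. \<gamma> (t + L) = \<gamma> t) \<and> inj_on \<gamma> {0..<L} \<and> range \<gamma> = frontier \<Omega> \<and>
     (\<forall>t. \<gamma> differentiable (at t) \<and> cmod (velocity \<gamma> t) = 1 \<and>
        (\<forall>\<^sub>F r in at_right 0. \<gamma> t + complex_of_real r * (\<i> * velocity \<gamma> t) \<in> \<Omega>))"

text \<open>Analyticity of \<open>\<gamma>\<close> makes the second \<open>vector_derivative\<close> below a genuine derivative.\<close>

definition strictly_convex_analytic_domain :: "complex set \<Rightarrow> bool" where
  "strictly_convex_analytic_domain \<Omega> \<longleftrightarrow>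
     open \<Omega> \<and> bounded \<Omega> \<and> \<Omega> \<noteq> {} \<and> convex \<Omega> \<and>
     (\<exists>L \<gamma>. arclength_boundary_param \<Omega> L \<gamma> \<and> real_analytic \<gamma> \<and>
        (\<forall>t. \<exists>\<kappa>>0. vector_derivative (velocity \<gamma>) (at t)
                      = complex_of_real \<kappa> * (\<i> * velocity \<gamma> t)))"

end

theory Submission
  imports Defs "HOL-Real_Asymp.Real_Asymp"
begin

text \<open>
  Inverting \<open>\<partial>\<close> and its conjugate by the Cauchy transform turns the system into two coupled integral
  equations on \<open>\<Omega>\<close>, each of them carrying the unimodular factor \<open>e = exp (cnj (k z) - k z)\<close>. Two gains
  in \<open>h\<close> are available. First, \<open>e\<close> changes sign under a translation by \<open>\<tau> = \<i> \<pi> / (2 k)\<close> of length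
  \<open>O(h)\<close>; averaging over this translation, and using that convexity of \<open>\<Omega>\<close> controls the set moved
  across the boundary, shows that the composition of two oscillating Cauchy transforms is of size
  \<open>(h ln (1/h))\<close> in squared norm. Second, Green's formula on \<open>\<Omega>\<close> gives
  \<open>cauchyT (1\<^sub>\<Omega> e) = 1\<^sub>\<Omega> e / cnj k\<close> up to a Cauchy integral of \<open>e\<close> over the boundary curve. Positive
  curvature makes the critical points of the phase on that curve nondegenerate, and an integration by
  parts, cut off at the singularity of the kernel and at the critical points, bounds this integral
  on horizontal lines and hence in the weighted norm. The theorem follows by absorbing the small term.
\<close>

text \<open>The error is governed by one rate: the boundary integral and the composed operator both
  have squared norm of order h ln (1/h). The former is divided by k and the latter acts on data of
  size h, so the squared error is h^3 ln (1/h). The logarithms reflect two borderline divergences,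
  of |z|^-2 at 0 in the plane and of 1/|y| at 0 on the line. In the composition the unknown factor
  is known only as the Cauchy transform of an L2 function. It need not be differentiable, but it has
  half a Hoelder derivative in an averaged sense; hence a translation instead of an integration by
  parts, and kernels |z - w|^(-3/2). The boundary integral is singular at the curve, so it is
  measured in L2 along horizontal lines rather than pointwise. The curve is cut into short arcs,
  each brought by quarter turns into a position where height is a coordinate on it. Conjugating the
  second equation leaves a single operator to invert. In the equation for the first component the
  exponential meets its own conjugate in the leading part of the second component; the product is 1
  on the domain, so the leading term there does not oscillate.\<close>

abbreviation (input) en :: "real => ennreal" where "en == ennreal"
abbreviation (input) ind :: "'a set => 'a => 'b::zero_neq_one" where "ind == indicator"
abbreviation (input) cr :: "real => complex" where "cr == complex_of_real"

abbreviation (input) nn_lborel :: "('a::euclidean_space => ennreal) => ennreal" (binder "II " 10) where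
 "nn_lborel f == nn_integral lborel f"

abbreviation (input) bmeas :: "('a::topological_space => 'b::topological_space) set" where
 "bmeas == borel_measurable borel"

section \<open>Lebesgue measure on the plane in real coordinates\<close>

lemma measurable_Complex [measurable (raw)]:
 assumes "f \<in> borel_measurable M" "g \<in> borel_measurable M"
 shows "(%x. Complex (f x) (g x)) \<in> borel_measurable M"
proof -
 have "(%x. cr (f x) + \<i> * cr (g x)) \<in> borel_measurable M"
  using assms by measurable
 then show ?thesis by (simp add: Complex_eq)
qed

text \<open>Both measures agree on boxes, whose sides along the basis vectors \<open>1\<close> and
  \<open>\<i>\<close> are intervals of real and imaginary parts. The identification gives access to
  Fubini in these two coordinates.\<close>

lemma lborel_complex_eq_distr:
 "distr (lborel \<Otimes>\<^sub>M lborel) borel (%(x, y). Complex x y) = (lborel :: complex measure)"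
proof (rule lborel_eqI[symmetric])
 fix l u :: complex
 assume le: "!!b. b \<in> Basis ==> l \<bullet> b <= u \<bullet> b"
 have le': "Re l <= Re u" "Im l <= Im u"
  using le[of 1] le[of \<i>] by (auto simp: Basis_complex_def inner_complex_def)
 have [measurable]: "(%(x, y). Complex x y) \<in> (lborel \<Otimes>\<^sub>M lborel) \<rightarrow>\<^sub>M borel"
  by measurable
 have "emeasure (distr (lborel \<Otimes>\<^sub>M lborel) borel (%(x, y). Complex x y)) (box l u)
   = emeasure (lborel \<Otimes>\<^sub>M lborel) ({Re l<..<Re u} \<times> {Im l<..<Im u})"
  by (subst emeasure_distr)
   (auto intro!: arg_cong2[where f=emeasure] simp: space_pair_measure in_box_complex_iff)
 also have "... = emeasure lborel {Re l<..<Re u} * emeasure lborel {Im l<..<Im u}"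
  by (rule lborel.emeasure_pair_measure_Times) auto
 also have "... = en ((Re u - Re l) * (Im u - Im l))"
  using le' by (simp add: ennreal_mult)
 also have "(Re u - Re l) * (Im u - Im l) = prod ((\<bullet>) (u - l)) Basis"
  by (simp add: Basis_complex_def inner_complex_def)
 finally show "emeasure (distr (lborel \<Otimes>\<^sub>M lborel) borel (%(x, y). Complex x y)) (box l u)
   = (\<Prod>b\<in>Basis. (u - l) \<bullet> b)" .
qed simp

lemma nn_integral_complex:
 assumes [measurable]: "f \<in> bmeas"
 shows "(II z. f z) = (II y. II x. f (Complex x y))"
  and "(II z. f z) = (II x. II y. f (Complex x y))"
proof -
 have [measurable]: "(%(x, y). Complex x y) \<in> (lborel \<Otimes>\<^sub>M lborel) \<rightarrow>\<^sub>M borel"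
  by measurable
 have *: "(II z. f z) = (\<integral>\<^sup>+p. f (case p of (x, y) => Complex x y) \<partial>(lborel \<Otimes>\<^sub>M lborel))"
  by (subst lborel_complex_eq_distr[symmetric], subst nn_integral_distr) auto
 show "(II z. f z) = (II y. II x. f (Complex x y))"
  unfolding * by (subst lborel_pair.nn_integral_snd[symmetric]) auto
 show "(II z. f z) = (II x. II y. f (Complex x y))"
  unfolding * by (subst lborel.nn_integral_fst[symmetric]) auto
qed

lemma lborel_integral_complex:
 fixes f :: "complex => 'a::{banach, second_countable_topology}"
 assumes f: "integrable lborel f"
 shows "(LINT z|lborel. f z) = (LINT y|lborel. LINT x|lborel. f (Complex x y))"
  and "(LINT z|lborel. f z) = (LINT x|lborel. LINT y|lborel. f (Complex x y))"
  and "AE y in lborel. integrable lborel (%x. f (Complex x y))"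
  and "integrable lborel (%y. LINT x|lborel. f (Complex x y))"
proof -
 have [measurable]: "f \<in> bmeas" using f by auto
 have [measurable]: "(%(x, y). Complex x y) \<in> (lborel \<Otimes>\<^sub>M lborel) \<rightarrow>\<^sub>M borel"
  by measurable
 have i: "integrable (lborel \<Otimes>\<^sub>M lborel) (%(x, y). f (Complex x y))"
  using f by (subst (asm) lborel_complex_eq_distr[symmetric], subst (asm) integrable_distr_eq)
    (auto simp: case_prod_beta')
 have *: "(LINT z|lborel. f z) = (LINT p|(lborel \<Otimes>\<^sub>M lborel). (case p of (x, y) => f (Complex x y)))"
  by (subst lborel_complex_eq_distr[symmetric], subst integral_distr) (auto simp: case_prod_beta')
 show "(LINT z|lborel. f z) = (LINT y|lborel. LINT x|lborel. f (Complex x y))"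
  unfolding * using lborel_pair.integral_snd[OF i] by simp
 show "(LINT z|lborel. f z) = (LINT x|lborel. LINT y|lborel. f (Complex x y))"
  unfolding * using lborel_pair.integral_fst'[OF i] by simp
 show "AE y in lborel. integrable lborel (%x. f (Complex x y))"
  using lborel_pair.AE_integrable_snd[OF i] by simp
 show "integrable lborel (%y. LINT x|lborel. f (Complex x y))"
  using lborel_pair.integrable_snd[OF i] by simp
qed

lemma nn_integral_complex_affine:
 fixes f :: "complex => ennreal"
 assumes [measurable]: "f \<in> bmeas" and c: "c ~= 0"
 shows "(II z. f z) = en (c\<^sup>2) * (II z. f (t + c *\<^sub>R z))"
 by (subst lborel_affine[OF c, of t])
   (simp add: nn_integral_density nn_integral_distr nn_integral_cmult ennreal_power)

text \<open>A quarter turn is a swap of the coordinates combined with a reflection, so Fubini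
  suffices. Quarter turns carry Green's formula from one coordinate to the other and bring boundary
  arcs into a standard position.\<close>

lemma nn_integral_complex_mult_ii:
 fixes f :: "complex => ennreal"
 assumes [measurable]: "f \<in> bmeas"
 shows "(II z. f (\<i> * z)) = (II z. f z)"
proof -
 have "(II z. f (\<i> * z)) = (II y. II x. f (Complex (- y) x))"
  by (subst nn_integral_complex) (auto simp: complex_eq_iff intro!: nn_integral_cong arg_cong[where f=f])
 also have "... = (II y. II x. f (Complex y x))"
  by (subst (2) nn_integral_real_affine[where c="-1" and t=0]) auto
 also have "... = (II z. f z)"
  by (subst nn_integral_complex(2)) auto
 finally show ?thesis .
qed

lemma distr_lborel_mult_ii: "distr lborel borel ((*) \<i>) = (lborel :: complex measure)"
proof (rule measure_eqI)
 fix A assume "A \<in> sets (distr lborel borel ((*) \<i>))"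
 then have [measurable]: "A \<in> sets borel" by simp
 have "emeasure (distr lborel borel ((*) \<i>)) A = (\<integral>\<^sup>+z. ind A z \<partial>distr lborel borel ((*) \<i>))"
  by simp
 also have "... = (II z. ind A (\<i> * z))"
  by (subst nn_integral_distr) auto
 also have "... = emeasure lborel A"
  by (subst nn_integral_complex_mult_ii) auto
 finally show "emeasure (distr lborel borel ((*) \<i>)) A = emeasure lborel A" .
qed simp

lemma integral_complex_mult_ii:
 fixes f :: "complex => 'a::{banach, second_countable_topology}"
 assumes [measurable]: "f \<in> bmeas"
 shows "(LINT z|lborel. f (\<i> * z)) = (LINT z|lborel. f z)"
  and "integrable lborel (%z. f (\<i> * z)) \<longleftrightarrow> integrable lborel f"
 using integral_distr[of "(*) \<i>" lborel borel f] integrable_distr_eq[of "(*) \<i>" lborel borel f]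
 by (simp_all add: distr_lborel_mult_ii)

text \<open>Integrate 2ab <= t a^2 + b^2 / t and take t = sqrt (B / A), the minimiser of the right
  side. Working in \<open>ennreal\<close> avoids integrability side conditions, at the price of
  separate cases where A or B is 0 or infinite.\<close>

lemma nn_integral_Cauchy_Schwarz:
 fixes f g :: "'a => ennreal"
 assumes [measurable]: "f \<in> borel_measurable M" "g \<in> borel_measurable M"
 shows "(\<integral>\<^sup>+x. f x * g x \<partial>M)\<^sup>2 <= (\<integral>\<^sup>+x. (f x)\<^sup>2 \<partial>M) * (\<integral>\<^sup>+x. (g x)\<^sup>2 \<partial>M)"
  (is "?I\<^sup>2 <= ?A * ?B")
proof -
 have amgm: "2 * (a * b) <= en t * a\<^sup>2 + en (1 / t) * b\<^sup>2" if "t > 0" for a b :: ennreal and t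
 proof (cases a; cases b)
  fix r s :: real assume *: "a = en r" "b = en s" "0 <= r" "0 <= s"
  have "0 <= (t * r - s)\<^sup>2 / t" using that by simp
  also have "(t * r - s)\<^sup>2 / t = t * r\<^sup>2 + (1 / t) * s\<^sup>2 - 2 * (r * s)"
   using that by (simp add: field_simps power2_eq_square)
  finally have "2 * (r * s) <= t * r\<^sup>2 + (1 / t) * s\<^sup>2" by simp
  then have "en (2 * (r * s)) <= en (t * r\<^sup>2 + (1 / t) * s\<^sup>2)"
   by (rule ennreal_leI)
  then show ?thesis
   using * that by (simp add: ennreal_mult ennreal_power del: times_divide_eq_left)
 qed (use that in \<open>auto simp: ennreal_mult_top ennreal_top_mult power2_eq_square\<close>)
 have key: "2 * ?I <= en t * ?A + en (1 / t) * ?B" if "t > 0" for t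
 proof -
  have "2 * ?I = (\<integral>\<^sup>+x. 2 * (f x * g x) \<partial>M)"
   by (subst nn_integral_cmult) auto
  also have "... <= (\<integral>\<^sup>+x. en t * (f x)\<^sup>2 + en (1 / t) * (g x)\<^sup>2 \<partial>M)"
   by (intro nn_integral_mono amgm that)
  also have "... = en t * ?A + en (1 / t) * ?B"
   by (subst nn_integral_add) (auto simp: nn_integral_cmult)
  finally show ?thesis .
 qed
 have zero: "?I = 0" if "?A = 0 \<or> ?B = 0"
 proof -
  have "AE x in M. f x * g x = 0"
   using that by (auto simp: nn_integral_0_iff_AE elim!: AE_mp)
  then have "?I = (\<integral>\<^sup>+x. 0 \<partial>M)" by (intro nn_integral_cong_AE) auto
  then show ?thesis by simp
 qed
 show ?thesis
 proof (cases "?A = 0 \<or> ?B = 0 \<or> ?A = \<infinity> \<or> ?B = \<infinity>")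
  case True
  then show ?thesis
   using zero by (cases "?A = 0 \<or> ?B = 0") (auto simp: ennreal_mult_top ennreal_top_mult)
 next
  case False
  then obtain a b where ab: "?A = en a" "?B = en b" "a > 0" "b > 0"
   by (cases ?A; cases ?B) (auto simp: less_le)
  have "2 * ?I <= en (sqrt (b / a)) * en a + en (1 / sqrt (b / a)) * en b"
   using key[of "sqrt (b / a)"] ab by simp
  also have "... = en (sqrt (b / a) * a + 1 / sqrt (b / a) * b)"
   using ab by (simp add: ennreal_mult[symmetric] ennreal_plus[symmetric] del: ennreal_plus times_divide_eq_left)
  also have "sqrt (b / a) * a + 1 / sqrt (b / a) * b = 2 * sqrt (a * b)"
  proof -
   have "sqrt (b / a) * a = sqrt (a * b)"
    using ab by (simp add: real_sqrt_divide real_sqrt_mult field_simps)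
   moreover have "1 / sqrt (b / a) * b = sqrt (a * b)"
    using ab by (simp add: real_sqrt_divide real_sqrt_mult field_simps)
   ultimately show ?thesis by simp
  qed
  finally have I2: "2 * ?I <= en (2 * sqrt (a * b))" .
  then have "?I < top"
   by (metis ennreal_less_top ennreal_mult_eq_top_iff infinity_ennreal_def le_less_trans less_top zero_neq_numeral)
  then obtain i where i: "?I = en i" "i \<ge> 0" by (cases ?I) auto
  have "en (2 * i) <= en (2 * sqrt (a * b))" using I2 i by (simp add: ennreal_mult)
  then have "i <= sqrt (a * b)" using ab by simp
  then have "i\<^sup>2 <= a * b" using i ab by (metis power_mono real_sqrt_pow2 mult_nonneg_nonneg less_imp_le)
  then show ?thesis
   unfolding i ab(1,2) using i ab by (simp add: ennreal_power ennreal_mult[symmetric] ennreal_leI)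
 qed
qed

section \<open>Power integrals on the line and in the plane\<close>

lemma nn_integral_even:
 fixes f :: "real => ennreal"
 assumes [measurable]: "f \<in> bmeas" and even: "!!x. f (- x) = f x"
 shows "(II x. f x) = 2 * (II x. f x * ind {0..} x)"
proof -
 have "(II x. f x) = (II x. f x * ind {0..} x + f x * ind {..0} x)"
  using AE_lborel_singleton[of "0::real"]
  by (intro nn_integral_cong_AE) (auto elim!: eventually_mono split: split_indicator)
 also have "... = (II x. f x * ind {0..} x) + (II x. f x * ind {..0} x)"
  by (rule nn_integral_add) auto
 also have "(II x. f x * ind {..0} x) = (II x. f x * ind {0..} x)"
  by (subst nn_integral_real_affine[where c="-1" and t=0])
    (auto simp: even intro!: nn_integral_cong split: split_indicator)
 finally show ?thesis by (simp add: mult_2)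
qed

lemma nn_integral_powr_0_1:
 fixes q R :: real
 assumes "q < 1" "0 <= R"
 shows "(II x. en (x powr (- q)) * ind {0..R} x) = en (R powr (1 - q) / (1 - q))"
 using nn_integral_has_integral_lebesgue'[OF _ has_integral_powr_from_0[of "- q" R]] assms by simp

lemma nn_integral_abs_powr:
 fixes q R :: real
 assumes "q < 1" "0 <= R"
 shows "(II x. en (\<bar>x\<bar> powr (- q)) * ind {-R..R} x) = en (2 * R powr (1 - q) / (1 - q))"
proof -
 have "(II x. en (\<bar>x\<bar> powr (- q)) * ind {-R..R} x)
   = 2 * (II x. en (\<bar>x\<bar> powr (- q)) * ind {-R..R} x * ind {0..} x)"
  by (rule nn_integral_even) (auto split: split_indicator)
 also have "(II x. en (\<bar>x\<bar> powr (- q)) * ind {-R..R} x * ind {0..} x)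
   = (II x. en (x powr (- q)) * ind {0..R} x)"
  using assms by (intro nn_integral_cong) (auto split: split_indicator)
 also have "... = en (R powr (1 - q) / (1 - q))"
  by (rule nn_integral_powr_0_1[OF assms])
 finally show ?thesis
  using assms by (simp add: ennreal_mult'[symmetric] flip: ennreal_numeral)
qed

lemma nn_integral_abs_powr_tail:
 fixes q R :: real
 assumes "1 < q" "0 < R"
 shows "(II x. en (\<bar>x\<bar> powr (- q)) * ind {x. R <= \<bar>x\<bar>} x) = en (2 * R powr (1 - q) / (q - 1))"
proof -
 have "(II x. en (\<bar>x\<bar> powr (- q)) * ind {x. R <= \<bar>x\<bar>} x)
   = 2 * (II x. en (\<bar>x\<bar> powr (- q)) * ind {x. R <= \<bar>x\<bar>} x * ind {0..} x)"
  by (rule nn_integral_even) (auto split: split_indicator)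
 also have "(II x. en (\<bar>x\<bar> powr (- q)) * ind {x. R <= \<bar>x\<bar>} x * ind {0..} x)
   = (II x. en (x powr (- q)) * ind {R..} x)"
  using assms by (intro nn_integral_cong) (auto split: split_indicator)
 also have "... = en (- (R powr (- q + 1)) / (- q + 1))"
  using nn_integral_has_integral_lebesgue'[OF _ has_integral_powr_to_inf[of "- q" R]] assms by simp
 also have "- (R powr (- q + 1)) / (- q + 1) = R powr (1 - q) / (q - 1)"
  using assms by (simp add: field_simps)
 finally show ?thesis
  using assms by (simp add: ennreal_mult'[symmetric] flip: ennreal_numeral)
qed

lemma AE_lborel_ne: "AE x in lborel. x ~= (a :: 'a :: euclidean_space)"
 using AE_lborel_singleton[of a] by simp

lemma cmod_Complex_mult_le: "\<bar>x\<bar> * \<bar>y\<bar> <= (cmod (Complex x y))\<^sup>2"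
proof -
 have "0 <= (\<bar>x\<bar> - \<bar>y\<bar>)\<^sup>2" by simp
 then have "2 * (\<bar>x\<bar> * \<bar>y\<bar>) <= x\<^sup>2 + y\<^sup>2" by (simp add: power2_diff)
 moreover have "0 <= \<bar>x\<bar> * \<bar>y\<bar>" by simp
 ultimately show ?thesis unfolding cmod_power2 complex.sel by linarith
qed

text \<open>\<open>|x + iy|\<^sup>2 \<ge> |x| |y|\<close> reduces integrability of radial powers to a product of one-dimensional integrals.\<close>

lemma cball_borel_measurable [measurable]: "cball (a :: 'a :: euclidean_space) r \<in> sets borel"
 by simp

lemma cmod_powr_integrable_cball:
 assumes "0 <= p" "p < 2"
 shows "(II z. en (cmod z powr (- p)) * ind (cball 0 1) z) < \<infinity>"
proof -
 let ?g = "%x::real. en (\<bar>x\<bar> powr (- (p / 2))) * ind {-1..1} x"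
 have le: "en (cmod (Complex x y) powr (- p)) * ind (cball 0 1) (Complex x y) <= ?g x * ?g y"
  if "x ~= 0" "y ~= 0" for x y
 proof (cases "cmod (Complex x y) <= 1")
  case True
  have xy: "\<bar>x\<bar> <= 1" "\<bar>y\<bar> <= 1"
   using True abs_Re_le_cmod[of "Complex x y"] abs_Im_le_cmod[of "Complex x y"] by auto
  have pos: "0 < \<bar>x\<bar> * \<bar>y\<bar>" using that by simp
  have "cmod (Complex x y) powr (- p) = ((cmod (Complex x y))\<^sup>2) powr (- (p / 2))"
   using that by (simp add: powr_powr flip: powr_numeral)
  also have "... <= (\<bar>x\<bar> * \<bar>y\<bar>) powr (- (p / 2))"
   using assms pos cmod_Complex_mult_le[of x y] by (intro powr_mono2') auto
  also have "... = \<bar>x\<bar> powr (- (p / 2)) * \<bar>y\<bar> powr (- (p / 2))"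
   by (rule powr_mult)
  finally show ?thesis
   using xy True by (auto simp: ennreal_mult[symmetric] abs_le_iff minus_le_iff intro!: ennreal_leI)
 qed auto
 have "(II z. en (cmod z powr (- p)) * ind (cball 0 1) z)
   = (II y. II x. en (cmod (Complex x y) powr (- p)) * ind (cball 0 1) (Complex x y))"
  by (rule nn_integral_complex) measurable
 also have "... <= (II y. II x. ?g x * ?g y)"
 proof (rule nn_integral_mono_AE, rule eventually_mono[OF AE_lborel_ne[of 0]])
  fix y :: real assume "y ~= 0"
  then show "(II x. en (cmod (Complex x y) powr (- p)) * ind (cball 0 1) (Complex x y))
    <= (II x. ?g x * ?g y)"
   by (intro nn_integral_mono_AE eventually_mono[OF AE_lborel_ne[of 0]] le)
 qed
 also have "... = (II x. ?g x) * (II y. ?g y)"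
  by (simp add: nn_integral_cmult nn_integral_multc)
 also have "... < \<infinity>"
  using assms by (subst (1 2) nn_integral_abs_powr) (auto simp: ennreal_mult_less_top)
 finally show ?thesis .
qed

section \<open>The weight, and Schur's test in weighted spaces\<close>

lemma jap_ge_1: "1 <= jap z" and jap_pos: "0 < jap z" and jap_nonneg [simp]: "0 <= jap z"
proof -
 show "1 <= jap z" by (simp add: jap_def)
 then show "0 < jap z" "0 <= jap z" by simp_all
qed

lemma jap_measurable [measurable]: "jap \<in> bmeas"
 unfolding jap_def[abs_def] by measurable

lemma jap_power2: "(jap z)\<^sup>2 = 1 + (cmod z)\<^sup>2"
 by (simp add: jap_def)

lemma jap_le: "jap z <= 1 + cmod z"
 unfolding jap_def by (rule real_le_lsqrt) (auto simp: power2_sum)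

lemma cmod_le_jap: "cmod z <= jap z"
 unfolding jap_def by (rule real_le_rsqrt) auto

text \<open>A lower bound in product form: it reduces the integrability of
  \<open>jap z powr (- q)\<close> for q > 2 to two integrals on the line with exponent q / 2 >
  1.\<close>

lemma jap_Complex_ge: "sqrt (1 + x\<^sup>2) * sqrt (1 + y\<^sup>2) <= (jap (Complex x y))\<^sup>2"
proof -
 have "0 <= (x\<^sup>2 + y\<^sup>2)\<^sup>2 + x\<^sup>2 + y\<^sup>2 + x\<^sup>2 * y\<^sup>2" by simp
 have "(1 + x\<^sup>2) * (1 + y\<^sup>2) <= (1 + x\<^sup>2 + y\<^sup>2)\<^sup>2"
 proof -
  have "(1 + x\<^sup>2 + y\<^sup>2)\<^sup>2 - (1 + x\<^sup>2) * (1 + y\<^sup>2) = x\<^sup>2 + y\<^sup>2 + x^4 + y^4 + x\<^sup>2 * y\<^sup>2"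
   by (simp add: power2_eq_square power4_eq_xxxx algebra_simps)
  also have "... \<ge> 0" by simp
  finally show ?thesis by simp
 qed
 then have "sqrt ((1 + x\<^sup>2) * (1 + y\<^sup>2)) <= sqrt ((1 + x\<^sup>2 + y\<^sup>2)\<^sup>2)"
  by (rule real_sqrt_le_mono)
 then show ?thesis
  by (simp add: jap_power2 cmod_power2 real_sqrt_mult add.assoc)
qed

lemma nn_integral_one_plus_square_powr:
 assumes "1 < q"
 shows "(II x. en ((sqrt (1 + x\<^sup>2)) powr (- q))) < \<infinity>"
proof -
 have "(II x. en ((sqrt (1 + x\<^sup>2)) powr (- q)))
  <= (II x. ind {-1..1} x + en (\<bar>x\<bar> powr (- q)) * ind {x. 1 <= \<bar>x\<bar>} x)"
 proof (rule nn_integral_mono)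
  fix x :: real
  have "sqrt (1 + x\<^sup>2) powr (- q) <= 1 powr (- q)"
   using assms by (intro powr_mono2') auto
  then have 1: "sqrt (1 + x\<^sup>2) powr (- q) <= 1" by simp
  have 2: "sqrt (1 + x\<^sup>2) powr (- q) <= \<bar>x\<bar> powr (- q)" if "1 <= \<bar>x\<bar>"
   using assms that by (intro powr_mono2') (auto intro: real_le_rsqrt)
  show "en ((sqrt (1 + x\<^sup>2)) powr (- q))
    <= ind {-1..1} x + en (\<bar>x\<bar> powr (- q)) * ind {x. 1 <= \<bar>x\<bar>} x"
   using 1 2 by (cases "1 <= \<bar>x\<bar>") (auto split: split_indicator intro: ennreal_leI add_increasing)
 qed
 also have "... = 2 + en (2 / (q - 1))"
  using assms by (subst nn_integral_add) (auto simp: nn_integral_abs_powr_tail)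
 also have "... < \<infinity>" by (auto simp: less_top[symmetric])
 finally show ?thesis .
qed

lemma jap_powr_integrable:
 assumes "2 < q"
 shows "(II z. en (jap z powr (- q))) < \<infinity>"
proof -
 let ?g = "%x::real. en (sqrt (1 + x\<^sup>2) powr (- (q / 2)))"
 have le: "en (jap (Complex x y) powr (- q)) <= ?g x * ?g y" for x y
 proof -
  have "jap (Complex x y) powr (- q) = ((jap (Complex x y))\<^sup>2) powr (- (q / 2))"
   using jap_pos[of "Complex x y"] by (simp add: powr_powr flip: powr_numeral)
  also have "... <= (sqrt (1 + x\<^sup>2) * sqrt (1 + y\<^sup>2)) powr (- (q / 2))"
   using assms jap_Complex_ge[of x y]
   by (intro powr_mono2') (auto intro!: mult_pos_pos add_pos_nonneg)
  also have "... = sqrt (1 + x\<^sup>2) powr (- (q / 2)) * sqrt (1 + y\<^sup>2) powr (- (q / 2))"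
   by (rule powr_mult)
  finally show ?thesis by (simp add: ennreal_mult[symmetric] ennreal_leI)
 qed
 have "(II z. en (jap z powr (- q)))
   = (II y. II x. en (jap (Complex x y) powr (- q)))"
  by (rule nn_integral_complex) measurable
 also have "... <= (II y. II x. ?g x * ?g y)"
  by (intro nn_integral_mono le)
 also have "... = (II x. ?g x) * (II y. ?g y)"
  by (simp add: nn_integral_cmult nn_integral_multc)
 also have "... < \<infinity>"
  using nn_integral_one_plus_square_powr[of "q / 2"] assms by (simp add: ennreal_mult_less_top)
 finally show ?thesis .
qed

lemma nn_integral_translate_reflect:
 fixes f :: "complex => ennreal"
 assumes [measurable]: "f \<in> bmeas"
 shows "(II w. f (z - w)) = (II w. f w)" "(II w. f (w - z)) = (II w. f w)"
  "(II w. f (w + z)) = (II w. f w)"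
 using nn_integral_complex_affine[of f "-1" z] nn_integral_complex_affine[of f 1 "-z"]
  nn_integral_complex_affine[of f 1 "z"]
 by (auto simp: add.commute)

text \<open>The square of \<open>weighted_L2_norm\<close>, taken in \<open>ennreal\<close> over
  \<open>lborel\<close>. It makes sense for every function, so finiteness can be derived instead of
  presupposed.\<close>

definition wN :: "real => (complex => complex) => ennreal" where
 "wN ep f = (II z. en (jap z powr (- 2 * ep) * (cmod (f z))\<^sup>2))"

text \<open>If |z - w| <= 1, then \<open>jap z\<close> is at most 2 + R. Otherwise p >= 1 bounds the
  kernel by 1 / |z - w|, which decays like 1 / \<open>jap z\<close> because w stays in a fixed
  disc.\<close>

lemma jap_kernel_bound:
 assumes "cmod w <= R" "1 <= p" "0 <= R"
 shows "en (cmod (z - w) powr (- p))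
  <= en ((2 + R) / jap z) * (1 + en (cmod (z - w) powr (- p)) * ind (cball 0 1) (z - w))"
proof -
 let ?r = "cmod (z - w)"
 have "cmod z <= R + ?r" using assms norm_triangle_ineq2[of z w] by linarith
 then have j: "jap z <= 1 + R + ?r" using jap_le[of z] by simp
 have *: "?r powr (- p) <= ((2 + R) / jap z) * (1 + ?r powr (- p) * ind (cball 0 1) (z - w))"
 proof (cases "?r <= 1")
  case True
  have "1 <= (2 + R) / jap z" using j True jap_pos[of z] by simp
  then have "1 * (?r powr (- p)) <= (2 + R) / jap z * (1 + ?r powr (- p))"
   by (intro mult_mono) auto
  then show ?thesis using True by simp
 next
  case False
  have "?r powr (- p) <= ?r powr (- 1)" using False assms by (intro powr_mono) auto
  also have "... = 1 / ?r" using False by (simp add: powr_minus_divide)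
  also have "... <= (2 + R) / jap z"
  proof -
   have "jap z <= (2 + R) * ?r"
   proof -
    have "(1 + R) * 1 <= (1 + R) * ?r" using False assms by (intro mult_left_mono) auto
    then show ?thesis using j by (simp add: algebra_simps)
   qed
   moreover have "0 < ?r" using False by linarith
   ultimately show ?thesis using jap_pos[of z]
    by (simp add: pos_le_divide_eq pos_divide_le_eq)
  qed
  finally show ?thesis using False by simp
 qed
 have "en a * (1 + en b) = en (a * (1 + b))" if "0 <= a" "0 <= b" for a b
  using that by (simp add: ennreal_mult)
 from this[of "(2 + R) / jap z" "?r powr (- p) * ind (cball 0 1) (z - w)"] ennreal_leI[OF *]
 show ?thesis
  using assms jap_pos[of z] by (auto split: split_indicator_asm split_indicator)
qed

text \<open>Schur's test for the kernels \<open>|z - w|\<^sup>-\<^sup>p\<close>; the weight only matters at infinity.\<close>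

lemma weighted_riesz_bound:
 assumes p: "1 <= p" "p < 2" and ep: "0 < ep" and R: "0 <= R"
 shows "\<exists>C\<ge>0. \<forall>F\<in>borel_measurable borel. (\<forall>w. R < cmod w --> F w = 0) -->
  (II z. en (jap z powr (- 2 * ep)) * (II w. F w * en (cmod (z - w) powr (- p)))\<^sup>2)
   <= en C * (II w. (F w)\<^sup>2)"
proof -
 define k where "k = (%z w. en (cmod (z - w) powr (- p)))"
 define A where "A = (II z. en (cmod z powr (- p)) * ind (cball 0 1) z)"
 define B where "B = emeasure lborel (cball (0::complex) R)"
 define D where "D = (II z. en (jap z powr (- (2 + 2 * ep))))"
 define C where "C = en (2 + R) * (B + A) * (en (2 + R) * (D + A))"
 have [measurable]: "case_prod k \<in> borel_measurable (borel \<Otimes>\<^sub>M borel)" unfolding k_def by measurable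
 have [measurable]: "k z \<in> bmeas" "(%z. k z w) \<in> bmeas" for z w
  unfolding k_def by measurable
 have kb: "k z w <= en ((2 + R) / jap z) * (1 + en (cmod (z - w) powr (- p)) * ind (cball 0 1) (z - w))"
  if "cmod w <= R" for z w
  unfolding k_def using jap_kernel_bound[OF that p(1) R] .
 have m: "(II w. k z w * ind (cball 0 R) w) <= en ((2 + R) / jap z) * (B + A)" for z
 proof -
  have "(II w. k z w * ind (cball 0 R) w)
   <= (II w. en ((2 + R) / jap z) * (ind (cball 0 R) w + en (cmod (z - w) powr (- p)) * ind (cball 0 1) (z - w)))"
   using kb by (intro nn_integral_mono) (auto split: split_indicator)
  also have "... = en ((2 + R) / jap z) * (B + (II w. en (cmod (z - w) powr (- p)) * ind (cball 0 1) (z - w)))"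
   unfolding B_def by (subst nn_integral_cmult, measurable, subst nn_integral_add) auto
  also have "(II w. en (cmod (z - w) powr (- p)) * ind (cball 0 1) (z - w)) = A"
   unfolding A_def by (rule nn_integral_translate_reflect) measurable
  finally show ?thesis .
 qed
 \<comment> \<open>One factor 1 / \<open>jap z\<close> comes from the row integral \<open>m\<close>,
   a second one from the kernel bound. With the weight this gives the exponent 2 + 2 ep, which is
   integrable over the plane because ep > 0.\<close>
 have n: "(II z. en (jap z powr (- 2 * ep) / jap z) * k z w) <= en (2 + R) * (D + A)"
  if "cmod w <= R" for w
 proof -
  have "(II z. en (jap z powr (- 2 * ep) / jap z) * k z w)
   <= (II z. en (2 + R) * (en (jap z powr (- (2 + 2 * ep))) + en (cmod (z - w) powr (- p)) * ind (cball 0 1) (z - w)))"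
  proof (rule nn_integral_mono)
   fix z
   let ?a = "en (cmod (z - w) powr (- p)) * ind (cball 0 1) (z - w)"
   have e: "jap z powr (- 2 * ep) / jap z * ((2 + R) / jap z) = (2 + R) * jap z powr (- (2 + 2 * ep))"
   proof -
    have "jap z powr (- (2 + 2 * ep)) = jap z powr (- 2 * ep) * jap z powr (- 2)"
     by (subst powr_add[symmetric]) (simp add: algebra_simps)
    also have "jap z powr (- 2) = 1 / (jap z * jap z)"
     using jap_pos[of z] by (simp add: powr_minus_divide powr_numeral power2_eq_square)
    finally show ?thesis by simp
   qed
   have le1: "jap z powr (- (2 + 2 * ep)) <= 1"
    using jap_ge_1[of z] ep powr_mono[of "- (2 + 2 * ep)" 0 "jap z"] by simp
   have "en (jap z powr (- 2 * ep) / jap z) * k z w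
    <= en (jap z powr (- 2 * ep) / jap z) * (en ((2 + R) / jap z) * (1 + ?a))"
    by (intro mult_left_mono kb that) auto
   also have "... = en ((2 + R) * jap z powr (- (2 + 2 * ep))) * (1 + ?a)"
    using R jap_pos[of z] by (simp only: mult.assoc[symmetric] ennreal_mult'[symmetric] e[symmetric]) (simp add: ennreal_mult'[symmetric])
   also have "... = en (2 + R) * (en (jap z powr (- (2 + 2 * ep))) + en (jap z powr (- (2 + 2 * ep))) * ?a)"
    using R by (simp add: ennreal_mult distrib_left mult.assoc)
   also have "... <= en (2 + R) * (en (jap z powr (- (2 + 2 * ep))) + 1 * ?a)"
    using le1 by (intro mult_left_mono add_left_mono mult_right_mono) auto
   finally show "en (jap z powr (- 2 * ep) / jap z) * k z w
    <= en (2 + R) * (en (jap z powr (- (2 + 2 * ep))) + ?a)" by simp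
  qed
  also have "... = en (2 + R) * (D + (II z. en (cmod (z - w) powr (- p)) * ind (cball 0 1) (z - w)))"
   unfolding D_def by (subst nn_integral_cmult, measurable, subst nn_integral_add) auto
  also have "(II z. en (cmod (z - w) powr (- p)) * ind (cball 0 1) (z - w)) = A"
   unfolding A_def by (rule nn_integral_translate_reflect) measurable
  finally show ?thesis .
 qed
 have "A < \<infinity>" unfolding A_def using p by (intro cmod_powr_integrable_cball) auto
 moreover have "D < \<infinity>" unfolding D_def using ep by (intro jap_powr_integrable) auto
 moreover have "B < \<infinity>" unfolding B_def by (rule emeasure_lborel_cball_finite)
 ultimately have "C < \<infinity>" unfolding C_def by (auto simp: ennreal_mult_less_top)
 then obtain c where c: "C = en c" "c \<ge> 0" by (cases C) auto
 show ?thesis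
 proof (intro exI[of _ c] conjI ballI impI c)
  fix F :: "complex => ennreal"
  assume [measurable]: "F \<in> bmeas" and F0: "\<forall>w. R < cmod w --> F w = 0"
  have cs: "(II w. F w * k z w)\<^sup>2 <= (II w. (F w)\<^sup>2 * k z w) * (en ((2 + R) / jap z) * (B + A))" for z
  proof -
   define s where "s = (%w. en (sqrt (cmod (z - w) powr (- p))))"
   have [measurable]: "s \<in> bmeas" unfolding s_def by measurable
   have s2: "s w * s w = k z w" for w unfolding s_def k_def by (simp add: ennreal_mult[symmetric])
   have "(II w. F w * k z w) = (II w. (F w * s w) * (s w * ind (cball 0 R) w))"
    using F0 s2 by (intro nn_integral_cong) (auto simp: mult.assoc s2 split: split_indicator)
   also have "...\<^sup>2 <= (II w. (F w * s w)\<^sup>2) * (II w. (s w * ind (cball 0 R) w)\<^sup>2)"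
    by (rule nn_integral_Cauchy_Schwarz) auto
   also have "(II w. (F w * s w)\<^sup>2) = (II w. (F w)\<^sup>2 * k z w)"
    by (simp add: power2_eq_square s2[symmetric] ac_simps)
   also have "(II w. (s w * ind (cball 0 R) w)\<^sup>2) = (II w. k z w * ind (cball 0 R) w)"
    by (intro nn_integral_cong) (auto simp: power2_eq_square s2[symmetric] split: split_indicator)
   finally show ?thesis
    by (rule order_trans[OF _ mult_left_mono[OF m]]) simp
  qed
  have "(II z. en (jap z powr (- 2 * ep)) * (II w. F w * en (cmod (z - w) powr (- p)))\<^sup>2)
   <= (II z. en (jap z powr (- 2 * ep)) * ((II w. (F w)\<^sup>2 * k z w) * (en ((2 + R) / jap z) * (B + A))))"
   using cs unfolding k_def by (intro nn_integral_mono mult_left_mono) auto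
  also have "... = (II z. (en (2 + R) * (B + A)) * (II w. en (jap z powr (- 2 * ep) / jap z) * ((F w)\<^sup>2 * k z w)))"
  proof (rule nn_integral_cong)
   fix z
   have "en (jap z powr (- 2 * ep)) * en ((2 + R) / jap z) = en (2 + R) * en (jap z powr (- 2 * ep) / jap z)"
    using R jap_pos[of z] by (simp add: ennreal_mult'[symmetric] mult.commute del: ennreal_plus)
   then have "en (jap z powr (- 2 * ep)) * (X * (en ((2 + R) / jap z) * Y))
    = (en (2 + R) * Y) * (en (jap z powr (- 2 * ep) / jap z) * X)" for X Y
   proof -
    have 1: "a * (X * (b * Y)) = (a * b) * (X * Y)" "(a * Y) * (b * X) = (a * b) * (X * Y)" for a b :: ennreal
     by (simp_all only: ac_simps)
    show ?thesis
     unfolding 1 using \<open>en (jap z powr (- 2 * ep)) * en ((2 + R) / jap z) = _\<close> by simp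
   qed
   then show "en (jap z powr (- 2 * ep)) * ((II w. (F w)\<^sup>2 * k z w) * (en ((2 + R) / jap z) * (B + A)))
    = (en (2 + R) * (B + A)) * (II w. en (jap z powr (- 2 * ep) / jap z) * ((F w)\<^sup>2 * k z w))"
    by (subst nn_integral_cmult) simp_all
  qed
  also have "... = (en (2 + R) * (B + A)) * (II z. II w. en (jap z powr (- 2 * ep) / jap z) * ((F w)\<^sup>2 * k z w))"
   by (rule nn_integral_cmult) measurable
  finally have outer: "(II z. en (jap z powr (- 2 * ep)) * (II w. F w * en (cmod (z - w) powr (- p)))\<^sup>2)
   <= (en (2 + R) * (B + A)) * (II z. II w. en (jap z powr (- 2 * ep) / jap z) * ((F w)\<^sup>2 * k z w))" .
  have "(II z. II w. en (jap z powr (- 2 * ep) / jap z) * ((F w)\<^sup>2 * k z w))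
    = (II w. II z. en (jap z powr (- 2 * ep) / jap z) * ((F w)\<^sup>2 * k z w))"
   by (rule lborel_pair.Fubini') measurable
  also have "... <= (II w. (F w)\<^sup>2 * (en (2 + R) * (D + A)))"
  proof (rule nn_integral_mono)
   fix w
   have "(II z. en (jap z powr (- 2 * ep) / jap z) * ((F w)\<^sup>2 * k z w))
    = (F w)\<^sup>2 * (II z. en (jap z powr (- 2 * ep) / jap z) * k z w)"
    by (subst nn_integral_cmult[symmetric]) (auto simp: ac_simps)
   also have "... <= (F w)\<^sup>2 * (en (2 + R) * (D + A))"
    using n[of w] F0 by (cases "cmod w <= R") (auto intro: mult_left_mono)
   finally show "(II z. en (jap z powr (- 2 * ep) / jap z) * ((F w)\<^sup>2 * k z w)) <= (F w)\<^sup>2 * (en (2 + R) * (D + A))" .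
  qed
  also have "... = (en (2 + R) * (D + A)) * (II w. (F w)\<^sup>2)"
   by (subst nn_integral_multc) (auto simp: ac_simps)
  finally have "(II z. II w. en (jap z powr (- 2 * ep) / jap z) * ((F w)\<^sup>2 * k z w))
   <= (en (2 + R) * (D + A)) * (II w. (F w)\<^sup>2)" .
  from order_trans[OF outer mult_left_mono[OF this]]
  show "(II z. en (jap z powr (- 2 * ep)) * (II w. F w * en (cmod (z - w) powr (- p)))\<^sup>2)
   <= en c * (II w. (F w)\<^sup>2)"
   unfolding c(1)[symmetric] C_def by (simp add: mult.assoc)
 qed
qed

section \<open>Test functions\<close>

lemma partial_eq:
 assumes "(f has_derivative D) (at z)"
 shows "partial_x f z = D 1" "partial_y f z = D \<i>"
 using frechet_derivative_at[OF assms] by (simp_all add: partial_x_def partial_y_def)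

lemma C_k_Suc_imp: "C_k (Suc n) f ==> C_k n f"
proof (induction n arbitrary: f)
 case 0 then show ?case by (simp add: differentiable_imp_continuous_on)
next
 case (Suc n)
 have "f differentiable_on UNIV" "C_k (Suc n) (partial_x f)" "C_k (Suc n) (partial_y f)"
  using Suc.prems unfolding C_k.simps(2)[of "Suc n"] by blast+
 then show ?case using Suc.IH unfolding C_k.simps(2)[of n] by blast
qed

lemma C_k_differentiable: "C_k (Suc n) f ==> f differentiable (at z)"
 by (simp add: differentiable_on_def)

lemma C_k_const: "C_k n (%z. c)"
proof (induction n arbitrary: c)
 case (Suc n)
 have "partial_x (%z. c) = (%z. 0)" "partial_y (%z. c) = (%z. 0)"
  by (auto simp: fun_eq_iff partial_eq[OF has_derivative_const])
 then show ?case using Suc by simp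
qed simp

lemma C_k_add: "C_k n f ==> C_k n g ==> C_k n (%z. f z + g z)"
proof (induction n arbitrary: f g)
 case 0 then show ?case by (auto intro: continuous_intros)
next
 case (Suc n)
 have f: "(f has_derivative frechet_derivative f (at z)) (at z)"
  and g: "(g has_derivative frechet_derivative g (at z)) (at z)" for z
  using C_k_differentiable[OF Suc.prems(1)] C_k_differentiable[OF Suc.prems(2)]
  by (auto simp: frechet_derivative_works)
 note d = has_derivative_add[OF f g]
 have "partial_x (%z. f z + g z) = (%z. partial_x f z + partial_x g z)"
    "partial_y (%z. f z + g z) = (%z. partial_y f z + partial_y g z)"
  by (auto simp: fun_eq_iff partial_eq[OF d] partial_eq[OF f] partial_eq[OF g])
 then show ?case
  using Suc by (auto simp: differentiable_on_def intro: differentiable_add)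
qed

lemma C_k_mult: "C_k n f ==> C_k n g ==> C_k n (%z. f z * g z)"
proof (induction n arbitrary: f g)
 case 0 then show ?case by (auto intro: continuous_intros)
next
 case (Suc n)
 have f: "(f has_derivative frechet_derivative f (at z)) (at z)"
  and g: "(g has_derivative frechet_derivative g (at z)) (at z)" for z
  using C_k_differentiable[OF Suc.prems(1)] C_k_differentiable[OF Suc.prems(2)]
  by (auto simp: frechet_derivative_works)
 note d = has_derivative_mult[OF f g]
 have "partial_x (%z. f z * g z) = (%z. f z * partial_x g z + partial_x f z * g z)"
    "partial_y (%z. f z * g z) = (%z. f z * partial_y g z + partial_y f z * g z)"
  by (auto simp: fun_eq_iff partial_eq[OF d] partial_eq[OF f] partial_eq[OF g])
 then show ?case
  using Suc C_k_Suc_imp[OF Suc.prems(1)] C_k_Suc_imp[OF Suc.prems(2)]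
  by (auto simp: differentiable_on_def intro!: differentiable_mult C_k_add Suc.IH)
qed

lemma C_k_bounded_linear:
 assumes "bounded_linear f" shows "C_k n (%z. f z)"
proof (cases n)
 case 0 then show ?thesis using linear_continuous_on[OF assms] by simp
next
 case (Suc m)
 note d = bounded_linear_imp_has_derivative[OF assms]
 have "partial_x f = (%z. f 1)" "partial_y f = (%z. f \<i>)"
  by (auto simp: fun_eq_iff partial_eq[OF d])
 then show ?thesis
  using C_k_const d unfolding Suc by (auto simp: differentiable_on_def differentiable_def intro: has_derivative_at_withinI)
qed

text \<open>The outer functions form a family closed under differentiation, \<open>s\<close> sending
  an index to the index of the derivative. The induction on \<open>n\<close> then runs over all
  indices at once, with no formula for higher derivatives of a composition.\<close>

lemma C_k_compose_real:
 fixes B :: "'i => real => real" and g :: "complex => real"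
 assumes B: "!!i z. (B i has_real_derivative B (s i) (g z)) (at (g z))"
  and g: "!!n. C_k n (%z. cr (g z))"
 shows "C_k n (%z. cr (B i (g z)))"
proof (induction n arbitrary: i)
 let ?G = "%z. cr (g z)"
 have G: "(?G has_derivative frechet_derivative ?G (at z)) (at z)" for z
  using C_k_differentiable[OF g] by (simp add: frechet_derivative_works)
 have gd: "(g has_derivative (%h. Re (frechet_derivative ?G (at z) h))) (at z)" for z
  using bounded_linear.has_derivative[OF bounded_linear_Re G] by simp
 have Gim: "frechet_derivative ?G (at z) h = cr (Re (frechet_derivative ?G (at z) h))" for z h
 proof -
  have "((%w. Im (?G w)) has_derivative (%h. Im (frechet_derivative ?G (at z) h))) (at z)"
   by (rule bounded_linear.has_derivative[OF bounded_linear_Im G])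
  then have "((%w. 0::real) has_derivative (%h. Im (frechet_derivative ?G (at z) h))) (at z)" by simp
  from has_derivative_unique[OF this has_derivative_const] show ?thesis
   by (simp add: complex_eq_iff fun_eq_iff)
 qed
 have d: "((%z. cr (B i (g z))) has_derivative
   (%h. cr (B (s i) (g z)) * frechet_derivative ?G (at z) h)) (at z)" for i z
 proof -
  have "((%z. B i (g z)) has_derivative (%h. B (s i) (g z) * Re (frechet_derivative ?G (at z) h))) (at z)"
   using has_derivative_compose[OF gd B[unfolded has_field_derivative_def]] .
  then have "((%z. cr (B i (g z))) has_derivative
   (%h. cr (B (s i) (g z) * Re (frechet_derivative ?G (at z) h)))) (at z)"
   by (rule bounded_linear.has_derivative[OF bounded_linear_of_real])
  then show ?thesis using Gim by simp
 qed
 case 0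
 show ?case
  unfolding C_k.simps continuous_on_eq_continuous_at[OF open_UNIV] using has_derivative_continuous[OF d] by blast
 case (Suc n)
 have "partial_x (%z. cr (B i (g z))) = (%z. cr (B (s i) (g z)) * partial_x ?G z)"
  "partial_y (%z. cr (B i (g z))) = (%z. cr (B (s i) (g z)) * partial_y ?G z)"
  by (auto simp: fun_eq_iff partial_eq[OF d] partial_eq[OF G])
 then show ?case
  using d Suc.IH g[of "Suc n"] by (auto simp: differentiable_on_def differentiable_def intro: has_derivative_at_withinI C_k_mult)
qed

subsection \<open>A smooth bump function\<close>

text \<open>The polynomial parameter makes the family closed under differentiation: with s = 1/t,
  the derivative of p(s) exp (-s) in t is s^2 (p(s) - p'(s)) exp (-s).\<close>

definition bump :: "real poly => real => real" where
 "bump p t = (if 0 < t then poly p (1 / t) * exp (- (1 / t)) else 0)"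

lemma poly_exp_tendsto_0: "((%s::real. poly p s * exp (- s)) \<longlongrightarrow> 0) at_top"
proof -
 have "((%s::real. \<Sum>i\<le>degree p. coeff p i * (s ^ i / exp s)) \<longlongrightarrow> (\<Sum>i\<le>degree p. coeff p i * 0)) at_top"
  by (intro tendsto_intros tendsto_power_div_exp_0)
 moreover have "(\<Sum>i\<le>degree p. coeff p i * (s ^ i / exp s)) = poly p s * exp (- s)" for s
  by (simp add: poly_altdef sum_distrib_right exp_minus divide_inverse mult.assoc)
 ultimately show ?thesis by simp
qed

lemma bump_has_derivative:
 "(bump p has_real_derivative bump (pCons 0 (pCons 0 (p - pderiv p))) t) (at t)"
proof -
 consider "t > 0" | "t < 0" | "t = 0" by linarith
 then show ?thesis
 proof cases
  case 1
  have "((%t. poly p (1 / t) * exp (- (1 / t))) has_real_derivative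
    bump (pCons 0 (pCons 0 (p - pderiv p))) t) (at t)"
   using 1 by (auto intro!: derivative_eq_intros simp: bump_def power2_eq_square field_simps)
  then show ?thesis
   by (rule has_field_derivative_transform_within_open[where S="{0<..}"]) (use 1 in \<open>auto simp: bump_def\<close>)
 next
  case 2
  have "((%t. 0) has_real_derivative bump (pCons 0 (pCons 0 (p - pderiv p))) t) (at t)"
   using 2 by (auto simp: bump_def)
  then show ?thesis
   by (rule has_field_derivative_transform_within_open[where S="{..<0}"]) (use 2 in \<open>auto simp: bump_def\<close>)
 next
  case 3
  have lim: "((%h. poly (pCons 0 p) (1 / h) * exp (- (1 / h))) \<longlongrightarrow> 0) (at_right 0)"
   using filterlim_compose[OF poly_exp_tendsto_0[of "pCons 0 p"] filterlim_inverse_at_top_right]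
   by (simp add: inverse_eq_divide)
  have "((%h. (bump p (0 + h) - bump p 0) / h) \<longlongrightarrow> 0) (at_right 0)"
   by (rule Lim_transform_eventually[OF lim])
     (auto simp: bump_def eventually_at_right_less field_simps intro!: eventually_mono[OF eventually_at_right_less])
  moreover have "((%h. (bump p (0 + h) - bump p 0) / h) \<longlongrightarrow> 0) (at_left 0)"
  proof (rule Lim_transform_eventually[OF tendsto_const])
   have "eventually (%h::real. h < 0) (at_left 0)" by (rule eventually_at_leftI[of "-1"]) auto
   then show "\<forall>\<^sub>F h in at_left 0. 0 = (bump p (0 + h) - bump p 0) / h"
    by eventually_elim (auto simp: bump_def)
  qed
  ultimately have "((%h. (bump p (0 + h) - bump p 0) / h) \<longlongrightarrow> 0) (at 0)"
   by (simp add: filterlim_split_at)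
  then show ?thesis using 3 by (simp add: DERIV_def bump_def)
 qed
qed

text \<open>The function in the third bound is the derivative of \<open>bump 1\<close>; the value 2
  comes from s^2 <= 2 exp s.\<close>

lemma bump_bounds: "0 <= bump 1 t" "bump 1 t <= 1" "\<bar>bump (pCons 0 (pCons 0 1)) t\<bar> <= 2"
proof -
 show "0 <= bump 1 t" "bump 1 t <= 1" by (auto simp: bump_def)
 have "s\<^sup>2 <= 2 * exp s" if "0 <= s" for s :: real
  using exp_lower_Taylor_quadratic[OF that] that by linarith
 then have "s\<^sup>2 * exp (- s) <= 2" if "0 <= s" for s :: real
  using that by (simp add: exp_minus field_simps)
 from this[of "1 / t"] show "\<bar>bump (pCons 0 (pCons 0 1)) t\<bar> <= 2"
  by (auto simp: bump_def abs_mult power2_eq_square)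
qed

text \<open>The factor \<open>exp 1\<close> normalises the value at the origin to 1, and hence the
  pointwise limit for R tending to infinity. The argument depends on |w|^2, a polynomial in the
  coordinates, so there is no loss of smoothness at 0.\<close>

definition cutoff :: "real => complex => complex" where
 "cutoff R w = cr (exp 1 * bump 1 (1 - (cmod w)\<^sup>2 / R\<^sup>2))"

lemma has_derivative_cmod_power2:
 "((%w. (cmod w)\<^sup>2) has_derivative (%h. 2 * (w \<bullet> h))) (at w)"
 unfolding power2_norm_eq_inner by (auto intro!: derivative_eq_intros simp: inner_commute)

lemma C_k_cmod_power2: "C_k n (%w. cr ((cmod (w - a))\<^sup>2))"
proof -
 have "C_k n (%w. (w + (- a)) * (cnj w + (- cnj a)))"
  by (intro C_k_mult C_k_add C_k_const C_k_bounded_linear bounded_linear_ident bounded_linear_cnj)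
 moreover have "cr ((cmod (w - a))\<^sup>2) = (w + (- a)) * (cnj w + (- cnj a))" for w
  unfolding complex_norm_square by simp
 ultimately show ?thesis by simp
qed

lemma C_k_cutoff: "C_k n (cutoff R)"
proof -
 have "C_k n (%w. cr 1 + cr (- (1 / R\<^sup>2)) * cr ((cmod (w - 0))\<^sup>2))" for n
  by (intro C_k_mult C_k_add C_k_const C_k_cmod_power2)
 then have g: "C_k n (%w. cr (1 - (cmod w)\<^sup>2 / R\<^sup>2))" for n by simp
 have "C_k n (%w. cr (bump 1 (1 - (cmod w)\<^sup>2 / R\<^sup>2)))"
  by (rule C_k_compose_real[where B=bump and s="%p. pCons 0 (pCons 0 (p - pderiv p))"
    and g="%w. 1 - (cmod w)\<^sup>2 / R\<^sup>2", OF bump_has_derivative g])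
 from C_k_mult[OF C_k_const this, of "cr (exp 1)"]
 show ?thesis by (simp add: cutoff_def[abs_def])
qed

section \<open>A smooth regularisation of the Cauchy kernel\<close>

definition Kreg :: "real => complex => complex" where
 "Kreg dl ze = cnj ze / cr ((cmod ze)\<^sup>2 + dl\<^sup>2)"

text \<open>\<open>Kreg\<close> replaces 1/z = conj z / |z|^2 by a smooth function, and
  \<open>Dreg\<close> is its conj-z derivative: a dilated bump of total mass pi that takes the place
  of pi times the Dirac mass.\<close>

definition Dreg :: "real => complex => real" where
 "Dreg dl ze = dl\<^sup>2 / ((cmod ze)\<^sup>2 + dl\<^sup>2)\<^sup>2"

lemma inverse_power_has_derivative:
 assumes "t ~= (0::real)"
 shows "((%t. c * inverse t ^ m) has_real_derivative (- c * real m) * inverse t ^ Suc m) (at t)"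
proof (cases m)
 case (Suc k)
 have "((%t. c * inverse t ^ m) has_real_derivative c * (real m * (- (inverse t * 1 * inverse t) * inverse t ^ (m - Suc 0)))) (at t)"
  using assms by (intro DERIV_cmult DERIV_power DERIV_inverse' DERIV_ident)
 then show ?thesis by (rule DERIV_cong) (simp add: Suc)
qed simp

lemma C_k_Kreg:
 assumes "dl ~= 0"
 shows "C_k n (%w. Kreg dl (z - w))"
proof -
 have pos: "0 < (cmod (w - z))\<^sup>2 + dl\<^sup>2" for w using assms by (simp add: add_nonneg_pos)
 have g: "C_k n (%w. cr ((cmod (w - z))\<^sup>2 + dl\<^sup>2))" for n
  using C_k_add[OF C_k_cmod_power2 C_k_const, of n z "cr (dl\<^sup>2)"] by simp
 \<comment> \<open>The pair (c, m) stands for c t^-m; differentiation sends it to (- c m, m +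
   1).\<close>
 define B where "B = (%i t. fst i * inverse t ^ snd i :: real)"
 have B: "(B i has_real_derivative B (- fst i * real (snd i), Suc (snd i)) ((cmod (w - z))\<^sup>2 + dl\<^sup>2))
   (at ((cmod (w - z))\<^sup>2 + dl\<^sup>2))" for i :: "real \<times> nat" and w
  unfolding B_def fst_conv snd_conv using pos[of w] by (intro inverse_power_has_derivative) linarith
 have "C_k n (%w. cr (B (1, 1) ((cmod (w - z))\<^sup>2 + dl\<^sup>2)))"
  by (rule C_k_compose_real[where B=B and s="%i. (- fst i * real (snd i), Suc (snd i))" and g="%w. (cmod (w - z))\<^sup>2 + dl\<^sup>2", OF B g])
 from C_k_mult[OF C_k_add[OF C_k_const C_k_mult[OF C_k_const C_k_bounded_linear[OF bounded_linear_cnj]]] this, of "cnj z" "- 1"]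
 show ?thesis
  by (simp add: Kreg_def B_def norm_minus_commute divide_inverse)
qed

lemma wirtinger_bar_eq:
 assumes "(f has_derivative D) (at z)"
 shows "wirtinger_bar f z = (D 1 + \<i> * D \<i>) / 2" "wirtinger f z = (D 1 - \<i> * D \<i>) / 2"
 by (simp_all add: wirtinger_bar_def wirtinger_def partial_eq[OF assms])

lemma Kreg_has_derivative:
 assumes "dl ~= 0"
 shows "((%w. Kreg dl (z - w)) has_derivative
   (%h. - cnj h / cr ((cmod (z - w))\<^sup>2 + dl\<^sup>2)
    + cnj (z - w) * cr (2 * ((z - w) \<bullet> h) / ((cmod (z - w))\<^sup>2 + dl\<^sup>2)\<^sup>2))) (at w)"
proof -
 have pos: "0 < (cmod (z - w))\<^sup>2 + dl\<^sup>2" for w using assms by (simp add: add_nonneg_pos)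
 have "((%w. (cmod (z - w))\<^sup>2) has_derivative (%h. - 2 * ((z - w) \<bullet> h))) (at w)"
  using has_derivative_compose[OF _ has_derivative_cmod_power2, of "%w. z - w" "%h. - h" w UNIV]
  by (simp add: has_derivative_diff[OF has_derivative_const has_derivative_ident, of z, simplified])
 then have "((%w. (cmod (z - w))\<^sup>2 + dl\<^sup>2) has_derivative (%h. - 2 * ((z - w) \<bullet> h))) (at w)"
  by (rule has_derivative_add_const)
 then have "((%w. inverse ((cmod (z - w))\<^sup>2 + dl\<^sup>2)) has_derivative
   (%h. - (inverse ((cmod (z - w))\<^sup>2 + dl\<^sup>2) * (- 2 * ((z - w) \<bullet> h)) * inverse ((cmod (z - w))\<^sup>2 + dl\<^sup>2)))) (at w)"
  by (intro Deriv.has_derivative_inverse) (use pos[of w] in linarith)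
 then have "((%w. inverse ((cmod (z - w))\<^sup>2 + dl\<^sup>2)) has_derivative
   (%h. 2 * ((z - w) \<bullet> h) / ((cmod (z - w))\<^sup>2 + dl\<^sup>2)\<^sup>2)) (at w)"
  by (simp add: divide_inverse power2_eq_square ac_simps)
 then have 1: "((%w. cr (inverse ((cmod (z - w))\<^sup>2 + dl\<^sup>2))) has_derivative
   (%h. cr (2 * ((z - w) \<bullet> h) / ((cmod (z - w))\<^sup>2 + dl\<^sup>2)\<^sup>2))) (at w)"
  by (rule bounded_linear.has_derivative[OF bounded_linear_of_real])
 have 2: "((%w. cnj (z - w)) has_derivative (%h. - cnj h)) (at w)"
  by (auto intro!: derivative_eq_intros)
 have "((%w. cnj (z - w) * cr (inverse ((cmod (z - w))\<^sup>2 + dl\<^sup>2))) has_derivative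
  (%h. cnj (z - w) * cr (2 * ((z - w) \<bullet> h) / ((cmod (z - w))\<^sup>2 + dl\<^sup>2)\<^sup>2)
   + - cnj h * cr (inverse ((cmod (z - w))\<^sup>2 + dl\<^sup>2)))) (at w)"
  by (rule has_derivative_mult[OF 2 1])
 then show ?thesis
  by (simp add: Kreg_def divide_inverse algebra_simps)
qed

lemma wirtinger_bar_Kreg:
 assumes "dl ~= 0"
 shows "wirtinger_bar (%w. Kreg dl (z - w)) w = - cr (Dreg dl (z - w))"
proof -
 define ze N where "ze = z - w" and "N = (cmod ze)\<^sup>2 + dl\<^sup>2"
 have "0 < N" unfolding N_def using assms by (simp add: add_nonneg_pos)
 then have n: "cr N ~= 0" by simp
 have "cnj ze * ze = cr ((cmod ze)\<^sup>2)" by (simp only: complex_norm_square mult.commute)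
 then have zz: "cnj ze * ze = cr N - cr (dl\<^sup>2)" by (simp add: N_def)
 define n where "n = cr N"
 have "wirtinger_bar (%w. Kreg dl (z - w)) w
   = (- 1 / n + cnj ze * (2 * cr (Re ze) / n\<^sup>2)
    + \<i> * (\<i> / n + cnj ze * (2 * cr (Im ze) / n\<^sup>2))) / 2"
  unfolding wirtinger_bar_eq(1)[OF Kreg_has_derivative[OF assms]] ze_def[symmetric] N_def[symmetric]
  by (simp add: inner_complex_def n_def)
 also have "... = (- 2 / n + 2 * (cnj ze * (cr (Re ze) + \<i> * cr (Im ze))) / n\<^sup>2) / 2"
 proof -
  have "\<i> * (\<i> / n) = - 1 / n" by simp
  then show ?thesis by (simp only: distrib_left add_divide_distrib mult_2) (simp add: mult_ac)
 qed
 also have "cr (Re ze) + \<i> * cr (Im ze) = ze" by (rule complex_eq[symmetric])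
 also have "(- 2 / n + 2 * (cnj ze * ze) / n\<^sup>2) / 2 = - cr (dl\<^sup>2) / n\<^sup>2"
  unfolding zz n_def[symmetric] using n[folded n_def] by (simp add: power2_eq_square diff_divide_distrib)
 also have "... = - cr (Dreg dl (z - w))"
  by (simp add: Dreg_def N_def n_def ze_def)
 finally show ?thesis .
qed

section \<open>The regularised Cauchy kernel as an approximate identity\<close>

lemma nn_integral_inverse_square_plus:
 fixes a :: real assumes "a > 0"
 shows "(II x. en (1 / (x\<^sup>2 + a\<^sup>2))) = en (pi / a)"
proof -
 have pos: "0 < x\<^sup>2 + a\<^sup>2" for x using assms by (simp add: add_nonneg_pos)
 have "(II x. en (1 / (x\<^sup>2 + a\<^sup>2))) = 2 * (II x. en (1 / (x\<^sup>2 + a\<^sup>2)) * ind {0..} x)"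
  by (rule nn_integral_even) auto
 also have "(II x. en (1 / (x\<^sup>2 + a\<^sup>2)) * ind {0..} x) = en (pi / (2 * a) - arctan (0 / a) / a)"
 proof (rule nn_integral_FTC_atLeast)
  show "((%x. arctan (x / a) / a) \<longlongrightarrow> pi / (2 * a)) at_top"
  proof -
   have "((%x. arctan (x / a)) \<longlongrightarrow> pi / 2) at_top"
    using assms by (intro filterlim_compose[OF tendsto_arctan_at_top]
      filterlim_at_top_mult_tendsto_pos[of "%_. 1 / a" "1 / a", simplified] filterlim_ident) 
      (auto simp: divide_inverse)
   from tendsto_divide[OF this tendsto_const, of a] show ?thesis using assms by simp
  qed
  show "((%x. arctan (x / a) / a) has_real_derivative 1 / (x\<^sup>2 + a\<^sup>2)) (at x)" for x
  proof -
   have "((%x. arctan (x / a) / a) has_real_derivative (1 / a) * inverse (1 + (x / a)\<^sup>2) / a) (at x)"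
    using assms by (auto intro!: derivative_eq_intros)
   also have "(1 / a) * inverse (1 + (x / a)\<^sup>2) / a = 1 / (x\<^sup>2 + a\<^sup>2)"
    using assms pos[of x] by (simp add: power_divide divide_simps) (simp add: power2_eq_square algebra_simps)
   finally show ?thesis .
  qed
 qed (use pos in auto)
 finally show ?thesis using assms by (simp add: ennreal_mult'[symmetric] flip: ennreal_numeral)
qed

lemma nn_integral_inverse_square_plus_power2:
 fixes a :: real assumes "a > 0"
 shows "(II x. en (1 / (x\<^sup>2 + a\<^sup>2)\<^sup>2)) = en (pi / (2 * a ^ 3))"
proof -
 have pos: "0 < x\<^sup>2 + a\<^sup>2" for x using assms by (simp add: add_nonneg_pos)
 let ?F = "%x. x / (2 * a\<^sup>2 * (x\<^sup>2 + a\<^sup>2)) + arctan (x / a) / (2 * a ^ 3)"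
 have "(II x. en (1 / (x\<^sup>2 + a\<^sup>2)\<^sup>2)) = 2 * (II x. en (1 / (x\<^sup>2 + a\<^sup>2)\<^sup>2) * ind {0..} x)"
  by (rule nn_integral_even) auto
 also have "(II x. en (1 / (x\<^sup>2 + a\<^sup>2)\<^sup>2) * ind {0..} x) = en (pi / (4 * a ^ 3) - ?F 0)"
 proof (rule nn_integral_FTC_atLeast)
  show "(?F \<longlongrightarrow> pi / (4 * a ^ 3)) at_top"
  proof -
   have "((%x. x / (2 * a\<^sup>2 * (x\<^sup>2 + a\<^sup>2))) \<longlongrightarrow> 0) at_top"
    using assms by real_asymp
   moreover have "((%x. arctan (x / a) / (2 * a ^ 3)) \<longlongrightarrow> (pi / 2) / (2 * a ^ 3)) at_top"
    using assms by (intro tendsto_divide tendsto_const filterlim_compose[OF tendsto_arctan_at_top]) (real_asymp, simp)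
   ultimately show ?thesis using tendsto_add by fastforce
  qed
  show "(?F has_real_derivative 1 / (x\<^sup>2 + a\<^sup>2)\<^sup>2) (at x)" for x
  proof -
   have "((%x. arctan (x / a)) has_real_derivative (1 / a) * inverse (1 + (x / a)\<^sup>2)) (at x)"
    using assms by (auto intro!: derivative_eq_intros)
   note 1 = DERIV_cdivide[OF this, of "2 * a ^ 3"]
   have 2: "((%x. x / (2 * a\<^sup>2 * (x\<^sup>2 + a\<^sup>2))) has_real_derivative
     (1 * (2 * a\<^sup>2 * (x\<^sup>2 + a\<^sup>2)) - x * (2 * a\<^sup>2 * (2 * x))) / ((2 * a\<^sup>2 * (x\<^sup>2 + a\<^sup>2)) * (2 * a\<^sup>2 * (x\<^sup>2 + a\<^sup>2)))) (at x)"
    using assms pos[of x] by (intro DERIV_divide) (auto intro!: derivative_eq_intros)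
   define N where "N = x\<^sup>2 + a\<^sup>2"
   have N: "N > 0" using pos by (simp add: N_def)
   have q: "1 + (x / a)\<^sup>2 = N / a\<^sup>2" using assms by (simp add: N_def field_simps)
   have e1: "(1 / a) * inverse (1 + (x / a)\<^sup>2) / (2 * a ^ 3) = 1 / (2 * a\<^sup>2 * (x\<^sup>2 + a\<^sup>2))"
    unfolding N_def[symmetric] q using assms N by (simp add: power2_eq_square power3_eq_cube)
   have num: "1 * (2 * a\<^sup>2 * N) - x * (2 * a\<^sup>2 * (2 * x)) = 2 * a\<^sup>2 * (a\<^sup>2 - x\<^sup>2)"
    by (simp add: N_def algebra_simps power2_eq_square)
   have den: "(2 * a\<^sup>2 * N) * (2 * a\<^sup>2 * N) = 2 * a\<^sup>2 * (2 * a\<^sup>2 * N\<^sup>2)"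
    by (simp add: power2_eq_square)
   have e2: "(1 * (2 * a\<^sup>2 * (x\<^sup>2 + a\<^sup>2)) - x * (2 * a\<^sup>2 * (2 * x))) / ((2 * a\<^sup>2 * (x\<^sup>2 + a\<^sup>2)) * (2 * a\<^sup>2 * (x\<^sup>2 + a\<^sup>2)))
     = (a\<^sup>2 - x\<^sup>2) / (2 * a\<^sup>2 * (x\<^sup>2 + a\<^sup>2)\<^sup>2)"
    unfolding N_def[symmetric] num den using assms by (intro nonzero_mult_divide_mult_cancel_left) simp
   have "1 / (2 * a\<^sup>2 * N) = N / (2 * a\<^sup>2 * N\<^sup>2)" using N by (simp add: power2_eq_square)
   then have "(a\<^sup>2 - x\<^sup>2) / (2 * a\<^sup>2 * N\<^sup>2) + 1 / (2 * a\<^sup>2 * N) = (a\<^sup>2 - x\<^sup>2 + N) / (2 * a\<^sup>2 * N\<^sup>2)"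
    by (simp add: add_divide_distrib)
   also have "a\<^sup>2 - x\<^sup>2 + N = 2 * a\<^sup>2" by (simp add: N_def)
   also have "2 * a\<^sup>2 / (2 * a\<^sup>2 * N\<^sup>2) = 1 / N\<^sup>2" using assms by simp
   finally have "(a\<^sup>2 - x\<^sup>2) / (2 * a\<^sup>2 * (x\<^sup>2 + a\<^sup>2)\<^sup>2) + 1 / (2 * a\<^sup>2 * (x\<^sup>2 + a\<^sup>2)) = 1 / (x\<^sup>2 + a\<^sup>2)\<^sup>2"
    unfolding N_def .
   with DERIV_add[OF 2 1] show ?thesis unfolding e1 e2 by simp
  qed
 qed (use pos in auto)
 finally show ?thesis using assms by (simp add: ennreal_mult'[symmetric] flip: ennreal_numeral)
qed

lemma nn_integral_one_plus_square_power3: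
 "(II y. en (1 / sqrt (1 + y\<^sup>2) ^ 3)) = 2"
proof -
 have pos: "0 < 1 + y\<^sup>2" for y :: real by (simp add: add_pos_nonneg)
 have "(II y. en (1 / sqrt (1 + y\<^sup>2) ^ 3)) = 2 * (II y. en (1 / sqrt (1 + y\<^sup>2) ^ 3) * ind {0..} y)"
  by (rule nn_integral_even) auto
 also have "(II y. en (1 / sqrt (1 + y\<^sup>2) ^ 3) * ind {0..} y) = en (1 - 0 / sqrt (1 + 0\<^sup>2))"
 proof (rule nn_integral_FTC_atLeast)
  show "((%y. y / sqrt (1 + y\<^sup>2)) \<longlongrightarrow> 1) at_top" by real_asymp
  show "((%y. y / sqrt (1 + y\<^sup>2)) has_real_derivative 1 / sqrt (1 + y\<^sup>2) ^ 3) (at y)" for y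
  proof -
   have s: "0 < sqrt (1 + y\<^sup>2)" "(sqrt (1 + y\<^sup>2))\<^sup>2 = 1 + y\<^sup>2" using pos[of y] by auto
   have "((%y. sqrt (1 + y\<^sup>2)) has_real_derivative y / sqrt (1 + y\<^sup>2)) (at y)"
    using pos[of y] by (auto intro!: derivative_eq_intros simp: field_simps)
   then have "((%y. y / sqrt (1 + y\<^sup>2)) has_real_derivative
     (1 * sqrt (1 + y\<^sup>2) - y * (y / sqrt (1 + y\<^sup>2))) / (sqrt (1 + y\<^sup>2) * sqrt (1 + y\<^sup>2))) (at y)"
    using s by (intro DERIV_divide DERIV_ident) auto
   moreover have eq: "(1 * r - y * (y / r)) / (r * r) = 1 / r ^ 3" if "0 < r" "r\<^sup>2 = 1 + y\<^sup>2" for r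
   proof -
    have "r * r - y * y = 1" using that by (simp add: power2_eq_square)
    then have "(1 * r - y * (y / r)) = 1 / r" using that by (simp add: field_simps)
    then show ?thesis using that by (simp add: power3_eq_cube field_simps)
   qed
   ultimately show ?thesis by (elim DERIV_cong) (rule eq[OF s])
  qed
 qed auto
 finally show ?thesis by simp
qed

lemma Dreg_nonneg [simp]: "0 <= Dreg dl ze"
 by (simp add: Dreg_def)

lemma Dreg_measurable [measurable]: "Dreg dl \<in> bmeas"
 unfolding Dreg_def[abs_def] by measurable

lemma Kreg_measurable [measurable]: "Kreg dl \<in> bmeas"
proof -
 have "continuous_on UNIV cnj" by (intro continuous_intros)
 then have [measurable]: "cnj \<in> bmeas" by (rule borel_measurable_continuous_onI)
 show ?thesis unfolding Kreg_def[abs_def] by measurable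
qed

lemma nn_integral_Dreg: "(II v. en (Dreg 1 v)) = en pi"
proof -
 have "(II v. en (Dreg 1 v)) = (II y. II x. en (Dreg 1 (Complex x y)))"
  by (rule nn_integral_complex) measurable
 also have "... = (II y. en (pi / 2) * en (1 / sqrt (1 + y\<^sup>2) ^ 3))"
 proof (rule nn_integral_cong)
  fix y :: real
  have "(II x. en (Dreg 1 (Complex x y))) = (II x. en (1 / (x\<^sup>2 + (sqrt (1 + y\<^sup>2))\<^sup>2)\<^sup>2))"
   by (simp add: Dreg_def cmod_power2 ac_simps)
  also have "... = en (pi / (2 * sqrt (1 + y\<^sup>2) ^ 3))"
   by (rule nn_integral_inverse_square_plus_power2) (simp add: add_pos_nonneg)
  finally show "(II x. en (Dreg 1 (Complex x y))) = en (pi / 2) * en (1 / sqrt (1 + y\<^sup>2) ^ 3)"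
   by (simp add: ennreal_mult'[symmetric])
 qed
 also have "... = en pi"
  by (subst nn_integral_cmult) (auto simp: nn_integral_one_plus_square_power3 ennreal_mult'[symmetric] simp flip: ennreal_numeral)
 finally show ?thesis .
qed

lemma integrable_Dreg1: "integrable lborel (Dreg 1)" and integral_Dreg1: "(LINT v|lborel. Dreg 1 v) = pi"
proof -
 show "integrable lborel (Dreg 1)"
  by (rule integrableI_nonneg) (auto simp: nn_integral_Dreg)
 show "(LINT v|lborel. Dreg 1 v) = pi"
  by (subst integral_eq_nn_integral) (auto simp: nn_integral_Dreg)
qed

lemma integral_complex_affine:
 fixes f :: "complex => 'a::{banach, second_countable_topology}"
 assumes [measurable]: "f \<in> bmeas" and c: "c ~= 0"
 shows "(LINT z|lborel. f z) = c\<^sup>2 *\<^sub>R (LINT z|lborel. f (t + c *\<^sub>R z))"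
 by (subst lborel_affine[OF c, of t])
   (simp add: integral_density integral_distr)

lemma Dreg_convolution:
 fixes g :: "complex => complex"
 assumes [measurable]: "g \<in> bmeas" and "dl > 0"
 shows "(LINT w|lborel. cr (Dreg dl (z - w)) * g w) = (LINT v|lborel. cr (Dreg 1 v) * g (z + dl *\<^sub>R v))"
proof -
 have "(LINT w|lborel. cr (Dreg dl (z - w)) * g w)
   = dl\<^sup>2 *\<^sub>R (LINT v|lborel. cr (Dreg dl (z - (z + dl *\<^sub>R v))) * g (z + dl *\<^sub>R v))"
  using assms by (intro integral_complex_affine) auto
 also have "... = (LINT v|lborel. dl\<^sup>2 *\<^sub>R (cr (Dreg dl (z - (z + dl *\<^sub>R v))) * g (z + dl *\<^sub>R v)))"
  by simp
 also have "... = (LINT v|lborel. cr (Dreg 1 v) * g (z + dl *\<^sub>R v))"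
 proof (rule Bochner_Integration.integral_cong[OF refl])
  fix v
  have "dl\<^sup>2 * Dreg dl (z - (z + dl *\<^sub>R v)) = Dreg 1 v"
  proof -
   have e: "(cmod (z - (z + dl *\<^sub>R v)))\<^sup>2 + dl\<^sup>2 = dl\<^sup>2 * ((cmod v)\<^sup>2 + 1)"
    using assms by (simp add: power_mult_distrib algebra_simps)
   have "dl\<^sup>2 * (dl\<^sup>2 / (dl\<^sup>2 * Q)\<^sup>2) = 1\<^sup>2 / (Q + 0)\<^sup>2" for Q
    using assms by (simp add: power2_eq_square)
   then show ?thesis unfolding Dreg_def e by simp
  qed
  then show "dl\<^sup>2 *\<^sub>R (cr (Dreg dl (z - (z + dl *\<^sub>R v))) * g (z + dl *\<^sub>R v)) = cr (Dreg 1 v) * g (z + dl *\<^sub>R v)"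
   by (simp only: scaleR_conv_of_real mult.assoc[symmetric] of_real_mult[symmetric])
 qed
 finally show ?thesis .
qed

text \<open>After rescaling, the density is the fixed function \<open>Dreg 1\<close> and the small
  parameter occurs only in the argument of \<open>g\<close>. Dominated convergence then needs no
  more than a bound on \<open>g\<close> and continuity at the single point \<open>z\<close>.\<close>

lemma Dreg_approx_identity:
 fixes g :: "complex => complex"
 assumes [measurable]: "g \<in> bmeas" and B: "!!w. cmod (g w) <= B" and c: "isCont g z"
 shows "(%n. LINT w|lborel. cr (Dreg (inverse (real (Suc n))) (z - w)) * g w) \<longlonglongrightarrow> cr pi * g z"
proof -
 have "(%n. LINT v|lborel. cr (Dreg 1 v) * g (z + inverse (real (Suc n)) *\<^sub>R v))
   \<longlonglongrightarrow> (LINT v|lborel. cr (Dreg 1 v) * g z)"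
 proof (rule integral_dominated_convergence[where w="%v. Dreg 1 v * B"])
  show "integrable lborel (%v. Dreg 1 v * B)" using integrable_Dreg1 by simp
  show "AE v in lborel. (%n. cr (Dreg 1 v) * g (z + inverse (real (Suc n)) *\<^sub>R v)) \<longlonglongrightarrow> cr (Dreg 1 v) * g z"
  proof (rule AE_I2, rule tendsto_mult[OF tendsto_const])
   fix v
   have "(%n. z + inverse (real (Suc n)) *\<^sub>R v) \<longlonglongrightarrow> z + 0 *\<^sub>R v"
    by (intro tendsto_intros LIMSEQ_inverse_real_of_nat)
   then show "(%n. g (z + inverse (real (Suc n)) *\<^sub>R v)) \<longlonglongrightarrow> g z"
    using isCont_tendsto_compose[OF c] by simp
  qed
  show "AE v in lborel. norm (cr (Dreg 1 v) * g (z + inverse (real (Suc n)) *\<^sub>R v)) <= Dreg 1 v * B" for n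
   using B by (auto simp: norm_mult intro!: AE_I2 mult_left_mono)
 qed auto
 moreover have "(LINT v|lborel. cr (Dreg 1 v) * g z) = cr pi * g z"
  using integral_Dreg1 integrable_Dreg1 by simp
 moreover have "(LINT w|lborel. cr (Dreg (inverse (real (Suc n))) (z - w)) * g w)
   = (LINT v|lborel. cr (Dreg 1 v) * g (z + inverse (real (Suc n)) *\<^sub>R v))" for n
  by (rule Dreg_convolution) auto
 ultimately show ?thesis by (simp only:)
qed

section \<open>Representation of decaying solutions of the \<open>\<partial>\<close>-bar equation\<close>

lemma jap_reg_le:
 assumes "dl > 0"
 shows "jap w <= ((1 + cmod z) / dl + 1) * sqrt ((cmod (z - w))\<^sup>2 + dl\<^sup>2)"
proof -
 define m where "m = sqrt ((cmod (z - w))\<^sup>2 + dl\<^sup>2)"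
 have m: "dl <= m" "cmod (z - w) <= m" "0 < m"
  unfolding m_def using assms by (auto intro!: real_le_rsqrt simp: add_nonneg_pos)
 have "jap w <= 1 + cmod w" by (rule jap_le)
 also have "cmod w <= cmod z + cmod (z - w)"
  using norm_triangle_ineq4[of z "z - w"] by simp
 also have "1 + (cmod z + cmod (z - w)) <= (1 + cmod z) * 1 + m" using m by simp
 also have "(1 + cmod z) * 1 <= (1 + cmod z) * (m / dl)"
  using m assms by (intro mult_left_mono) (auto simp: field_simps)
 finally show ?thesis unfolding m_def[symmetric] by (simp add: algebra_simps add_divide_distrib)
qed

text \<open>The first two bounds give decay in w for fixed z and fixed dl; their constants explode
  as dl tends to 0, which is harmless while a cutoff is being removed at fixed dl. The last bound is
  uniform in dl and serves the limit dl to 0.\<close>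

lemma Kreg_bounds:
 assumes "dl > 0"
 shows "cmod (Kreg dl (z - w)) <= ((1 + cmod z) / dl + 1) / jap w"
  and "Dreg dl (z - w) <= dl\<^sup>2 * ((1 + cmod z) / dl + 1) ^ 4 / jap w ^ 4"
  and "cmod (Kreg dl ze) <= 1 / dl" and "cmod (Kreg dl ze) <= 1 / cmod ze"
proof -
 define c m where "c = (1 + cmod z) / dl + 1" and "m = sqrt ((cmod (z - w))\<^sup>2 + dl\<^sup>2)"
 have c: "0 < c" unfolding c_def using assms by (simp add: add_nonneg_pos)
 have m: "dl <= m" "cmod (z - w) <= m" "0 < m"
  unfolding m_def using assms by (auto intro!: real_le_rsqrt simp: add_nonneg_pos)
 have m2: "(cmod (z - w))\<^sup>2 + dl\<^sup>2 = m\<^sup>2" unfolding m_def by simp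
 have j: "jap w <= c * m" using jap_reg_le[OF assms] by (simp add: c_def m_def)
 then have j': "1 / m <= c / jap w" using m jap_pos[of w] by (simp add: field_simps)
 have "cmod (Kreg dl (z - w)) = cmod (z - w) / m\<^sup>2"
  using m by (simp add: Kreg_def norm_divide m2 del: of_real_add of_real_power complex_cnj_diff)
 also have "... <= 1 / m" using m by (simp add: field_simps power2_eq_square)
 also note j'
 finally show "cmod (Kreg dl (z - w)) <= c / jap w" .
 have "Dreg dl (z - w) = dl\<^sup>2 * (1 / m) ^ 4"
  by (simp add: Dreg_def m2 power_one_over flip: power_mult)
 also have "... <= dl\<^sup>2 * (c / jap w) ^ 4"
  using j' m by (intro mult_left_mono power_mono) auto
 finally show "Dreg dl (z - w) <= dl\<^sup>2 * c ^ 4 / jap w ^ 4" by (simp add: power_divide)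
 define n where "n = sqrt ((cmod ze)\<^sup>2 + dl\<^sup>2)"
 have n: "dl <= n" "cmod ze <= n" "0 < n"
  unfolding n_def using assms by (auto intro!: real_le_rsqrt simp: add_nonneg_pos)
 have n2: "(cmod ze)\<^sup>2 + dl\<^sup>2 = n\<^sup>2" unfolding n_def by simp
 have k: "cmod (Kreg dl ze) = cmod ze / n\<^sup>2"
  using n by (simp add: Kreg_def norm_divide n2 del: of_real_add of_real_power)
 have "cmod ze / n\<^sup>2 <= 1 / n" using n by (simp add: field_simps power2_eq_square)
 also have "... <= 1 / dl" using n assms by (simp add: field_simps)
 finally show "cmod (Kreg dl ze) <= 1 / dl" unfolding k .
 show "cmod (Kreg dl ze) <= 1 / cmod ze"
 proof (cases "ze = 0")
  case False
  have "cmod ze * cmod ze <= n\<^sup>2" using n by (simp add: power2_eq_square mult_mono)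
  then show ?thesis unfolding k using False n by (simp add: field_simps)
 qed (simp add: Kreg_def)
qed

lemma Kreg_tendsto: "(%n. Kreg (inverse (real (Suc n))) ze) \<longlonglongrightarrow> 1 / ze"
proof (cases "ze = 0")
 case False
 have "(%n. cnj ze / cr ((cmod ze)\<^sup>2 + (inverse (real (Suc n)))\<^sup>2)) \<longlonglongrightarrow> cnj ze / cr ((cmod ze)\<^sup>2 + 0\<^sup>2)"
  using False by (intro tendsto_intros LIMSEQ_inverse_real_of_nat) auto
 moreover have "cr ((cmod ze)\<^sup>2 + 0\<^sup>2) = ze * cnj ze"
  unfolding complex_norm_square[symmetric] by simp
 then have "cnj ze / cr ((cmod ze)\<^sup>2 + 0\<^sup>2) = 1 / ze"
  using False by simp
 ultimately show ?thesis by (simp add: Kreg_def)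
qed (simp add: Kreg_def)

text \<open>Cauchy-Schwarz against <w>^(ep - 3), whose square is at most <w>^-4 because ep <= 1. The
  power 3 is within the decay of \<open>Dreg\<close>, so u can be paired with it.\<close>

lemma weighted_integrable:
 assumes [measurable]: "u \<in> bmeas" and "wN ep u < \<infinity>" "ep <= 1"
 shows "integrable lborel (%w. cmod (u w) / jap w ^ 3)"
proof (rule integrableI_nonneg)
 have "(II w. en (jap w powr (- ep) * cmod (u w)) * en (jap w powr ep / jap w ^ 3))\<^sup>2
  <= (II w. (en (jap w powr (- ep) * cmod (u w)))\<^sup>2) * (II w. (en (jap w powr ep / jap w ^ 3))\<^sup>2)"
  by (rule nn_integral_Cauchy_Schwarz) auto
 also have "(II w. (en (jap w powr (- ep) * cmod (u w)))\<^sup>2) = wN ep u"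
  unfolding wN_def
 proof (rule nn_integral_cong)
  fix w
  have "(jap w powr (- ep))\<^sup>2 = jap w powr (- 2 * ep)"
   using jap_pos[of w] by (simp add: powr_powr mult.commute flip: powr_numeral)
  then show "(en (jap w powr (- ep) * cmod (u w)))\<^sup>2 = en (jap w powr (- 2 * ep) * (cmod (u w))\<^sup>2)"
   by (simp add: ennreal_power power_mult_distrib)
 qed
 also have "wN ep u * (II w. (en (jap w powr ep / jap w ^ 3))\<^sup>2) < \<infinity>"
 proof -
  have "(II w. (en (jap w powr ep / jap w ^ 3))\<^sup>2) <= (II w. en (jap w powr (- 4)))"
  proof (rule nn_integral_mono)
   fix w
   have "jap w powr ep <= jap w" using jap_ge_1[of w] assms(3) powr_mono[of ep 1 "jap w"] by simp
   then have "jap w powr ep / jap w ^ 3 <= jap w / jap w ^ 3" using jap_pos[of w] by (intro divide_right_mono) auto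
   also have "... = 1 / (jap w)\<^sup>2" using jap_pos[of w] by (simp add: power3_eq_cube power2_eq_square)
   finally have "(jap w powr ep / jap w ^ 3)\<^sup>2 <= (1 / (jap w)\<^sup>2)\<^sup>2" by (intro power_mono) auto
   also have "... = jap w powr (- 4)" using jap_pos[of w] by (simp add: powr_minus_divide powr_numeral power_one_over flip: power_mult)
   finally show "(en (jap w powr ep / jap w ^ 3))\<^sup>2 <= en (jap w powr (- 4))"
    by (simp add: ennreal_power ennreal_leI)
  qed
  also have "... < \<infinity>" using jap_powr_integrable[of 4] by simp
  finally show ?thesis using assms(2) by (auto simp: ennreal_mult_less_top)
 qed
 finally have "(II w. en (jap w powr (- ep) * cmod (u w)) * en (jap w powr ep / jap w ^ 3)) < \<infinity>"
  by (simp add: power_less_top_ennreal)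
 moreover have "en (jap w powr (- ep) * cmod (u w)) * en (jap w powr ep / jap w ^ 3) = en (cmod (u w) / jap w ^ 3)" for w
  using jap_pos[of w] by (simp add: ennreal_mult'[symmetric] powr_minus field_simps)
 ultimately show "(II w. en (cmod (u w) / jap w ^ 3)) < \<infinity>" by simp
qed auto

lemma cutoff_has_derivative:
 "(cutoff R has_derivative (%h. cr (- (2 * exp 1 / R\<^sup>2) * bump (pCons 0 (pCons 0 1)) (1 - (cmod w)\<^sup>2 / R\<^sup>2) * (w \<bullet> h)))) (at w)"
proof -
 have "((%w. 1 - (cmod w)\<^sup>2 / R\<^sup>2) has_derivative (%h. - (2 * (w \<bullet> h)) / R\<^sup>2)) (at w)"
  using has_derivative_diff[OF has_derivative_const has_derivative_mult_right[OF has_derivative_cmod_power2, of "1 / R\<^sup>2"], of 1]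
  by simp
 from has_derivative_compose[OF this bump_has_derivative[unfolded has_field_derivative_def, of 1]]
 have "((%w. bump 1 (1 - (cmod w)\<^sup>2 / R\<^sup>2)) has_derivative
  (%h. bump (pCons 0 (pCons 0 (1 - pderiv 1))) (1 - (cmod w)\<^sup>2 / R\<^sup>2) * (- (2 * (w \<bullet> h)) / R\<^sup>2))) (at w)"
  by simp
 note d = has_derivative_mult_right[OF this, of "exp 1"]
 have "(cutoff R has_derivative (%h. cr (exp 1 *
  (bump (pCons 0 (pCons 0 (1 - pderiv 1))) (1 - (cmod w)\<^sup>2 / R\<^sup>2) * (- (2 * (w \<bullet> h)) / R\<^sup>2))))) (at w)"
  unfolding cutoff_def[abs_def] by (rule bounded_linear.has_derivative[OF bounded_linear_of_real d])
 then show ?thesis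
  by (rule has_derivative_eq_rhs) (intro ext arg_cong[where f=cr], simp add: pderiv_1)
qed

lemma wirtinger_bar_cutoff:
 "wirtinger_bar (cutoff R) w = - cr (exp 1 / R\<^sup>2 * bump (pCons 0 (pCons 0 1)) (1 - (cmod w)\<^sup>2 / R\<^sup>2)) * w"
proof -
 define b where "b = exp 1 / R\<^sup>2 * bump (pCons 0 (pCons 0 1)) (1 - (cmod w)\<^sup>2 / R\<^sup>2)"
 have "wirtinger_bar (cutoff R) w = (cr (- 2 * b * Re w) + \<i> * cr (- 2 * b * Im w)) / 2"
  unfolding wirtinger_bar_eq(1)[OF cutoff_has_derivative] b_def by (simp add: inner_complex_def)
 also have "... = - cr b * (cr (Re w) + \<i> * cr (Im w))"
  by (simp add: field_simps)
 finally show ?thesis unfolding b_def complex_eq[symmetric] .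
qed

text \<open>The factor \<open>cmod w\<close> in the third bound is kept because it cancels against
  the decay 1/<w> of \<open>Kreg\<close>, leaving 1/R^2. The constant 6 is the bound 3 for e times
  the bound 2 for the derivative of the bump.\<close>

lemma cutoff_bounds:
 assumes "R > 0"
 shows "cmod (cutoff R w) <= 3" "R <= cmod w ==> cutoff R w = 0"
  "cmod (wirtinger_bar (cutoff R) w) <= 6 * cmod w / R\<^sup>2 * ind (ball 0 R) w"
proof -
 have e: "exp 1 <= (3::real)" by (rule exp_le)
 have out: "bump p (1 - (cmod w)\<^sup>2 / R\<^sup>2) = 0" if "R <= cmod w" for p
 proof -
  have "R\<^sup>2 <= (cmod w)\<^sup>2" using assms that by (intro power_mono) auto
  then have "1 <= (cmod w)\<^sup>2 / R\<^sup>2" using assms by simp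
  then show ?thesis by (simp add: bump_def)
 qed
 have "exp 1 * bump 1 (1 - (cmod w)\<^sup>2 / R\<^sup>2) <= 3 * 1"
  using e bump_bounds by (intro mult_mono) auto
 then show "cmod (cutoff R w) <= 3" using bump_bounds(1) by (simp add: cutoff_def norm_mult)
 show "cutoff R w = 0" if "R <= cmod w" using out[OF that] by (simp add: cutoff_def)
 show "cmod (wirtinger_bar (cutoff R) w) <= 6 * cmod w / R\<^sup>2 * ind (ball 0 R) w"
 proof (cases "R <= cmod w")
  case True then show ?thesis using out[OF True] by (simp add: wirtinger_bar_cutoff)
 next
  case False
  have "exp 1 * \<bar>bump (pCons 0 (pCons 0 1)) (1 - (cmod w)\<^sup>2 / R\<^sup>2)\<bar> <= 3 * 2"
   using e bump_bounds by (intro mult_mono) auto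
  then have "exp 1 * \<bar>bump (pCons 0 (pCons 0 1)) (1 - (cmod w)\<^sup>2 / R\<^sup>2)\<bar> * cmod w / R\<^sup>2 <= 6 * cmod w / R\<^sup>2"
   by (intro divide_right_mono mult_right_mono) auto
  then show ?thesis using False
   by (simp add: wirtinger_bar_cutoff norm_mult norm_divide norm_power abs_mult mult_ac)
 qed
qed

lemma cutoff_tendsto: "(%n. cutoff (real (Suc n)) w) \<longlonglongrightarrow> 1"
proof -
 have "(%n. 1 - (cmod w)\<^sup>2 * (inverse (real (Suc n)))\<^sup>2) \<longlonglongrightarrow> 1 - (cmod w)\<^sup>2 * 0\<^sup>2"
  by (intro tendsto_intros LIMSEQ_inverse_real_of_nat)
 then have "(%n. 1 - (cmod w)\<^sup>2 / (real (Suc n))\<^sup>2) \<longlonglongrightarrow> 1"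
  by (simp add: divide_inverse power_inverse)
 then have "(%n. bump 1 (1 - (cmod w)\<^sup>2 / (real (Suc n))\<^sup>2)) \<longlonglongrightarrow> bump 1 1"
  by (rule isCont_tendsto_compose[OF DERIV_isCont[OF bump_has_derivative]])
 then have "(%n. cr (exp 1 * bump 1 (1 - (cmod w)\<^sup>2 / (real (Suc n))\<^sup>2))) \<longlonglongrightarrow> cr (exp 1 * bump 1 1)"
  by (intro tendsto_intros)
 then show ?thesis by (simp add: cutoff_def bump_def exp_minus)
qed

lemma wirtinger_bar_mult:
 assumes "f differentiable (at z)" "g differentiable (at z)"
 shows "wirtinger_bar (%z. f z * g z) z = f z * wirtinger_bar g z + wirtinger_bar f z * g z"
proof -
 obtain F G where F: "(f has_derivative F) (at z)" and G: "(g has_derivative G) (at z)"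
  using assms by (auto simp: differentiable_def)
 show ?thesis
  unfolding wirtinger_bar_eq(1)[OF has_derivative_mult[OF F G]] wirtinger_bar_eq(1)[OF F] wirtinger_bar_eq(1)[OF G]
  by (simp add: algebra_simps add_divide_distrib)
qed

lemma test_function_cutoff_Kreg:
 assumes "R > 0" "dl > 0"
 shows "test_function (%w. cutoff R w * Kreg dl (z - w))"
 unfolding test_function_def
proof (intro conjI allI)
 show "C_k n (%w. cutoff R w * Kreg dl (z - w))" for n
  using assms by (intro C_k_mult C_k_cutoff C_k_Kreg) auto
 have "{w. cutoff R w * Kreg dl (z - w) ~= 0} \<subseteq> cball 0 R"
  using cutoff_bounds(2)[OF assms(1)] by (auto simp: not_le) (meson linear)
 then have "closure {w. cutoff R w * Kreg dl (z - w) ~= 0} \<subseteq> cball 0 R"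
  by (simp add: closure_minimal)
 then show "compact (closure {w. cutoff R w * Kreg dl (z - w) ~= 0})"
  by (meson bounded_cball bounded_subset closed_closure compact_eq_bounded_closed)
qed

lemma test_function_measurable:
 assumes "test_function ps"
 shows "ps \<in> bmeas" "wirtinger_bar ps \<in> bmeas" "wirtinger ps \<in> bmeas"
proof -
 have C: "C_k n ps" for n using assms by (simp add: test_function_def)
 have "continuous_on UNIV ps" "continuous_on UNIV (partial_x ps)" "continuous_on UNIV (partial_y ps)"
  using C[of 0] C[of "Suc 0"] by auto
 note [measurable] = this[THEN borel_measurable_continuous_onI]
 show "ps \<in> bmeas" by measurable
 show "wirtinger_bar ps \<in> bmeas" "wirtinger ps \<in> bmeas"
  unfolding wirtinger_bar_def[abs_def] wirtinger_def[abs_def] by measurable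
qed

lemma ennreal_times_indicator_power2:
 "0 <= x ==> (en x * ind S w)\<^sup>2 = en (x\<^sup>2) * ind S w"
 by (cases "w \<in> S") (simp_all add: ennreal_power)

lemma ennreal_times_indicator_mono:
 "(w \<in> S ==> x <= y) ==> ennreal x * ind S w <= en y * ind S w"
 by (cases "w \<in> S") (simp_all add: ennreal_leI)

lemma ball_borel_measurable [measurable]: "ball (a :: 'a :: euclidean_space) r \<in> sets borel"
 by simp

lemma emeasure_ball_complex_le: "emeasure lborel (ball (0::complex) R) <= en (4 * R\<^sup>2)"
proof (cases "R <= 0")
 case False
 have "ball (0::complex) R \<subseteq> box (Complex (- R) (- R)) (Complex R R)"
 proof
  fix w :: complex assume "w \<in> ball 0 R"
  then have "\<bar>Re w\<bar> < R" "\<bar>Im w\<bar> < R"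
   using abs_Re_le_cmod[of w] abs_Im_le_cmod[of w] by auto
  then show "w \<in> box (Complex (- R) (- R)) (Complex R R)"
   by (auto simp: in_box_complex_iff abs_less_iff)
 qed
 then have "emeasure lborel (ball (0::complex) R) <= emeasure lborel (box (Complex (- R) (- R)) (Complex R R))"
  by (intro emeasure_mono) auto
 also have "... = en (4 * R\<^sup>2)"
  using False by (subst emeasure_lborel_box) (auto simp: Basis_complex_def inner_complex_def power2_eq_square)
 finally show ?thesis .
qed (simp add: ball_empty)

text \<open>The error term created by the cutoff; \<open>ep <= 1\<close> is what makes it vanish.\<close>

lemma cutoff_error_tendsto:
 assumes [measurable]: "u \<in> bmeas" and fin: "wN ep u < \<infinity>" "ep <= 1"
 shows "(%n. II w. en (cmod (u w) / (real (Suc n))\<^sup>2) * ind (ball 0 (real (Suc n))) w) \<longlonglongrightarrow> 0"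
proof -
 \<comment> \<open>At ep = 1 a direct Cauchy-Schwarz estimate is bounded but does not tend to 0. A
   factor sqrt (<w> / R) is therefore shifted onto u: <w> / R is at most 2 on the disc and vanishes
   in the limit for each w, so \<open>a\<close> tends to 0, while the complementary factor stays
   bounded by 8.\<close>
 define a where "a = (%n. II w. en (jap w powr (- 2 * ep) * (cmod (u w))\<^sup>2 * (jap w / real (Suc n))) * ind (ball 0 (real (Suc n))) w)"
 have a0: "a \<longlonglongrightarrow> (\<integral>\<^sup>+w. 0 \<partial>(lborel :: complex measure))"
  unfolding a_def
 proof (rule nn_integral_dominated_convergence[where w="%w. 2 * en (jap w powr (- 2 * ep) * (cmod (u w))\<^sup>2)"])
  show "(II w. 2 * en (jap w powr (- 2 * ep) * (cmod (u w))\<^sup>2)) < \<infinity>"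
   using fin by (subst nn_integral_cmult) (auto simp: wN_def ennreal_mult_less_top)
  show "AE w in lborel. en (jap w powr (- 2 * ep) * (cmod (u w))\<^sup>2 * (jap w / real (Suc n))) * ind (ball 0 (real (Suc n))) w
    <= 2 * en (jap w powr (- 2 * ep) * (cmod (u w))\<^sup>2)" for n
  proof (rule AE_I2)
   fix w
   have "jap w / real (Suc n) <= 2" if "cmod w < real (Suc n)"
    using that jap_le[of w] by (simp add: field_simps)
   then have "jap w powr (- 2 * ep) * (cmod (u w))\<^sup>2 * (jap w / real (Suc n)) <= jap w powr (- 2 * ep) * (cmod (u w))\<^sup>2 * 2" if "cmod w < real (Suc n)"
    using that by (intro mult_left_mono) auto
   then show "en (jap w powr (- 2 * ep) * (cmod (u w))\<^sup>2 * (jap w / real (Suc n))) * ind (ball 0 (real (Suc n))) w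
    <= 2 * en (jap w powr (- 2 * ep) * (cmod (u w))\<^sup>2)"
    by (auto simp: ennreal_mult'[symmetric] mult.commute intro!: ennreal_leI simp flip: ennreal_numeral split: split_indicator)
  qed
  show "AE w in lborel. (%n. en (jap w powr (- 2 * ep) * (cmod (u w))\<^sup>2 * (jap w / real (Suc n))) * ind (ball 0 (real (Suc n))) w) \<longlonglongrightarrow> 0"
  proof (rule AE_I2)
   fix w
   let ?b = "%n. en (jap w powr (- 2 * ep) * (cmod (u w))\<^sup>2 * (jap w / real (Suc n)))"
   have "(%n. jap w powr (- 2 * ep) * (cmod (u w))\<^sup>2 * (jap w * inverse (real (Suc n)))) \<longlonglongrightarrow> jap w powr (- 2 * ep) * (cmod (u w))\<^sup>2 * (jap w * 0)"
    by (intro tendsto_intros LIMSEQ_inverse_real_of_nat)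
   then have "?b \<longlonglongrightarrow> en 0" by (intro tendsto_ennrealI) (simp add: divide_inverse)
   then have b0: "?b \<longlonglongrightarrow> 0" by simp
   have i: "c * ind A w <= c" for c :: ennreal and A
    by (cases "w \<in> A") simp_all
   show "(%n. ?b n * ind (ball 0 (real (Suc n))) w) \<longlonglongrightarrow> 0"
    by (rule tendsto_sandwich[OF always_eventually always_eventually tendsto_const b0]) (intro allI zero_le i)+
  qed
 qed measurable
 let ?I = "%n. II w. en (cmod (u w) / (real (Suc n))\<^sup>2) * ind (ball 0 (real (Suc n))) w"
 have le: "(?I n)\<^sup>2 <= 8 * a n" for n
 proof -
  define R where "R = real (Suc n)"
  have R: "R \<ge> 1" by (simp add: R_def)
  let ?f = "%w. en (jap w powr (- ep) * cmod (u w) * sqrt (jap w / R)) * ind (ball 0 R) w"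
  let ?g = "%w. en (jap w powr ep / R\<^sup>2 * sqrt (R / jap w)) * ind (ball 0 R) w"
  have I: "?I n = (II w. ?f w * ?g w)"
  proof (rule nn_integral_cong)
   fix w
   have st: "sqrt (jap w / R) * sqrt (R / jap w) = 1"
    using R jap_pos[of w] by (simp flip: real_sqrt_mult)
   have "A * c * s * (B / r * t) = (A * B) * c * (s * t) / r" for A B c s t r :: real
    by (simp add: mult_ac)
   from this[of "jap w powr (- ep)" "cmod (u w)" "sqrt (jap w / R)" "jap w powr ep" "R\<^sup>2" "sqrt (R / jap w)"]
   have "jap w powr (- ep) * cmod (u w) * sqrt (jap w / R) * (jap w powr ep / R\<^sup>2 * sqrt (R / jap w)) = (jap w powr (- ep) * jap w powr ep) * cmod (u w) / R\<^sup>2"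
    by (simp only: st mult_1_right)
   also have "jap w powr (- ep) * jap w powr ep = 1" using jap_pos[of w] by (simp flip: powr_add)
   finally have E: "jap w powr (- ep) * cmod (u w) * sqrt (jap w / R) * (jap w powr ep / R\<^sup>2 * sqrt (R / jap w)) = cmod (u w) / R\<^sup>2"
    by simp
   have "0 <= jap w powr (- ep) * cmod (u w) * sqrt (jap w / R)" using R by simp
   from ennreal_mult'[OF this, of "jap w powr ep / R\<^sup>2 * sqrt (R / jap w)"]
   show "en (cmod (u w) / (real (Suc n))\<^sup>2) * ind (ball 0 (real (Suc n))) w = ?f w * ?g w"
    unfolding R_def[symmetric] E by (cases "w \<in> ball 0 R") (simp_all only: indicator_simps mult_1_right mult_zero_right not_False_eq_True)
  qed
  have CS: "(II w. ?f w * ?g w)\<^sup>2 <= (II w. (?f w)\<^sup>2) * (II w. (?g w)\<^sup>2)"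
   by (rule nn_integral_Cauchy_Schwarz) measurable
  have f2: "(II w. (?f w)\<^sup>2) = a n"
   unfolding a_def R_def[symmetric]
  proof (rule nn_integral_cong)
   fix w
   have "(jap w powr (- ep))\<^sup>2 = jap w powr (- 2 * ep)"
    using jap_pos[of w] by (simp add: powr_powr mult.commute flip: powr_numeral)
   moreover have "(sqrt (jap w / R))\<^sup>2 = jap w / R" using R jap_pos[of w] by simp
   ultimately have "(jap w powr (- ep) * cmod (u w) * sqrt (jap w / R))\<^sup>2 = jap w powr (- 2 * ep) * (cmod (u w))\<^sup>2 * (jap w / R)"
    by (simp only: power_mult_distrib)
   moreover have "0 <= jap w powr (- ep) * cmod (u w) * sqrt (jap w / R)" using R by simp
   ultimately show "(?f w)\<^sup>2 = en (jap w powr (- 2 * ep) * (cmod (u w))\<^sup>2 * (jap w / R)) * ind (ball 0 R) w"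
    by (simp only: ennreal_times_indicator_power2)
  qed
  have g2: "(II w. (?g w)\<^sup>2) <= 8"
  proof -
   have "(II w. (?g w)\<^sup>2) <= (II w. en (2 / R\<^sup>2) * ind (ball (0::complex) R) w)"
   proof (rule nn_integral_mono)
    fix w
    have "(jap w powr ep / R\<^sup>2 * sqrt (R / jap w))\<^sup>2 <= 2 / R\<^sup>2" if "cmod w < R"
    proof -
     have "jap w powr ep <= jap w" using jap_ge_1[of w] fin(2) powr_mono[of ep 1 "jap w"] by simp
     then have "(jap w powr ep)\<^sup>2 <= (jap w)\<^sup>2" by (intro power_mono) auto
     then have "(jap w powr ep)\<^sup>2 * (R / jap w) / R ^ 4 <= (jap w)\<^sup>2 * (R / jap w) / R ^ 4"
      using R jap_pos[of w] by (intro divide_right_mono mult_right_mono) auto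
     also have "... = jap w * R / R ^ 4" using jap_pos[of w] by (simp add: power2_eq_square)
     also have "... <= (2 * R) * R / R ^ 4"
      using that R jap_le[of w] by (intro divide_right_mono mult_right_mono) auto
     also have "... = 2 / R\<^sup>2" using R by (simp add: power2_eq_square power4_eq_xxxx)
     finally show ?thesis
      using R jap_pos[of w] by (simp add: power_mult_distrib power_divide flip: power_mult)
    qed
    moreover have "0 <= jap w powr ep / R\<^sup>2 * sqrt (R / jap w)" using R by simp
    ultimately show "(?g w)\<^sup>2 <= en (2 / R\<^sup>2) * ind (ball 0 R) w"
     by (simp only: ennreal_times_indicator_power2) (rule ennreal_times_indicator_mono, simp)
   qed
   also have "... = en (2 / R\<^sup>2) * emeasure lborel (ball (0::complex) R)"
    by (subst nn_integral_cmult_indicator) auto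
   also have "... <= en (2 / R\<^sup>2) * en (4 * R\<^sup>2)"
    by (intro mult_left_mono emeasure_ball_complex_le) auto
   also have "... = 8" using R by (simp add: ennreal_mult'[symmetric])
   finally show ?thesis .
  qed
  show ?thesis
   unfolding I using order_trans[OF CS[unfolded f2] mult_left_mono[OF g2]] by (simp only: mult.commute zero_le)
 qed
 have "(%n. 8 * a n) \<longlonglongrightarrow> 8 * 0"
  using a0 by (intro ennreal_tendsto_cmult) auto
 then have a8: "(%n. 8 * a n) \<longlonglongrightarrow> 0" by simp
 have sq: "(%n. (?I n)\<^sup>2) \<longlonglongrightarrow> 0"
  by (rule tendsto_sandwich[OF always_eventually always_eventually tendsto_const a8]) (intro allI zero_le le)+
 show ?thesis
 proof (rule order_tendstoI)
  fix e :: ennreal assume "0 < e"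
  then have "0 < e\<^sup>2" by (simp add: power2_eq_square ennreal_zero_less_mult_iff)
  from order_tendstoD(2)[OF sq this] show "\<forall>\<^sub>F n in sequentially. ?I n < e"
   by eventually_elim (metis not_le power_mono zero_le)
 qed auto
qed

text \<open>The solution operator of the conj-z derivative without the semiclassical scaling, that
  is, h times the operator E. Where the kernel is not integrable its value is 0, the default of the
  Bochner integral.\<close>

definition cauchyT :: "(complex => complex) => complex => complex" where
 "cauchyT F z = (LINT w|lborel. F w / (z - w)) / cr pi"

text \<open>The equation is tested with a cutoff times \<open>Kreg dl (z - w)\<close> and the cutoff
  radius is sent to infinity at fixed dl. The term in which the derivative falls on the cutoff
  disappears by \<open>cutoff_error_tendsto\<close>; the other two converge by domination.\<close>

lemma weak_solution_regularised:
 assumes weak: "has_weak_wirtinger_bar u f"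
  and [measurable]: "u \<in> bmeas" "f \<in> bmeas"
  and fin: "wN ep u < \<infinity>" "ep <= 1" and f: "integrable lborel f" and dl: "dl > 0"
 shows "(LINT w|lborel. u w * cr (Dreg dl (z - w))) = (LINT w|lborel. f w * Kreg dl (z - w))"
proof -
 define c where "c = (1 + cmod z) / dl + 1"
 have c: "c > 0" unfolding c_def using dl by (simp add: add_nonneg_pos)
 define X where "X = (%n. cutoff (real (Suc n)))"
 have X: "test_function (%w. X n w * Kreg dl (z - w))" for n
  unfolding X_def using dl by (intro test_function_cutoff_Kreg) auto
 have Xd: "X n differentiable (at w)" for n w
  unfolding X_def using cutoff_has_derivative[of "real (Suc n)" w] by (auto simp: differentiable_def)
 have Kd: "(%w. Kreg dl (z - w)) differentiable (at w)" for w
  using Kreg_has_derivative[of dl z w] dl by (auto simp: differentiable_def)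
 have [measurable]: "X n \<in> bmeas" for n
  using C_k_cutoff[of 0 "real (Suc n)"] unfolding X_def by (intro borel_measurable_continuous_onI) simp
 have [measurable]: "wirtinger_bar (X n) \<in> bmeas" for n
 proof -
  have "continuous_on UNIV (partial_x (X n))" "continuous_on UNIV (partial_y (X n))"
   using C_k_cutoff[of "Suc 0" "real (Suc n)"] unfolding X_def by simp_all
  note [measurable] = this[THEN borel_measurable_continuous_onI]
  show ?thesis unfolding wirtinger_bar_def[abs_def] by measurable
 qed
 have wb: "wirtinger_bar (%w. X n w * Kreg dl (z - w)) w = - (X n w * cr (Dreg dl (z - w))) + wirtinger_bar (X n) w * Kreg dl (z - w)" for n w
  using wirtinger_bar_mult[OF Xd Kd] wirtinger_bar_Kreg[of dl z w] dl by simp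
 have iu: "integrable lborel (%w. cmod (u w) / jap w ^ 3)"
  using weighted_integrable[OF _ fin] by simp
 have jD: "Dreg dl (z - w) <= (dl\<^sup>2 * c ^ 4) / jap w ^ 3" for w
 proof -
  have "Dreg dl (z - w) <= (dl\<^sup>2 * c ^ 4) / jap w ^ 4" using Kreg_bounds(2)[OF dl] by (simp add: c_def)
  also have "... <= (dl\<^sup>2 * c ^ 4) / jap w ^ 3"
   using jap_ge_1[of w] c by (intro divide_left_mono power_increasing) auto
  finally show ?thesis .
 qed
 have bD: "cmod (u w * (X n w * cr (Dreg dl (z - w)))) <= 3 * (dl\<^sup>2 * c ^ 4) * (cmod (u w) / jap w ^ 3)" for n w
 proof -
  have "cmod (X n w) * Dreg dl (z - w) <= 3 * ((dl\<^sup>2 * c ^ 4) / jap w ^ 3)"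
   unfolding X_def by (intro mult_mono cutoff_bounds jD) auto
  from mult_left_mono[OF this, of "cmod (u w)"] show ?thesis by (simp add: norm_mult mult_ac)
 qed
 have iD: "integrable lborel (%w. u w * (X n w * cr (Dreg dl (z - w))))" for n
  by (rule Bochner_Integration.integrable_bound[OF integrable_mult_right[OF iu, of "3 * (dl\<^sup>2 * c ^ 4)"]])
    (use bD c jap_pos in \<open>auto intro!: AE_I2 simp: abs_mult abs_of_pos\<close>)
 have bM: "cmod (u w * (wirtinger_bar (X n) w * Kreg dl (z - w))) <= 6 * c * (cmod (u w) / (real (Suc n))\<^sup>2) * ind (ball 0 (real (Suc n))) w" for n w
 proof -
  have "cmod (wirtinger_bar (X n) w) * cmod (Kreg dl (z - w)) <= (6 * cmod w / (real (Suc n))\<^sup>2 * ind (ball 0 (real (Suc n))) w) * (c / jap w)"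
   unfolding X_def using Kreg_bounds(1)[OF dl] jap_pos[of w] c
   by (intro mult_mono cutoff_bounds) (auto simp: c_def)
  also have "... = 6 * c * (cmod w / jap w) / (real (Suc n))\<^sup>2 * ind (ball 0 (real (Suc n))) w" by (simp add: mult_ac)
  also have "... <= 6 * c * 1 / (real (Suc n))\<^sup>2 * ind (ball 0 (real (Suc n))) w"
   using cmod_le_jap[of w] jap_pos[of w] c by (intro mult_right_mono divide_right_mono mult_left_mono) auto
  finally have "cmod (u w) * (cmod (wirtinger_bar (X n) w) * cmod (Kreg dl (z - w))) <= cmod (u w) * (6 * c * 1 / (real (Suc n))\<^sup>2 * ind (ball 0 (real (Suc n))) w)"
   by (rule mult_left_mono) simp
  then show ?thesis by (simp add: norm_mult mult_ac)
 qed
 let ?err = "%n. II w. en (cmod (u w) / (real (Suc n))\<^sup>2) * ind (ball 0 (real (Suc n))) w"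
 have nM: "(II w. en (cmod (u w * (wirtinger_bar (X n) w * Kreg dl (z - w))))) <= en (6 * c) * ?err n" for n
 proof -
  have "(II w. en (cmod (u w * (wirtinger_bar (X n) w * Kreg dl (z - w)))))
   <= (II w. en (6 * c) * (en (cmod (u w) / (real (Suc n))\<^sup>2) * ind (ball 0 (real (Suc n))) w))"
  proof (rule nn_integral_mono)
   fix w
   have "en (6 * c) * (en (cmod (u w) / (real (Suc n))\<^sup>2) * ind (ball 0 (real (Suc n))) w)
    = en (6 * c * (cmod (u w) / (real (Suc n))\<^sup>2) * ind (ball 0 (real (Suc n))) w)"
    using c by (cases "w \<in> ball 0 (real (Suc n))") (simp_all only: indicator_simps ennreal_mult''[symmetric] divide_nonneg_nonneg norm_ge_zero zero_le_power2 mult_1_right mult_zero_right ennreal_0 not_False_eq_True)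
   then show "en (cmod (u w * (wirtinger_bar (X n) w * Kreg dl (z - w)))) <= en (6 * c) * (en (cmod (u w) / (real (Suc n))\<^sup>2) * ind (ball 0 (real (Suc n))) w)"
    using bM[of w n] by (simp only: ennreal_leI)
  qed
  also have "... = en (6 * c) * ?err n" by (rule nn_integral_cmult) measurable
  finally show ?thesis .
 qed
 have errlim: "(%n. en (6 * c) * ?err n) \<longlonglongrightarrow> 0"
  using ennreal_tendsto_cmult[OF _ cutoff_error_tendsto[OF _ fin], of "en (6 * c)"] by simp
 have iM: "integrable lborel (%w. u w * (wirtinger_bar (X n) w * Kreg dl (z - w)))" for n
 proof (rule Bochner_Integration.integrable_bound[OF integrable_mult_right[OF iu, of "6 * c * (1 + real (Suc n)) ^ 3"]])
  show "AE w in lborel. norm (u w * (wirtinger_bar (X n) w * Kreg dl (z - w))) <= norm (6 * c * (1 + real (Suc n)) ^ 3 * (cmod (u w) / jap w ^ 3))"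
  proof (rule AE_I2)
   fix w
   have "6 * c * (cmod (u w) / (real (Suc n))\<^sup>2) * ind (ball 0 (real (Suc n))) w <= 6 * c * (1 + real (Suc n)) ^ 3 * (cmod (u w) / jap w ^ 3)"
   proof (cases "cmod w < real (Suc n)")
    case True
    have "jap w ^ 3 <= (1 + real (Suc n)) ^ 3" using True jap_le[of w] by (intro power_mono) auto
    then have "1 <= (1 + real (Suc n)) ^ 3 / jap w ^ 3" using jap_pos[of w] by simp
    moreover have "1 / (real (Suc n))\<^sup>2 <= 1" by simp
    ultimately have "1 / (real (Suc n))\<^sup>2 <= (1 + real (Suc n)) ^ 3 / jap w ^ 3" by linarith
    from mult_left_mono[OF this, of "6 * c * cmod (u w)"] show ?thesis using True c by (simp add: mult_ac)
   next
    case False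
    then show ?thesis using c jap_pos[of w] by simp
   qed
   also have "... = norm (6 * c * (1 + real (Suc n)) ^ 3 * (cmod (u w) / jap w ^ 3))"
    using c jap_pos[of w] by (simp add: abs_mult)
   finally show "norm (u w * (wirtinger_bar (X n) w * Kreg dl (z - w))) <= norm (6 * c * (1 + real (Suc n)) ^ 3 * (cmod (u w) / jap w ^ 3))"
    using bM[of w n] by linarith
  qed
 qed measurable
 have eq: "(LINT w|lborel. u w * (X n w * cr (Dreg dl (z - w))))
   = (LINT w|lborel. u w * (wirtinger_bar (X n) w * Kreg dl (z - w))) + (LINT w|lborel. f w * (X n w * Kreg dl (z - w)))" for n
 proof -
  have "(LINT w|lebesgue. u w * wirtinger_bar (%w. X n w * Kreg dl (z - w)) w) = - (LINT w|lebesgue. f w * (X n w * Kreg dl (z - w)))"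
   using weak X unfolding has_weak_wirtinger_bar_def by blast
  then have "(LINT w|lborel. u w * wirtinger_bar (%w. X n w * Kreg dl (z - w)) w) = - (LINT w|lborel. f w * (X n w * Kreg dl (z - w)))"
   using test_function_measurable[OF X] by (simp add: integral_completion)
  also have "(LINT w|lborel. u w * wirtinger_bar (%w. X n w * Kreg dl (z - w)) w)
    = (LINT w|lborel. u w * (wirtinger_bar (X n) w * Kreg dl (z - w)) - u w * (X n w * cr (Dreg dl (z - w))))"
   unfolding wb by (simp add: algebra_simps)
  also have "... = (LINT w|lborel. u w * (wirtinger_bar (X n) w * Kreg dl (z - w))) - (LINT w|lborel. u w * (X n w * cr (Dreg dl (z - w))))"
   by (rule Bochner_Integration.integral_diff[OF iM iD])
  finally show ?thesis by (simp add: algebra_simps)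
 qed
 have l1: "(%n. LINT w|lborel. u w * (X n w * cr (Dreg dl (z - w)))) \<longlonglongrightarrow> (LINT w|lborel. u w * (1 * cr (Dreg dl (z - w))))"
 proof (rule integral_dominated_convergence[where w="%w. 3 * (dl\<^sup>2 * c ^ 4) * (cmod (u w) / jap w ^ 3)"])
  show "AE w in lborel. (%n. u w * (X n w * cr (Dreg dl (z - w)))) \<longlonglongrightarrow> u w * (1 * cr (Dreg dl (z - w)))"
   unfolding X_def by (intro AE_I2 tendsto_intros cutoff_tendsto)
  show "integrable lborel (%w. 3 * (dl\<^sup>2 * c ^ 4) * (cmod (u w) / jap w ^ 3))"
   by (rule integrable_mult_right[OF iu])
 qed (use bD in auto)
 have l2: "(%n. LINT w|lborel. f w * (X n w * Kreg dl (z - w))) \<longlonglongrightarrow> (LINT w|lborel. f w * (1 * Kreg dl (z - w)))"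
 proof (rule integral_dominated_convergence[where w="%w. cmod (f w) * (3 * (1 / dl))"])
  show "AE w in lborel. (%n. f w * (X n w * Kreg dl (z - w))) \<longlonglongrightarrow> f w * (1 * Kreg dl (z - w))"
   unfolding X_def by (intro AE_I2 tendsto_intros cutoff_tendsto)
  show "AE w in lborel. norm (f w * (X n w * Kreg dl (z - w))) <= cmod (f w) * (3 * (1 / dl))" for n
   unfolding norm_mult X_def using dl by (intro AE_I2 mult_left_mono mult_mono cutoff_bounds Kreg_bounds) auto
  show "integrable lborel (%w. cmod (f w) * (3 * (1 / dl)))" using f by simp
 qed auto
 have l3: "(%n. LINT w|lborel. u w * (wirtinger_bar (X n) w * Kreg dl (z - w))) \<longlonglongrightarrow> 0"
 proof -
  have "en (norm (LINT w|lborel. u w * (wirtinger_bar (X n) w * Kreg dl (z - w)))) <= en (6 * c) * ?err n" for n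
   using order_trans[OF integral_norm_bound_ennreal[OF iM] nM] by simp
  then have "(%n. en (norm (LINT w|lborel. u w * (wirtinger_bar (X n) w * Kreg dl (z - w))))) \<longlonglongrightarrow> 0"
   by (intro tendsto_sandwich[OF always_eventually always_eventually tendsto_const errlim]) auto
  then have "(%n. norm (LINT w|lborel. u w * (wirtinger_bar (X n) w * Kreg dl (z - w)))) \<longlonglongrightarrow> 0"
   using tendsto_ennreal_iff[of "%n. norm (LINT w|lborel. u w * (wirtinger_bar (X n) w * Kreg dl (z - w)))" sequentially 0] by simp
  then show ?thesis by (rule tendsto_norm_zero_cancel)
 qed
 have "(%n. LINT w|lborel. u w * (X n w * cr (Dreg dl (z - w)))) \<longlonglongrightarrow> 0 + (LINT w|lborel. f w * (1 * Kreg dl (z - w)))"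
  unfolding eq by (intro tendsto_add l2 l3)
 from LIMSEQ_unique[OF l1 this] show ?thesis by simp
qed

text \<open>Boxes are stable under intersection and generate the Borel sets, so a Dynkin argument
  extends the vanishing to all Borel sets. The hypothesis on the total integral takes care of
  complements.\<close>

lemma AE_eq_0_if_box_integrals_eq_0:
 fixes g :: "'a::euclidean_space => complex"
 assumes g: "integrable lborel g" and total: "(LINT x|lborel. g x) = 0"
  and box: "!!a b. (LINT x:box a b|lborel. g x) = 0"
 shows "AE x in lborel. g x = 0"
proof -
 have si: "set_integrable lborel A g" if "A \<in> sets borel" for A
  unfolding set_integrable_def using g that by (intro integrable_mult_indicator) auto
 have zero: "(LINT x:A|lborel. g x) = 0" if A: "A \<in> sets borel" for A
 proof -
  let ?G = "range (%(a, b). box a b :: 'a set)"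
  have "Int_stable ?G" "?G \<subseteq> Pow UNIV" "A \<in> sigma_sets UNIV ?G"
   using A by (auto simp: borel_eq_box Int_stable_def box_Int_box)
  then show ?thesis
  proof (induction rule: sigma_sets_induct_disjoint)
   case (basic A) then show ?case using box by auto
  next
   case empty show ?case by (simp add: set_lebesgue_integral_def)
  next
   case (compl A)
   have A: "A \<in> sets borel" using compl.hyps by (auto simp: borel_eq_box)
   have "(LINT x:(A \<union> (UNIV - A))|lborel. g x) = (LINT x:A|lborel. g x) + (LINT x:(UNIV - A)|lborel. g x)"
    using A by (intro set_integral_Un si) auto
   then show ?case using compl.IH total by (simp add: set_lebesgue_integral_def)
  next
   case (union A)
   have A: "A i \<in> sets borel" for i using union.hyps(2) by (auto simp: borel_eq_box)
   have "(LINT x:(\<Union>i. A i)|lborel. g x) = (\<Sum>i. (LINT x:A i|lborel. g x))"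
    using A union.hyps(1) by (intro lebesgue_integral_countable_add si) (auto simp: disjoint_family_on_def)
   then show ?case using union.IH by simp
  qed
 qed
 have "AE x in lborel. Re (g x) = 0"
 proof (rule density_unique_real)
  show "integrable lborel (%x. Re (g x))" using g by simp
  show "(LINT x:A|lborel. Re (g x)) = (LINT x:A|lborel. 0)" if "A \<in> sets lborel" for A
   using arg_cong[OF zero[of A], of Re] that si[of A]
   by (simp add: set_lebesgue_integral_def set_integrable_def flip: integral_Re)
 qed simp
 moreover have "AE x in lborel. Im (g x) = 0"
 proof (rule density_unique_real)
  show "integrable lborel (%x. Im (g x))" using g by simp
  show "(LINT x:A|lborel. Im (g x)) = (LINT x:A|lborel. 0)" if "A \<in> sets lborel" for A
   using arg_cong[OF zero[of A], of Im] that si[of A]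
   by (simp add: set_lebesgue_integral_def set_integrable_def flip: integral_Im)
 qed simp
 ultimately show ?thesis by eventually_elim (simp add: complex_eq_iff)
qed

lemma nn_integral_Dreg_delta:
 assumes "dl > 0"
 shows "(II z. en (Dreg dl (w - z))) = en pi"
proof -
 have "(II z. en (Dreg dl (w - z))) = (II z. en (Dreg dl z))"
  by (rule nn_integral_translate_reflect) measurable
 also have "... = en (dl\<^sup>2) * (II z. en (Dreg dl (0 + dl *\<^sub>R z)))"
  using assms by (intro nn_integral_complex_affine) auto
 also have "... = (II z. en (dl\<^sup>2) * en (Dreg dl (0 + dl *\<^sub>R z)))"
  by (rule nn_integral_cmult[symmetric]) measurable
 also have "... = (II z. en (Dreg 1 z))"
 proof (rule nn_integral_cong)
  fix z
  have e: "(cmod (0 + dl *\<^sub>R z))\<^sup>2 + dl\<^sup>2 = dl\<^sup>2 * ((cmod z)\<^sup>2 + 1)"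
   using assms by (simp add: power_mult_distrib algebra_simps)
  have "dl\<^sup>2 * (dl\<^sup>2 / (dl\<^sup>2 * Q)\<^sup>2) = 1\<^sup>2 / (Q + 0)\<^sup>2" for Q
   using assms by (simp add: power2_eq_square)
  then have "dl\<^sup>2 * Dreg dl (0 + dl *\<^sub>R z) = Dreg 1 z" unfolding Dreg_def e by simp
  then show "en (dl\<^sup>2) * en (Dreg dl (0 + dl *\<^sub>R z)) = en (Dreg 1 z)"
   by (metis ennreal_mult'' Dreg_nonneg)
 qed
 finally show ?thesis by (simp add: nn_integral_Dreg)
qed

text \<open>Provides the majorant for the limit dl to 0: uniform in dl and decaying like <w>^-3,
  against which u is integrable. For w near the disc the total mass pi is used; for w far away
  \<open>Dreg\<close> itself is at most 256 / <w>^4, with 256 = 4^4 from <w> <= 4 |w - z|.\<close>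

lemma Dreg_ball_mass:
 assumes dl: "0 < dl" "dl <= 1" and [measurable]: "A \<in> sets borel" and A: "A \<subseteq> ball 0 rh" and rh: "0 <= rh"
 shows "(II z. en (Dreg dl (w - z)) * ind A z) <= en ((pi * (2 + 2 * rh) ^ 3 + 1024 * rh\<^sup>2) / jap w ^ 3)"
proof (cases "cmod w <= 2 * rh + 1")
 case True
 have "(II z. en (Dreg dl (w - z)) * ind A z) <= (II z. en (Dreg dl (w - z)))"
 proof (rule nn_integral_mono)
  fix z show "en (Dreg dl (w - z)) * ind A z <= en (Dreg dl (w - z))"
   by (cases "z \<in> A") simp_all
 qed
 also have "... = en pi" by (rule nn_integral_Dreg_delta[OF dl(1)])
 also have "... <= en ((pi * (2 + 2 * rh) ^ 3 + 1024 * rh\<^sup>2) / jap w ^ 3)"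
 proof (rule ennreal_leI)
  have "jap w ^ 3 <= (2 + 2 * rh) ^ 3" using True jap_le[of w] by (intro power_mono) auto
  then have "pi * jap w ^ 3 <= pi * (2 + 2 * rh) ^ 3" by (intro mult_left_mono) auto
  also have "... <= pi * (2 + 2 * rh) ^ 3 + 1024 * rh\<^sup>2" by simp
  finally show "pi <= (pi * (2 + 2 * rh) ^ 3 + 1024 * rh\<^sup>2) / jap w ^ 3"
   using jap_pos[of w] by (simp add: pos_le_divide_eq)
 qed
 finally show ?thesis .
next
 case False
 have w1: "1 <= cmod w" using False rh by linarith
 have "(II z. en (Dreg dl (w - z)) * ind A z) <= (II z. en (256 / jap w ^ 3) * ind (ball (0::complex) rh) z)"
 proof (rule nn_integral_mono)
  fix z
  show "en (Dreg dl (w - z)) * ind A z <= en (256 / jap w ^ 3) * ind (ball 0 rh) z"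
  proof (cases "z \<in> A")
   case True
   then have z: "z \<in> ball 0 rh" "cmod z < rh" using A by auto
   have "cmod w <= cmod (w - z) + cmod z" using norm_triangle_ineq[of "w - z" z] by simp
   then have d: "cmod w / 2 <= cmod (w - z)" using z False by linarith
   have "jap w <= 4 * cmod (w - z)" using jap_le[of w] w1 d by linarith
   then have "jap w ^ 4 <= (4 * cmod (w - z)) ^ 4" by (intro power_mono) auto
   also have "... = 256 * ((cmod (w - z))\<^sup>2)\<^sup>2" by (simp add: power_mult_distrib flip: power_mult)
   also have "... <= 256 * ((cmod (w - z))\<^sup>2 + dl\<^sup>2)\<^sup>2" by (intro mult_left_mono power_mono) auto
   finally have j4: "jap w ^ 4 <= 256 * ((cmod (w - z))\<^sup>2 + dl\<^sup>2)\<^sup>2" .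
   have "Dreg dl (w - z) <= 1 / ((cmod (w - z))\<^sup>2 + dl\<^sup>2)\<^sup>2"
    unfolding Dreg_def using dl by (intro divide_right_mono) (auto simp: power_le_one)
   also have "... <= 256 / jap w ^ 4"
   proof -
    have "0 < ((cmod (w - z))\<^sup>2 + dl\<^sup>2)\<^sup>2" using dl by (simp add: add_nonneg_pos)
    then show ?thesis using j4 jap_pos[of w] by (simp add: pos_divide_le_eq pos_le_divide_eq)
   qed
   also have "... <= 256 / jap w ^ 3"
    using jap_ge_1[of w] by (intro divide_left_mono power_increasing) auto
   finally show ?thesis using True z by (simp add: ennreal_leI)
  qed simp
 qed
 also have "... = en (256 / jap w ^ 3) * emeasure lborel (ball (0::complex) rh)"
  by (rule nn_integral_cmult_indicator) auto
 also have "... <= en (256 / jap w ^ 3) * en (4 * rh\<^sup>2)"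
  by (intro mult_left_mono emeasure_ball_complex_le) auto
 also have "... = en ((1024 * rh\<^sup>2) / jap w ^ 3)"
  using jap_pos[of w] by (simp add: ennreal_mult'[symmetric])
 also have "... <= en ((pi * (2 + 2 * rh) ^ 3 + 1024 * rh\<^sup>2) / jap w ^ 3)"
  using jap_pos[of w] rh by (intro ennreal_leI divide_right_mono) auto
 finally show ?thesis .
qed

lemma L2_cball_integrable:
 fixes f :: "complex => complex"
 assumes [measurable]: "f \<in> bmeas" and supp: "\<forall>w. R < cmod w --> f w = 0"
  and fin: "(II w. en ((cmod (f w))\<^sup>2)) < \<infinity>"
 shows "integrable lborel f"
proof (rule integrableI_bounded)
 have "(II w. en (cmod (f w))) <= (II w. en ((cmod (f w))\<^sup>2) + ind (cball 0 R) w)"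
 proof (rule nn_integral_mono)
  fix w
  have "cmod (f w) <= (cmod (f w))\<^sup>2 + 1"
   using sum_squares_bound[of 1 "cmod (f w)"] norm_ge_zero[of "f w"] by (simp only: power_one mult_1_right)
  then show "en (cmod (f w)) <= en ((cmod (f w))\<^sup>2) + ind (cball 0 R) w"
   using supp by (cases "R < cmod w") (auto simp: ennreal_leI simp flip: ennreal_1 ennreal_plus)
 qed
 also have "... = (II w. en ((cmod (f w))\<^sup>2)) + emeasure lborel (cball (0::complex) R)"
  by (subst nn_integral_add) auto
 also have "... < \<infinity>" using fin emeasure_lborel_cball_finite[of "0::complex" R] by simp
 finally show "(II w. en (norm (f w))) < \<infinity>" .
qed simp

text \<open>At z = w both sides vanish, since division by zero and \<open>0 powr (- 1)\<close> are
  both 0.\<close>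

lemma cauchy_kernel_norm: "en (cmod (F w / (z - w))) = en (cmod (F w)) * en (cmod (z - w) powr (- 1))"
 by (cases "z = w") (simp_all add: norm_divide powr_minus_divide ennreal_mult'[symmetric])

lemma cauchyT_measurable [measurable]:
 assumes [measurable]: "F \<in> bmeas"
 shows "cauchyT F \<in> bmeas"
proof -
 have "(%z. LINT w|lborel. F w / (z - w)) \<in> bmeas"
  using lborel.borel_measurable_lebesgue_integral[of "%z w. F w / (z - w)" borel] by simp
 then show ?thesis unfolding cauchyT_def[abs_def] by measurable
qed

text \<open>Holds also where the kernel is not integrable, the left side being 0 there. The factor
  1/pi is estimated by 1.\<close>

lemma cauchyT_le: "en (cmod (cauchyT F z)) <= (II w. en (cmod (F w)) * en (cmod (z - w) powr (- 1)))"
proof -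
 have "cmod (LINT w|lborel. F w / (z - w)) / pi <= cmod (LINT w|lborel. F w / (z - w)) / 1"
  using pi_ge_two by (intro divide_left_mono) auto
 then have "en (cmod (cauchyT F z)) <= en (cmod (LINT w|lborel. F w / (z - w)))"
  by (simp add: cauchyT_def norm_divide ennreal_leI)
 also have "... <= (II w. en (cmod (F w / (z - w))))"
 proof (cases "integrable lborel (%w. F w / (z - w))")
  case True then show ?thesis by (rule integral_norm_bound_ennreal)
 next
  case False then show ?thesis by (simp add: not_integrable_integral_eq)
 qed
 finally show ?thesis by (simp only: cauchy_kernel_norm)
qed

lemma cauchyT_weighted_bound:
 assumes ep: "0 < ep" and R: "0 <= R"
 shows "\<exists>C\<ge>0. \<forall>F\<in>borel_measurable borel. (\<forall>w. R < cmod w --> F w = 0) -->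
  wN ep (cauchyT F) <= en C * (II w. en ((cmod (F w))\<^sup>2))"
proof -
 obtain C where C: "C \<ge> 0" "!!F. F \<in> bmeas ==> (\<forall>w. R < cmod w --> F w = 0) ==>
  (II z. en (jap z powr (- 2 * ep)) * (II w. F w * en (cmod (z - w) powr (- 1)))\<^sup>2)
   <= en C * (II w. (F w)\<^sup>2)"
  using weighted_riesz_bound[of 1 ep R] assms by auto
 show ?thesis
 proof (intro exI[of _ C] conjI ballI impI C)
  fix F :: "complex => complex" assume [measurable]: "F \<in> bmeas" and F: "\<forall>w. R < cmod w --> F w = 0"
  have "wN ep (cauchyT F) <= (II z. en (jap z powr (- 2 * ep)) * (II w. en (cmod (F w)) * en (cmod (z - w) powr (- 1)))\<^sup>2)"
   unfolding wN_def
  proof (rule nn_integral_mono)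
   fix z
   have "(en (cmod (cauchyT F z)))\<^sup>2 <= (II w. en (cmod (F w)) * en (cmod (z - w) powr (- 1)))\<^sup>2"
    by (intro power_mono cauchyT_le) auto
   from mult_left_mono[OF this, of "en (jap z powr (- 2 * ep))"]
   show "en (jap z powr (- 2 * ep) * (cmod (cauchyT F z))\<^sup>2) <= en (jap z powr (- 2 * ep)) * (II w. en (cmod (F w)) * en (cmod (z - w) powr (- 1)))\<^sup>2"
    by (simp add: ennreal_mult ennreal_power)
  qed
  also have "... <= en C * (II w. (en (cmod (F w)))\<^sup>2)"
   using F by (intro C) auto
  finally show "wN ep (cauchyT F) <= en C * (II w. en ((cmod (F w))\<^sup>2))"
   by (simp add: ennreal_power)
 qed
qed

lemma isCont_indicator_open:
 fixes A :: "'a::t2_space set"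
 assumes "open A" "w \<notin> frontier A"
 shows "isCont (ind A :: 'a => complex) w"
proof (cases "w \<in> A")
 case True
 then have "\<forall>\<^sub>F z in nhds w. (ind A z :: complex) = 1"
  using assms(1) by (auto simp: eventually_nhds intro!: exI[of _ A])
 then have "isCont (ind A :: 'a => complex) w \<longleftrightarrow> isCont (%_. 1 :: complex) w" by (rule isCont_cong)
 then show ?thesis by simp
next
 case False
 then have "w \<in> - closure A" using assms by (auto simp: frontier_def interior_open)
 moreover have "open (- closure A)" by auto
 moreover have "ind A z = (0::complex)" if "z \<in> - closure A" for z
  using that closure_subset[of A] by (auto simp: indicator_def)
 ultimately have "\<forall>\<^sub>F z in nhds w. (ind A z :: complex) = 0"
  unfolding eventually_nhds by blast
 then have "isCont (ind A :: 'a => complex) w \<longleftrightarrow> isCont (%_. 0 :: complex) w" by (rule isCont_cong)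
 then show ?thesis by simp
qed

text \<open>As u need not be continuous, the regularised identity cannot be passed to the limit
  pointwise. It is integrated over a box; Fubini moves \<open>Dreg\<close> onto the indicator of the
  box, which is continuous off a null set, and the box integrals determine u almost everywhere. For
  f = 0 this contains a Liouville theorem: the weighted space with ep <= 1 contains no entire
  function except 0.\<close>

theorem cauchy_representation:
 assumes weak: "has_weak_wirtinger_bar u f"
  and u [measurable]: "u \<in> bmeas" and f [measurable]: "f \<in> bmeas"
  and ep: "0 < ep" "ep <= 1" and fin: "wN ep u < \<infinity>"
  and supp: "\<forall>w. R < cmod w --> f w = 0" and R: "0 <= R"
  and f2: "(II w. en ((cmod (f w))\<^sup>2)) < \<infinity>"
 shows "AE z in lborel. u z = cauchyT f z"
proof -
 define dl where "dl = (%n. inverse (real (Suc n)))"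
 have dl: "0 < dl n" "dl n <= 1" for n by (auto simp: dl_def field_simps)
 have fi: "integrable lborel f" by (rule L2_cball_integrable[OF f supp f2])
 have iu: "integrable lborel (%w. cmod (u w) / jap w ^ 3)"
  by (rule weighted_integrable[OF u fin ep(2)])
 define G where "G = (%z. II w. en (cmod (f w)) * en (cmod (z - w) powr (- 1)))"
 have [measurable]: "G \<in> bmeas"
  unfolding G_def using lborel.borel_measurable_nn_integral[of "%z w. en (cmod (f w)) * en (cmod (z - w) powr (- 1))" borel] by simp
 obtain C where "C \<ge> 0" and "(II z. en (jap z powr (- 2 * ep)) * (G z)\<^sup>2) <= en C * (II w. (en (cmod (f w)))\<^sup>2)"
  using weighted_riesz_bound[of 1 ep R] ep R supp unfolding G_def by fastforce
 then have G2: "(II z. en (jap z powr (- 2 * ep)) * (G z)\<^sup>2) < \<infinity>"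
  using f2 by (auto simp: ennreal_power ennreal_mult_less_top intro: le_less_trans)
 have Gfin: "AE z in lborel. G z < \<infinity>"
 proof -
  have "AE z in lborel. en (jap z powr (- 2 * ep)) * (G z)\<^sup>2 ~= \<infinity>"
   using G2 by (intro nn_integral_PInf_AE) auto
  then show ?thesis
  proof eventually_elim
   case (elim z)
   then show ?case using jap_pos[of z]
    by (cases "G z = \<infinity>") (auto simp: power2_eq_square ennreal_mult_top ennreal_top_mult less_top)
  qed
 qed
 define V where "V = (%z. LINT w|lborel. f w / (z - w))"
 have V: "V z = cr pi * cauchyT f z" for z by (simp add: V_def cauchyT_def)
 have [measurable]: "V \<in> bmeas" unfolding V[abs_def] by measurable
 have Vbound: "cmod (V z) <= enn2real (G z)" "!!n. cmod (LINT w|lborel. f w * Kreg (dl n) (z - w)) <= enn2real (G z)"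
   "(%n. LINT w|lborel. f w * Kreg (dl n) (z - w)) \<longlonglongrightarrow> V z" if "G z < \<infinity>" for z
 proof -
  have i: "integrable lborel (%w. f w / (z - w))"
   using that by (intro integrableI_bounded) (auto simp: cauchy_kernel_norm G_def)
  have n: "(LINT w|lborel. cmod (f w / (z - w))) = enn2real (G z)"
   unfolding G_def cauchy_kernel_norm[symmetric] by (subst integral_eq_nn_integral) auto
  have k: "cmod (f w * Kreg (dl m) (z - w)) <= cmod (f w / (z - w))" for w m
   using mult_left_mono[OF Kreg_bounds(4)[OF dl(1)[of m], of "z - w"], of "cmod (f w)"] by (simp add: norm_mult norm_divide)
  show "cmod (V z) <= enn2real (G z)" unfolding V_def n[symmetric] by (rule integral_norm_bound)
  show "cmod (LINT w|lborel. f w * Kreg (dl n) (z - w)) <= enn2real (G z)" for n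
  proof -
   have "cmod (LINT w|lborel. f w * Kreg (dl n) (z - w)) <= (LINT w|lborel. cmod (f w * Kreg (dl n) (z - w)))"
    by (rule integral_norm_bound)
   also have "... <= (LINT w|lborel. cmod (f w / (z - w)))"
    using i k by (intro integral_mono_AE' AE_I2) auto
   finally show ?thesis unfolding n .
  qed
  show "(%n. LINT w|lborel. f w * Kreg (dl n) (z - w)) \<longlonglongrightarrow> V z"
   unfolding V_def
  proof (rule integral_dominated_convergence[where w="%w. cmod (f w / (z - w))"])
   show "AE w in lborel. (%n. f w * Kreg (dl n) (z - w)) \<longlonglongrightarrow> f w / (z - w)"
   proof (rule AE_I2)
    fix w show "(%n. f w * Kreg (dl n) (z - w)) \<longlonglongrightarrow> f w / (z - w)"
     unfolding dl_def using tendsto_mult[OF tendsto_const Kreg_tendsto, of "f w" "z - w"] by simp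
   qed
  qed (use i k in auto)
 qed
 have box_eq: "set_integrable lborel (box a b) V \<and> set_integrable lborel (box a b) u \<and>
   (LINT z:box a b|lborel. cr pi * u z - V z) = 0" for a b
 proof -
  define A where "A = box a b"
  have [measurable]: "A \<in> sets borel" unfolding A_def by simp
  obtain rh where rh: "0 < rh" "A \<subseteq> ball 0 rh"
   using bounded_subset_ballD[OF bounded_box, of a b 0] unfolding A_def by auto
  have jA: "jap z <= 1 + rh" if "z \<in> A" for z using jap_le[of z] rh that by force
  have Gi: "integrable lborel (%z. enn2real (G z) * ind A z)"
  proof (rule integrableI_nonneg)
   have "(II z. en (enn2real (G z) * ind A z)) <= (II z. en ((1 + rh) powr (2 * ep)) * (en (jap z powr (- 2 * ep)) * (G z)\<^sup>2) + ind A z)"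
   proof (rule nn_integral_mono_AE, use Gfin in eventually_elim)
    fix z assume "G z < \<infinity>"
    then obtain g where g: "G z = en g" "g \<ge> 0" by (cases "G z") auto
    have "g <= g\<^sup>2 + 1" using sum_squares_bound[of 1 g] g by simp
    moreover have "1 <= (1 + rh) powr (2 * ep) * jap z powr (- 2 * ep)" if "z \<in> A"
    proof -
     have "jap z powr (2 * ep) <= (1 + rh) powr (2 * ep)"
      using jA[OF that] ep by (intro powr_mono2) auto
     then show ?thesis using jap_pos[of z] by (simp add: powr_minus field_simps)
    qed
    ultimately have "g <= (1 + rh) powr (2 * ep) * jap z powr (- 2 * ep) * g\<^sup>2 + 1" if "z \<in> A"
     using mult_right_mono[of 1 "(1 + rh) powr (2 * ep) * jap z powr (- 2 * ep)" "g\<^sup>2"] that by simp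
    then show "en (enn2real (G z) * ind A z) <= en ((1 + rh) powr (2 * ep)) * (en (jap z powr (- 2 * ep)) * (G z)\<^sup>2) + ind A z"
     using g by (cases "z \<in> A") (auto simp: ennreal_power ennreal_mult'[symmetric] mult.assoc ennreal_leI simp flip: ennreal_1 ennreal_plus)
   qed
   also have "... = en ((1 + rh) powr (2 * ep)) * (II z. en (jap z powr (- 2 * ep)) * (G z)\<^sup>2) + emeasure lborel A"
    by (subst nn_integral_add) (auto simp: nn_integral_cmult)
   also have "... < \<infinity>"
    using G2 emeasure_bounded_finite[of A] bounded_box unfolding A_def by (auto simp: ennreal_mult_less_top)
   finally show "(II z. en (enn2real (G z) * ind A z)) < \<infinity>" .
  qed auto
  have Vi: "set_integrable lborel A V"
   unfolding set_integrable_def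
  proof (rule Bochner_Integration.integrable_bound[OF Gi])
   show "AE z in lborel. norm (indicat_real A z *\<^sub>R V z) <= norm (enn2real (G z) * indicat_real A z)"
    using Gfin by eventually_elim (auto simp: Vbound indicator_def)
  qed auto
  have ui: "set_integrable lborel A u"
   unfolding set_integrable_def
  proof (rule Bochner_Integration.integrable_bound[OF integrable_mult_right[OF iu, of "(1 + rh) ^ 3"]])
   show "AE z in lborel. norm (indicat_real A z *\<^sub>R u z) <= norm ((1 + rh) ^ 3 * (cmod (u z) / jap z ^ 3))"
   proof (rule AE_I2)
    fix z
    have "1 <= (1 + rh) ^ 3 / jap z ^ 3" if "z \<in> A"
     using jA[OF that] jap_pos[of z] by (simp add: power_mono)
    from mult_left_mono[OF this, of "cmod (u z)"] show "norm (indicat_real A z *\<^sub>R u z) <= norm ((1 + rh) ^ 3 * (cmod (u z) / jap z ^ 3))"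
     using jap_pos[of z] rh by (cases "z \<in> A") (auto simp: abs_mult mult.commute)
   qed
  qed auto
  let ?D = "%n w z. cr (Dreg (dl n) (w - z)) * ind A z"
  have mass: "(II z. en (cmod (?D n w z))) <= en ((pi * (2 + 2 * rh) ^ 3 + 1024 * rh\<^sup>2) / jap w ^ 3)" for n w
  proof -
   have "en (cmod (?D n w z)) = en (Dreg (dl n) (w - z)) * ind A z" for z
    by (cases "z \<in> A") (simp_all add: norm_mult)
   then show ?thesis using Dreg_ball_mass[OF dl, of A rh n w] rh by simp
  qed
  define M where "M = pi * (2 + 2 * rh) ^ 3 + 1024 * rh\<^sup>2"
  have M0: "M \<ge> 0" using rh by (simp add: M_def)
  have mass': "cmod (LINT z|lborel. ?D n w z) <= M / jap w ^ 3" for n w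
  proof -
   have i: "integrable lborel (?D n w)"
    using mass[where n=n and w=w] by (intro integrableI_bounded) (auto intro: le_less_trans)
   have "en (cmod (LINT z|lborel. ?D n w z)) <= en (M / jap w ^ 3)"
    using order_trans[OF integral_norm_bound_ennreal[OF i] mass] by (simp add: M_def)
   then show ?thesis using M0 jap_pos[of w] by (simp add: ennreal_le_iff)
  qed
  \<comment> \<open>Absolute integrability on the product follows from the mass bound, because |u| /
    <w>^3 is integrable.\<close>
  have fub: "(LINT z|lborel. LINT w|lborel. u w * ?D n w z) = (LINT w|lborel. LINT z|lborel. u w * ?D n w z)" for n
  proof (rule lborel_pair.Fubini_integral, rule integrableI_bounded)
   have "(\<integral>\<^sup>+p. en (norm (case p of (w, z) => u w * ?D n w z)) \<partial>(lborel \<Otimes>\<^sub>M lborel)) = (II w. II z. en (cmod (u w * ?D n w z)))"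
    by (subst lborel.nn_integral_fst[symmetric]) auto
   also have "... <= (II w. en M * en (cmod (u w) / jap w ^ 3))"
   proof (rule nn_integral_mono)
    fix w
    have "(II z. en (cmod (u w * ?D n w z))) = en (cmod (u w)) * (II z. en (cmod (?D n w z)))"
     by (subst nn_integral_cmult[symmetric]) (auto simp: norm_mult ennreal_mult')
    also have "... <= en (cmod (u w)) * en (M / jap w ^ 3)"
     unfolding M_def by (intro mult_left_mono mass) auto
    finally show "(II z. en (cmod (u w * ?D n w z))) <= en M * en (cmod (u w) / jap w ^ 3)"
     using M0 by (simp add: ennreal_mult'[symmetric] mult.commute)
   qed
   also have "... = en M * (II w. en (cmod (u w) / jap w ^ 3))" by (rule nn_integral_cmult) measurable
   also have "... < \<infinity>"
    using iu jap_pos unfolding integrable_iff_bounded by (auto simp: ennreal_mult_less_top abs_of_pos)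
   finally show "(\<integral>\<^sup>+p. en (norm (case p of (w, z) => u w * ?D n w z)) \<partial>(lborel \<Otimes>\<^sub>M lborel)) < \<infinity>" .
  qed measurable
  have eq: "(LINT z|lborel. ind A z * (LINT w|lborel. f w * Kreg (dl n) (z - w))) = (LINT w|lborel. u w * (LINT z|lborel. ?D n w z))" for n
  proof -
   have "Dreg (dl n) (z - w) = Dreg (dl n) (w - z)" for z w by (simp add: Dreg_def norm_minus_commute)
   then have "(LINT w|lborel. f w * Kreg (dl n) (z - w)) = (LINT w|lborel. u w * cr (Dreg (dl n) (w - z)))" for z
    using weak_solution_regularised[OF weak u f fin ep(2) fi dl(1)[of n], of z] by simp
   then have "(LINT z|lborel. ind A z * (LINT w|lborel. f w * Kreg (dl n) (z - w))) = (LINT z|lborel. LINT w|lborel. u w * ?D n w z)"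
    by (simp only: mult.assoc[symmetric] Bochner_Integration.integral_mult_left_zero) (simp only: mult.commute)
   also have "... = (LINT w|lborel. u w * (LINT z|lborel. ?D n w z))" unfolding fub by simp
   finally show ?thesis .
  qed
  have l1: "(%n. LINT z|lborel. ind A z * (LINT w|lborel. f w * Kreg (dl n) (z - w))) \<longlonglongrightarrow> (LINT z|lborel. ind A z * V z)"
  proof (rule integral_dominated_convergence[OF _ _ Gi])
   show "AE z in lborel. (%n. ind A z * (LINT w|lborel. f w * Kreg (dl n) (z - w))) \<longlonglongrightarrow> ind A z * V z"
    using Gfin by eventually_elim (intro tendsto_intros Vbound)
   show "AE z in lborel. norm (ind A z * (LINT w|lborel. f w * Kreg (dl n) (z - w))) <= enn2real (G z) * indicat_real A z" for n
    using Gfin by eventually_elim (auto simp: norm_mult Vbound indicator_def)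
   show "(%z. ind A z * (LINT w|lborel. f w * Kreg (dl n) (z - w))) \<in> borel_measurable lborel" for n
   proof -
    have [measurable]: "(%z. LINT w|lborel. f w * Kreg (dl n) (z - w)) \<in> bmeas"
     using lborel.borel_measurable_lebesgue_integral[of "%z w. f w * Kreg (dl n) (z - w)" borel] by simp
    show ?thesis by simp
   qed
  qed simp
  have l2: "(%n. LINT w|lborel. u w * (LINT z|lborel. ?D n w z)) \<longlonglongrightarrow> (LINT w|lborel. u w * (cr pi * ind A w))"
  proof (rule integral_dominated_convergence[where w="%w. M * (cmod (u w) / jap w ^ 3)"])
   have "AE w in lborel. w \<notin> frontier A"
    unfolding A_def using negligible_convex_frontier[OF convex_box(2), of a b]
    by (intro AE_not_in) (simp add: null_sets_completion_iff negligible_iff_null_sets)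
   then show "AE w in lborel. (%n. u w * (LINT z|lborel. ?D n w z)) \<longlonglongrightarrow> u w * (cr pi * ind A w)"
   proof eventually_elim
    case (elim w)
    have "isCont (ind A :: complex => complex) w"
     using elim unfolding A_def by (intro isCont_indicator_open) auto
    from Dreg_approx_identity[OF _ _ this, of 1]
    have "(%n. LINT z|lborel. ?D n w z) \<longlonglongrightarrow> cr pi * ind A w"
     unfolding dl_def by (simp add: indicator_def)
    then show ?case by (intro tendsto_intros)
   qed
   show "AE w in lborel. norm (u w * (LINT z|lborel. ?D n w z)) <= M * (cmod (u w) / jap w ^ 3)" for n
   proof (rule AE_I2)
    fix w
    show "norm (u w * (LINT z|lborel. ?D n w z)) <= M * (cmod (u w) / jap w ^ 3)"
     using mult_left_mono[OF mass', of "cmod (u w)" n w] by (simp add: norm_mult mult.commute)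
   qed
   show "(%w. u w * (LINT z|lborel. ?D n w z)) \<in> borel_measurable lborel" for n
   proof -
    have [measurable]: "(%w. LINT z|lborel. ?D n w z) \<in> bmeas"
     using lborel.borel_measurable_lebesgue_integral[of "?D n" borel] by simp
    show ?thesis by simp
   qed
   show "integrable lborel (%w. M * (cmod (u w) / jap w ^ 3))"
    by (rule integrable_mult_right[OF iu])
  qed simp
  have "(LINT w|lborel. u w * (cr pi * ind A w)) = (LINT z|lborel. ind A z * V z)"
   using LIMSEQ_unique[OF l2 l1[unfolded eq]] .
  moreover have "(LINT z:A|lborel. cr pi * u z - V z) = cr pi * (LINT z:A|lborel. u z) - (LINT z:A|lborel. V z)"
   using Vi ui by (subst set_integral_diff) auto
  ultimately have "(LINT z:A|lborel. cr pi * u z - V z) = 0"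
   by (simp add: set_lebesgue_integral_def scaleR_conv_of_real of_real_indicator mult_ac flip: Bochner_Integration.integral_mult_right_zero)
  then show ?thesis using Vi ui unfolding A_def by simp
 qed
 \<comment> \<open>The box criterion asks for a function integrable over the whole plane, so the
   difference is truncated to growing squares. Intersecting a box with a square gives a box
   again.\<close>
 have "AE z in lborel. z \<in> box (Complex (- real N) (- real N)) (Complex (real N) (real N)) --> u z = cauchyT f z" for N :: nat
 proof -
  let ?B = "box (Complex (- real N) (- real N)) (Complex (real N) (real N))"
  let ?g = "%z. indicator ?B z * (cr pi * u z - V z)"
  have "AE z in lborel. ?g z = 0"
  proof (rule AE_eq_0_if_box_integrals_eq_0)
   have "set_integrable lborel ?B (%z. cr pi * u z - V z)"
    using box_eq by (intro set_integral_diff set_integrable_mult_right) auto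
   then show "integrable lborel ?g"
    by (simp add: set_integrable_def scaleR_conv_of_real of_real_indicator)
   show "(LINT z|lborel. ?g z) = 0"
    using box_eq[of "Complex (- real N) (- real N)" "Complex (real N) (real N)"]
    by (simp add: set_lebesgue_integral_def scaleR_conv_of_real of_real_indicator)
   show "(LINT z:box a b|lborel. ?g z) = 0" for a b
   proof -
    obtain c d where cd: "box a b \<inter> ?B = box c d" unfolding box_Int_box by blast
    have "(LINT z:box a b|lborel. ?g z) = (LINT z:box c d|lborel. cr pi * u z - V z)"
     unfolding cd[symmetric] set_lebesgue_integral_def
     by (intro Bochner_Integration.integral_cong) (auto simp: indicator_def)
    then show ?thesis using box_eq by simp
   qed
  qed
  then show ?thesis
   by eventually_elim (auto simp: V)
 qed
 then have "AE z in lborel. \<forall>N::nat. z \<in> box (Complex (- real N) (- real N)) (Complex (real N) (real N)) --> u z = cauchyT f z"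
  unfolding AE_all_countable by blast
 then show ?thesis
 proof eventually_elim
  case (elim z)
  obtain N :: nat where "cmod z < real N" using reals_Archimedean2 by blast
  then have "\<bar>Re z\<bar> < real N" "\<bar>Im z\<bar> < real N" using abs_Re_le_cmod[of z] abs_Im_le_cmod[of z] by auto
  then have "z \<in> box (Complex (- real N) (- real N)) (Complex (real N) (real N))" by (auto simp: in_box_complex_iff)
  with elim show ?case by blast
 qed
qed

section \<open>Smallness of the composed oscillatory operator\<close>

text \<open>With p = 1 it majorises the Cauchy transform; p = 3/2 arises from differences of Cauchy
  kernels.\<close>

definition rieszJ :: "real => (complex => ennreal) => complex => ennreal" where
 "rieszJ p F z = (II w. F w * en (cmod (z - w) powr (- p)))"

lemma rieszJ_measurable [measurable]:
 assumes [measurable]: "F \<in> bmeas"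
 shows "rieszJ p F \<in> bmeas"
 unfolding rieszJ_def[abs_def]
 using lborel.borel_measurable_nn_integral[of "%z w. F w * en (cmod (z - w) powr (- p))" borel] by simp

text \<open>Only half of the available power of |a - b| is extracted: the full power would leave
  |a|^-2, which is not locally integrable in the plane, whereas |a|^(-3/2) is. With 1/0 = 0 the
  estimate persists when a or b vanishes.\<close>

lemma inverse_diff_le:
 fixes a b :: complex
 shows "cmod (1 / a - 1 / b) <= 2 * sqrt (cmod (a - b)) * (cmod a powr (- (3/2)) + cmod b powr (- (3/2)))"
proof -
 have main: "cmod (1 / a - 1 / b) <= 2 * sqrt (cmod (a - b)) * cmod a powr (- (3/2))"
  if "a ~= 0" "b ~= 0" "cmod a <= cmod b" for a b :: complex
 proof -
  have pa: "0 < cmod a" "0 < cmod b" using that by auto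
  have "cmod (1 / a - 1 / b) = cmod (a - b) / (cmod a * cmod b)"
  proof -
   have "1 / a - 1 / b = (b - a) / (a * b)" using that by (simp add: field_simps)
   then show ?thesis by (simp add: norm_divide norm_mult norm_minus_commute)
  qed
  also have "cmod (a - b) = sqrt (cmod (a - b)) * sqrt (cmod (a - b))" by simp
  also have "... <= sqrt (cmod (a - b)) * sqrt (4 * cmod b)"
  proof (intro mult_left_mono real_sqrt_le_mono)
   have "cmod (a - b) <= cmod a + cmod b" by (rule norm_triangle_ineq4)
   then show "cmod (a - b) <= 4 * cmod b" using that(3) pa by linarith
  qed simp
  also have "... = 2 * sqrt (cmod (a - b)) * sqrt (cmod b)" by (simp add: real_sqrt_mult)
  finally have "cmod (1 / a - 1 / b) <= 2 * sqrt (cmod (a - b)) * sqrt (cmod b) / (cmod a * cmod b)"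
   using pa by (simp add: divide_right_mono)
  also have "... = 2 * sqrt (cmod (a - b)) * (1 / (cmod a * sqrt (cmod b)))"
  proof -
   have "2 * q * r / (A * (r * r)) = 2 * q * (1 / (A * r))" if "0 < r" "0 < A" for q r A :: real
    using that by simp
   from this[of "sqrt (cmod b)" "cmod a" "sqrt (cmod (a - b))"] show ?thesis using pa by simp
  qed
  also have "... <= 2 * sqrt (cmod (a - b)) * (1 / (cmod a * sqrt (cmod a)))"
   using pa that(3) by (intro mult_left_mono divide_left_mono mult_left_mono) auto
  also have "1 / (cmod a * sqrt (cmod a)) = cmod a powr (- (3/2))"
  proof -
   have "cmod a powr (1 + 1/2) = cmod a * sqrt (cmod a)"
    using pa by (simp only: powr_add powr_half_sqrt powr_one norm_ge_zero)
   then show ?thesis by (simp add: powr_minus_divide)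
  qed
  finally show ?thesis .
 qed
 consider "a = 0" | "b = 0" | "a ~= 0" "b ~= 0" "cmod a <= cmod b" | "a ~= 0" "b ~= 0" "cmod b <= cmod a" by linarith
 then show ?thesis
 proof cases
  case 1
  have "sqrt (cmod b) * cmod b powr (- (3/2)) = cmod b powr (1/2 + - (3/2))" by (simp only: powr_add powr_half_sqrt norm_ge_zero)
  then have e: "sqrt (cmod b) * cmod b powr (- (3/2)) = 1 / cmod b" by (cases "b = 0") (simp_all add: powr_minus_divide)
  have "0 <= 1 / cmod b" by simp
  then have "1 / cmod b <= 2 * (1 / cmod b)" by linarith
  then show ?thesis using 1 e by (simp add: norm_divide mult.assoc)
 next
  case 2
  have "sqrt (cmod a) * cmod a powr (- (3/2)) = cmod a powr (1/2 + - (3/2))" by (simp only: powr_add powr_half_sqrt norm_ge_zero)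
  then have e: "sqrt (cmod a) * cmod a powr (- (3/2)) = 1 / cmod a" by (cases "a = 0") (simp_all add: powr_minus_divide)
  have "0 <= 1 / cmod a" by simp
  then have "1 / cmod a <= 2 * (1 / cmod a)" by linarith
  then show ?thesis using 2 e by (simp add: norm_divide mult.assoc)
 next
  case 3
  from main[OF this] show ?thesis by (rule order_trans) (auto intro!: mult_left_mono)
 next
  case 4
  from main[OF 4(2,1,3)] have "cmod (1 / a - 1 / b) <= 2 * sqrt (cmod (a - b)) * cmod b powr (- (3/2))"
   by (simp add: norm_minus_commute)
  then show ?thesis by (rule order_trans) (auto intro!: mult_left_mono)
 qed
qed

lemma cauchyT_diff_le:
 assumes [measurable]: "F \<in> bmeas" and fin: "rieszJ 1 (%w. en (cmod (F w))) a < \<infinity>" "rieszJ 1 (%w. en (cmod (F w))) b < \<infinity>"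
 shows "en (cmod (cauchyT F a - cauchyT F b)) \<le>
   en (2 * sqrt (cmod (a - b))) * (rieszJ (3/2) (%w. en (cmod (F w))) a + rieszJ (3/2) (%w. en (cmod (F w))) b)"
proof -
 have i: "integrable lborel (%w. F w / (z - w))" if "rieszJ 1 (%w. en (cmod (F w))) z < \<infinity>" for z
  using that by (intro integrableI_bounded) (auto simp: cauchy_kernel_norm rieszJ_def)
 have "cmod (cauchyT F a - cauchyT F b) = cmod (LINT w|lborel. F w / (a - w) - F w / (b - w)) / pi"
  using i fin by (simp add: cauchyT_def norm_divide flip: diff_divide_distrib)
 also have "... <= cmod (LINT w|lborel. F w / (a - w) - F w / (b - w)) / 1"
  using pi_ge_two by (intro divide_left_mono) auto
 finally have "en (cmod (cauchyT F a - cauchyT F b)) <= en (cmod (LINT w|lborel. F w / (a - w) - F w / (b - w)))"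
  by (simp add: ennreal_leI)
 also have "... <= (II w. en (cmod (F w / (a - w) - F w / (b - w))))"
  using i fin by (intro integral_norm_bound_ennreal) auto
 also have "... <= (II w. en (2 * sqrt (cmod (a - b))) * (en (cmod (F w)) * en (cmod (a - w) powr (- (3/2))) + en (cmod (F w)) * en (cmod (b - w) powr (- (3/2)))))"
 proof (rule nn_integral_mono)
  fix w
  have "F w / (a - w) - F w / (b - w) = F w * (1 / (a - w) - 1 / (b - w))" by (simp add: algebra_simps)
  then have "cmod (F w / (a - w) - F w / (b - w)) <= cmod (F w) * (2 * sqrt (cmod (a - b)) * (cmod (a - w) powr (- (3/2)) + cmod (b - w) powr (- (3/2))))"
   using mult_left_mono[OF inverse_diff_le[of "a - w" "b - w"], of "cmod (F w)"] by (simp add: norm_mult)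
  also have "... = 2 * sqrt (cmod (a - b)) * (cmod (F w) * cmod (a - w) powr (- (3/2)) + cmod (F w) * cmod (b - w) powr (- (3/2)))"
   by (simp add: algebra_simps)
  finally show "en (cmod (F w / (a - w) - F w / (b - w))) <= en (2 * sqrt (cmod (a - b))) * (en (cmod (F w)) * en (cmod (a - w) powr (- (3/2))) + en (cmod (F w)) * en (cmod (b - w) powr (- (3/2))))"
   by (simp add: ennreal_mult'[symmetric] ennreal_plus[symmetric] ennreal_leI del: ennreal_plus)
 qed
 also have "... = en (2 * sqrt (cmod (a - b))) * (rieszJ (3/2) (%w. en (cmod (F w))) a + rieszJ (3/2) (%w. en (cmod (F w))) b)"
  unfolding rieszJ_def by (simp add: nn_integral_cmult nn_integral_add)
 finally show ?thesis .
qed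

text \<open>The square of the Cauchy kernel just fails to be integrable at 0, and cutting it off at
  distance h costs a logarithm. On the annulus it is at most 2 / (|z|^2 + h^2), which can be
  integrated along horizontal lines. By h <= 1/2 one has ln (1/h) >= 1/2, so bounded terms are
  absorbed into the logarithm.\<close>

lemma far_kernel_bound:
 assumes h: "0 < h" "h <= 1 / 2" and rh: "1 <= rh"
 shows "(II ze. en ((cmod ze powr (- 1))\<^sup>2) * ind {ze. h <= cmod ze \<and> cmod ze <= rh} ze) <= en (160 * rh * ln (1 / h))"
proof -
 have "(II ze. en ((cmod ze powr (- 1))\<^sup>2) * ind {ze. h <= cmod ze \<and> cmod ze <= rh} ze)
  <= (II ze. en (2 / ((cmod ze)\<^sup>2 + h\<^sup>2)) * ind {-rh..rh} (Im ze))"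
 proof (rule nn_integral_mono)
  fix ze :: complex
  show "en ((cmod ze powr (- 1))\<^sup>2) * ind {ze. h <= cmod ze \<and> cmod ze <= rh} ze <= en (2 / ((cmod ze)\<^sup>2 + h\<^sup>2)) * ind {-rh..rh} (Im ze)"
  proof (cases "h <= cmod ze \<and> cmod ze <= rh")
   case True
   then have *: "0 < cmod ze" "h\<^sup>2 <= (cmod ze)\<^sup>2" "\<bar>Im ze\<bar> <= rh" using h abs_Im_le_cmod[of ze] by (auto intro: power_mono)
   have "(cmod ze powr (- 1))\<^sup>2 = 1 / (cmod ze)\<^sup>2" using * by (simp add: powr_minus_divide power_divide)
   also have "... <= 2 / ((cmod ze)\<^sup>2 + h\<^sup>2)" using * by (simp add: divide_simps add_pos_nonneg)
   finally show ?thesis using True * by (simp add: ennreal_leI abs_le_iff minus_le_iff)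
  qed simp
 qed
 also have "... = (II y. II x. en (2 / ((cmod (Complex x y))\<^sup>2 + h\<^sup>2)) * ind {-rh..rh} (Im (Complex x y)))"
  by (rule nn_integral_complex) measurable
 also have "... = (II y. en (2 * (pi / sqrt (y\<^sup>2 + h\<^sup>2))) * ind {-rh..rh} y)"
 proof (rule nn_integral_cong)
  fix y
  have pos: "0 < sqrt (y\<^sup>2 + h\<^sup>2)" using h by (simp add: add_nonneg_pos)
  have "(II x. en (2 / ((cmod (Complex x y))\<^sup>2 + h\<^sup>2)) * ind {-rh..rh} (Im (Complex x y)))
   = (II x. en 2 * ind {-rh..rh} y * en (1 / (x\<^sup>2 + (sqrt (y\<^sup>2 + h\<^sup>2))\<^sup>2)))"
  proof (rule nn_integral_cong)
   fix x
   have "2 / ((cmod (Complex x y))\<^sup>2 + h\<^sup>2) = 2 * (1 / (x\<^sup>2 + (sqrt (y\<^sup>2 + h\<^sup>2))\<^sup>2))"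
    using h by (simp add: cmod_power2 add.assoc)
   then show "en (2 / ((cmod (Complex x y))\<^sup>2 + h\<^sup>2)) * ind {-rh..rh} (Im (Complex x y)) = en 2 * ind {-rh..rh} y * en (1 / (x\<^sup>2 + (sqrt (y\<^sup>2 + h\<^sup>2))\<^sup>2))"
    by (cases "y \<in> {-rh..rh}") (simp_all only: complex.sel ennreal_mult'[of 2] indicator_simps mult_1_right mult_zero_right mult_zero_left not_False_eq_True zero_le_numeral)
  qed
  also have "... = en 2 * ind {-rh..rh} y * en (pi / sqrt (y\<^sup>2 + h\<^sup>2))"
   by (subst nn_integral_cmult) (use nn_integral_inverse_square_plus[OF pos] in simp_all)
  also have "... = en (2 * (pi / sqrt (y\<^sup>2 + h\<^sup>2))) * ind {-rh..rh} y"
   by (simp only: ennreal_mult'[of 2] mult_ac zero_le_numeral)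
  finally show "(II x. en (2 / ((cmod (Complex x y))\<^sup>2 + h\<^sup>2)) * ind {-rh..rh} (Im (Complex x y))) = en (2 * (pi / sqrt (y\<^sup>2 + h\<^sup>2))) * ind {-rh..rh} y" .
 qed
 also have "... <= (II y. en (16 / (\<bar>y\<bar> + h)) * ind {-rh..rh} y)"
 proof (rule nn_integral_mono)
  fix y
  have pos: "0 < sqrt (y\<^sup>2 + h\<^sup>2)" "0 < \<bar>y\<bar> + h" using h by (auto simp: add_nonneg_pos)
  have "(\<bar>y\<bar> + h)\<^sup>2 <= 2 * (y\<^sup>2 + h\<^sup>2)" using sum_squares_bound[of "\<bar>y\<bar>" h] by (simp add: power2_sum)
  also have "... <= (2 * sqrt (y\<^sup>2 + h\<^sup>2))\<^sup>2" by (simp add: power_mult_distrib)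
  finally have "\<bar>y\<bar> + h <= 2 * sqrt (y\<^sup>2 + h\<^sup>2)"
   by (rule power2_le_imp_le) (use pos in simp)
  then have "1 / sqrt (y\<^sup>2 + h\<^sup>2) <= 2 / (\<bar>y\<bar> + h)" using pos by (simp add: pos_divide_le_eq pos_le_divide_eq)
  then have "(2 * pi) * (1 / sqrt (y\<^sup>2 + h\<^sup>2)) <= 8 * (2 / (\<bar>y\<bar> + h))"
   using pi_less_4 pos by (intro mult_mono) auto
  then show "en (2 * (pi / sqrt (y\<^sup>2 + h\<^sup>2))) * ind {-rh..rh} y <= en (16 / (\<bar>y\<bar> + h)) * ind {-rh..rh} y"
   by (intro mult_right_mono ennreal_leI) auto
 qed
 also have "... = 2 * (II y. en (16 / (\<bar>y\<bar> + h)) * ind {-rh..rh} y * ind {0..} y)"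
  by (rule nn_integral_even) (auto simp: indicator_def)
 also have "(II y. en (16 / (\<bar>y\<bar> + h)) * ind {-rh..rh} y * ind {0..} y) = (II y. en (16 / (\<bar>y\<bar> + h)) * ind {0..rh} y)"
  using rh by (intro nn_integral_cong) (auto simp: indicator_def)
 also have "... = en (16 * ln (rh + h) - 16 * ln (0 + h))"
 proof (rule nn_integral_FTC_Icc)
  show "((%y. 16 * ln (y + h)) has_real_derivative 16 / (\<bar>y\<bar> + h)) (at y)" if "y \<in> {0..rh}" for y
   using that h by (auto intro!: derivative_eq_intros)
 qed (use rh h in auto)
 also have "2 * en (16 * ln (rh + h) - 16 * ln (0 + h)) = en (32 * (ln (rh + h) - ln h))"
  using h rh by (simp add: ennreal_mult'[symmetric] algebra_simps flip: ennreal_numeral)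
 also have "... <= en (160 * rh * ln (1 / h))"
 proof (rule ennreal_leI)
  have "ln (rh + h) <= ln (2 * rh)" using h rh by simp
  also have "... <= 2 * rh" using ln_le_minus_one[of "2 * rh"] rh by simp
  finally have 1: "ln (rh + h) <= 2 * rh" .
  have "1 / 2 <= ln (2::real)" using ln2_ge_two_thirds by linarith
  also have "... <= ln (1 / h)" using h by (subst ln_le_cancel_iff) (auto simp: field_simps)
  finally have 2: "1 / 2 <= ln (1 / h)" .
  have "2 * rh * 1 <= 2 * rh * (2 * ln (1 / h))" using 2 rh by (intro mult_left_mono) auto
  moreover have "1 * ln (1 / h) <= rh * ln (1 / h)" using 2 rh by (intro mult_right_mono) auto
  moreover have "ln (1 / h) = - ln h" using h by (simp add: ln_div)
  ultimately show "32 * (ln (rh + h) - ln h) <= 160 * rh * ln (1 / h)" using 1 by (simp add: algebra_simps)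
 qed
 finally show ?thesis .
qed

section \<open>Sets moved across the boundary by a translation\<close>

lemma interval_shift_measure:
 fixes I :: "real set"
 assumes I: "convex I" "bounded I" "open I"
 shows "(II x. ind {x. (x \<in> I) ~= (x + t \<in> I)} x) <= en (4 * \<bar>t\<bar>)"
proof (cases "I = {}")
 case False
 define l r where "l = Inf I" and "r = Sup I"
 have b: "bdd_below I" "bdd_above I" using I by (auto simp: bounded_imp_bdd_below bounded_imp_bdd_above)
 have le: "l <= x" "x <= r" if "x \<in> I" for x
  unfolding l_def r_def using that b by (auto intro: cInf_lower cSup_upper)
 have mid: "x \<in> I" if x: "l < x" "x < r" for x
 proof -
  obtain a where a: "a \<in> I" "a < x" using x(1) unfolding l_def cInf_less_iff[OF False b(1)] by blast
  obtain c where c: "c \<in> I" "x < c" using x(2) unfolding r_def less_cSup_iff[OF False b(2)] by blast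
  have "is_interval I" using I(1) by (simp add: is_interval_convex_1)
  from mem_is_interval_1_I[OF this a(1) c(1)] show ?thesis using a c by simp
 qed
 have "{x. (x \<in> I) ~= (x + t \<in> I)} \<subseteq> {l - \<bar>t\<bar>..l + \<bar>t\<bar>} \<union> {r - \<bar>t\<bar>..r + \<bar>t\<bar>}"
 proof
  fix x assume "x \<in> {x. (x \<in> I) ~= (x + t \<in> I)}"
  then consider "x \<in> I" "x + t \<notin> I" | "x \<notin> I" "x + t \<in> I" by auto
  then show "x \<in> {l - \<bar>t\<bar>..l + \<bar>t\<bar>} \<union> {r - \<bar>t\<bar>..r + \<bar>t\<bar>}"
  proof cases
   case 1
   then have "x + t <= l \<or> r <= x + t" using mid[of "x + t"] by linarith
   then show ?thesis using le[OF 1(1)] by auto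
  next
   case 2
   then have "x <= l \<or> r <= x" using mid[of "x"] by linarith
   then show ?thesis using le[OF 2(2)] by auto
  qed
 qed
 then have "(II x. ind {x. (x \<in> I) ~= (x + t \<in> I)} x) <= (II x. ind {l - \<bar>t\<bar>..l + \<bar>t\<bar>} x + ind {r - \<bar>t\<bar>..r + \<bar>t\<bar>} x)"
  by (intro nn_integral_mono) (auto simp: indicator_def)
 also have "... = en (4 * \<bar>t\<bar>)"
  by (subst nn_integral_add) (auto simp: ennreal_plus[symmetric] simp del: ennreal_plus)
 finally show ?thesis .
qed simp

text \<open>The translation is split into a horizontal and a vertical one. Slices of a convex set
  are intervals, so each of them contributes at most 4 |t|, and slices occur only over an interval
  of length 2 R.\<close>

lemma convex_shift_measure:
 fixes Om :: "complex set"
 assumes Om: "convex Om" "open Om" "Om \<subseteq> ball 0 R" and R: "0 <= R"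
 shows "(II z. ind {z. (z \<in> Om) ~= (z + ta \<in> Om)} z) <= en (16 * R * cmod ta)"
proof -
 have [measurable]: "Om \<in> sets borel" using Om by simp
 have [measurable]: "Measurable.pred borel (%z. z \<in> Om)" by measurable
 have out: "Complex x y \<notin> Om" if "\<bar>x\<bar> > R \<or> \<bar>y\<bar> > R" for x y
  using that Om(3) abs_Re_le_cmod[of "Complex x y"] abs_Im_le_cmod[of "Complex x y"] by auto
 have slice: "convex {x. Complex x y \<in> Om}" "bounded {x. Complex x y \<in> Om}" "open {x. Complex x y \<in> Om}"
   "convex {x. Complex y x \<in> Om}" "bounded {x. Complex y x \<in> Om}" "open {x. Complex y x \<in> Om}" for y
 proof -
  have c: "Complex (u * a + v * b) y = u *\<^sub>R Complex a y + v *\<^sub>R Complex b y" "Complex y (u * a + v * b) = u *\<^sub>R Complex y a + v *\<^sub>R Complex y b" if "u + v = 1" for u v a b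
   using that by (auto simp: complex_eq_iff simp flip: distrib_right)
  show "convex {x. Complex x y \<in> Om}" "convex {x. Complex y x \<in> Om}"
   using Om(1) by (auto simp: convex_def c)
  show "bounded {x. Complex x y \<in> Om}" "bounded {x. Complex y x \<in> Om}"
   unfolding bounded_real using out by (meson mem_Collect_eq not_le)+
  have "continuous_on UNIV (%x. Complex x y)" "continuous_on UNIV (%x. Complex y x)" by (auto intro!: continuous_intros)
  from this[THEN open_vimage[OF Om(2)]] show "open {x. Complex x y \<in> Om}" "open {x. Complex y x \<in> Om}"
   by (simp_all add: vimage_def)
 qed
 have tot: "(II y. en (4 * \<bar>t\<bar>) * ind {-R..R} y) = en (8 * R * \<bar>t\<bar>)" for t
  using R by (subst nn_integral_cmult_indicator) (auto simp: ennreal_mult'[symmetric])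
 have re: "(II z. ind {z. (z \<in> Om) ~= (z + Complex t 0 \<in> Om)} z) <= en (8 * R * \<bar>t\<bar>)" for t
 proof -
  have "(II z. ind {z. (z \<in> Om) ~= (z + Complex t 0 \<in> Om)} z) = (II y. II x. ind {z. (z \<in> Om) ~= (z + Complex t 0 \<in> Om)} (Complex x y))"
   by (rule nn_integral_complex) measurable
  also have "... <= (II y. en (4 * \<bar>t\<bar>) * ind {-R..R} y)"
  proof (rule nn_integral_mono)
   fix y
   show "(II x. ind {z. (z \<in> Om) ~= (z + Complex t 0 \<in> Om)} (Complex x y)) <= en (4 * \<bar>t\<bar>) * ind {-R..R} y"
   proof (cases "\<bar>y\<bar> <= R")
    case True
    then show ?thesis using interval_shift_measure[OF slice(1,2,3), of y t] by (simp add: complex_add abs_le_iff minus_le_iff indicator_def)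
   next
    case False then show ?thesis using out by (simp add: complex_add)
   qed
  qed
  finally show ?thesis unfolding tot .
 qed
 have im: "(II z. ind {z. (z \<in> Om) ~= (z + Complex 0 t \<in> Om)} z) <= en (8 * R * \<bar>t\<bar>)" for t
 proof -
  have "(II z. ind {z. (z \<in> Om) ~= (z + Complex 0 t \<in> Om)} z) = (II x. II y. ind {z. (z \<in> Om) ~= (z + Complex 0 t \<in> Om)} (Complex x y))"
   by (rule nn_integral_complex) measurable
  also have "... <= (II y. en (4 * \<bar>t\<bar>) * ind {-R..R} y)"
  proof (rule nn_integral_mono)
   fix x
   show "(II y. ind {z. (z \<in> Om) ~= (z + Complex 0 t \<in> Om)} (Complex x y)) <= en (4 * \<bar>t\<bar>) * ind {-R..R} x"
   proof (cases "\<bar>x\<bar> <= R")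
    case True
    then show ?thesis using interval_shift_measure[OF slice(4,5,6), of x t] by (simp add: complex_add abs_le_iff minus_le_iff indicator_def)
   next
    case False then show ?thesis using out by (simp add: complex_add)
   qed
  qed
  finally show ?thesis unfolding tot .
 qed
 define a b where "a = Complex (Re ta) 0" and "b = Complex 0 (Im ta)"
 have ab: "z + ta = (z + a) + b" for z by (simp add: a_def b_def complex_eq_iff)
 have "(II z. ind {z. (z \<in> Om) ~= (z + ta \<in> Om)} z) \<le>
   (II z. ind {z. (z \<in> Om) ~= (z + a \<in> Om)} z + ind {z. (z \<in> Om) ~= (z + b \<in> Om)} (z + a))"
  unfolding ab by (intro nn_integral_mono) (auto simp: indicator_def)
 also have "... = (II z. ind {z. (z \<in> Om) ~= (z + a \<in> Om)} z) + (II z. ind {z. (z \<in> Om) ~= (z + b \<in> Om)} (z + a))"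
  by (rule nn_integral_add) measurable
 also have "(II z. ind {z. (z \<in> Om) ~= (z + b \<in> Om)} (z + a)) = (II z. ind {z. (z \<in> Om) ~= (z + b \<in> Om)} z)"
  by (rule nn_integral_translate_reflect(3)) measurable
 also have "(II z. ind {z. (z \<in> Om) ~= (z + a \<in> Om)} z) + (II z. ind {z. (z \<in> Om) ~= (z + b \<in> Om)} z) <= en (8 * R * \<bar>Re ta\<bar>) + en (8 * R * \<bar>Im ta\<bar>)"
  unfolding a_def b_def by (intro add_mono re im)
 also have "... = en (8 * R * (\<bar>Re ta\<bar> + \<bar>Im ta\<bar>))"
  using R by (simp add: ennreal_plus[symmetric] distrib_left del: ennreal_plus)
 also have "... <= en (8 * R * (2 * cmod ta))"
  using R abs_Re_le_cmod[of ta] abs_Im_le_cmod[of ta] by (intro ennreal_leI mult_left_mono) auto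
 finally show ?thesis by (simp add: mult_ac)
qed

lemma ennreal_sum4_power2: "((a::ennreal) + b + c + d)\<^sup>2 <= 4 * (a\<^sup>2 + b\<^sup>2 + c\<^sup>2 + d\<^sup>2)"
proof (cases "a = top \<or> b = top \<or> c = top \<or> d = top")
 case True
 then have "4 * (a\<^sup>2 + b\<^sup>2 + c\<^sup>2 + d\<^sup>2) = top"
  by (auto simp: power2_eq_square ennreal_mult_top ennreal_top_mult)
 then show ?thesis by (simp only: top_greatest)
next
 case False
 then obtain x y z w where e: "a = en x" "b = en y" "c = en z" "d = en w" "0 <= x" "0 <= y" "0 <= z" "0 <= w"
  by (metis ennreal_cases)
 have "(x + y + z + w)\<^sup>2 <= 4 * (x\<^sup>2 + y\<^sup>2 + z\<^sup>2 + w\<^sup>2)"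
 proof -
  have "4 * (x\<^sup>2 + y\<^sup>2 + z\<^sup>2 + w\<^sup>2) - (x + y + z + w)\<^sup>2 = (x - y)\<^sup>2 + (x - z)\<^sup>2 + (x - w)\<^sup>2 + (y - z)\<^sup>2 + (y - w)\<^sup>2 + (z - w)\<^sup>2"
   by (simp add: power2_eq_square algebra_simps)
  also have "... \<ge> 0" by simp
  finally show ?thesis by simp
 qed
 then have "en ((x + y + z + w)\<^sup>2) <= en (4 * (x\<^sup>2 + y\<^sup>2 + z\<^sup>2 + w\<^sup>2))" by (rule ennreal_leI)
 then show ?thesis using e by (simp add: ennreal_power[symmetric] ennreal_mult')
qed

lemma ennreal_sum3_power2: "((a::ennreal) + b + c)\<^sup>2 <= 4 * (a\<^sup>2 + b\<^sup>2 + c\<^sup>2)"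
 using ennreal_sum4_power2[of a b c 0] by simp

lemma ennreal_power2_le_imp_le: "(a::ennreal)\<^sup>2 <= b\<^sup>2 ==> a <= b"
proof (cases b)
 case (real r)
 assume le: "a\<^sup>2 <= b\<^sup>2"
 show ?thesis
 proof (cases a)
  case (real s)
  with le \<open>b = en r\<close> \<open>0 <= r\<close> have "s\<^sup>2 <= r\<^sup>2" by (simp add: ennreal_power)
  then have "s <= r" using \<open>0 <= r\<close> by (rule power2_le_imp_le)
  then show ?thesis using real \<open>b = en r\<close> by (simp add: ennreal_leI)
 next
  case top
  with le \<open>b = en r\<close> \<open>0 <= r\<close> show ?thesis by (simp add: ennreal_power power2_eq_square[of top] ennreal_mult_top top_unique)
 qed
qed simp

text \<open>Since e changes sign under the shift by \<open>ta\<close>, twice the integral equals the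
  integral of e times a difference of shifted terms. The difference falls either on V = 1_Om W or on
  the kernel. On the kernel it gains sqrt |ta| with exponent 3/2. On V it gains the same where both
  points lie in \<open>Om\<close>; where only one does, the set has measure O(h) and W is bounded up
  to sqrt (ln (1/h)), which yields the rate h ln (1/h) for the square.\<close>

lemma oscillating_composition_bound:
 assumes Om: "convex Om" "open Om" "Om \<subseteq> ball 0 R" and R: "1 <= R" and ep: "0 < ep"
 shows "\<exists>C\<ge>0. \<forall>h ta e F W. 0 < h \<and> h <= 1/2 \<and> cmod ta <= 2 * h \<and> e \<in> bmeas \<and>
   (\<forall>z. cmod (e z) <= 1) \<and> (\<forall>z. e (z + ta) = - e z) \<and> F \<in> bmeas \<and>
   (\<forall>w. R < cmod w --> F w = 0) \<and> (II w. en ((cmod (F w))\<^sup>2)) < \<infinity> \<and>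
   (W = cauchyT F \<or> W = (%z. cnj (cauchyT F z))) -->
   wN ep (cauchyT (%y. e y * (ind Om y * W y))) <= en (C * (h * ln (1 / h))) * (II w. en ((cmod (F w))\<^sup>2))"
proof -
 obtain C1 where C1: "C1 \<ge> 0" "!!F. F \<in> bmeas ==> (!!w. R + 2 < cmod w ==> F w = 0) ==>
  (II z. en (jap z powr (- 2 * ep)) * (rieszJ 1 F z)\<^sup>2) <= en C1 * (II w. (F w)\<^sup>2)"
  using weighted_riesz_bound[of 1 ep "R + 2"] R ep unfolding rieszJ_def by auto
 obtain C2 where C2: "C2 \<ge> 0" "!!F. F \<in> bmeas ==> (!!w. R + 2 < cmod w ==> F w = 0) ==>
  (II z. en (jap z powr (- 2 * ep)) * (rieszJ (3/2) F z)\<^sup>2) <= en C2 * (II w. (F w)\<^sup>2)"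
  using weighted_riesz_bound[of "3/2" ep "R + 2"] R ep unfolding rieszJ_def by auto
 \<comment> \<open>\<open>K\<close> bounds the two Riesz potentials in L2 on the disc of radius R +
   2, \<open>Q\<close> the squared norm of V minus its translate, and \<open>C\<close> the resulting
   transform. The 36 in \<open>Q\<close> dominates (8 + 8 + 1) h <= 34 h ln (1/h).\<close>
 define K where "K = (R + 3) powr (2 * ep) * (C1 + C2)"
 have K: "K \<ge> 0" unfolding K_def using C1(1) C2(1) by simp
 define Q where "Q = 4 * (36 * K + 16 * R * 160 * (2 * R + 2) * 2)"
 have Q: "Q \<ge> 0" unfolding Q_def using K R by simp
 define C where "C = 4 * (C1 * Q + 32 * C2 * K)"
 have C: "C \<ge> 0" unfolding C_def using C1(1) C2(1) K Q by simp
 show ?thesis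
 proof (intro exI[of _ C] conjI allI impI C)
  fix h ta e F W
  assume A: "0 < h \<and> h <= 1/2 \<and> cmod ta <= 2 * h \<and> e \<in> bmeas \<and>
   (\<forall>z. cmod (e z) <= 1) \<and> (\<forall>z. e (z + ta) = - e z) \<and> F \<in> bmeas \<and>
   (\<forall>w. R < cmod w --> F w = 0) \<and> (II w. en ((cmod (F w))\<^sup>2)) < \<infinity> \<and>
   (W = cauchyT F \<or> W = (%z. cnj (cauchyT F z)))"
  define F' where "F' = (%w. en (cmod (F w)))"
  define N where "N = (II w. en ((cmod (F w))\<^sup>2))"
  have h: "0 < h" "h <= 1/2" and ta: "cmod ta <= 2 * h" and e: "!!z. cmod (e z) <= 1" "!!z. e (z + ta) = - e z"
   and F: "!!w. R < cmod w ==> F w = 0" and Nfin: "N < \<infinity>"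
   and [measurable]: "e \<in> bmeas" "F \<in> bmeas"
   using A by (auto simp: N_def)
  have [measurable]: "cnj \<in> bmeas"
   by (intro borel_measurable_continuous_onI continuous_intros)
  have [measurable]: "W \<in> bmeas" using A by (auto intro: measurable_compose)
  have [measurable]: "F' \<in> bmeas" unfolding F'_def by measurable
  have [measurable]: "Om \<in> sets borel" using Om by simp
  have [measurable]: "Measurable.pred borel (%z. z \<in> Om)" by measurable
  have N': "(II w. (F' w)\<^sup>2) = N" unfolding F'_def N_def by (simp add: ennreal_power)
  have ta1: "cmod ta <= 1" using ta h by linarith
  have l2: "1 / 2 <= ln (1 / h)"
  proof -
   have "1 / 2 <= ln (2::real)" using ln2_ge_two_thirds by linarith
   also have "... <= ln (1 / h)" using h by (subst ln_le_cancel_iff) (auto simp: field_simps)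
   finally show ?thesis .
  qed
  define L where "L = h * ln (1 / h)"
  have L: "0 <= L" "h <= 2 * L" unfolding L_def using l2 h mult_left_mono[OF l2, of "2 * h"] by (auto simp: mult_ac)
  have Wb: "en (cmod (W z)) <= rieszJ 1 F' z" for z
   using A cauchyT_le[of F z] by (auto simp: rieszJ_def F'_def)
  have Wd: "en (cmod (W a - W b)) <= en (2 * sqrt (cmod (a - b))) * (rieszJ (3/2) F' a + rieszJ (3/2) F' b)"
   if "rieszJ 1 F' a < \<infinity>" "rieszJ 1 F' b < \<infinity>" for a b
   using A cauchyT_diff_le[of F a b] that by (auto simp: F'_def simp flip: complex_cnj_diff)
  have loc: "(II z. (rieszJ p F' z)\<^sup>2 * ind (cball 0 (R + 2)) z) <= en K * N" if p: "p = 1 \<or> p = 3/2" for p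
  proof -
   have "(II z. (rieszJ p F' z)\<^sup>2 * ind (cball 0 (R + 2)) z) <= (II z. en ((R + 3) powr (2 * ep)) * (en (jap z powr (- 2 * ep)) * (rieszJ p F' z)\<^sup>2))"
   proof (rule nn_integral_mono)
    fix z :: complex
    have "1 <= (R + 3) powr (2 * ep) * jap z powr (- 2 * ep)" if "cmod z <= R + 2"
    proof -
     have "jap z powr (2 * ep) <= (R + 3) powr (2 * ep)"
      using jap_le[of z] that ep by (intro powr_mono2) auto
     then show ?thesis using jap_pos[of z] by (simp add: powr_minus field_simps)
    qed
    then have "1 * X <= en ((R + 3) powr (2 * ep)) * en (jap z powr (- 2 * ep)) * X" if "cmod z <= R + 2" for X
     using that by (intro mult_right_mono) (auto simp: ennreal_mult'[symmetric] simp flip: ennreal_1)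
    from this[of "(rieszJ p F' z)\<^sup>2"] show "(rieszJ p F' z)\<^sup>2 * ind (cball 0 (R + 2)) z <= en ((R + 3) powr (2 * ep)) * (en (jap z powr (- 2 * ep)) * (rieszJ p F' z)\<^sup>2)"
     by (cases "cmod z <= R + 2") (simp_all add: mult.assoc)
   qed
   also have "... = en ((R + 3) powr (2 * ep)) * (II z. en (jap z powr (- 2 * ep)) * (rieszJ p F' z)\<^sup>2)"
    by (rule nn_integral_cmult) measurable
   also have "... <= en ((R + 3) powr (2 * ep)) * (en (C1 + C2) * N)"
   proof (rule mult_left_mono)
    have c1: "(II z. en (jap z powr (- 2 * ep)) * (rieszJ 1 F' z)\<^sup>2) <= en C1 * N"
     using C1(2)[of F'] F unfolding N' by (auto simp: F'_def)
    have c2: "(II z. en (jap z powr (- 2 * ep)) * (rieszJ (3/2) F' z)\<^sup>2) <= en C2 * N"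
     using C2(2)[of F'] F unfolding N' by (auto simp: F'_def)
    have "(II z. en (jap z powr (- 2 * ep)) * (rieszJ p F' z)\<^sup>2) <= en C1 * N \<or> (II z. en (jap z powr (- 2 * ep)) * (rieszJ p F' z)\<^sup>2) <= en C2 * N"
     using p c1 c2 by blast
    moreover have "en C1 * N <= en (C1 + C2) * N" "en C2 * N <= en (C1 + C2) * N"
     using C1(1) C2(1) by (auto intro!: mult_right_mono ennreal_leI simp del: ennreal_plus)
    ultimately show "(II z. en (jap z powr (- 2 * ep)) * (rieszJ p F' z)\<^sup>2) <= en (C1 + C2) * N"
     by (auto intro: order_trans)
   qed simp
   also have "... = en K * N"
    unfolding K_def using C1(1) C2(1) by (simp add: ennreal_mult mult.assoc del: ennreal_plus)
   finally show ?thesis .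
  qed
  have locs: "(II z. (rieszJ p F' (z + ta))\<^sup>2 * ind (cball 0 (R + 1)) z) <= en K * N" if p: "p = 1 \<or> p = 3/2" for p
  proof -
   have "(II z. (rieszJ p F' (z + ta))\<^sup>2 * ind (cball 0 (R + 1)) z) <= (II z. (rieszJ p F' (z + ta))\<^sup>2 * ind (cball 0 (R + 2)) (z + ta))"
   proof (intro nn_integral_mono mult_left_mono)
    fix z :: complex
    have "cmod (z + ta) <= R + 2" if "cmod z <= R + 1" using norm_triangle_ineq[of z ta] that ta1 by linarith
    then show "ind (cball 0 (R + 1)) z <= (ind (cball 0 (R + 2)) (z + ta) :: ennreal)" by (simp add: indicator_def)
   qed simp
   also have "... = (II z. (rieszJ p F' z)\<^sup>2 * ind (cball 0 (R + 2)) z)"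
    by (rule nn_integral_translate_reflect(3)) measurable
   also note loc[OF p]
   finally show ?thesis .
  qed
  have fin1: "AE z in lborel. rieszJ 1 F' z < \<infinity>"
  proof -
   have "AE z in lborel. en (jap z powr (- 2 * ep)) * (rieszJ 1 F' z)\<^sup>2 ~= \<infinity>"
   proof (intro nn_integral_PInf_AE)
    have "(II z. en (jap z powr (- 2 * ep)) * (rieszJ 1 F' z)\<^sup>2) <= en C1 * N"
     using C1(2)[of F'] F unfolding N' by (auto simp: F'_def)
    also have "... < \<infinity>" using Nfin by (simp add: ennreal_mult_less_top)
    finally show "(II z. en (jap z powr (- 2 * ep)) * (rieszJ 1 F' z)\<^sup>2) ~= \<infinity>" by simp
   qed simp
   then show ?thesis
   proof eventually_elim
    case (elim z)
    then show ?case using jap_pos[of z]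
     by (cases "rieszJ 1 F' z = \<infinity>") (auto simp: power2_eq_square ennreal_mult_top ennreal_top_mult less_top)
   qed
  qed
  have fin2: "AE z in lborel. rieszJ 1 F' (z + ta) < \<infinity>"
  proof -
   have "(II z. ind {z. \<not> rieszJ 1 F' z < \<infinity>} (z + ta)) = (II z. ind {z. \<not> rieszJ 1 F' z < \<infinity>} z)"
    by (rule nn_integral_translate_reflect(3)) measurable
   also have "... = 0" using fin1 by (subst nn_integral_0_iff_AE) (auto elim!: eventually_mono)
   finally show ?thesis by (subst (asm) nn_integral_0_iff_AE) (auto elim!: eventually_mono split: split_indicator_asm)
  qed
  define V where "V = (%y. ind Om y * W y)"
  have [measurable]: "V \<in> bmeas" unfolding V_def by measurable
  define V' where "V' = (%y. en (cmod (V y)))"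
  define D where "D = (%y. en (cmod (V y - V (y + ta))))"
  have [measurable]: "V' \<in> bmeas" "D \<in> bmeas" unfolding V'_def D_def by measurable
  have OmR: "cmod y < R" if "y \<in> Om" for y using that Om by auto
  have V0: "V y = 0" if "R <= cmod y" for y using OmR[of y] that by (auto simp: V_def indicator_def)
  have Vs0: "V (y + ta) = 0" if "R + 1 < cmod y" for y
  proof (rule V0)
   have "cmod y <= cmod (y + ta) + cmod ta" using norm_triangle_ineq4[of "y + ta" ta] by simp
   then show "R <= cmod (y + ta)" using that ta1 by linarith
  qed
  have V2: "(II y. (V' y)\<^sup>2) <= en K * N"
  proof -
   have "(II y. (V' y)\<^sup>2) <= (II z. (rieszJ 1 F' z)\<^sup>2 * ind (cball 0 (R + 2)) z)"
   proof (rule nn_integral_mono)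
    fix y
    show "(V' y)\<^sup>2 <= (rieszJ 1 F' y)\<^sup>2 * ind (cball 0 (R + 2)) y"
     using Wb[of y] OmR[of y] by (cases "y \<in> Om") (auto simp: V'_def V_def intro: power_mono)
   qed
   also note loc
   finally show ?thesis by simp
  qed
  have V2s: "(II y. (V' (y + ta))\<^sup>2) <= en K * N"
   using V2 by (subst nn_integral_translate_reflect(3)[where f="%y. (V' y)\<^sup>2"]) auto
  define E where "E = {z. (z \<in> Om) ~= (z + ta \<in> Om)}"
  have [measurable]: "E \<in> sets borel" unfolding E_def by measurable
  have Em: "emeasure lborel E <= en (32 * R * h)"
  proof -
   have "emeasure lborel E <= en (16 * R * cmod ta)"
    using convex_shift_measure[OF Om, of ta] R unfolding E_def[symmetric] by simp
   also have "... <= en (32 * R * h)" using mult_left_mono[OF ta, of "16 * R"] R by (intro ennreal_leI) simp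
   finally show ?thesis .
  qed
  define B where "B = en (160 * (2 * R + 2) * ln (1 / h)) * N"
  \<comment> \<open>For |y - w| < h the kernel is at most sqrt h |y - w|^(-3/2), which is as good as
    the half-Hoelder gain. For larger distances Cauchy-Schwarz leaves the logarithmic integral over
    an annulus.\<close>
  have far: "rieszJ 1 F' y <= en (sqrt h) * rieszJ (3/2) F' y + X" if y: "cmod y <= R + 2" and X: "X\<^sup>2 = B" for y X
  proof -
   define S where "S = {ze. h <= cmod ze \<and> cmod ze <= 2 * R + 2}"
   have [measurable]: "S \<in> sets borel" unfolding S_def by measurable
   have "rieszJ 1 F' y <= (II w. en (sqrt h) * (F' w * en (cmod (y - w) powr (- (3/2)))) + F' w * (en (cmod (y - w) powr (- 1)) * ind S (y - w)))"
    unfolding rieszJ_def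
   proof (rule nn_integral_mono)
    fix w
    show "F' w * en (cmod (y - w) powr (- 1)) <= en (sqrt h) * (F' w * en (cmod (y - w) powr (- (3/2)))) + F' w * (en (cmod (y - w) powr (- 1)) * ind S (y - w))"
    proof (cases "R < cmod w \<or> y - w \<in> S")
     case True then show ?thesis using F[of w] by (auto simp: F'_def)
    next
     case False
     have "cmod (y - w) <= 2 * R + 2" using norm_triangle_ineq4[of y w] y False by linarith
     then have r: "cmod (y - w) < h" using False by (auto simp: S_def)
     have "cmod (y - w) powr (- 1) = sqrt (cmod (y - w)) * cmod (y - w) powr (- (3/2))"
     proof -
      have "cmod (y - w) powr (1/2 + - (3/2)) = cmod (y - w) powr (1/2) * cmod (y - w) powr (- (3/2))" by (rule powr_add)
      then show ?thesis by (simp add: powr_half_sqrt)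
     qed
     also have "... <= sqrt h * cmod (y - w) powr (- (3/2))" using r by (intro mult_right_mono) auto
     finally have "en (cmod (y - w) powr (- 1)) <= en (sqrt h) * en (cmod (y - w) powr (- (3/2)))"
      using h by (simp add: ennreal_mult[symmetric] ennreal_leI)
     from mult_left_mono[OF this, of "F' w"] have "F' w * en (cmod (y - w) powr (- 1)) <= en (sqrt h) * (F' w * en (cmod (y - w) powr (- (3/2))))"
      by (simp add: mult_ac)
     then show ?thesis by (rule order_trans) simp
    qed
   qed
   also have "... = en (sqrt h) * rieszJ (3/2) F' y + (II w. F' w * (en (cmod (y - w) powr (- 1)) * ind S (y - w)))"
    unfolding rieszJ_def by (simp add: nn_integral_cmult nn_integral_add)
   also have "(II w. F' w * (en (cmod (y - w) powr (- 1)) * ind S (y - w))) <= X"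
   proof (rule ennreal_power2_le_imp_le)
    have "(II w. (en (cmod (y - w) powr (- 1)) * ind S (y - w))\<^sup>2) = (II w. (en (cmod w powr (- 1)) * ind S w)\<^sup>2)"
     by (rule nn_integral_translate_reflect(1)) measurable
    also have "... = (II w. en ((cmod w powr (- 1))\<^sup>2) * ind S w)"
     by (simp only: ennreal_times_indicator_power2 powr_ge_zero)
    also have "... <= en (160 * (2 * R + 2) * ln (1 / h))"
     unfolding S_def using h R by (intro far_kernel_bound) auto
    finally have far2: "(II w. (en (cmod (y - w) powr (- 1)) * ind S (y - w))\<^sup>2) <= en (160 * (2 * R + 2) * ln (1 / h))" .
    have "(II w. F' w * (en (cmod (y - w) powr (- 1)) * ind S (y - w)))\<^sup>2 <= (II w. (F' w)\<^sup>2) * (II w. (en (cmod (y - w) powr (- 1)) * ind S (y - w))\<^sup>2)"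
     by (rule nn_integral_Cauchy_Schwarz) measurable
    then show "(II w. F' w * (en (cmod (y - w) powr (- 1)) * ind S (y - w)))\<^sup>2 <= X\<^sup>2"
     unfolding N' X B_def by (rule order_trans) (subst mult.commute, rule mult_right_mono[OF far2], simp)
   qed
   finally show ?thesis by (simp add: add_left_mono)
  qed
  have sta: "(2 * sqrt (cmod ta))\<^sup>2 <= 8 * h" using ta by (simp add: power_mult_distrib)
  have D2: "(II y. (D y)\<^sup>2) <= en (Q * L) * N"
  proof -
   obtain n where n: "N = en n" "n \<ge> 0" using Nfin by (cases N) auto
   define X where "X = en (sqrt (160 * (2 * R + 2) * ln (1 / h) * n))"
   have lR: "0 <= 160 * (2 * R + 2) * ln (1 / h)" using R l2 by simp
   have X: "X\<^sup>2 = B" unfolding X_def B_def n using lR n by (simp add: ennreal_power ennreal_mult'[symmetric])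
   define I where "I = (ind (cball 0 (R + 1)) :: complex => ennreal)"
   have [measurable]: "I \<in> bmeas" unfolding I_def by measurable
   define s where "s = en (2 * sqrt (cmod ta))"
   \<comment> \<open>If both points lie in \<open>Om\<close> the first two terms suffice. If exactly
     one does, y lies in \<open>E\<close>; there W (y + ta) is estimated by \<open>far\<close>, and
     when y is the inner point W y is compared with W (y + ta) across the shift.\<close>
   have Dle: "D y <= s * rieszJ (3/2) F' y * I y + s * rieszJ (3/2) F' (y + ta) * I y + en (sqrt h) * rieszJ (3/2) F' (y + ta) * I y + X * ind E y"
    if f: "rieszJ 1 F' y < \<infinity>" "rieszJ 1 F' (y + ta) < \<infinity>" for y
   proof -
    have wd: "en (cmod (W y - W (y + ta))) <= s * rieszJ (3/2) F' y + s * rieszJ (3/2) F' (y + ta)"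
     using Wd[OF f] by (simp add: s_def distrib_left)
    have wf: "en (cmod (W (y + ta))) <= en (sqrt h) * rieszJ (3/2) F' (y + ta) + X" if "cmod (y + ta) <= R + 2"
     using order_trans[OF Wb far[OF that X]] .
    consider "y \<in> Om" "y + ta \<in> Om" | "y \<in> Om" "y + ta \<notin> Om" | "y \<notin> Om" "y + ta \<in> Om" | "y \<notin> Om" "y + ta \<notin> Om" by blast
    then show ?thesis
    proof cases
     case 1
     then have "I y = 1" using OmR[of y] by (simp add: I_def)
     then show ?thesis using 1 wd unfolding D_def V_def by (simp add: add.assoc) (rule order_trans, assumption, simp add: add_left_mono add_increasing2)
    next
     case 2
     then have I: "I y = 1" "y \<in> E" using OmR[of y] by (simp_all add: I_def E_def)
     have "cmod (y + ta) <= R + 2" using norm_triangle_ineq[of y ta] OmR[OF 2(1)] ta1 by linarith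
     note wf[OF this]
     moreover have "en (cmod (W y)) <= en (cmod (W y - W (y + ta))) + en (cmod (W (y + ta)))"
      using norm_triangle_ineq[of "W y - W (y + ta)" "W (y + ta)"] by (simp add: ennreal_plus[symmetric] ennreal_leI del: ennreal_plus)
     ultimately have "en (cmod (W y)) <= (s * rieszJ (3/2) F' y + s * rieszJ (3/2) F' (y + ta)) + (en (sqrt h) * rieszJ (3/2) F' (y + ta) + X)"
      using wd by (meson add_mono order_trans)
     then show ?thesis using 2 I unfolding D_def V_def by (simp add: add.assoc)
    next
     case 3
     have "cmod y <= cmod (y + ta) + cmod ta" using norm_triangle_ineq4[of "y + ta" ta] by simp
     then have I: "I y = 1" "y \<in> E" using OmR[OF 3(2)] 3 ta1 by (simp_all add: I_def E_def)
     have "cmod (y + ta) <= R + 2" using OmR[OF 3(2)] by linarith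
     note wf[OF this]
     then show ?thesis using 3 I unfolding D_def V_def by (simp add: add.assoc add_increasing)
    next
     case 4 then show ?thesis by (simp add: D_def V_def)
    qed
   qed
   have I2: "(I y)\<^sup>2 = I y" for y by (simp add: I_def indicator_def)
   have E2: "(ind E y :: ennreal)\<^sup>2 = ind E y" for y by (simp add: indicator_def)
   have s2: "s\<^sup>2 <= en (8 * h)" unfolding s_def using sta by (simp add: ennreal_power ennreal_leI)
   have h2: "(en (sqrt h))\<^sup>2 = en h" using h by (simp add: ennreal_power)
   have J: "(II y. (rieszJ (3/2) F' y)\<^sup>2 * I y) <= en K * N"
   proof (rule order_trans[OF _ loc[of "3/2"]])
    show "(II y. (rieszJ (3/2) F' y)\<^sup>2 * I y) <= (II z. (rieszJ (3/2) F' z)\<^sup>2 * ind (cball 0 (R + 2)) z)"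
     by (intro nn_integral_mono mult_left_mono) (auto simp: I_def indicator_def)
   qed simp
   have Js: "(II y. (rieszJ (3/2) F' (y + ta))\<^sup>2 * I y) <= en K * N"
    using locs[of "3/2"] by (simp add: I_def)
   have "(II y. (D y)\<^sup>2) <= (II y. 4 * (s\<^sup>2 * ((rieszJ (3/2) F' y)\<^sup>2 * I y) + s\<^sup>2 * ((rieszJ (3/2) F' (y + ta))\<^sup>2 * I y) + en h * ((rieszJ (3/2) F' (y + ta))\<^sup>2 * I y) + B * ind E y))"
   proof (rule nn_integral_mono_AE, use fin1 fin2 in eventually_elim)
    fix y assume f: "rieszJ 1 F' y < \<infinity>" "rieszJ 1 F' (y + ta) < \<infinity>"
    have "(D y)\<^sup>2 <= (s * rieszJ (3/2) F' y * I y + s * rieszJ (3/2) F' (y + ta) * I y + en (sqrt h) * rieszJ (3/2) F' (y + ta) * I y + X * ind E y)\<^sup>2"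
     by (intro power_mono Dle f) simp
    also note ennreal_sum4_power2
    finally show "(D y)\<^sup>2 <= 4 * (s\<^sup>2 * ((rieszJ (3/2) F' y)\<^sup>2 * I y) + s\<^sup>2 * ((rieszJ (3/2) F' (y + ta))\<^sup>2 * I y) + en h * ((rieszJ (3/2) F' (y + ta))\<^sup>2 * I y) + B * ind E y)"
     by (simp only: power_mult_distrib I2 E2 h2 X mult.assoc)
   qed
   also have "... = 4 * (s\<^sup>2 * (II y. (rieszJ (3/2) F' y)\<^sup>2 * I y) + s\<^sup>2 * (II y. (rieszJ (3/2) F' (y + ta))\<^sup>2 * I y) + en h * (II y. (rieszJ (3/2) F' (y + ta))\<^sup>2 * I y) + B * emeasure lborel E)"
    by (simp add: nn_integral_cmult nn_integral_add nn_integral_cmult_indicator)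
   also have "... <= 4 * (en (8 * h) * (en K * N) + en (8 * h) * (en K * N) + en h * (en K * N) + B * en (32 * R * h))"
    by (intro mult_left_mono add_mono mult_mono J Js s2 Em) auto
   also have "... = en (4 * (8 * h * (K * n) + 8 * h * (K * n) + h * (K * n) + 160 * (2 * R + 2) * ln (1 / h) * n * (32 * R * h)))"
    unfolding n B_def using n K h R lR l2
    by (simp add: ennreal_mult'[symmetric] ennreal_plus[symmetric] del: ennreal_plus flip: ennreal_numeral)
   also have "... <= en (Q * L * n)"
   proof (rule ennreal_leI)
    have "17 * h * K <= 17 * (2 * L) * K" using L K by (intro mult_right_mono) auto
    also have "... <= 36 * K * L" using K L by (simp add: mult_right_mono)
    finally have "4 * (17 * h * K + 160 * (2 * R + 2) * 32 * R * L) <= Q * L" unfolding Q_def by (simp add: algebra_simps)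
    from mult_right_mono[OF this n(2)]
    show "4 * (8 * h * (K * n) + 8 * h * (K * n) + h * (K * n) + 160 * (2 * R + 2) * ln (1 / h) * n * (32 * R * h)) <= Q * L * n"
     by (simp add: L_def algebra_simps)
   qed
   also have "... = en (Q * L) * N" unfolding n using Q L n by (simp add: ennreal_mult)
   finally show ?thesis .
  qed
  define g where "g = cauchyT (%y. e y * V y)"
  define V's where "V's = (%y. V' (y + ta))"
  have [measurable]: "V's \<in> bmeas" unfolding V's_def by measurable
  define s where "s = en (2 * sqrt (cmod ta))"
  have s2: "s\<^sup>2 <= en (8 * h)" unfolding s_def using sta by (simp add: ennreal_power ennreal_leI)
  have g: "en (cmod (g x)) <= rieszJ 1 D x + s * rieszJ (3/2) V's x + s * rieszJ (3/2) V' x" for x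
  proof (cases "integrable lborel (%y. e y * V y / (x - y))")
   case False
   then show ?thesis by (simp add: g_def cauchyT_def not_integrable_integral_eq)
  next
   case True
   define f where "f = (%y. e y * V y / (x - y))"
   have [measurable]: "f \<in> bmeas" unfolding f_def by measurable
   have i: "integrable lborel f" using True by (simp add: f_def)
   have ish: "integrable lborel (%y. f (y + ta))"
   proof (rule integrableI_bounded)
    have "(II y. en (norm (f (y + ta)))) = (II y. en (norm (f y)))"
     by (rule nn_integral_translate_reflect(3)[where f="%y. en (norm (f y))"]) measurable
    then show "(II y. en (norm (f (y + ta)))) < \<infinity>" using i by (simp add: integrable_iff_bounded)
   qed measurable
   have sh: "(LINT y|lborel. f y) = (LINT y|lborel. f (y + ta))"
    using integral_complex_affine[of f 1 ta] by (simp add: add.commute)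
   \<comment> \<open>The averaging step: translation invariance turns half of the integral into its
     shifted copy, where e has the opposite sign.\<close>
   have "2 * (LINT y|lborel. f y) = (LINT y|lborel. f y + f (y + ta))"
    using i ish sh by simp
   then have "2 * cmod (LINT y|lborel. f y) = cmod (LINT y|lborel. f y + f (y + ta))"
    using norm_mult[of 2 "LINT y|lborel. f y"] by simp
   then have "cmod (LINT y|lborel. f y) <= cmod (LINT y|lborel. f y + f (y + ta))"
    using norm_ge_zero[of "LINT y|lborel. f y"] by linarith
   moreover have "cmod (g x) <= cmod (LINT y|lborel. f y)"
    using divide_left_mono[of 1 pi "cmod (LINT y|lborel. f y)"] pi_ge_two by (simp add: g_def cauchyT_def f_def norm_divide)
   ultimately have "en (cmod (g x)) <= en (cmod (LINT y|lborel. f y + f (y + ta)))"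
    by (intro ennreal_leI) linarith
   also have "... <= (II y. en (cmod (f y + f (y + ta))))"
    using i ish by (intro integral_norm_bound_ennreal) simp
   also have "... <= (II y. D y * en (cmod (x - y) powr (- 1)) + (s * (V's y * en (cmod (x - y) powr (- (3/2)))) + s * (V' (y + ta) * en (cmod (x - (y + ta)) powr (- (3/2))))))"
   proof (rule nn_integral_mono)
    fix y
    have "f y + f (y + ta) = e y * ((V y - V (y + ta)) / (x - y) + V (y + ta) * (1 / (x - y) - 1 / (x - (y + ta))))"
     unfolding f_def e(2) by (simp add: algebra_simps diff_divide_distrib)
    then have "cmod (f y + f (y + ta)) <= 1 * cmod ((V y - V (y + ta)) / (x - y) + V (y + ta) * (1 / (x - y) - 1 / (x - (y + ta))))"
     by (simp only: norm_mult[of "e y"]) (rule mult_right_mono[OF e(1) norm_ge_zero])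
    also have "... <= cmod ((V y - V (y + ta)) / (x - y)) + cmod (V (y + ta)) * cmod (1 / (x - y) - 1 / (x - (y + ta)))"
     using norm_triangle_ineq[of "(V y - V (y + ta)) / (x - y)" "V (y + ta) * (1 / (x - y) - 1 / (x - (y + ta)))"] by (simp add: norm_mult)
    also have "... <= cmod ((V y - V (y + ta)) / (x - y)) + cmod (V (y + ta)) * (2 * sqrt (cmod ta) * (cmod (x - y) powr (- (3/2)) + cmod (x - (y + ta)) powr (- (3/2))))"
     using inverse_diff_le[of "x - y" "x - (y + ta)"] by (intro add_left_mono mult_left_mono) auto
    finally have "en (cmod (f y + f (y + ta))) <= en (cmod ((V y - V (y + ta)) / (x - y)) + cmod (V (y + ta)) * (2 * sqrt (cmod ta) * (cmod (x - y) powr (- (3/2)) + cmod (x - (y + ta)) powr (- (3/2)))))"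
     by (rule ennreal_leI)
    also have "... = en (cmod ((V y - V (y + ta)) / (x - y))) + V's y * (s * (en (cmod (x - y) powr (- (3/2))) + en (cmod (x - (y + ta)) powr (- (3/2)))))"
     unfolding V's_def V'_def s_def by (simp add: ennreal_mult')
    also have "en (cmod ((V y - V (y + ta)) / (x - y))) = D y * en (cmod (x - y) powr (- 1))"
     using cauchy_kernel_norm[of "%y. V y - V (y + ta)" y x] by (simp add: D_def)
    finally show "en (cmod (f y + f (y + ta))) <= D y * en (cmod (x - y) powr (- 1)) + (s * (V's y * en (cmod (x - y) powr (- (3/2)))) + s * (V' (y + ta) * en (cmod (x - (y + ta)) powr (- (3/2)))))"
     by (simp only: V's_def distrib_left mult_ac)
   qed
   also have "... = rieszJ 1 D x + (s * rieszJ (3/2) V's x + s * (II y. V' (y + ta) * en (cmod (x - (y + ta)) powr (- (3/2)))))"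
    unfolding rieszJ_def by (simp add: nn_integral_cmult nn_integral_add)
   also have "(II y. V' (y + ta) * en (cmod (x - (y + ta)) powr (- (3/2)))) = rieszJ (3/2) V' x"
    unfolding rieszJ_def by (rule nn_integral_translate_reflect(3)[where f="%y. V' y * en (cmod (x - y) powr (- (3/2)))"]) measurable
   finally show ?thesis by (simp add: add.assoc)
  qed
  have "wN ep g <= (II x. 4 * (en (jap x powr (- 2 * ep)) * (rieszJ 1 D x)\<^sup>2 + s\<^sup>2 * (en (jap x powr (- 2 * ep)) * (rieszJ (3/2) V's x)\<^sup>2) + s\<^sup>2 * (en (jap x powr (- 2 * ep)) * (rieszJ (3/2) V' x)\<^sup>2)))"
   unfolding wN_def
  proof (rule nn_integral_mono)
   fix x
   have "(en (cmod (g x)))\<^sup>2 <= (rieszJ 1 D x + s * rieszJ (3/2) V's x + s * rieszJ (3/2) V' x)\<^sup>2"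
    by (intro power_mono g) simp
   also note ennreal_sum3_power2
   finally have "en (jap x powr (- 2 * ep)) * (en (cmod (g x)))\<^sup>2 <= en (jap x powr (- 2 * ep)) * (4 * ((rieszJ 1 D x)\<^sup>2 + (s * rieszJ (3/2) V's x)\<^sup>2 + (s * rieszJ (3/2) V' x)\<^sup>2))"
    by (rule mult_left_mono) simp
   also have "... = 4 * (en (jap x powr (- 2 * ep)) * (rieszJ 1 D x)\<^sup>2 + s\<^sup>2 * (en (jap x powr (- 2 * ep)) * (rieszJ (3/2) V's x)\<^sup>2) + s\<^sup>2 * (en (jap x powr (- 2 * ep)) * (rieszJ (3/2) V' x)\<^sup>2))"
    by (simp only: power_mult_distrib distrib_left mult_ac)
   finally show "en (jap x powr (- 2 * ep) * (cmod (g x))\<^sup>2) <= 4 * (en (jap x powr (- 2 * ep)) * (rieszJ 1 D x)\<^sup>2 + s\<^sup>2 * (en (jap x powr (- 2 * ep)) * (rieszJ (3/2) V's x)\<^sup>2) + s\<^sup>2 * (en (jap x powr (- 2 * ep)) * (rieszJ (3/2) V' x)\<^sup>2))"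
    by (simp add: ennreal_mult ennreal_power)
  qed
  also have "... = 4 * ((II x. en (jap x powr (- 2 * ep)) * (rieszJ 1 D x)\<^sup>2) + s\<^sup>2 * (II x. en (jap x powr (- 2 * ep)) * (rieszJ (3/2) V's x)\<^sup>2) + s\<^sup>2 * (II x. en (jap x powr (- 2 * ep)) * (rieszJ (3/2) V' x)\<^sup>2))"
   by (simp add: nn_integral_cmult nn_integral_add)
  also have "... <= 4 * (en C1 * (en (Q * L) * N) + en (8 * h) * (en C2 * (en K * N)) + en (8 * h) * (en C2 * (en K * N)))"
  proof (intro mult_left_mono add_mono mult_mono s2)
   show "(II x. en (jap x powr (- 2 * ep)) * (rieszJ 1 D x)\<^sup>2) <= en C1 * (en (Q * L) * N)"
    by (rule order_trans[OF C1(2) mult_left_mono[OF D2]]) (auto simp: D_def V0 Vs0)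
   show "(II x. en (jap x powr (- 2 * ep)) * (rieszJ (3/2) V's x)\<^sup>2) <= en C2 * (en K * N)"
    using V2s by (intro order_trans[OF C2(2) mult_left_mono]) (auto simp: V's_def V'_def Vs0)
   show "(II x. en (jap x powr (- 2 * ep)) * (rieszJ (3/2) V' x)\<^sup>2) <= en C2 * (en K * N)"
    using V2 by (intro order_trans[OF C2(2) mult_left_mono]) (auto simp: V'_def V0)
  qed auto
  also have "... = en (4 * (C1 * (Q * L) + 8 * h * (C2 * K) + 8 * h * (C2 * K))) * N"
  proof -
   obtain n where n: "N = en n" "n \<ge> 0" using Nfin by (cases N) auto
   show ?thesis
    unfolding n using n(2) C1(1) C2(1) K Q L h
    by (simp add: ennreal_mult'[symmetric] ennreal_plus[symmetric] algebra_simps del: ennreal_plus flip: ennreal_numeral)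
  qed
  also have "... <= en (C * L) * N"
  proof (intro mult_right_mono ennreal_leI)
   have "16 * h * (C2 * K) <= 16 * (2 * L) * (C2 * K)" using L C2(1) K by (intro mult_right_mono) auto
   then show "4 * (C1 * (Q * L) + 8 * h * (C2 * K) + 8 * h * (C2 * K)) <= C * L" unfolding C_def by (simp add: algebra_simps)
  qed simp
  finally show "wN ep (cauchyT (%y. e y * (ind Om y * W y))) <= en (C * (h * ln (1 / h))) * (II w. en ((cmod (F w))\<^sup>2))"
   unfolding g_def V_def L_def N_def .
 qed
qed

section \<open>Green's formula on convex domains\<close>

text \<open>Only a continuously differentiable, positively oriented unit speed parametrisation is
  recorded. Curvature enters later as a hypothesis of single lemmas, so Green's formula does not see
  it, and the setting is preserved by a quarter turn.\<close>

locale convex_curve =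
 fixes Om :: "complex set" and L :: real and ga ga' :: "real => complex"
 assumes opn: "open Om" and bdd: "bounded Om" and ne: "Om ~= {}" and cvx: "convex Om"
  and L: "0 < L" and per: "!!t. ga (t + L) = ga t" and inj: "inj_on ga {0..<L}"
  and rng: "range ga = frontier Om"
  and der: "!!t. (ga has_vector_derivative ga' t) (at t)" and unit: "!!t. cmod (ga' t) = 1"
  and cont': "continuous_on UNIV ga'"
  and inward: "!!t. \<forall>\<^sub>F r in at_right 0. ga t + cr r * (\<i> * ga' t) \<in> Om"
begin

lemma ga_frontier: "ga t \<in> frontier Om" using rng by auto

lemma ga_notin: "ga t \<notin> Om"
 using ga_frontier[of t] opn by (simp add: frontier_def interior_open)

lemma ga_closure: "ga t \<in> closure Om"
 using ga_frontier[of t] by (simp add: frontier_def)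

lemma cont: "continuous_on UNIV ga"
 unfolding continuous_on_eq_continuous_at[OF open_UNIV] using has_vector_derivative_continuous[OF der] by blast

lemma per_int: "ga (t + of_int n * L) = ga t"
proof -
 have nat: "ga (t + of_nat m * L) = ga t" for t m
 proof (induction m)
  case (Suc m)
  have "t + of_nat (Suc m) * L = (t + of_nat m * L) + L" by (simp add: algebra_simps)
  then show ?case using per[of "t + of_nat m * L"] Suc by (simp only:)
 qed simp
 show ?thesis
 proof (cases "0 <= n")
  case True then show ?thesis using nat[of t "nat n"] by simp
 next
  case False
  then show ?thesis using nat[of "t + of_int n * L" "nat (- n)"] by (simp add: algebra_simps)
 qed
qed

lemma frontier_param:
 assumes "w \<in> frontier Om" obtains s where "s \<in> {0..<L}" "ga s = w"
proof -
 obtain t where t: "w = ga t" using assms rng by auto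
 define s where "s = t + of_int (- \<lfloor>t / L\<rfloor>) * L"
 have "ga s = w" unfolding s_def per_int t ..
 moreover have "of_int \<lfloor>t / L\<rfloor> * L <= t" "t < (of_int \<lfloor>t / L\<rfloor> + 1) * L"
  using floor_correct[of "t / L"] L by (simp_all only: pos_le_divide_eq pos_divide_less_eq of_int_add of_int_1)
 then have "s \<in> {0..<L}" by (auto simp: s_def algebra_simps)
 ultimately show ?thesis using that by blast
qed

text \<open>The tangent line is a supporting line.\<close>

lemma support: assumes u: "u \<in> Om" shows "0 < Im ((u - ga t) * cnj (ga' t))"
proof -
 define n where "n = \<i> * ga' t"
 \<comment> \<open>Take any hyperplane separating the boundary point from \<open>Om\<close>. As a .
   ga is minimal at t, the normal a is orthogonal to the tangent, hence a multiple of i ga'; the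
   inward condition fixes its sign, and openness of \<open>Om\<close> makes the inequality
   strict.\<close>
 obtain a b where a: "a ~= 0" "a \<bullet> ga t <= b" "!!x. x \<in> Om ==> b <= a \<bullet> x"
  using separating_hyperplane_sets[of "{ga t}" Om] cvx ne ga_notin by auto
 have cl: "b <= a \<bullet> x" if "x \<in> closure Om" for x
 proof -
  have "closure Om \<subseteq> {x. b <= a \<bullet> x}"
   by (intro closure_minimal closed_halfspace_ge) (use a in auto)
  then show ?thesis using that by auto
 qed
 have d: "((%s. a \<bullet> ga s) has_real_derivative a \<bullet> ga' t) (at t)"
  using bounded_linear.has_vector_derivative[OF bounded_linear_inner_right der, of a t]
  by (simp add: has_real_derivative_iff_has_vector_derivative)
 have "a \<bullet> ga' t = 0"
  by (rule DERIV_local_min[OF d, of 1]) (use cl[OF ga_closure] a in \<open>auto intro: order_trans\<close>)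
 then have ort: "Re a * Re (ga' t) + Im a * Im (ga' t) = 0" by (simp add: inner_complex_def)
 have u2: "(Re (ga' t))\<^sup>2 + (Im (ga' t))\<^sup>2 = 1" using unit[of t] by (simp add: cmod_def)
 define c where "c = a \<bullet> n"
 have c': "c = Im a * Re (ga' t) - Re a * Im (ga' t)" by (simp add: c_def n_def inner_complex_def)
 have an: "a = c *\<^sub>R n"
 proof -
  have "Re a = Re a * ((Re (ga' t))\<^sup>2 + (Im (ga' t))\<^sup>2)" using u2 by simp
  also have "... = Re (ga' t) * (Re a * Re (ga' t) + Im a * Im (ga' t)) - Im (ga' t) * c" by (simp add: c' power2_eq_square algebra_simps)
  finally have 1: "Re a = - (Im (ga' t) * c)" using ort by simp
  have "Im a = Im a * ((Re (ga' t))\<^sup>2 + (Im (ga' t))\<^sup>2)" using u2 by simp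
  also have "... = Im (ga' t) * (Re a * Re (ga' t) + Im a * Im (ga' t)) + Re (ga' t) * c" by (simp add: c' power2_eq_square algebra_simps)
  finally have 2: "Im a = Re (ga' t) * c" using ort by simp
  show ?thesis using 1 2 by (simp add: complex_eq_iff n_def)
 qed
 have cpos: "0 < c"
 proof -
  have "\<forall>\<^sub>F r in at_right (0::real). 0 < r" by (rule eventually_at_right_less)
  with inward[of t] have "\<forall>\<^sub>F r in at_right 0. ga t + cr r * n \<in> Om \<and> 0 < r"
   unfolding n_def by eventually_elim simp
  then obtain r where r: "ga t + cr r * n \<in> Om" "0 < r"
   by (metis (mono_tags, lifting) eventually_happens' trivial_limit_at_right_real)
  have "a \<bullet> (ga t + cr r * n) = a \<bullet> ga t + r * c"
   by (simp add: inner_add_right c_def flip: scaleR_conv_of_real)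
  with a(3)[OF r(1)] a(2) have "0 <= r * c" by linarith
  then have "0 <= c" using r(2) by (simp add: zero_le_mult_iff)
  moreover have "c ~= 0" using a(1) an by auto
  ultimately show ?thesis by simp
 qed
 obtain e where e: "0 < e" "ball u e \<subseteq> Om" using opn u open_contains_ball by blast
 have nn: "n \<bullet> n = 1" "cmod n = 1" using unit[of t] by (simp_all add: n_def dot_square_norm norm_mult)
 have "u - (e / 2) *\<^sub>R n \<in> ball u e" using e nn by (simp add: dist_norm)
 with e have "u - (e / 2) *\<^sub>R n \<in> Om" by blast
 from a(3)[OF this] a(2) have "a \<bullet> ga t <= a \<bullet> u - (e / 2) * c" by (simp add: inner_diff_right c_def)
 moreover have "0 < (e / 2) * c" using cpos e by simp
 ultimately have "0 < a \<bullet> (u - ga t)" unfolding inner_diff_right by linarith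
 also have "a \<bullet> (u - ga t) = c * Im ((u - ga t) * cnj (ga' t))"
  by (subst an) (simp add: n_def inner_complex_def algebra_simps)
 finally show ?thesis using cpos by (simp add: zero_less_mult_iff)
qed

section \<open>Horizontal slices and their end points on the curve\<close>

definition slice :: "real => real set" where "slice y = {x. Complex x y \<in> Om}"
definition heights :: "real set" where "heights = {y. slice y ~= {}}"
definition rt :: "real => real" where "rt y = Sup (slice y)"
definition lf :: "real => real" where "lf y = Inf (slice y)"

lemma slice_bdd: "bdd_above (slice y)" "bdd_below (slice y)"
proof -
 obtain B where B: "!!z. z \<in> Om ==> cmod z <= B" using bdd by (auto simp: bounded_iff)
 have "\<bar>x\<bar> <= B" if "x \<in> slice y" for x
  using B[of "Complex x y"] abs_Re_le_cmod[of "Complex x y"] that by (auto simp: slice_def)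
 then show "bdd_above (slice y)" "bdd_below (slice y)"
  by (meson abs_le_D1 bdd_aboveI) (meson abs_le_D2 bdd_belowI minus_le_iff \<open>!!x. x \<in> slice y ==> \<bar>x\<bar> <= B\<close>)
qed

lemma slice_open: "open (slice y)"
proof -
 have "continuous_on UNIV (%x. Complex x y)" by (auto intro!: continuous_intros)
 from open_vimage[OF opn this] show ?thesis by (simp add: slice_def vimage_def)
qed

lemma slice_between:
 assumes "a \<in> slice y" "b \<in> slice y" "a <= x" "x <= b" shows "x \<in> slice y"
proof (cases "a = b")
 case False
 define u where "u = (x - a) / (b - a)"
 have u: "0 <= u" "u <= 1" using assms False by (auto simp: u_def field_simps)
 have "(1 - u) * a + u * b = a + u * (b - a)" by (simp add: algebra_simps)
 also have "... = x" using False by (simp add: u_def)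
 finally have "x = (1 - u) * a + u * b" by simp
 then have "Complex x y = (1 - u) *\<^sub>R Complex a y + u *\<^sub>R Complex b y"
  by (simp add: complex_eq_iff algebra_simps)
 moreover have "(1 - u) *\<^sub>R Complex a y + u *\<^sub>R Complex b y \<in> Om"
  using assms u by (intro convexD_alt[OF cvx]) (auto simp: slice_def)
 ultimately show ?thesis by (simp add: slice_def)
qed (use assms in auto)

lemma slice_eq: assumes "y \<in> heights" shows "slice y = {lf y<..<rt y}" "lf y < rt y"
proof -
 have n: "slice y ~= {}" using assms by (simp add: heights_def)
 show eq: "slice y = {lf y<..<rt y}"
 proof (intro set_eqI iffI)
  fix x assume x: "x \<in> slice y"
  obtain e where e: "0 < e" "!!x'. dist x' x < e ==> x' \<in> slice y"
   using slice_open x unfolding open_dist by blast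
  have "x + e / 2 \<in> slice y" "x - e / 2 \<in> slice y" using e by (auto simp: dist_norm)
  then have "x + e / 2 <= rt y" "lf y <= x - e / 2"
   unfolding rt_def lf_def using slice_bdd by (auto intro: cSup_upper cInf_lower)
  then show "x \<in> {lf y<..<rt y}" using e by auto
 next
  fix x assume x: "x \<in> {lf y<..<rt y}"
  then have x': "lf y < x" "x < rt y" by auto
  obtain a where a: "a \<in> slice y" "a < x" using x'(1) unfolding lf_def cInf_less_iff[OF n slice_bdd(2)] by blast
  obtain b where b: "b \<in> slice y" "x < b" using x'(2) unfolding rt_def less_cSup_iff[OF n slice_bdd(1)] by blast
  show "x \<in> slice y" using slice_between[OF a(1) b(1)] a b by simp
 qed
 show "lf y < rt y" using n unfolding eq by auto
qed

lemma slice_end_frontier: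
 assumes y: "y \<in> heights" and x: "x = lf y \<or> x = rt y"
 shows "Complex x y \<in> frontier Om"
proof -
 have "x \<in> closure (slice y)"
  using slice_eq[OF y] x by (auto simp: closure_greaterThanLessThan)
 then have "Complex x y \<in> closure Om"
 proof -
  have "continuous_on (closure (slice y)) (%x. Complex x y)" by (auto intro!: continuous_intros)
  then have "(%x. Complex x y) ` closure (slice y) \<subseteq> closure Om"
   by (rule image_closure_subset) (auto simp: slice_def closure_subset[THEN subsetD])
  then show ?thesis using \<open>x \<in> closure (slice y)\<close> by blast
 qed
 moreover have "Complex x y \<notin> Om"
  using slice_eq[OF y] x by (auto simp: slice_def set_eq_iff)
 ultimately show ?thesis using opn by (simp add: frontier_def interior_open)
qed

text \<open>Where the tangent is not horizontal the curve crosses its height strictly, so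
  \<open>Om\<close> has points below and above it; the segment joining two such points meets the
  height inside \<open>Om\<close>.\<close>

lemma height_of_nonhorizontal:
 assumes "Im (ga' s) ~= 0" shows "Im (ga s) \<in> heights"
proof -
 define y where "y = Im (ga s)"
 have d: "((%t. Im (ga t)) has_real_derivative Im (ga' s)) (at s)"
  using bounded_linear.has_vector_derivative[OF bounded_linear_Im der, of s]
  by (simp add: has_real_derivative_iff_has_vector_derivative)
 have "\<exists>t1 t2. Im (ga t1) < y \<and> y < Im (ga t2)"
 proof (cases "Im (ga' s) > 0")
  case True
  obtain e1 where "0 < e1" "!!h. 0 < h ==> h < e1 ==> Im (ga s) < Im (ga (s + h))" using DERIV_pos_inc_right[OF d True] by blast
  moreover obtain e2 where "0 < e2" "!!h. 0 < h ==> h < e2 ==> Im (ga (s - h)) < Im (ga s)" using DERIV_pos_inc_left[OF d True] by blast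
  ultimately show ?thesis unfolding y_def by (intro exI[of _ "s - e2 / 2"] exI[of _ "s + e1 / 2"]) auto
 next
  case False
  then have neg: "Im (ga' s) < 0" using assms by simp
  obtain e1 where "0 < e1" "!!h. 0 < h ==> h < e1 ==> Im (ga s) > Im (ga (s + h))" using DERIV_neg_dec_right[OF d neg] by blast
  moreover obtain e2 where "0 < e2" "!!h. 0 < h ==> h < e2 ==> Im (ga (s - h)) > Im (ga s)" using DERIV_neg_dec_left[OF d neg] by blast
  ultimately show ?thesis unfolding y_def by (intro exI[of _ "s + e1 / 2"] exI[of _ "s - e2 / 2"]) auto
 qed
 then obtain t1 t2 where t: "Im (ga t1) < y" "y < Im (ga t2)" by blast
 have "open {z. Im z < y}" "open {z. y < Im z}" by (simp_all add: open_halfspace_Im_lt open_halfspace_Im_gt)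
 then obtain u v where uv: "u \<in> Om" "Im u < y" "v \<in> Om" "y < Im v"
  using t ga_closure[of t1] ga_closure[of t2] open_Int_closure_eq_empty[of "{z. Im z < y}" Om] open_Int_closure_eq_empty[of "{z. y < Im z}" Om]
  by blast
 define a where "a = (y - Im u) / (Im v - Im u)"
 have a: "0 <= a" "a <= 1" using uv by (auto simp: a_def field_simps)
 have z: "(1 - a) *\<^sub>R u + a *\<^sub>R v \<in> Om" using uv a by (intro convexD_alt[OF cvx]) auto
 have "Im ((1 - a) *\<^sub>R u + a *\<^sub>R v) = Im u + a * (Im v - Im u)" by (simp add: algebra_simps)
 also have "... = y" using uv by (simp add: a_def)
 finally have "Re ((1 - a) *\<^sub>R u + a *\<^sub>R v) \<in> slice y" using z unfolding slice_def by (metis complex_surj mem_Collect_eq)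
 then show ?thesis by (auto simp: heights_def y_def)
qed

text \<open>The support inequality for a point at the same height as ga s, where only the product of
  the horizontal offset and the vertical velocity survives.\<close>

lemma slice_side:
 assumes "x \<in> slice (Im (ga s))" shows "0 < (Re (ga s) - x) * Im (ga' s)"
 using support[of "Complex x (Im (ga s))" s] assms by (simp add: slice_def algebra_simps)

text \<open>Positive orientation in concrete form: rising parts of the curve bound the slices on the
  right, falling parts on the left. The open segment from an interior point to ga s stays inside
  \<open>Om\<close>, so ga s really is an end point of its slice.\<close>

lemma param_end:
 assumes "Im (ga' s) ~= 0"
 shows "Re (ga s) = (if Im (ga' s) > 0 then rt (Im (ga s)) else lf (Im (ga s)))"
proof -
 define y where "y = Im (ga s)"
 have y: "y \<in> heights" unfolding y_def by (rule height_of_nonhorizontal[OF assms])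
 obtain x0 where x0: "x0 \<in> slice y" using y by (auto simp: heights_def)
 have w: "ga s = Complex (Re (ga s)) y" by (simp add: y_def)
 have seg: "x \<in> slice y" if "x0 <= x \<and> x < Re (ga s) \<or> Re (ga s) < x \<and> x <= x0" for x
 proof (cases "x = x0")
  case False
  define u where "u = (x - x0) / (Re (ga s) - x0)"
  have u: "0 < u" "u < 1" using that False by (auto simp: u_def field_simps)
  have ne: "Re (ga s) - x0 ~= 0" using that by auto
  have "x = (1 - u) * x0 + u * Re (ga s)"
  proof -
   have "(1 - u) * x0 + u * Re (ga s) = x0 + u * (Re (ga s) - x0)" by (simp add: algebra_simps)
   also have "... = x" using ne by (simp add: u_def)
   finally show ?thesis by simp
  qed
  then have "Complex x y = (1 - u) *\<^sub>R Complex x0 y + u *\<^sub>R ga s"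
   by (subst w) (simp add: complex_eq_iff algebra_simps)
  moreover have "Complex x0 y ~= ga s" using ne by (auto simp: complex_eq_iff)
  ultimately have "Complex x y \<in> open_segment (Complex x0 y) (ga s)"
   unfolding in_segment using u by blast
  moreover have "open_segment (Complex x0 y) (ga s) \<subseteq> interior Om"
   using x0 ga_closure[of s] opn by (intro in_interior_closure_convex_segment[OF cvx]) (auto simp: interior_open slice_def)
  ultimately show ?thesis using opn by (auto simp: interior_open slice_def)
 qed (use x0 in auto)
 have side: "0 < (Re (ga s) - x) * Im (ga' s)" if "x \<in> slice y" for x
  using slice_side[of x s] that by (simp add: y_def)
 show ?thesis
 proof (cases "Im (ga' s) > 0")
  case True
  have lt: "x < Re (ga s)" if "x \<in> slice y" for x using side[OF that] True by (simp add: zero_less_mult_iff)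
  have "rt y <= Re (ga s)" unfolding rt_def using x0 lt by (intro cSup_least) (auto intro: less_imp_le)
  moreover have "\<not> rt y < Re (ga s)"
  proof
   assume "rt y < Re (ga s)"
   have "max (rt y) x0 \<in> slice y" using seg[of "max (rt y) x0"] lt[OF x0] \<open>rt y < Re (ga s)\<close> by auto
   then show False using slice_eq[OF y] by auto
  qed
  ultimately show ?thesis using True by (simp add: y_def)
 next
  case False
  then have neg: "Im (ga' s) < 0" using assms by simp
  have gt: "Re (ga s) < x" if "x \<in> slice y" for x using side[OF that] neg by (simp add: zero_less_mult_iff)
  have "Re (ga s) <= lf y" unfolding lf_def using x0 gt by (intro cInf_greatest) (auto intro: less_imp_le)
  moreover have "\<not> Re (ga s) < lf y"
  proof
   assume "Re (ga s) < lf y"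
   have "min (lf y) x0 \<in> slice y" using seg[of "min (lf y) x0"] gt[OF x0] \<open>Re (ga s) < lf y\<close> by auto
   then show False using slice_eq[OF y] by auto
  qed
  ultimately show ?thesis using False by (simp add: y_def)
 qed
qed

definition Splus :: "real set" where "Splus = {s \<in> {0..<L}. 0 < Im (ga' s)}"
definition Sminus :: "real set" where "Sminus = {s \<in> {0..<L}. Im (ga' s) < 0}"

text \<open>An end point of a slice is a frontier point and hence on the curve;
  \<open>slice_side\<close> then forces the sign of the vertical velocity there, so no slice ends at
  a horizontal tangent.\<close>

lemma image_heights: "(%s. Im (ga s)) ` Splus = heights" "(%s. Im (ga s)) ` Sminus = heights"
proof -
 show "(%s. Im (ga s)) ` Splus = heights"
 proof
  show "(%s. Im (ga s)) ` Splus \<subseteq> heights" by (auto simp: Splus_def intro: height_of_nonhorizontal)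
  show "heights \<subseteq> (%s. Im (ga s)) ` Splus"
  proof
   fix y assume y: "y \<in> heights"
   obtain s where s: "s \<in> {0..<L}" "ga s = Complex (rt y) y"
    using frontier_param[OF slice_end_frontier[OF y]] by blast
   obtain x0 where "x0 \<in> slice y" using y by (auto simp: heights_def)
   moreover have "x0 < rt y" using \<open>x0 \<in> slice y\<close> slice_eq[OF y] by auto
   ultimately have "0 < Im (ga' s)" using slice_side[of x0 s] s by (simp add: zero_less_mult_iff)
   then show "y \<in> (%s. Im (ga s)) ` Splus" using s by (force simp: Splus_def)
  qed
 qed
 show "(%s. Im (ga s)) ` Sminus = heights"
 proof
  show "(%s. Im (ga s)) ` Sminus \<subseteq> heights" by (auto simp: Sminus_def intro: height_of_nonhorizontal)
  show "heights \<subseteq> (%s. Im (ga s)) ` Sminus"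
  proof
   fix y assume y: "y \<in> heights"
   obtain s where s: "s \<in> {0..<L}" "ga s = Complex (lf y) y"
    using frontier_param[OF slice_end_frontier[OF y]] by blast
   obtain x0 where "x0 \<in> slice y" using y by (auto simp: heights_def)
   moreover have "lf y < x0" using \<open>x0 \<in> slice y\<close> slice_eq[OF y] by auto
   ultimately have "Im (ga' s) < 0" using slice_side[of x0 s] s by (simp add: zero_less_mult_iff)
   then show "y \<in> (%s. Im (ga s)) ` Sminus" using s by (force simp: Sminus_def)
  qed
 qed
qed

lemma inj_heights: "inj_on (%s. Im (ga s)) Splus" "inj_on (%s. Im (ga s)) Sminus"
proof -
 have "s = t" if "s \<in> {0..<L}" "t \<in> {0..<L}" "Im (ga s) = Im (ga t)" "Re (ga s) = Re (ga t)" for s t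
  using inj that by (auto simp: inj_on_def complex_eq_iff)
 then show "inj_on (%s. Im (ga s)) Splus" "inj_on (%s. Im (ga s)) Sminus"
  using param_end by (auto simp: inj_on_def Splus_def Sminus_def)
qed

text \<open>The substitution y = Im (ga s) is made separately on rising and falling parameters;
  horizontal tangents contribute 0 to the left side. The minus sign is that of Im ga' on the falling
  part. Integrability of the right sides is a result of the substitution, so nothing about the
  regularity of \<open>rt\<close> and \<open>lf\<close> has to be shown.\<close>

lemma boundary_change_of_variables:
 fixes f :: "complex => complex"
 assumes f: "continuous_on UNIV f"
 shows "(%y. f (Complex (rt y) y)) absolutely_integrable_on heights"
  "(%y. f (Complex (lf y) y)) absolutely_integrable_on heights"
  "integral {0..L} (%s. Im (ga' s) *\<^sub>R f (ga s))
   = integral heights (%y. f (Complex (rt y) y)) - integral heights (%y. f (Complex (lf y) y))"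
proof -
 define G where "G = (%s. Im (ga' s) *\<^sub>R f (ga s))"
 have cG: "continuous_on UNIV G"
  unfolding G_def by (intro continuous_intros cont' continuous_on_compose2[OF f cont]) auto
 have cIm: "continuous_on UNIV (%s. Im (ga' s))" by (intro continuous_intros cont')
 have S: "Splus \<in> sets lebesgue" "Sminus \<in> sets lebesgue"
 proof -
  have [measurable]: "(%s. Im (ga' s)) \<in> bmeas" by (rule borel_measurable_continuous_onI[OF cIm])
  have "Splus \<in> sets borel" "Sminus \<in> sets borel" unfolding Splus_def Sminus_def by measurable
  then show "Splus \<in> sets lebesgue" "Sminus \<in> sets lebesgue" by auto
 qed
 have aiG: "G absolutely_integrable_on {0..L}"
  by (intro absolutely_integrable_continuous_real continuous_on_subset[OF cG]) auto
 have sub: "Splus \<subseteq> {0..L}" "Sminus \<subseteq> {0..L}" by (auto simp: Splus_def Sminus_def)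
 have aiS: "G absolutely_integrable_on Splus" "G absolutely_integrable_on Sminus"
  using set_integrable_subset[OF aiG] S sub by auto
 have d: "((%s. Im (ga s)) has_field_derivative Im (ga' s)) (at s within T)" for s T
  using bounded_linear.has_vector_derivative[OF bounded_linear_Im der, of s]
  by (rule has_field_derivative_at_within[OF iffD2[OF has_real_derivative_iff_has_vector_derivative]])
 have p: "\<bar>Im (ga' s)\<bar> *\<^sub>R f (Complex (rt (Im (ga s))) (Im (ga s))) = G s" if "s \<in> Splus" for s
 proof -
  have "Complex (rt (Im (ga s))) (Im (ga s)) = ga s"
   using param_end[of s] that by (simp add: Splus_def complex_eq_iff)
  then show ?thesis using that by (simp add: G_def Splus_def)
 qed
 have m: "\<bar>Im (ga' s)\<bar> *\<^sub>R f (Complex (lf (Im (ga s))) (Im (ga s))) = - G s" if "s \<in> Sminus" for s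
 proof -
  have "Complex (lf (Im (ga s))) (Im (ga s)) = ga s"
   using param_end[of s] that by (simp add: Sminus_def complex_eq_iff)
  then show ?thesis using that by (simp add: G_def Sminus_def)
 qed
 have aip: "(%s. \<bar>Im (ga' s)\<bar> *\<^sub>R f (Complex (rt (Im (ga s))) (Im (ga s)))) absolutely_integrable_on Splus"
  using aiS(1) p by (subst set_integrable_cong[OF refl refl, where f'=G]) auto
 have aim: "(%s. \<bar>Im (ga' s)\<bar> *\<^sub>R f (Complex (lf (Im (ga s))) (Im (ga s)))) absolutely_integrable_on Sminus"
  using aiS(2) m by (subst set_integrable_cong[OF refl refl, where f'="%s. - G s"]) (auto simp: set_integrable_def)
 show ar: "(%y. f (Complex (rt y) y)) absolutely_integrable_on heights"
  using absolutely_integrable_change_of_variables_real[OF S(1) d inj_heights(1), of "%y. f (Complex (rt y) y)"] aip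
  by (simp add: image_heights)
 show al: "(%y. f (Complex (lf y) y)) absolutely_integrable_on heights"
  using absolutely_integrable_change_of_variables_real[OF S(2) d inj_heights(2), of "%y. f (Complex (lf y) y)"] aim
  by (simp add: image_heights)
 have ir: "integral Splus G = integral heights (%y. f (Complex (rt y) y))"
 proof -
  have "integral Splus G = integral Splus (%s. \<bar>Im (ga' s)\<bar> *\<^sub>R f (Complex (rt (Im (ga s))) (Im (ga s))))"
   by (intro Henstock_Kurzweil_Integration.integral_cong p[symmetric])
  also have "... = integral heights (%y. f (Complex (rt y) y))"
   using has_absolute_integral_change_of_variables_real[OF S(1) d inj_heights(1), of "%y. f (Complex (rt y) y)"] aip ar
   by (simp add: image_heights)
  finally show ?thesis .
 qed
 have il: "- integral Sminus G = integral heights (%y. f (Complex (lf y) y))"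
 proof -
  have "- integral Sminus G = integral Sminus (%s. - G s)" by simp
  also have "... = integral Sminus (%s. \<bar>Im (ga' s)\<bar> *\<^sub>R f (Complex (lf (Im (ga s))) (Im (ga s))))"
   by (intro Henstock_Kurzweil_Integration.integral_cong m[symmetric])
  also have "... = integral heights (%y. f (Complex (lf y) y))"
   using has_absolute_integral_change_of_variables_real[OF S(2) d inj_heights(2), of "%y. f (Complex (lf y) y)"] aim al
   by (simp add: image_heights)
  finally show ?thesis .
 qed
 have io: "(%s. if s \<in> Splus then G s else 0) integrable_on {0..L}" "(%s. if s \<in> Sminus then G s else 0) integrable_on {0..L}"
  using aiS[THEN set_lebesgue_integral_eq_integral(1)] sub by (simp_all add: integrable_restrict_Int Int_absorb2)
 have "integral {0..L} G = integral {0..L} (%s. (if s \<in> Splus then G s else 0) + (if s \<in> Sminus then G s else 0))"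
  by (rule integral_spike[of "{L}"]) (auto simp: Splus_def Sminus_def G_def)
 also have "... = integral {0..L} (%s. if s \<in> Splus then G s else 0) + integral {0..L} (%s. if s \<in> Sminus then G s else 0)"
  by (rule Henstock_Kurzweil_Integration.integral_add[OF io])
 also have "... = integral Splus G + integral Sminus G"
  using sub by (simp add: integral_restrict_Int Int_absorb2)
 finally show "integral {0..L} (%s. Im (ga' s) *\<^sub>R f (ga s))
   = integral heights (%y. f (Complex (rt y) y)) - integral heights (%y. f (Complex (lf y) y))"
  unfolding ir[symmetric] il[symmetric] G_def[symmetric] by simp
qed

text \<open>The fundamental theorem of calculus on each slice leaves the values at its two ends, and
  the preceding substitution collects them into a curve integral.\<close>

lemma green_x:
 fixes f fx :: "complex => complex"
 assumes f: "continuous_on UNIV f" and fx: "continuous_on UNIV fx"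
  and d: "!!x y. ((%x. f (Complex x y)) has_vector_derivative fx (Complex x y)) (at x)"
 shows "(LINT w|lborel. ind Om w * fx w) = integral {0..L} (%s. Im (ga' s) *\<^sub>R f (ga s))"
proof -
 have [measurable]: "Om \<in> sets borel" using opn by simp
 have [measurable]: "fx \<in> bmeas" by (rule borel_measurable_continuous_onI[OF fx])
 have int: "integrable lborel (%w. ind Om w * fx w)"
 proof -
  have c: "compact (closure Om)" using bdd by (simp add: compact_closure)
  have "bounded (fx ` closure Om)"
   using compact_continuous_image[OF continuous_on_subset[OF fx] c] by (auto intro: compact_imp_bounded)
  then obtain B where B: "!!w. w \<in> closure Om ==> cmod (fx w) <= B" by (auto simp: bounded_iff)
  have "emeasure lborel Om < \<infinity>" using emeasure_bounded_finite[OF bdd] by simp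
  then have i1: "integrable lborel (%w. ind Om w * B)" by (intro integrable_mult_left integrable_real_indicator) auto
  show ?thesis
  proof (rule Bochner_Integration.integrable_bound[OF i1])
   show "AE w in lborel. norm (ind Om w * fx w) <= norm (indicat_real Om w * B)"
   proof (rule AE_I2)
    fix w
    have "cmod (fx w) <= \<bar>B\<bar>" if "w \<in> Om" using B[of w] closure_subset[of Om] that by force
    then show "norm (ind Om w * fx w) <= norm (indicat_real Om w * B)"
     by (cases "w \<in> Om") auto
   qed
  qed measurable
 qed
 have inner: "(LINT x|lborel. ind Om (Complex x y) * fx (Complex x y)) = (if y \<in> heights then f (Complex (rt y) y) - f (Complex (lf y) y) else 0)" for y
 proof (cases "y \<in> heights")
  case True
  note sl = slice_eq[OF True]
  have "(LINT x|lborel. ind Om (Complex x y) * fx (Complex x y)) = (LINT x|lborel. ind {lf y..rt y} x *\<^sub>R fx (Complex x y))"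
  proof (rule integral_cong_AE)
   have "continuous_on UNIV (%x. fx (Complex x y))"
    by (rule continuous_on_compose2[OF fx]) (auto intro!: continuous_intros)
   note [measurable] = borel_measurable_continuous_onI[OF this]
   show "(%x. indicat_real {lf y..rt y} x *\<^sub>R fx (Complex x y)) \<in> borel_measurable lborel" by simp
   show "(%x. ind Om (Complex x y) * fx (Complex x y)) \<in> borel_measurable lborel" by measurable
   show "AE x in lborel. ind Om (Complex x y) * fx (Complex x y) = indicat_real {lf y..rt y} x *\<^sub>R fx (Complex x y)"
    using AE_lborel_ne[of "lf y"] AE_lborel_ne[of "rt y"]
   proof eventually_elim
    case (elim x)
    have "Complex x y \<in> Om \<longleftrightarrow> x \<in> {lf y<..<rt y}" using sl(1) by (auto simp: slice_def)
    then show ?case using elim by (auto simp: indicator_def)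
   qed
  qed
  also have "... = f (Complex (rt y) y) - f (Complex (lf y) y)"
   using sl(2) d
   by (intro integral_FTC_Icc) (auto intro: has_vector_derivative_at_within intro!: continuous_on_compose2[OF fx] continuous_intros)
  finally show ?thesis using True by simp
 next
  case False
  then have "Complex x y \<notin> Om" for x by (auto simp: heights_def slice_def)
  then show ?thesis using False by simp
 qed
 note bc = boundary_change_of_variables[OF f]
 have "(LINT w|lborel. ind Om w * fx w) = (LINT y|lborel. LINT x|lborel. ind Om (Complex x y) * fx (Complex x y))"
  by (rule lborel_integral_complex(1)[OF int])
 also have "... = integral UNIV (%y. LINT x|lborel. ind Om (Complex x y) * fx (Complex x y))"
  using lborel_integral_complex(4)[OF int] by (rule integral_lborel[symmetric])
 also have "... = integral heights (%y. f (Complex (rt y) y) - f (Complex (lf y) y))"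
  unfolding inner by (rule integral_restrict_UNIV)
 also have "... = integral heights (%y. f (Complex (rt y) y)) - integral heights (%y. f (Complex (lf y) y))"
  using bc(1,2)[THEN set_lebesgue_integral_eq_integral(1)] by (rule Henstock_Kurzweil_Integration.integral_diff)
 also note bc(3)[symmetric]
 finally show ?thesis .
qed

text \<open>The purpose is \<open>green_y\<close>: after a quarter turn, vertical slices become
  horizontal ones and \<open>green_x\<close> applies, so vertical slices need no treatment of their
  own.\<close>

lemma rotated: "convex_curve ((*) \<i> ` Om) L (%s. \<i> * ga s) (%s. \<i> * ga' s)"
proof
 have lin: "linear ((*) \<i>)" "inj ((*) \<i>)" by (auto simp: linear_iff algebra_simps inj_on_def)
 have im: "(*) \<i> ` A = (%z. - \<i> * z) -` A" for A :: "complex set"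
  by (auto simp: image_iff) (metis complex_i_mult_minus mult_minus_left minus_minus)
 show "open ((*) \<i> ` Om)" unfolding im by (intro open_vimage opn continuous_intros)
 show "bounded ((*) \<i> ` Om)" using bdd lin(1) by (simp add: bounded_linear_image linear_conv_bounded_linear)
 show "(*) \<i> ` Om ~= {}" using ne by simp
 show "convex ((*) \<i> ` Om)" using convex_linear_image[OF lin(1) cvx] .
 show "0 < L" by (rule L)
 show "\<i> * ga (t + L) = \<i> * ga t" for t by (simp add: per)
 show "inj_on (%s. \<i> * ga s) {0..<L}" using inj by (auto simp: inj_on_def)
 have "range (%s. \<i> * ga s) = (*) \<i> ` frontier Om" by (simp add: rng[symmetric] image_image)
 also have "... = frontier ((*) \<i> ` Om)"
  unfolding frontier_def image_set_diff[OF lin(2)]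
  by (simp add: closure_injective_linear_image[OF lin] interior_injective_linear_image[OF lin])
 finally show "range (%s. \<i> * ga s) = frontier ((*) \<i> ` Om)" .
 show "((%s. \<i> * ga s) has_vector_derivative \<i> * ga' t) (at t)" for t
  by (rule has_vector_derivative_mult_right[OF der])
 show "cmod (\<i> * ga' t) = 1" for t by (simp add: norm_mult unit)
 show "continuous_on UNIV (%s. \<i> * ga' s)" by (intro continuous_intros cont')
 show "\<forall>\<^sub>F r in at_right 0. \<i> * ga t + cr r * (\<i> * (\<i> * ga' t)) \<in> (*) \<i> ` Om" for t
  using inward[of t]
 proof eventually_elim
  case (elim r)
  have "\<i> * ga t + cr r * (\<i> * (\<i> * ga' t)) = \<i> * (ga t + cr r * (\<i> * ga' t))"
   by (simp add: algebra_simps)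
  with elim show ?case by blast
 qed
qed

lemma green_y:
 fixes f fy :: "complex => complex"
 assumes f: "continuous_on UNIV f" and fy: "continuous_on UNIV fy"
  and d: "!!x y. ((%y. f (Complex x y)) has_vector_derivative fy (Complex x y)) (at y)"
 shows "(LINT w|lborel. ind Om w * fy w) = - integral {0..L} (%s. Re (ga' s) *\<^sub>R f (ga s))"
proof -
 interpret R: convex_curve "(*) \<i> ` Om" L "%s. \<i> * ga s" "%s. \<i> * ga' s" by (rule rotated)
 have e: "- (\<i> * Complex x y) = Complex y (- x)" for x y by (simp add: complex_eq_iff)
 have dd: "((%x. f (- (\<i> * Complex x y))) has_vector_derivative - fy (- (\<i> * Complex x y))) (at x)" for x y
 proof -
  have "((%y'. f (Complex y y')) \<circ> uminus has_vector_derivative (- 1) *\<^sub>R fy (Complex y (- x))) (at x)"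
   by (rule vector_diff_chain_at) (auto intro!: derivative_eq_intros d)
  then show ?thesis by (simp add: e o_def)
 qed
 have cf: "continuous_on UNIV (%w. f (- (\<i> * w)))" "continuous_on UNIV (%w. - fy (- (\<i> * w)))"
  by (auto intro!: continuous_intros continuous_on_compose2[OF f] continuous_on_compose2[OF fy])
 have [measurable]: "(*) \<i> ` Om \<in> sets borel" using R.opn by simp
 have [measurable]: "fy \<in> bmeas" by (rule borel_measurable_continuous_onI[OF fy])
 have "(LINT w|lborel. ind ((*) \<i> ` Om) w * - fy (- (\<i> * w))) = integral {0..L} (%s. Im (\<i> * ga' s) *\<^sub>R f (- (\<i> * (\<i> * ga s))))"
  by (rule R.green_x[OF cf dd])
 also have "(LINT w|lborel. ind ((*) \<i> ` Om) w * - fy (- (\<i> * w))) = (LINT w|lborel. ind ((*) \<i> ` Om) (\<i> * w) * - fy (- (\<i> * (\<i> * w))))"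
  by (rule integral_complex_mult_ii(1)[symmetric]) measurable
 also have "... = (LINT w|lborel. - (ind Om w * fy w))"
 proof (rule Bochner_Integration.integral_cong[OF refl])
  fix w
  have "\<i> * w \<in> (*) \<i> ` Om \<longleftrightarrow> w \<in> Om" by auto
  then show "ind ((*) \<i> ` Om) (\<i> * w) * - fy (- (\<i> * (\<i> * w))) = - (ind Om w * fy w)"
   by (simp add: indicator_def flip: mult.assoc)
 qed
 also have "... = - (LINT w|lborel. ind Om w * fy w)" by simp
 finally show ?thesis by (simp flip: mult.assoc) (metis minus_minus)
qed

lemma green_bar:
 assumes f: "C_k (Suc 0) f"
 shows "(LINT w|lborel. ind Om w * wirtinger_bar f w) = - (\<i> / 2) * integral {0..L} (%s. f (ga s) * ga' s)"
proof -
 have D: "(f has_derivative frechet_derivative f (at z)) (at z)" for z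
  using C_k_differentiable[OF f] by (simp add: frechet_derivative_works)
 have c: "continuous_on UNIV f" "continuous_on UNIV (partial_x f)" "continuous_on UNIV (partial_y f)"
  using f C_k_Suc_imp[OF f] by simp_all
 have dx: "((%x. f (Complex x y)) has_vector_derivative partial_x f (Complex x y)) (at x)" for x y
 proof -
  have "((%x. Complex x y) has_vector_derivative 1) (at x)"
   unfolding has_vector_derivative_complex_iff by (auto intro!: derivative_eq_intros)
  from vector_derivative_diff_chain_within[OF this D[THEN has_derivative_at_withinI]]
  show ?thesis by (simp add: o_def partial_x_def)
 qed
 have dy: "((%y. f (Complex x y)) has_vector_derivative partial_y f (Complex x y)) (at y)" for x y
 proof -
  have "((%y. Complex x y) has_vector_derivative \<i>) (at y)"
   unfolding has_vector_derivative_complex_iff by (auto intro!: derivative_eq_intros)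
  from vector_derivative_diff_chain_within[OF this D[THEN has_derivative_at_withinI]]
  show ?thesis by (simp add: o_def partial_y_def)
 qed
 note gx = green_x[OF c(1,2) dx] and gy = green_y[OF c(1,3) dy]
 have int: "integrable lborel (%w. ind Om w * g w)" if g: "continuous_on UNIV g" for g :: "complex => complex"
 proof -
  have "compact (closure Om)" using bdd by (simp add: compact_closure)
  then have "set_integrable lborel (closure Om) g"
   unfolding set_integrable_def by (rule borel_integrable_compact) (rule continuous_on_subset[OF g], simp)
  then have "set_integrable lborel Om g"
   using opn closure_subset by (elim set_integrable_subset) auto
  then show ?thesis by (simp add: set_integrable_def scaleR_conv_of_real of_real_indicator)
 qed
 have "(LINT w|lborel. ind Om w * wirtinger_bar f w) = (LINT w|lborel. (ind Om w * partial_x f w) / 2 + (\<i> / 2) * (ind Om w * partial_y f w))"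
  by (simp add: wirtinger_bar_def algebra_simps add_divide_distrib)
 also have "... = (LINT w|lborel. ind Om w * partial_x f w) / 2 + (\<i> / 2) * (LINT w|lborel. ind Om w * partial_y f w)"
  using int[OF c(2)] int[OF c(3)] by simp
 also have "... = integral {0..L} (%s. Im (ga' s) *\<^sub>R f (ga s)) / 2 - (\<i> / 2) * integral {0..L} (%s. Re (ga' s) *\<^sub>R f (ga s))"
  unfolding gx gy by simp
 also have "... = - (\<i> / 2) * (integral {0..L} (%s. Re (ga' s) *\<^sub>R f (ga s)) + \<i> * integral {0..L} (%s. Im (ga' s) *\<^sub>R f (ga s)))"
  by (simp add: algebra_simps)
 also have "integral {0..L} (%s. Re (ga' s) *\<^sub>R f (ga s)) + \<i> * integral {0..L} (%s. Im (ga' s) *\<^sub>R f (ga s)) = integral {0..L} (%s. f (ga s) * ga' s)"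
 proof -
  have cc: "continuous_on {0..L} ga'" "continuous_on {0..L} (%s. f (ga s))"
   by (rule continuous_on_subset[OF cont'], simp) (rule continuous_on_compose2[OF c(1) continuous_on_subset[OF cont]], auto)
  have i1: "(%s. Re (ga' s) *\<^sub>R f (ga s)) integrable_on {0..L}" "(%s. \<i> * (Im (ga' s) *\<^sub>R f (ga s))) integrable_on {0..L}"
   by (intro integrable_continuous_interval continuous_intros cc)+
  have "integral {0..L} (%s. f (ga s) * ga' s) = integral {0..L} (%s. Re (ga' s) *\<^sub>R f (ga s) + \<i> * (Im (ga' s) *\<^sub>R f (ga s)))"
  proof (rule Henstock_Kurzweil_Integration.integral_cong)
   fix s
   have "f (ga s) * ga' s = f (ga s) * (cr (Re (ga' s)) + \<i> * cr (Im (ga' s)))"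
    by (simp flip: complex_eq)
   then show "f (ga s) * ga' s = Re (ga' s) *\<^sub>R f (ga s) + \<i> * (Im (ga' s) *\<^sub>R f (ga s))"
    by (simp add: scaleR_conv_of_real algebra_simps)
  qed
  also have "... = integral {0..L} (%s. Re (ga' s) *\<^sub>R f (ga s)) + integral {0..L} (%s. \<i> * (Im (ga' s) *\<^sub>R f (ga s)))"
   by (rule Henstock_Kurzweil_Integration.integral_add[OF i1])
  finally show ?thesis by (simp only: Henstock_Kurzweil_Integration.integral_mult_right)
 qed
 finally show ?thesis .
qed

end

section \<open>Oscillatory Cauchy integrals over the boundary\<close>

text \<open>Minkowski's integral inequality in L2: the square of the integral over s is a double
  integral over s and t, and Cauchy-Schwarz in x bounds each inner product. The norm bound is
  required only where the density \<open>fi\<close> does not vanish.\<close>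

lemma nn_integral_Minkowski:
 fixes K :: "real => real => ennreal" and fi N :: "real => ennreal"
 assumes [measurable]: "case_prod K \<in> borel_measurable (borel \<Otimes>\<^sub>M borel)" "fi \<in> bmeas" "N \<in> bmeas"
  and N: "AE s in lborel. fi s ~= 0 --> (II x. (K x s)\<^sup>2) <= (N s)\<^sup>2"
 shows "(II x. (II s. fi s * K x s)\<^sup>2) <= (II s. fi s * N s)\<^sup>2"
proof -
 have [measurable]: "(%s. K x s) \<in> bmeas" "(%x. K x s) \<in> bmeas" for x s
  by measurable
 have sq: "(II s. F s)\<^sup>2 = (II s. II t. F s * F t)"
  if [measurable]: "F \<in> bmeas" for F :: "real => ennreal"
  by (simp add: power2_eq_square nn_integral_cmult nn_integral_multc)
 have "(II x. (II s. fi s * K x s)\<^sup>2) = (II x. II s. II t. (fi s * K x s) * (fi t * K x t))"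
  by (subst sq) auto
 also have "... = (II s. II x. II t. (fi s * K x s) * (fi t * K x t))"
  by (rule lborel_pair.Fubini') measurable
 also have "... = (II s. II t. II x. (fi s * K x s) * (fi t * K x t))"
  by (rule nn_integral_cong, rule lborel_pair.Fubini') measurable
 also have "... <= (II s. II t. (fi s * N s) * (fi t * N t))"
 proof (rule nn_integral_mono_AE, use N in eventually_elim)
  fix s assume s: "fi s ~= 0 --> (II x. (K x s)\<^sup>2) <= (N s)\<^sup>2"
  show "(II t. II x. (fi s * K x s) * (fi t * K x t)) <= (II t. (fi s * N s) * (fi t * N t))"
  proof (rule nn_integral_mono_AE, use N in eventually_elim)
   fix t assume t: "fi t ~= 0 --> (II x. (K x t)\<^sup>2) <= (N t)\<^sup>2"
   show "(II x. (fi s * K x s) * (fi t * K x t)) <= (fi s * N s) * (fi t * N t)"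
   proof (cases "fi s = 0 \<or> fi t = 0")
    case False
    have "(II x. K x s * K x t)\<^sup>2 <= (II x. (K x s)\<^sup>2) * (II x. (K x t)\<^sup>2)"
     by (rule nn_integral_Cauchy_Schwarz) auto
    also have "... <= (N s)\<^sup>2 * (N t)\<^sup>2" using s t False by (intro mult_mono) auto
    also have "... = (N s * N t)\<^sup>2" by (simp add: power_mult_distrib)
    finally have "(II x. K x s * K x t) <= N s * N t" by (rule ennreal_power2_le_imp_le)
    then have "fi s * fi t * (II x. K x s * K x t) <= fi s * fi t * (N s * N t)" by (rule mult_left_mono) simp
    moreover have "(II x. (fi s * K x s) * (fi t * K x t)) = fi s * fi t * (II x. K x s * K x t)"
     by (subst nn_integral_cmult[symmetric]) (auto simp: mult_ac)
    ultimately show ?thesis by (simp add: mult_ac)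
   qed auto
  qed
 qed
 also have "... = (II s. fi s * N s)\<^sup>2" by (subst sq) auto
 finally show ?thesis .
qed

lemma norm_integral_le_nn_integral:
 fixes F :: "real => complex"
 assumes F: "continuous_on {aa..be} F"
 shows "en (cmod (integral {aa..be} F)) <= (II s. en (cmod (F s)) * ind {aa..be} s)"
proof -
 have si: "set_integrable lborel {aa..be} F"
  unfolding set_integrable_def by (rule borel_integrable_compact) (use F in auto)
 have "integral {aa..be} F = (LINT s:{aa..be}|lborel. F s)"
  using set_borel_integral_eq_integral(2)[OF si] by simp
 also have "en (cmod ...) <= (II s. en (cmod (ind {aa..be} s *\<^sub>R F s)))"
  unfolding set_lebesgue_integral_def using si unfolding set_integrable_def by (rule integral_norm_bound_ennreal)
 also have "... = (II s. en (cmod (F s)) * ind {aa..be} s)"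
  by (intro nn_integral_cong) (auto simp: indicator_def)
 finally show ?thesis .
qed

text \<open>Write 1 = (1 - f1 q) + f1 q. The factor f1 exp (i f / h) is - i h times a derivative, so
  the second part is integrated by parts and gains h; the first part is the price for letting
  \<open>q\<close> differ from 1 / f1. The choice of \<open>q\<close> is left open: it should
  resemble 1 / f1 away from critical points and vanish where the kernel is singular.\<close>

lemma oscillatory_cauchy_by_parts:
 fixes ga ga' ga'' :: "real => complex" and f f1 q q1 :: "real => real"
 assumes ab: "aa <= be" and h: "h > 0"
  and ga: "!!s. s \<in> {aa..be} ==> (ga has_vector_derivative ga' s) (at s)"
  and ga': "!!s. s \<in> {aa..be} ==> (ga' has_vector_derivative ga'' s) (at s)"
  and ga'': "continuous_on {aa..be} ga''" "!!s. s \<in> {aa..be} ==> cmod (ga'' s) <= ka"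
  and unit: "!!s. s \<in> {aa..be} ==> cmod (ga' s) = 1"
  and f: "!!s. s \<in> {aa..be} ==> (f has_real_derivative f1 s) (at s)" "continuous_on {aa..be} f1"
  and q: "!!s. s \<in> {aa..be} ==> (q has_real_derivative q1 s) (at s)" "continuous_on {aa..be} q1"
  and z: "!!s. s \<in> {aa..be} ==> ga s ~= z"
 shows "en (cmod (integral {aa..be} (%s. exp (\<i> * cr (f s / h)) * (ga' s / (z - ga s)))))
  <= (II s. en ((\<bar>1 - f1 s * q s\<bar> + h * ka * \<bar>q s\<bar> + h * \<bar>q1 s\<bar>) * (1 / cmod (z - ga s))) * ind {aa..be} s)
   + (II s. en (h * \<bar>q s\<bar> * (1 / (cmod (z - ga s))\<^sup>2)) * ind {aa..be} s)
   + en (h * \<bar>q aa\<bar> * (1 / cmod (z - ga aa))) + en (h * \<bar>q be\<bar> * (1 / cmod (z - ga be)))"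
proof -
 define e where "e = (%s. exp (\<i> * cr (f s / h)))"
 define A where "A = (%s. ga' s / (z - ga s))"
 define A' where "A' = (%s. ga'' s / (z - ga s) + (ga' s / (z - ga s))\<^sup>2)"
 define P where "P = (%s. e s * (A s * cr (q s)))"
 define B' where "B' = (%s. A' s * cr (q s) + A s * cr (q1 s))"
 have ne: "z - ga s ~= 0" if "s \<in> {aa..be}" for s using z[OF that] by auto
 have norme: "cmod (e s) = 1" for s by (simp add: e_def)
 have de: "(e has_vector_derivative \<i> * cr (f1 s / h) * e s) (at s)" if "s \<in> {aa..be}" for s
 proof -
  have "((%s. \<i> * cr (f s / h)) has_vector_derivative \<i> * cr (f1 s / h)) (at s)"
   using f(1)[OF that] by (intro has_vector_derivative_mult_right has_vector_derivative_of_real DERIV_cdivide) (simp add: has_real_derivative_iff_has_vector_derivative[symmetric] DERIV_cdivide)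
  from field_vector_diff_chain_at[OF this DERIV_exp] show ?thesis
   by (simp add: e_def o_def mult_ac)
 qed
 have dA: "(A has_vector_derivative A' s) (at s)" if s: "s \<in> {aa..be}" for s
 proof -
  have "((%s. z - ga s) has_vector_derivative - ga' s) (at s)"
   using has_vector_derivative_diff[OF has_vector_derivative_const ga[OF s], of z] by simp
  then have "((%s. inverse (z - ga s)) has_vector_derivative - (inverse (z - ga s))\<^sup>2 * - ga' s) (at s)"
   using field_vector_diff_chain_at[of "%s. z - ga s" "- ga' s" s inverse "- (inverse (z - ga s))\<^sup>2"] DERIV_inverse[OF ne[OF s]]
   by (simp add: o_def mult_ac numeral_2_eq_2)
  from has_vector_derivative_mult[OF ga'[OF s] this]
  show ?thesis by (simp add: A_def A'_def divide_inverse power2_eq_square algebra_simps)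
 qed
 have dP: "(P has_vector_derivative \<i> * cr (f1 s / h) * P s + e s * B' s) (at s)" if s: "s \<in> {aa..be}" for s
 proof -
  have "((%s. cr (q s)) has_vector_derivative cr (q1 s)) (at s)"
   using q(1)[OF s] by (intro has_vector_derivative_of_real) (simp add: has_real_derivative_iff_has_vector_derivative[symmetric])
  from has_vector_derivative_mult[OF de[OF s] has_vector_derivative_mult[OF dA[OF s] this]]
  show ?thesis by (simp add: P_def B'_def algebra_simps)
 qed
 have cga: "continuous_on {aa..be} ga" "continuous_on {aa..be} ga'" "continuous_on {aa..be} q" "continuous_on {aa..be} e"
  using has_vector_derivative_continuous[OF ga] has_vector_derivative_continuous[OF ga']
   DERIV_isCont[OF q(1)] has_vector_derivative_continuous[OF de]
  by (blast intro: continuous_at_imp_continuous_on)+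
 have cA: "continuous_on {aa..be} A" "continuous_on {aa..be} A'"
  unfolding A_def A'_def using ne by (intro continuous_intros cga ga''; simp)+
 have cB: "continuous_on {aa..be} B'" unfolding B'_def by (intro continuous_intros cA cga q)
 have cP: "continuous_on {aa..be} P" unfolding P_def by (intro continuous_intros cA cga)
 have ftc: "((%s. \<i> * cr (f1 s / h) * P s + e s * B' s) has_integral (P be - P aa)) {aa..be}"
  by (rule fundamental_theorem_of_calculus[OF ab]) (use dP has_vector_derivative_at_within in blast)
 \<comment> \<open>The integrand minus the exact derivative: e A = R - i h P' with P = e A q, so
   only \<open>R\<close> and the two end values of \<open>P\<close> have to be estimated.\<close>
 define R where "R = (%s. e s * A s * cr (1 - f1 s * q s) + \<i> * cr h * (e s * B' s))"
 have cR: "continuous_on {aa..be} R" unfolding R_def by (intro continuous_intros cA cB cga f(2))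
 have split: "e s * A s = R s - \<i> * cr h * (\<i> * cr (f1 s / h) * P s + e s * B' s)" for s
  using h by (simp add: R_def P_def algebra_simps)
 have "integral {aa..be} (%s. e s * A s) = integral {aa..be} R - \<i> * cr h * (P be - P aa)"
  unfolding split
  by (rule integral_unique, intro has_integral_diff has_integral_mult_right ftc integrable_integral integrable_continuous_interval cR)
 then have "cmod (integral {aa..be} (%s. e s * A s)) <= cmod (integral {aa..be} R) + cmod (\<i> * cr h * (P be - P aa))"
  by (simp add: norm_triangle_ineq4)
 also have "cmod (\<i> * cr h * (P be - P aa)) <= h * (cmod (P aa) + cmod (P be))"
  using h norm_triangle_ineq4[of "P be" "P aa"] by (simp add: norm_mult)
 finally have 1: "cmod (integral {aa..be} (%s. e s * A s)) <= cmod (integral {aa..be} R) + (h * cmod (P aa) + h * cmod (P be))"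
  by (simp add: distrib_left)
 have nA: "cmod (A s) = 1 / cmod (z - ga s)" "cmod (P s) = \<bar>q s\<bar> * (1 / cmod (z - ga s))" if "s \<in> {aa..be}" for s
  using unit[OF that] norme by (simp_all add: P_def A_def norm_divide norm_mult)
 have rearr: "m * a + h * ((ka * m + n) * b + m * c) = (a + h * ka * b + h * c) * m + h * b * n" for m a n b c :: real
  by algebra
 have nR: "cmod (R s) <= (\<bar>1 - f1 s * q s\<bar> + h * ka * \<bar>q s\<bar> + h * \<bar>q1 s\<bar>) * (1 / cmod (z - ga s)) + h * \<bar>q s\<bar> * (1 / (cmod (z - ga s))\<^sup>2)" if s: "s \<in> {aa..be}" for s
 proof -
  have nA': "cmod (A' s) <= ka * (1 / cmod (z - ga s)) + 1 / (cmod (z - ga s))\<^sup>2"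
  proof -
   have "cmod (A' s) <= cmod (ga'' s) / cmod (z - ga s) + (cmod (ga' s) / cmod (z - ga s))\<^sup>2"
    unfolding A'_def by (rule order_trans[OF norm_triangle_ineq]) (simp add: norm_divide norm_power power_divide)
   also have "... <= ka / cmod (z - ga s) + (1 / cmod (z - ga s))\<^sup>2"
    using ga''(2)[OF s] unit[OF s] by (intro add_mono divide_right_mono) auto
   finally show ?thesis by (simp add: power_divide)
  qed
  have "cmod (R s) <= cmod (A s) * \<bar>1 - f1 s * q s\<bar> + h * cmod (B' s)"
  proof -
   have "cmod (R s) <= cmod (e s * A s * cr (1 - f1 s * q s)) + cmod (\<i> * cr h * (e s * B' s))"
    unfolding R_def by (rule norm_triangle_ineq)
   then show ?thesis using h by (simp only: norm_mult norme norm_of_real norm_ii mult_1_left abs_of_pos)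
  qed
  also have "cmod (B' s) <= cmod (A' s) * \<bar>q s\<bar> + cmod (A s) * \<bar>q1 s\<bar>"
   unfolding B'_def by (rule order_trans[OF norm_triangle_ineq]) (simp add: norm_mult)
  also have "... <= (ka * (1 / cmod (z - ga s)) + 1 / (cmod (z - ga s))\<^sup>2) * \<bar>q s\<bar> + 1 / cmod (z - ga s) * \<bar>q1 s\<bar>"
   using nA' nA[OF s] by (intro add_mono mult_right_mono) auto
  finally have "cmod (R s) <= (1 / cmod (z - ga s)) * \<bar>1 - f1 s * q s\<bar> + h * ((ka * (1 / cmod (z - ga s)) + 1 / (cmod (z - ga s))\<^sup>2) * \<bar>q s\<bar> + 1 / cmod (z - ga s) * \<bar>q1 s\<bar>)"
   using h nA[OF s] by (simp add: mult_left_mono)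
  also have "... = (\<bar>1 - f1 s * q s\<bar> + h * ka * \<bar>q s\<bar> + h * \<bar>q1 s\<bar>) * (1 / cmod (z - ga s)) + h * \<bar>q s\<bar> * (1 / (cmod (z - ga s))\<^sup>2)"
   by (rule rearr)
  finally show ?thesis .
 qed
 have ka0: "0 <= ka"
  by (rule order_trans[OF norm_ge_zero ga''(2)[of aa]]) (use ab in simp)
 have "en (cmod (integral {aa..be} R)) <= (II s. en (cmod (R s)) * ind {aa..be} s)"
  by (rule norm_integral_le_nn_integral[OF cR])
 also have "... <= (II s. en ((\<bar>1 - f1 s * q s\<bar> + h * ka * \<bar>q s\<bar> + h * \<bar>q1 s\<bar>) * (1 / cmod (z - ga s))) * ind {aa..be} s
    + en (h * \<bar>q s\<bar> * (1 / (cmod (z - ga s))\<^sup>2)) * ind {aa..be} s)"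
 proof (rule nn_integral_mono)
  fix s
  show "en (cmod (R s)) * ind {aa..be} s <= en ((\<bar>1 - f1 s * q s\<bar> + h * ka * \<bar>q s\<bar> + h * \<bar>q1 s\<bar>) * (1 / cmod (z - ga s))) * ind {aa..be} s
    + en (h * \<bar>q s\<bar> * (1 / (cmod (z - ga s))\<^sup>2)) * ind {aa..be} s"
  proof (cases "s \<in> {aa..be}")
   case True
   have "0 <= (\<bar>1 - f1 s * q s\<bar> + h * ka * \<bar>q s\<bar> + h * \<bar>q1 s\<bar>) * (1 / cmod (z - ga s))" "0 <= h * \<bar>q s\<bar> * (1 / (cmod (z - ga s))\<^sup>2)"
    using h ka0 by auto
   then show ?thesis using True ennreal_leI[OF nR[OF True]] by (simp only: ennreal_plus indicator_simps mult_1_right)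
  qed simp
 qed
 also have "... = (II s. en ((\<bar>1 - f1 s * q s\<bar> + h * ka * \<bar>q s\<bar> + h * \<bar>q1 s\<bar>) * (1 / cmod (z - ga s))) * ind {aa..be} s)
   + (II s. en (h * \<bar>q s\<bar> * (1 / (cmod (z - ga s))\<^sup>2)) * ind {aa..be} s)"
 proof (rule nn_integral_add)
  have m: "(%s. en (F s) * ind {aa..be} s) \<in> borel_measurable lborel" if "continuous_on {aa..be} F" for F :: "real => real"
  proof -
   have "(%s. ind {aa..be} s *\<^sub>R F s) \<in> bmeas"
    using that by (intro borel_measurable_continuous_on_indicator) auto
   then have "(%s. en (ind {aa..be} s *\<^sub>R F s)) \<in> borel_measurable lborel" by simp
   moreover have "en (ind {aa..be} s *\<^sub>R F s) = en (F s) * ind {aa..be} s" for s by (simp add: indicator_def)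
   ultimately show ?thesis by simp
  qed
  show "(%s. en ((\<bar>1 - f1 s * q s\<bar> + h * ka * \<bar>q s\<bar> + h * \<bar>q1 s\<bar>) * (1 / cmod (z - ga s))) * ind {aa..be} s) \<in> borel_measurable lborel"
   using ne by (intro m continuous_intros cga f(2) q(2)) auto
  show "(%s. en (h * \<bar>q s\<bar> * (1 / (cmod (z - ga s))\<^sup>2)) * ind {aa..be} s) \<in> borel_measurable lborel"
   using ne by (intro m continuous_intros cga f(2) q(2)) auto
 qed
 finally have 2: "en (cmod (integral {aa..be} R)) <= (II s. en ((\<bar>1 - f1 s * q s\<bar> + h * ka * \<bar>q s\<bar> + h * \<bar>q1 s\<bar>) * (1 / cmod (z - ga s))) * ind {aa..be} s)
   + (II s. en (h * \<bar>q s\<bar> * (1 / (cmod (z - ga s))\<^sup>2)) * ind {aa..be} s)" .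
 have "en (cmod (integral {aa..be} (%s. e s * A s))) <= en (cmod (integral {aa..be} R)) + (en (h * cmod (P aa)) + en (h * cmod (P be)))"
  using ennreal_leI[OF 1] h by simp
 also have "... <= ((II s. en ((\<bar>1 - f1 s * q s\<bar> + h * ka * \<bar>q s\<bar> + h * \<bar>q1 s\<bar>) * (1 / cmod (z - ga s))) * ind {aa..be} s)
   + (II s. en (h * \<bar>q s\<bar> * (1 / (cmod (z - ga s))\<^sup>2)) * ind {aa..be} s)) + (en (h * cmod (P aa)) + en (h * cmod (P be)))"
  by (rule add_right_mono[OF 2])
 finally have fin: "en (cmod (integral {aa..be} (%s. e s * A s))) <= ((II s. en ((\<bar>1 - f1 s * q s\<bar> + h * ka * \<bar>q s\<bar> + h * \<bar>q1 s\<bar>) * (1 / cmod (z - ga s))) * ind {aa..be} s)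
   + (II s. en (h * \<bar>q s\<bar> * (1 / (cmod (z - ga s))\<^sup>2)) * ind {aa..be} s)) + (en (h * cmod (P aa)) + en (h * cmod (P be)))" .
 have Paa: "h * cmod (P aa) = h * \<bar>q aa\<bar> * (1 / cmod (z - ga aa))" using ab by (subst nA(2)) auto
 have Pbe: "h * cmod (P be) = h * \<bar>q be\<bar> * (1 / cmod (z - ga be))" using ab by (subst nA(2)) auto
 show ?thesis
  using fin unfolding Paa Pbe unfolding e_def A_def add.assoc .
qed

section \<open>One-dimensional integrals behind the estimates on horizontal lines\<close>

lemma nn_integral_real_translate:
 fixes F :: "real => ennreal"
 assumes [measurable]: "F \<in> bmeas"
 shows "(II v. F (v - y)) = (II v. F v)"
 using nn_integral_real_affine[of F 1 "- y"] by simp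

text \<open>The loss from cutting off at the singularity: |v - y|^(-1/2) is, up to a constant, the
  norm of the Cauchy kernel along the line at height y, and the other factor is 1 minus the cutoff
  at scale rh. The integral is split at |v - y| = rh.\<close>

lemma kernel_integral_1:
 assumes rh: "0 < rh"
 shows "(II v. en (\<bar>v - y\<bar> powr (-1/2) * (rh\<^sup>2 / ((v - y)\<^sup>2 + rh\<^sup>2)))) <= en (6 * sqrt rh)"
proof -
 have pw: "rh powr (1 - 1/2) = sqrt rh" using rh by (simp add: powr_half_sqrt)
 have "(II v. en (\<bar>v - y\<bar> powr (-1/2) * (rh\<^sup>2 / ((v - y)\<^sup>2 + rh\<^sup>2)))) = (II v. en (\<bar>v\<bar> powr (-1/2) * (rh\<^sup>2 / (v\<^sup>2 + rh\<^sup>2))))"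
  by (rule nn_integral_real_translate[where F="%v. en (\<bar>v\<bar> powr (-1/2) * (rh\<^sup>2 / (v\<^sup>2 + rh\<^sup>2)))"]) measurable
 also have "... <= (II v. en (\<bar>v\<bar> powr (- (1/2))) * ind {-rh..rh} v + en (rh\<^sup>2) * (en (\<bar>v\<bar> powr (- (5/2))) * ind {v. rh <= \<bar>v\<bar>} v))"
 proof (rule nn_integral_mono)
  fix v :: real
  show "en (\<bar>v\<bar> powr (-1/2) * (rh\<^sup>2 / (v\<^sup>2 + rh\<^sup>2))) <= en (\<bar>v\<bar> powr (- (1/2))) * ind {-rh..rh} v + en (rh\<^sup>2) * (en (\<bar>v\<bar> powr (- (5/2))) * ind {v. rh <= \<bar>v\<bar>} v)"
  proof (cases "\<bar>v\<bar> <= rh")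
   case True
   have "rh\<^sup>2 / (v\<^sup>2 + rh\<^sup>2) <= 1" using rh by (simp add: divide_le_eq_1 add_nonneg_pos)
   then have "\<bar>v\<bar> powr (-1/2) * (rh\<^sup>2 / (v\<^sup>2 + rh\<^sup>2)) <= \<bar>v\<bar> powr (-1/2) * 1" by (intro mult_left_mono) auto
   then have "en (\<bar>v\<bar> powr (-1/2) * (rh\<^sup>2 / (v\<^sup>2 + rh\<^sup>2))) <= en (\<bar>v\<bar> powr (- (1/2)))" by (intro ennreal_leI) simp
   moreover have "v \<in> {-rh..rh}" using True by auto
   ultimately show ?thesis by (simp add: add_increasing2)
  next
   case False
   then have v: "0 < \<bar>v\<bar>" "rh <= \<bar>v\<bar>" using rh by auto
   have "rh\<^sup>2 / (v\<^sup>2 + rh\<^sup>2) <= rh\<^sup>2 / v\<^sup>2" using v rh by (intro divide_left_mono) (auto simp: zero_less_mult_iff add_pos_nonneg)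
   then have "\<bar>v\<bar> powr (-1/2) * (rh\<^sup>2 / (v\<^sup>2 + rh\<^sup>2)) <= \<bar>v\<bar> powr (-1/2) * (rh\<^sup>2 / v\<^sup>2)" by (intro mult_left_mono) auto
   also have "... = rh\<^sup>2 * (\<bar>v\<bar> powr (-1/2) * \<bar>v\<bar> powr (-2))" using v by (simp add: powr_minus_divide powr_numeral)
   also have "\<bar>v\<bar> powr (-1/2) * \<bar>v\<bar> powr (-2) = \<bar>v\<bar> powr (- (5/2))" by (simp flip: powr_add)
   finally have "en (\<bar>v\<bar> powr (-1/2) * (rh\<^sup>2 / (v\<^sup>2 + rh\<^sup>2))) <= en (rh\<^sup>2) * en (\<bar>v\<bar> powr (- (5/2)))"
    by (simp add: ennreal_mult'[symmetric] ennreal_leI)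
   then show ?thesis using v by (simp add: add_increasing)
  qed
 qed
 also have "... = en (2 * rh powr (1 - 1/2) / (1 - 1/2)) + en (rh\<^sup>2) * en (2 * rh powr (1 - 5/2) / (5/2 - 1))"
  using rh by (subst nn_integral_add) (auto simp: nn_integral_cmult nn_integral_abs_powr nn_integral_abs_powr_tail simp del: powr_minus)
 also have "... = en (4 * sqrt rh + rh\<^sup>2 * (4/3 * rh powr (1 - 5/2)))"
  unfolding pw using rh by (simp add: ennreal_mult'[symmetric] ennreal_plus[symmetric] del: ennreal_plus)
 also have "rh\<^sup>2 * (4/3 * rh powr (1 - 5/2)) = 4/3 * (rh powr 2 * rh powr (1 - 5/2))" using rh by (simp add: powr_numeral)
 also have "rh powr 2 * rh powr (1 - 5/2) = rh powr (2 + (1 - 5/2))" by (rule powr_add[symmetric])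
 also have "... = sqrt rh" using rh by (simp add: powr_half_sqrt)
 also have "en (4 * sqrt rh + 4/3 * sqrt rh) <= en (6 * sqrt rh)" using rh by (intro ennreal_leI) simp
 finally show ?thesis .
qed

lemma kernel_integral_2:
 assumes rh: "0 < rh"
 shows "(II v. en (\<bar>v - y\<bar> powr (1/2) / ((v - y)\<^sup>2 + rh\<^sup>2))) <= en (6 / sqrt rh)"
proof -
 have pw: "rh powr (-1/2) = 1 / sqrt rh" using rh by (simp add: powr_minus_divide powr_half_sqrt)
 have "(II v. en (\<bar>v - y\<bar> powr (1/2) / ((v - y)\<^sup>2 + rh\<^sup>2))) = (II v. en (\<bar>v\<bar> powr (1/2) / (v\<^sup>2 + rh\<^sup>2)))"
  by (rule nn_integral_real_translate[where F="%v. en (\<bar>v\<bar> powr (1/2) / (v\<^sup>2 + rh\<^sup>2))"]) measurable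
 also have "... <= (II v. en (rh powr (1/2) / rh\<^sup>2) * ind {-rh..rh} v + en (\<bar>v\<bar> powr (- (3/2))) * ind {v. rh <= \<bar>v\<bar>} v)"
 proof (rule nn_integral_mono)
  fix v :: real
  show "en (\<bar>v\<bar> powr (1/2) / (v\<^sup>2 + rh\<^sup>2)) <= en (rh powr (1/2) / rh\<^sup>2) * ind {-rh..rh} v + en (\<bar>v\<bar> powr (- (3/2))) * ind {v. rh <= \<bar>v\<bar>} v"
  proof (cases "\<bar>v\<bar> <= rh")
   case True
   have "\<bar>v\<bar> powr (1/2) / (v\<^sup>2 + rh\<^sup>2) <= rh powr (1/2) / rh\<^sup>2"
    using True rh by (intro frac_le powr_mono2) auto
   moreover have "v \<in> {-rh..rh}" using True by auto
   ultimately show ?thesis by (simp add: add_increasing2 ennreal_leI)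
  next
   case False
   then have v: "0 < \<bar>v\<bar>" "rh <= \<bar>v\<bar>" using rh by auto
   have "\<bar>v\<bar> powr (1/2) / (v\<^sup>2 + rh\<^sup>2) <= \<bar>v\<bar> powr (1/2) / v\<^sup>2" using v rh by (intro divide_left_mono) (auto simp: zero_less_mult_iff add_pos_nonneg)
   also have "... = \<bar>v\<bar> powr (1/2) * \<bar>v\<bar> powr (-2)" using v by (simp add: powr_minus_divide powr_numeral)
   also have "... = \<bar>v\<bar> powr (- (3/2))" by (simp flip: powr_add)
   finally show ?thesis using v by (simp add: add_increasing ennreal_leI)
  qed
 qed
 also have "... = en (rh powr (1/2) / rh\<^sup>2) * en (2 * rh) + en (2 * rh powr (1 - 3/2) / (3/2 - 1))"
  using rh by (subst nn_integral_add) (auto simp: nn_integral_cmult_indicator nn_integral_abs_powr_tail simp del: powr_minus)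
 also have "... = en (2 * (rh powr (1/2) / rh\<^sup>2 * rh) + 4 * rh powr (-1/2))"
  using rh by (simp add: ennreal_mult'[symmetric] ennreal_plus[symmetric] mult_ac del: ennreal_plus)
 also have "rh powr (1/2) / rh\<^sup>2 * rh = rh powr (-1/2)"
 proof -
  have "rh powr (1/2) * rh powr (-1) = rh powr (1/2 + (-1))" by (rule powr_add[symmetric])
  moreover have "rh powr (-1) = 1 / rh" using rh by (simp add: powr_minus_divide)
  moreover have "rh powr (1/2) / rh\<^sup>2 * rh = rh powr (1/2) * (1 / rh)"
   using rh by (simp add: power2_eq_square)
  ultimately show ?thesis by simp
 qed
 finally show ?thesis using pw by simp
qed

text \<open>The loss from regularising at the critical point. The singularity y of the kernel and
  the critical height y0 are separated at scale H. For |v - y| > H/4 the kernel is at most 2 / sqrt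
  H and the Lorentzian has integral pi / sqrt h (times h); for |v - y| <= H/4 the Lorentzian is at
  most 2 h / H^2.\<close>

lemma kernel_integral_3:
 assumes h: "0 < h" and H: "H = max \<bar>y - y0\<bar> (sqrt h)"
 shows "(II v. en (\<bar>v - y\<bar> powr (-1/2) * (h / ((v - y0)\<^sup>2 + h)))) <= en (12 * sqrt (h / H))"
proof -
 have Hpos: "0 < H" "sqrt h <= H" "h <= H\<^sup>2" using h unfolding H by (auto simp: less_max_iff_disj max_def intro: real_le_rsqrt sqrt_le_D)
 have pos: "0 < (v - y0)\<^sup>2 + h" for v using h by (simp add: add_nonneg_pos)
 have "(II v. en (\<bar>v - y\<bar> powr (-1/2) * (h / ((v - y0)\<^sup>2 + h))))
  <= (II v. en (2 / sqrt H * h) * en (1 / ((v - y0)\<^sup>2 + (sqrt h)\<^sup>2)) + en (2 * h / H\<^sup>2) * (en (\<bar>v - y\<bar> powr (- (1/2))) * ind {-(H/4)..H/4} (v - y)))"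
 proof (rule nn_integral_mono)
  fix v
  show "en (\<bar>v - y\<bar> powr (-1/2) * (h / ((v - y0)\<^sup>2 + h))) <= en (2 / sqrt H * h) * en (1 / ((v - y0)\<^sup>2 + (sqrt h)\<^sup>2)) + en (2 * h / H\<^sup>2) * (en (\<bar>v - y\<bar> powr (- (1/2))) * ind {-(H/4)..H/4} (v - y))"
  proof (cases "\<bar>v - y\<bar> <= H / 4")
   case False
   have "\<bar>v - y\<bar> powr (-1/2) <= (H / 4) powr (-1/2)" using False Hpos by (intro powr_mono2') auto
   also have "... = 2 / sqrt H" using Hpos by (simp add: powr_minus_divide powr_half_sqrt real_sqrt_divide)
   finally have "\<bar>v - y\<bar> powr (-1/2) * (h / ((v - y0)\<^sup>2 + h)) <= 2 / sqrt H * (h / ((v - y0)\<^sup>2 + h))"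
    using pos h by (intro mult_right_mono) (auto intro: less_imp_le)
   also have "... = 2 / sqrt H * h * (1 / ((v - y0)\<^sup>2 + (sqrt h)\<^sup>2))" using h by simp
   finally have "en (\<bar>v - y\<bar> powr (-1/2) * (h / ((v - y0)\<^sup>2 + h))) <= en (2 / sqrt H * h) * en (1 / ((v - y0)\<^sup>2 + (sqrt h)\<^sup>2))"
    using Hpos h by (subst ennreal_mult'[symmetric]) (auto intro!: ennreal_leI)
   then show ?thesis by (rule order_trans) simp
  next
   case True
   have "h / ((v - y0)\<^sup>2 + h) <= 2 * h / H\<^sup>2"
   proof -
    have "H\<^sup>2 <= 2 * ((v - y0)\<^sup>2 + h)"
    proof (cases "H = sqrt h")
     case True then show ?thesis using h by simp
    next
     case False
     then have "H = \<bar>y - y0\<bar>" using H by (auto simp: max_def split: if_splits)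
     then have "3/4 * H <= \<bar>v - y0\<bar>" using True by linarith
     then have "(3/4 * H)\<^sup>2 <= \<bar>v - y0\<bar>\<^sup>2" using Hpos by (intro power_mono) auto
     then have "9/16 * H\<^sup>2 <= (v - y0)\<^sup>2" by (simp add: power_mult_distrib power_divide)
     then show ?thesis unfolding distrib_left using h zero_le_power2[of H] by linarith
    qed
    from mult_left_mono[OF this, of h] show ?thesis using pos[of v] Hpos h by (simp add: pos_divide_le_eq pos_le_divide_eq mult_ac)
   qed
   then have "\<bar>v - y\<bar> powr (-1/2) * (h / ((v - y0)\<^sup>2 + h)) <= \<bar>v - y\<bar> powr (-1/2) * (2 * h / H\<^sup>2)" by (intro mult_left_mono) auto
   also have "... = 2 * h / H\<^sup>2 * \<bar>v - y\<bar> powr (- (1/2))" by simp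
   finally have "en (\<bar>v - y\<bar> powr (-1/2) * (h / ((v - y0)\<^sup>2 + h))) <= en (2 * h / H\<^sup>2) * en (\<bar>v - y\<bar> powr (- (1/2)))"
    using h by (subst ennreal_mult'[symmetric]) (auto intro!: ennreal_leI)
   moreover have "v - y \<in> {-(H/4)..H/4}" using abs_le_D1[OF True] abs_le_D2[OF True] by simp
   ultimately show ?thesis by (simp add: add_increasing)
  qed
 qed
 also have "... = en (2 / sqrt H * h) * (II v. en (1 / ((v - y0)\<^sup>2 + (sqrt h)\<^sup>2))) + en (2 * h / H\<^sup>2) * (II v. en (\<bar>v - y\<bar> powr (- (1/2))) * ind {-(H/4)..H/4} (v - y))"
  by (subst nn_integral_add) (auto simp: nn_integral_cmult)
 also have "(II v. en (1 / ((v - y0)\<^sup>2 + (sqrt h)\<^sup>2))) = (II v. en (1 / (v\<^sup>2 + (sqrt h)\<^sup>2)))"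
  by (rule nn_integral_real_translate[where F="%v. en (1 / (v\<^sup>2 + (sqrt h)\<^sup>2))"]) measurable
 also have "... = en (pi / sqrt h)" using h by (intro nn_integral_inverse_square_plus) simp
 also have "(II v. en (\<bar>v - y\<bar> powr (- (1/2))) * ind {-(H/4)..H/4} (v - y)) = (II v. en (\<bar>v\<bar> powr (- (1/2))) * ind {-(H/4)..H/4} v)"
  by (rule nn_integral_real_translate[where F="%v. en (\<bar>v\<bar> powr (- (1/2))) * ind {-(H/4)..H/4} v"]) measurable
 also have "... = en (2 * (H/4) powr (1 - 1/2) / (1 - 1/2))" using Hpos by (intro nn_integral_abs_powr) auto
 also have "2 * (H/4) powr (1 - 1/2) / (1 - 1/2) = 2 * sqrt H" using Hpos by (simp add: powr_half_sqrt real_sqrt_divide)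
 also have "en (2 / sqrt H * h) * en (pi / sqrt h) + en (2 * h / H\<^sup>2) * en (2 * sqrt H) = en (2 / sqrt H * h * (pi / sqrt h) + 2 * h / H\<^sup>2 * (2 * sqrt H))"
  using h Hpos by (simp add: ennreal_mult'[symmetric] ennreal_plus[symmetric] del: ennreal_plus)
 also have "... <= en (12 * sqrt (h / H))"
 proof (rule ennreal_leI)
  have s: "sqrt (h / H) = sqrt h / sqrt H" by (rule real_sqrt_divide)
  have 1: "2 / sqrt H * h * (pi / sqrt h) = 2 * pi * (sqrt h / sqrt H)"
  proof -
   have "2 / b * (a * a) * (pi / a) = 2 * pi * (a / b)" if "a > 0" for a b :: real using that by simp
   from this[of "sqrt h" "sqrt H"] show ?thesis using h by simp
  qed
  have 2: "2 * h / H\<^sup>2 * (2 * sqrt H) <= 4 * (sqrt h / sqrt H)"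
  proof -
   have "2 * (a * a) / (b * b)\<^sup>2 * (2 * b) = 4 * (a / b) * (a / (b * b))" if "b > 0" for a b :: real
    using that by (simp add: power2_eq_square)
   from this[of "sqrt H" "sqrt h"] have "2 * h / H\<^sup>2 * (2 * sqrt H) = 4 * (sqrt h / sqrt H) * (sqrt h / H)" using h Hpos by simp
   also have "... <= 4 * (sqrt h / sqrt H) * 1" using Hpos h by (intro mult_left_mono) auto
   finally show ?thesis by simp
  qed
  have "2 * pi * (sqrt h / sqrt H) <= 8 * (sqrt h / sqrt H)" using pi_less_4 h Hpos by (intro mult_right_mono) auto
  then show "2 / sqrt H * h * (pi / sqrt h) + 2 * h / H\<^sup>2 * (2 * sqrt H) <= 12 * sqrt (h / H)" unfolding s 1 using 2 by linarith
 qed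
 finally show ?thesis .
qed

text \<open>Here d is the distance to the singular height, e that to the critical height, and H <= d
  + e + sqrt h. Either e + sqrt h >= H/2, and dividing by it gains 2/H, or d >= H/2, and the point
  is far from the singularity.\<close>

lemma kernel_pointwise:
 fixes d e h H :: real
 assumes h: "0 < h" and d: "0 < d" and e: "0 <= e" and H: "sqrt h <= H" "H <= d + e + sqrt h" and rh: "rh = h / H"
 shows "h * (d powr (3/2) / (d\<^sup>2 + rh\<^sup>2)) / (e + sqrt h) <= 2 * sqrt (h / H)"
  and "h * (d powr (1/2) / (d\<^sup>2 + rh\<^sup>2)) / (e + sqrt h) <= 2 * rh * (d powr (1/2) / (d\<^sup>2 + rh\<^sup>2)) + (if e <= H / 2 then sqrt h * (H / 2) powr (- 3/2) else 0)"
proof -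
 have Hpos: "0 < H" using H h by (meson less_le_trans real_sqrt_gt_zero)
 have rhpos: "0 < rh" using rh h Hpos by simp
 have es: "0 < e + sqrt h" "sqrt h <= e + sqrt h" using e h by (auto intro: add_nonneg_pos)
 have pos: "0 < d\<^sup>2 + rh\<^sup>2" using d by (simp add: add_pos_nonneg)
 have s: "sqrt (h / H) = sqrt rh" by (simp add: rh)
 have dr: "d powr (3/2) / (d\<^sup>2 + rh\<^sup>2) <= d powr (-1/2)"
 proof -
  have "d powr (3/2) / (d\<^sup>2 + rh\<^sup>2) <= d powr (3/2) / d\<^sup>2" using d by (intro divide_left_mono) (auto simp: add_pos_nonneg)
  also have "... = d powr (3/2) * d powr (-2)" using d by (simp add: powr_minus_divide powr_numeral)
  also have "... = d powr (-1/2)" by (simp flip: powr_add)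
  finally show ?thesis .
 qed
 have rr: "d powr (3/2) / (d\<^sup>2 + rh\<^sup>2) <= rh powr (-1/2)"
 proof (cases "rh <= d")
  case True
  have "d powr (-1/2) <= rh powr (-1/2)" using True rhpos by (intro powr_mono2') auto
  then show ?thesis using dr by linarith
 next
  case False
  have "d powr (3/2) / (d\<^sup>2 + rh\<^sup>2) <= rh powr (3/2) / rh\<^sup>2" using False d rhpos by (intro frac_le powr_mono2) auto
  also have "... = rh powr (3/2) * rh powr (-2)" using rhpos by (simp add: powr_minus_divide powr_numeral)
  also have "... = rh powr (-1/2)" by (simp flip: powr_add)
  finally show ?thesis .
 qed
 show "h * (d powr (3/2) / (d\<^sup>2 + rh\<^sup>2)) / (e + sqrt h) <= 2 * sqrt (h / H)"
 proof (cases "H / 2 <= e + sqrt h")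
  case True
  have "h * (d powr (3/2) / (d\<^sup>2 + rh\<^sup>2)) / (e + sqrt h) <= h * rh powr (-1/2) / (H / 2)"
   using True rr h Hpos by (intro frac_le mult_left_mono) auto
  also have "... = 2 * (rh * rh powr (-1/2))" by (simp add: rh)
  also have "rh * rh powr (-1/2) = rh powr 1 * rh powr (-1/2)" using rhpos by simp
  also have "... = rh powr (1 + (-1/2))" by (rule powr_add[symmetric])
  also have "... = sqrt rh" using rhpos by (simp add: powr_half_sqrt)
  finally show ?thesis unfolding s .
 next
  case False
  then have "H / 2 <= d" using H by linarith
  then have "d powr (-1/2) <= (H / 2) powr (-1/2)" using Hpos by (intro powr_mono2') auto
  also have "... = 1 / sqrt (H / 2)" using Hpos by (simp add: powr_minus_divide powr_half_sqrt)
  also have "... <= 2 / sqrt H"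
  proof -
   have "sqrt H <= sqrt (4 * (H / 2))" using Hpos by simp
   also have "... = 2 * sqrt (H / 2)" by (simp only: real_sqrt_mult real_sqrt_four)
   finally show ?thesis using Hpos by (simp add: pos_divide_le_eq pos_le_divide_eq)
  qed
  finally have "d powr (3/2) / (d\<^sup>2 + rh\<^sup>2) <= 2 / sqrt H" using dr by linarith
  then have "h * (d powr (3/2) / (d\<^sup>2 + rh\<^sup>2)) / (e + sqrt h) <= h * (2 / sqrt H) / sqrt h"
   by - (rule frac_le[OF _ mult_left_mono], use es h Hpos in simp_all)
  also have "... = 2 * sqrt (h / H)"
  proof -
   have "(a * a) * (2 / b) / a = 2 * (a / b)" if "a > 0" for a b :: real using that by simp
   from this[of "sqrt h" "sqrt H"] show ?thesis using h by (simp add: real_sqrt_divide)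
  qed
  finally show ?thesis .
 qed
 show "h * (d powr (1/2) / (d\<^sup>2 + rh\<^sup>2)) / (e + sqrt h) <= 2 * rh * (d powr (1/2) / (d\<^sup>2 + rh\<^sup>2)) + (if e <= H / 2 then sqrt h * (H / 2) powr (- 3/2) else 0)"
 proof (cases "H / 2 <= e + sqrt h")
  case True
  have "h * (d powr (1/2) / (d\<^sup>2 + rh\<^sup>2)) / (e + sqrt h) <= h * (d powr (1/2) / (d\<^sup>2 + rh\<^sup>2)) / (H / 2)"
   using True h Hpos pos by (intro divide_left_mono) (auto intro!: mult_pos_pos es)
  also have "... = 2 * rh * (d powr (1/2) / (d\<^sup>2 + rh\<^sup>2))" by (simp add: rh mult_ac)
  finally show ?thesis using h by (auto intro: order_trans)
 next
  case False
  then have d2: "H / 2 <= d" and e2: "e <= H / 2" using H h by (auto, smt (verit) real_sqrt_gt_zero)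
  have "d powr (1/2) / (d\<^sup>2 + rh\<^sup>2) <= d powr (1/2) / d\<^sup>2" using d by (intro divide_left_mono) (auto simp: add_pos_nonneg)
  also have "... = d powr (1/2) * d powr (-2)" using d by (simp add: powr_minus_divide powr_numeral)
  also have "... = d powr (- 3/2)" by (simp flip: powr_add)
  also have "... <= (H / 2) powr (- 3/2)" using d2 Hpos by (intro powr_mono2') auto
  finally have "h * (d powr (1/2) / (d\<^sup>2 + rh\<^sup>2)) / (e + sqrt h) <= h * (H / 2) powr (- 3/2) / sqrt h"
   using es h by (intro frac_le mult_left_mono) auto
  also have "... = sqrt h * (H / 2) powr (- 3/2)"
  proof -
   have "(a * a) * X / a = a * X" if "a > 0" for a X :: real using that by simp
   from this[of "sqrt h"] show ?thesis using h by simp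
  qed
  finally show ?thesis using e2 pos rhpos by (simp add: add_increasing)
 qed
qed

text \<open>The amplitude is q = th b, with F the derivative of the phase and t the height above the
  line. The factor b = F / (F^2 + h) regularises 1/F at the natural width sqrt h of a critical
  point. The factor th removes the singularity of the kernel at scale rh = h/H, the wavelength of
  the oscillation at a height where the phase derivative has size H. The powers d^(-1/2) and
  d^(-3/2) are the norms of the kernel and of its square along the line.\<close>

lemma amplitude_bounds:
 fixes t v F F2 d e c h H ka M :: real
 defines "rh \<equiv> h / H"
 defines "th \<equiv> t\<^sup>2 / (t\<^sup>2 + rh\<^sup>2)" and "b \<equiv> F / (F\<^sup>2 + h)"
 defines "th' \<equiv> 2 * t * v * rh\<^sup>2 / (t\<^sup>2 + rh\<^sup>2)\<^sup>2" and "b' \<equiv> F2 * (h - F\<^sup>2) / (F\<^sup>2 + h)\<^sup>2"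
 defines "E5 \<equiv> 2 * rh * (d powr (1/2) / (d\<^sup>2 + rh\<^sup>2)) + (if e <= H / 2 then sqrt h * (H / 2) powr (- 3/2) else 0)"
 assumes h: "0 < h" and d: "0 < d" and e: "0 <= e" and H: "sqrt h <= H" "H <= d + e + sqrt h"
  and c: "0 < c" "c <= 1" and t: "\<bar>t\<bar> = d" and v: "\<bar>v\<bar> <= 1" and F: "c * e <= \<bar>F\<bar>" and F2: "\<bar>F2\<bar> <= M" and ka: "0 <= ka"
 shows "(\<bar>1 - F * (th * b)\<bar> + h * ka * \<bar>th * b\<bar> + h * \<bar>th' * b + th * b'\<bar>) * d powr (-1/2)
   <= d powr (-1/2) * (rh\<^sup>2 / (d\<^sup>2 + rh\<^sup>2)) + (1 + M) / c\<^sup>2 * (d powr (-1/2) * (h / (e\<^sup>2 + h))) + 4 * ka / c * sqrt (h / H) + 4 / c * E5" (is ?A)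
  and "h * \<bar>th * b\<bar> * d powr (-3/2) <= 2 / c * E5" (is ?B)
  and "h * \<bar>th * b\<bar> * d powr (-1/2) <= 4 / c * sqrt (h / H)" (is ?C)
proof -
 have Hpos: "0 < H" using H h by (meson less_le_trans real_sqrt_gt_zero)
 have rhpos: "0 < rh" using h Hpos by (simp add: rh_def)
 have t2: "t\<^sup>2 = d\<^sup>2" using t by auto
 define D where "D = d\<^sup>2 + rh\<^sup>2"
 have D: "0 < D" "d\<^sup>2 <= D" "rh\<^sup>2 <= D" using d by (auto simp: D_def add_pos_nonneg)
 have es: "0 < e + sqrt h" "0 < e\<^sup>2 + h" using e h by (auto intro: add_nonneg_pos)
 have Fh: "0 < F\<^sup>2 + h" using h by (simp add: add_nonneg_pos)
 have M: "0 <= M" using F2 by linarith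
 have th: "th = d\<^sup>2 / D" "0 <= th" "th <= 1" using D by (auto simp: th_def t2 D_def)
 have b: "\<bar>b\<bar> <= 2 / c * (1 / (e + sqrt h))"
 proof -
  have "\<bar>F\<bar> * (\<bar>F\<bar> + sqrt h) <= 2 * (F\<^sup>2 + h)"
  proof -
   have "2 * (\<bar>F\<bar> * sqrt h) <= \<bar>F\<bar>\<^sup>2 + (sqrt h)\<^sup>2" using sum_squares_bound[of "\<bar>F\<bar>" "sqrt h"] by (simp add: mult.assoc)
   moreover have "\<bar>F\<bar> * \<bar>F\<bar> = F\<^sup>2" by (simp add: power2_eq_square abs_mult_self_eq)
   moreover have "(sqrt h)\<^sup>2 = h" "\<bar>F\<bar>\<^sup>2 = F\<^sup>2" using h by simp_all
   ultimately show ?thesis unfolding distrib_left using h zero_le_power2[of F] by linarith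
  qed
  then have "\<bar>F\<bar> / (F\<^sup>2 + h) <= 2 / (\<bar>F\<bar> + sqrt h)"
   using Fh h by (subst frac_le_eq) (auto simp: add_nonneg_eq_0_iff divide_le_0_iff mult_ac intro: add_nonneg_pos)
  also have "... <= 2 / (c * (e + sqrt h))"
  proof (rule divide_left_mono)
   have "c * sqrt h <= 1 * sqrt h" using c h by (intro mult_right_mono) auto
   then show "c * (e + sqrt h) <= \<bar>F\<bar> + sqrt h" using F by (simp add: distrib_left)
   show "0 < (\<bar>F\<bar> + sqrt h) * (c * (e + sqrt h))" using c h es by (auto intro!: mult_pos_pos add_nonneg_pos)
  qed simp
  finally show ?thesis using Fh by (simp add: b_def)
 qed
 have cF: "1 / (F\<^sup>2 + h) <= 1 / c\<^sup>2 * (1 / (e\<^sup>2 + h))"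
 proof -
  have "(c * e)\<^sup>2 <= \<bar>F\<bar>\<^sup>2" using F c e by (intro power_mono) auto
  moreover have "c\<^sup>2 * h <= 1 * h" using c h by (intro mult_right_mono) (auto simp: power_le_one)
  ultimately have "c\<^sup>2 * (e\<^sup>2 + h) <= F\<^sup>2 + h" by (simp add: power_mult_distrib distrib_left)
  then have "1 / (F\<^sup>2 + h) <= 1 / (c\<^sup>2 * (e\<^sup>2 + h))" using c es by (intro divide_left_mono) (auto intro!: mult_pos_pos Fh)
  then show ?thesis by simp
 qed
 have b': "\<bar>b'\<bar> <= M * (1 / c\<^sup>2 * (1 / (e\<^sup>2 + h)))"
 proof -
  have "\<bar>h - F\<^sup>2\<bar> <= F\<^sup>2 + h" using h by (simp add: abs_le_iff)
  then have "\<bar>F2\<bar> * \<bar>h - F\<^sup>2\<bar> / (F\<^sup>2 + h)\<^sup>2 <= M * (F\<^sup>2 + h) / (F\<^sup>2 + h)\<^sup>2" using F2 M by (intro divide_right_mono mult_mono) auto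
  also have "... = M * (1 / (F\<^sup>2 + h))" using Fh by (simp add: power2_eq_square)
  also have "... <= M * (1 / c\<^sup>2 * (1 / (e\<^sup>2 + h)))" using cF M by (rule mult_left_mono)
  finally show ?thesis by (simp add: b'_def abs_mult)
 qed
 have th': "\<bar>th'\<bar> <= 2 * d / D"
 proof -
  have "\<bar>th'\<bar> = 2 * d * \<bar>v\<bar> * (rh\<^sup>2 / D) / D" unfolding th'_def t2 D_def[symmetric] using D t by (simp add: abs_mult power2_eq_square[of D])
  also have "... <= 2 * d * 1 * 1 / D" using D v d by (intro divide_right_mono mult_mono) auto
  finally show ?thesis by simp
 qed
 define p where "p = d powr (-1/2)"
 have p: "0 < p" using d by (simp add: p_def)
 have pw1: "d\<^sup>2 * p = d powr (3/2)"
 proof -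
  have "d powr 2 * d powr (-1/2) = d powr (2 + (-1/2))" by (rule powr_add[symmetric])
  then show ?thesis using d by (simp add: p_def powr_numeral)
 qed
 have pw2: "d * p = d powr (1/2)"
 proof -
  have "d powr 1 * d powr (-1/2) = d powr (1 + (-1/2))" by (rule powr_add[symmetric])
  then show ?thesis using d by (simp add: p_def)
 qed
 have pw3: "d\<^sup>2 * d powr (-3/2) = d powr (1/2)"
 proof -
  have "d powr 2 * d powr (-3/2) = d powr (2 + (-3/2))" by (rule powr_add[symmetric])
  then show ?thesis using d by (simp add: powr_numeral)
 qed
 note kp = kernel_pointwise[OF h d e H rh_def[THEN meta_eq_to_obj_eq]]
 have C0: "h * \<bar>th * b\<bar> * p <= 4 / c * sqrt (h / H)"
 proof -
  have "h * \<bar>th * b\<bar> * p <= h * (d\<^sup>2 / D * (2 / c * (1 / (e + sqrt h)))) * p"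
   unfolding abs_mult using h b th p D by (intro mult_right_mono mult_left_mono mult_mono) auto
  also have "... = 2 / c * (h * ((d\<^sup>2 * p) / D) / (e + sqrt h))" by (simp add: mult_ac)
  also have "... = 2 / c * (h * (d powr (3/2) / D) / (e + sqrt h))" by (simp only: pw1)
  also have "... <= 2 / c * (2 * sqrt (h / H))" using kp(1) c unfolding D_def by (intro mult_left_mono) auto
  finally show ?thesis by simp
 qed
 then show ?C by (simp add: p_def)
 show ?B
 proof -
  have "h * \<bar>th * b\<bar> * d powr (-3/2) <= h * (d\<^sup>2 / D * (2 / c * (1 / (e + sqrt h)))) * d powr (-3/2)"
   unfolding abs_mult using h b th D by (intro mult_right_mono mult_left_mono mult_mono) auto
  also have "... = 2 / c * (h * ((d\<^sup>2 * d powr (-3/2)) / D) / (e + sqrt h))" by (simp add: mult_ac)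
  also have "... = 2 / c * (h * (d powr (1/2) / D) / (e + sqrt h))" by (simp only: pw3)
  also have "... <= 2 / c * E5" using kp(2) c unfolding D_def E5_def by (intro mult_left_mono) auto
  finally show ?thesis .
 qed
 have A1: "\<bar>1 - F * (th * b)\<bar> * p <= p * (rh\<^sup>2 / D) + 1 / c\<^sup>2 * (p * (h / (e\<^sup>2 + h)))"
 proof -
  have "1 - F * b = h * (1 / (F\<^sup>2 + h))" using Fh by (simp add: b_def field_simps power2_eq_square)
  moreover have "1 - th = rh\<^sup>2 / D" using D by (simp add: th(1) field_simps) (simp add: D_def)
  moreover have "1 - F * (th * b) = (1 - th) + th * (1 - F * b)" by algebra
  ultimately have eq: "1 - F * (th * b) = rh\<^sup>2 / D + th * (h * (1 / (F\<^sup>2 + h)))" by simp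
  have "th * (h * (1 / (F\<^sup>2 + h))) <= 1 * (h * (1 / c\<^sup>2 * (1 / (e\<^sup>2 + h))))"
   using th h cF Fh by (intro mult_mono) auto
  moreover have "0 <= th * (h * (1 / (F\<^sup>2 + h)))" "0 <= rh\<^sup>2 / D" using th h Fh D by auto
  ultimately have "\<bar>1 - F * (th * b)\<bar> <= rh\<^sup>2 / D + h * (1 / c\<^sup>2 * (1 / (e\<^sup>2 + h)))" unfolding eq by linarith
  from mult_right_mono[OF this less_imp_le[OF p]] show ?thesis by (simp add: distrib_left distrib_right mult_ac)
 qed
 have A3: "h * \<bar>th' * b + th * b'\<bar> * p <= 4 / c * E5 + M / c\<^sup>2 * (p * (h / (e\<^sup>2 + h)))"
 proof -
  have "\<bar>th' * b + th * b'\<bar> <= 2 * d / D * (2 / c * (1 / (e + sqrt h))) + 1 * (M * (1 / c\<^sup>2 * (1 / (e\<^sup>2 + h))))"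
  proof (rule order_trans[OF abs_triangle_ineq])
   show "\<bar>th' * b\<bar> + \<bar>th * b'\<bar> <= 2 * d / D * (2 / c * (1 / (e + sqrt h))) + 1 * (M * (1 / c\<^sup>2 * (1 / (e\<^sup>2 + h))))"
    unfolding abs_mult using b b' th th' D d by (intro add_mono mult_mono) auto
  qed
  then have "h * \<bar>th' * b + th * b'\<bar> * p <= h * (2 * d / D * (2 / c * (1 / (e + sqrt h))) + 1 * (M * (1 / c\<^sup>2 * (1 / (e\<^sup>2 + h))))) * p"
   using h p by (intro mult_right_mono mult_left_mono) auto
  also have "... = 4 / c * (h * ((d * p) / D) / (e + sqrt h)) + M / c\<^sup>2 * (p * (h / (e\<^sup>2 + h)))"
   by (simp add: distrib_left distrib_right mult_ac)
  also have "... = 4 / c * (h * (d powr (1/2) / D) / (e + sqrt h)) + M / c\<^sup>2 * (p * (h / (e\<^sup>2 + h)))" by (simp only: pw2)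
  also have "... <= 4 / c * E5 + M / c\<^sup>2 * (p * (h / (e\<^sup>2 + h)))"
   using kp(2) c unfolding D_def E5_def by (intro add_right_mono mult_left_mono) auto
  finally show ?thesis .
 qed
 have A2: "h * ka * \<bar>th * b\<bar> * p <= 4 * ka / c * sqrt (h / H)"
  using mult_left_mono[OF C0 ka] by (simp add: mult_ac)
 have "(\<bar>1 - F * (th * b)\<bar> + h * ka * \<bar>th * b\<bar> + h * \<bar>th' * b + th * b'\<bar>) * p
   = \<bar>1 - F * (th * b)\<bar> * p + h * ka * \<bar>th * b\<bar> * p + h * \<bar>th' * b + th * b'\<bar> * p" by (simp only: distrib_right)
 also have "... <= (p * (rh\<^sup>2 / D) + 1 / c\<^sup>2 * (p * (h / (e\<^sup>2 + h)))) + 4 * ka / c * sqrt (h / H) + (4 / c * E5 + M / c\<^sup>2 * (p * (h / (e\<^sup>2 + h))))"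
  by (intro add_mono A1 A2 A3)
 also have "... = p * (rh\<^sup>2 / D) + (1 + M) / c\<^sup>2 * (p * (h / (e\<^sup>2 + h))) + 4 * ka / c * sqrt (h / H) + 4 / c * E5"
  by (simp add: add_divide_distrib distrib_right)
 finally show ?A by (simp only: p_def D_def)
qed

text \<open>The substitution v = et s; the lower bound 1/2 for the derivative costs the factor 2. A
  one-point interval is treated apart because the substitution rule asks for a nondegenerate
  one.\<close>

lemma nn_integral_compose_le:
 fixes F :: "real => ennreal" and et et' :: "real => real"
 assumes ab: "aa <= be" and [measurable]: "F \<in> bmeas"
  and et: "!!s. (et has_real_derivative et' s) (at s)" "continuous_on UNIV et'" "!!s. s \<in> {aa..be} ==> 1/2 <= et' s"
 shows "(II s. F (et s) * ind {aa..be} s) <= 2 * (II v. F v)"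
proof (cases "aa < be")
 case True
 have [measurable]: "et \<in> bmeas" "et' \<in> bmeas"
  using et(2) DERIV_isCont[OF et(1)] by (auto intro!: borel_measurable_continuous_onI continuous_at_imp_continuous_on)
 have le: "F (et s) * ind {aa..be} s <= 2 * (F (et s) * en (et' s) * ind {aa..be} s)" for s
 proof (cases "s \<in> {aa..be}")
  case True
  have "1 <= en (2 * et' s)" using et(3)[OF True] by simp
  also have "... = 2 * en (et' s)" using et(3)[OF True] by (simp add: ennreal_mult)
  finally have "F (et s) * 1 <= F (et s) * (2 * en (et' s))" by (rule mult_left_mono) simp
  then show ?thesis using True by (simp add: mult_ac)
 qed simp
 have sub: "(II v. F v * ind {et aa..et be} v) = (II s. F (et s) * en (et' s) * ind {aa..be} s)"
  by (rule nn_integral_substitution_aux) (use et continuous_on_subset[OF et(2)] True in \<open>auto intro: order_trans[of 0 "1/2"]\<close>)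
 have "(II s. F (et s) * ind {aa..be} s) <= (II s. 2 * (F (et s) * en (et' s) * ind {aa..be} s))"
  by (rule nn_integral_mono) (rule le)
 also have "... = 2 * (II v. F v * ind {et aa..et be} v)"
  unfolding sub by (rule nn_integral_cmult) measurable
 also have "... <= 2 * (II v. F v)"
  by (intro mult_left_mono nn_integral_mono) (auto simp: indicator_def)
 finally show ?thesis .
next
 case False
 then have eq: "{aa..be} = {aa}" using ab by auto
 have ae: "AE s in lborel. F (et s) * ind {aa} s = 0"
  by (rule AE_mp[OF AE_lborel_singleton[of aa]]) (rule AE_I2, simp)
 have "(II s. F (et s) * ind {aa} s) = (\<integral>\<^sup>+s. 0 \<partial>(lborel :: real measure))"
  by (rule nn_integral_cong_AE[OF ae])
 then show ?thesis unfolding eq by (simp only: nn_integral_const mult_zero_left zero_le)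
qed

text \<open>Along a horizontal line only the vertical distance to the pole matters. The pole on the
  line itself is excluded, as the norms are infinite there.\<close>

lemma nn_integral_Cauchy_kernel_row:
 assumes "Im w ~= y"
 shows "(II x. (en (1 / cmod (Complex x y - w)))\<^sup>2) = (en (sqrt pi * \<bar>Im w - y\<bar> powr (-1/2)))\<^sup>2"
  and "(II x. (en (1 / (cmod (Complex x y - w))\<^sup>2))\<^sup>2) <= (en (sqrt pi * \<bar>Im w - y\<bar> powr (-3/2)))\<^sup>2"
proof -
 define d where "d = \<bar>Im w - y\<bar>"
 have d: "0 < d" using assms by (simp add: d_def)
 have r: "(cmod (Complex x y - w))\<^sup>2 = (x - Re w)\<^sup>2 + d\<^sup>2" for x
  by (simp add: cmod_power2 d_def power2_commute)
 have sq: "(d powr a)\<^sup>2 = d powr (2 * a)" for a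
  using d by (simp add: power2_eq_square flip: powr_add)
 have "(II x. (en (1 / cmod (Complex x y - w)))\<^sup>2) = (II x. en (1 / ((x - Re w)\<^sup>2 + d\<^sup>2)))"
  by (simp add: ennreal_power power_divide r)
 also have "... = (II x. en (1 / (x\<^sup>2 + d\<^sup>2)))"
  by (rule nn_integral_real_translate[where F="%x. en (1 / (x\<^sup>2 + d\<^sup>2))"]) measurable
 also have "... = en (pi / d)" using d by (rule nn_integral_inverse_square_plus)
 also have "... = (en (sqrt pi * d powr (-1/2)))\<^sup>2"
 proof -
  have "(sqrt pi * d powr (-1/2))\<^sup>2 = pi / d" unfolding power_mult_distrib sq using d by (simp add: powr_minus_divide)
  then show ?thesis by (subst ennreal_power) simp_all
 qed
 finally show "(II x. (en (1 / cmod (Complex x y - w)))\<^sup>2) = (en (sqrt pi * \<bar>Im w - y\<bar> powr (-1/2)))\<^sup>2"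
  by (simp add: d_def)
 have "(II x. (en (1 / (cmod (Complex x y - w))\<^sup>2))\<^sup>2) = (II x. en (1 / ((x - Re w)\<^sup>2 + d\<^sup>2)\<^sup>2))"
  by (simp add: ennreal_power power_divide r)
 also have "... = (II x. en (1 / (x\<^sup>2 + d\<^sup>2)\<^sup>2))"
  by (rule nn_integral_real_translate[where F="%x. en (1 / (x\<^sup>2 + d\<^sup>2)\<^sup>2)"]) measurable
 also have "... = en (pi / (2 * d ^ 3))" using d by (rule nn_integral_inverse_square_plus_power2)
 also have "... <= en (pi / d ^ 3)" using d by (intro ennreal_leI divide_left_mono) auto
 also have "... = (en (sqrt pi * d powr (-3/2)))\<^sup>2"
 proof -
  have "(sqrt pi * d powr (-3/2))\<^sup>2 = pi / d ^ 3" unfolding power_mult_distrib sq using d by (simp add: powr_minus_divide powr_numeral)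
  then show ?thesis by (subst ennreal_power) simp_all
 qed
 finally show "(II x. (en (1 / (cmod (Complex x y - w))\<^sup>2))\<^sup>2) <= (en (sqrt pi * \<bar>Im w - y\<bar> powr (-3/2)))\<^sup>2"
  by (simp add: d_def)
qed

text \<open>The quantity \<open>E5\<close> of \<open>amplitude_bounds\<close> as a function of the
  height v, with d = |v - y|, e = |v - y0| and H the larger of |y - y0| and sqrt h.\<close>

definition osc_amplitude :: "real => real => real => real => real" where
 "osc_amplitude h y y0 v = 2 * (h / max \<bar>y - y0\<bar> (sqrt h)) * (\<bar>v - y\<bar> powr (1/2) / (\<bar>v - y\<bar>\<^sup>2 + (h / max \<bar>y - y0\<bar> (sqrt h))\<^sup>2))
   + (if \<bar>v - y0\<bar> <= max \<bar>y - y0\<bar> (sqrt h) / 2 then sqrt h * (max \<bar>y - y0\<bar> (sqrt h) / 2) powr (- 3/2) else 0)"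

lemma osc_amplitude_measurable [measurable]: "osc_amplitude h y y0 \<in> bmeas"
 unfolding osc_amplitude_def[abs_def] by measurable

lemma osc_amplitude_nonneg: "0 < h ==> 0 <= osc_amplitude h y y0 v"
 unfolding osc_amplitude_def by (auto intro!: add_nonneg_nonneg mult_nonneg_nonneg divide_nonneg_nonneg simp: le_max_iff_disj)

text \<open>The first term contributes 12 through \<open>kernel_integral_2\<close>; the second is
  constant on an interval of length H and contributes at most 3.\<close>

lemma nn_integral_osc_amplitude:
 assumes h: "0 < h"
 shows "(II v. en (osc_amplitude h y y0 v)) <= en (15 * sqrt (h / max \<bar>y - y0\<bar> (sqrt h)))"
proof -
 define H where "H = max \<bar>y - y0\<bar> (sqrt h)"
 define rh where "rh = h / H"
 have Hpos: "0 < H" using h by (auto simp: H_def less_max_iff_disj)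
 have rh: "0 < rh" using h Hpos by (simp add: rh_def)
 have "(II v. en (osc_amplitude h y y0 v))
   = (II v. en (2 * rh) * en (\<bar>v - y\<bar> powr (1/2) / ((v - y)\<^sup>2 + rh\<^sup>2)) + en (sqrt h * (H / 2) powr (- 3/2)) * ind {y0 - H/2..y0 + H/2} v)"
 proof (rule nn_integral_cong)
  fix v
  have iff: "(\<bar>v - y0\<bar> <= H / 2) = (v \<in> {y0 - H/2..y0 + H/2})"
   unfolding abs_le_iff atLeastAtMost_iff by linarith
  have i: "(if \<bar>v - y0\<bar> <= H / 2 then X else 0) = X * ind {y0 - H/2..y0 + H/2} v" for X :: real
   unfolding iff indicator_def by (simp del: atLeastAtMost_iff)
  have ei: "en (X * ind S v) = en X * ind S v" for X S by (simp add: indicator_def)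
  have "en (osc_amplitude h y y0 v) = en (2 * rh * (\<bar>v - y\<bar> powr (1/2) / ((v - y)\<^sup>2 + rh\<^sup>2)) + sqrt h * (H / 2) powr (- 3/2) * ind {y0 - H/2..y0 + H/2} v)"
   unfolding osc_amplitude_def H_def[symmetric] rh_def[symmetric] i power2_abs ..
  also have "... = en (2 * rh * (\<bar>v - y\<bar> powr (1/2) / ((v - y)\<^sup>2 + rh\<^sup>2))) + en (sqrt h * (H / 2) powr (- 3/2) * ind {y0 - H/2..y0 + H/2} v)"
   using rh h by (intro ennreal_plus) auto
  also have "en (2 * rh * (\<bar>v - y\<bar> powr (1/2) / ((v - y)\<^sup>2 + rh\<^sup>2))) = en (2 * rh) * en (\<bar>v - y\<bar> powr (1/2) / ((v - y)\<^sup>2 + rh\<^sup>2))"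
   using rh by (intro ennreal_mult) auto
  finally show "en (osc_amplitude h y y0 v) = en (2 * rh) * en (\<bar>v - y\<bar> powr (1/2) / ((v - y)\<^sup>2 + rh\<^sup>2)) + en (sqrt h * (H / 2) powr (- 3/2)) * ind {y0 - H/2..y0 + H/2} v"
   unfolding ei .
 qed
 also have "... = en (2 * rh) * (II v. en (\<bar>v - y\<bar> powr (1/2) / ((v - y)\<^sup>2 + rh\<^sup>2))) + en (sqrt h * (H / 2) powr (- 3/2)) * en H"
  using Hpos by (subst nn_integral_add) (auto simp: nn_integral_cmult nn_integral_cmult_indicator)
 also have "... <= en (2 * rh) * en (6 / sqrt rh) + en (sqrt h * (H / 2) powr (- 3/2)) * en H"
  by (intro add_right_mono mult_left_mono kernel_integral_2 rh) simp
 also have "... = en (2 * rh * (6 / sqrt rh) + sqrt h * (H / 2) powr (- 3/2) * H)"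
  using rh h Hpos by (simp add: ennreal_mult'[symmetric] ennreal_plus[symmetric] del: ennreal_plus)
 also have "... <= en (15 * sqrt rh)"
 proof (rule ennreal_leI)
  have 1: "2 * rh * (6 / sqrt rh) = 12 * sqrt rh"
  proof -
   have "2 * (a * a) * (6 / a) = 12 * a" if "a > 0" for a :: real using that by simp
   from this[of "sqrt rh"] show ?thesis using rh by simp
  qed
  have 2: "sqrt h * (H / 2) powr (- 3/2) * H <= 3 * sqrt rh"
  proof -
   have "(H / 2) powr (- 3/2) * (H / 2) powr 1 = (H / 2) powr (- 3/2 + 1)" by (rule powr_add[symmetric])
   then have "(H / 2) powr (- 3/2) * H = 2 * (H / 2) powr (-1/2)" using Hpos by simp
   also have "(H / 2) powr (-1/2) = 1 / sqrt (H / 2)" using Hpos by (simp add: powr_minus_divide powr_half_sqrt)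
   also have "2 * (1 / sqrt (H / 2)) = 2 * sqrt 2 / sqrt H" by (simp add: real_sqrt_divide)
   finally have "sqrt h * (H / 2) powr (- 3/2) * H = 2 * sqrt 2 * (sqrt h / sqrt H)" by (simp add: mult.assoc)
   moreover have "sqrt 2 <= 3/2" by (rule real_le_lsqrt) (auto simp: power2_eq_square)
   moreover have "2 * sqrt 2 * (sqrt h / sqrt H) <= 3 * (sqrt h / sqrt H)"
    by (rule mult_right_mono) (use calculation h Hpos in simp_all)
   ultimately have "sqrt h * (H / 2) powr (- 3/2) * H <= 3 * (sqrt h / sqrt H)"
    by linarith
   then show ?thesis by (simp add: rh_def real_sqrt_divide)
  qed
  show "2 * rh * (6 / sqrt rh) + sqrt h * (H / 2) powr (- 3/2) * H <= 15 * sqrt rh" using 1 2 by linarith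
 qed
 finally show ?thesis by (simp add: rh_def H_def)
qed

text \<open>The factor 4 comes from squaring a sum of four terms and pi from the norms of the
  kernel. The squares belong to the two integrals and the two end point terms of the integration by
  parts.\<close>

definition osc_const :: "real => real => real => real" where
 "osc_const c ka M = 4 * pi * ((12 + 24 * (1 + M) / c\<^sup>2 + 4 * ka / c + 120 / c)\<^sup>2 + (60 / c)\<^sup>2 + 2 * (4 / c)\<^sup>2)"

lemma osc_const_nonneg: "0 <= osc_const c ka M"
 by (simp add: osc_const_def)

text \<open>Written as a Lebesgue integral, so that measurability in \<open>z\<close> is available
  for all \<open>z\<close>, the curve included. Off the curve it agrees with the gauge integral used
  in the integration by parts.\<close>

definition osc_cauchy :: "real => real => (real => complex) => (real => complex) => (real => real) => complex => complex" where
 "osc_cauchy aa be ga ga' f z = (LINT s:{aa..be}|lborel. exp (\<i> * cr (f s)) * (ga' s / (z - ga s)))"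

lemma osc_cauchy_integral:
 assumes "continuous_on {aa..be} ga" "continuous_on {aa..be} ga'" "continuous_on {aa..be} f" "!!s. s \<in> {aa..be} ==> ga s ~= z"
 shows "osc_cauchy aa be ga ga' f z = integral {aa..be} (%s. exp (\<i> * cr (f s)) * (ga' s / (z - ga s)))"
  and "(%s. exp (\<i> * cr (f s)) * (ga' s / (z - ga s))) integrable_on {aa..be}"
proof -
 have ne: "z - ga s ~= 0" if "s \<in> {aa..be}" for s using assms(4)[OF that] by auto
 have c: "continuous_on {aa..be} (%s. exp (\<i> * cr (f s)) * (ga' s / (z - ga s)))"
  using ne by (intro continuous_intros assms) auto
 then have "set_integrable lborel {aa..be} (%s. exp (\<i> * cr (f s)) * (ga' s / (z - ga s)))"
  unfolding set_integrable_def by (intro borel_integrable_compact) auto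
 then show "osc_cauchy aa be ga ga' f z = integral {aa..be} (%s. exp (\<i> * cr (f s)) * (ga' s / (z - ga s)))"
  unfolding osc_cauchy_def by (rule set_borel_integral_eq_integral(2))
 show "(%s. exp (\<i> * cr (f s)) * (ga' s / (z - ga s))) integrable_on {aa..be}"
  by (rule integrable_continuous_interval[OF c])
qed

lemma osc_cauchy_measurable:
 assumes "continuous_on UNIV ga" "continuous_on UNIV ga'" "continuous_on UNIV f"
 shows "osc_cauchy aa be ga ga' f \<in> bmeas"
proof -
 note [measurable] = assms[THEN borel_measurable_continuous_onI]
 have "(%z. LINT s|lborel. ind {aa..be} s *\<^sub>R (exp (\<i> * cr (f s)) * (ga' s / (z - ga s)))) \<in> bmeas"
  by (rule lborel.borel_measurable_lebesgue_integral) measurable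
 then show ?thesis unfolding osc_cauchy_def[abs_def] set_lebesgue_integral_def .
qed

lemma osc_cauchy_mult_ii: "osc_cauchy aa be (%s. \<i> * ga s) (%s. \<i> * ga' s) f (\<i> * z) = osc_cauchy aa be ga ga' f z"
 unfolding osc_cauchy_def right_diff_distrib[symmetric] by simp

text \<open>The integral is singular as z approaches the arc, which rules out a uniform pointwise
  bound. Its L2 norm on a horizontal line is controlled by Minkowski's inequality applied to the
  terms of the integration by parts. The condition on Im ga' makes height a coordinate on the arc;
  the decay in the distance from the critical height expresses nonstationary phase.\<close>

lemma oscillatory_cauchy_piece:
 fixes ga ga' ga'' :: "real => complex" and f f1 f2 :: "real => real"
 assumes ab: "aa <= be" "be <= aa + 1" and h: "0 < h" and c: "0 < c" "c <= 1"
  and ga: "!!s. (ga has_vector_derivative ga' s) (at s)" "!!s. (ga' has_vector_derivative ga'' s) (at s)"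
  and ga'': "continuous_on UNIV ga''" "!!s. cmod (ga'' s) <= ka" and unit: "!!s. cmod (ga' s) = 1"
  and im: "!!s. s \<in> {aa..be} ==> 1/2 <= Im (ga' s)"
  and f: "!!s. (f has_real_derivative f1 s) (at s)" "!!s. (f1 has_real_derivative f2 s) (at s)" "continuous_on UNIV f2"
   "!!s. \<bar>f2 s\<bar> <= M"
  and s0: "s0 \<in> {aa..be}" "!!s. s \<in> {aa..be} ==> c * \<bar>s - s0\<bar> <= \<bar>f1 s\<bar>"
 shows "(II x. (en (cmod (osc_cauchy aa be ga ga' (%s. f s / h) (Complex x y))))\<^sup>2)
  <= en (osc_const c ka M * (h / max \<bar>y - Im (ga s0)\<bar> (sqrt h)))"
proof -
 define et where "et = (%s. Im (ga s))"
 define et' where "et' = (%s. Im (ga' s))"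
 define y0 where "y0 = et s0"
 define H where "H = max \<bar>y - y0\<bar> (sqrt h)"
 define rh where "rh = h / H"
 define S where "S = sqrt (h / H)"
 have Hpos: "0 < H" "sqrt h <= H" using h by (auto simp: H_def less_max_iff_disj)
 have rh: "0 < rh" using h Hpos by (simp add: rh_def)
 have S: "0 <= S" "S\<^sup>2 = h / H" using h Hpos by (auto simp: S_def)
 have ka: "0 <= ka" using order_trans[OF norm_ge_zero ga''(2)] .
 have M: "0 <= M" using order_trans[OF abs_ge_zero f(4)] .
 define t where "t = (%s. et s - y)"
 define th where "th = (%s. (t s)\<^sup>2 / ((t s)\<^sup>2 + rh\<^sup>2))"
 define th' where "th' = (%s. 2 * t s * et' s * rh\<^sup>2 / ((t s)\<^sup>2 + rh\<^sup>2)\<^sup>2)"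
 define b where "b = (%s. f1 s / ((f1 s)\<^sup>2 + h))"
 define b' where "b' = (%s. f2 s * (h - (f1 s)\<^sup>2) / ((f1 s)\<^sup>2 + h)\<^sup>2)"
 define q where "q = (%s. th s * b s)"
 define q1 where "q1 = (%s. th' s * b s + th s * b' s)"
 have pos: "0 < (t s)\<^sup>2 + rh\<^sup>2" "0 < (f1 s)\<^sup>2 + h" for s using rh h by (auto intro: add_nonneg_pos)
 have det: "(et has_real_derivative et' s) (at s)" for s
  unfolding et_def et'_def using has_derivative_Im[OF ga(1)[unfolded has_vector_derivative_def], of s]
  by (simp add: has_field_derivative_def mult_commute_abs)
 have dt: "(t has_real_derivative et' s) (at s)" for s
  unfolding t_def using DERIV_diff[OF det DERIV_const, of y s] by simp
 have dth: "(th has_real_derivative th' s) (at s)" for s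
 proof -
  have "((%s. (t s)\<^sup>2) has_real_derivative 2 * t s * et' s) (at s)"
   using DERIV_power[OF dt, of 2 s] by (simp add: mult_ac)
  from DERIV_divide[OF this DERIV_add[OF this DERIV_const[of "rh\<^sup>2"]] pos(1)[of s, THEN less_imp_neq, THEN not_sym]]
  have "(th has_real_derivative (2 * t s * et' s * ((t s)\<^sup>2 + rh\<^sup>2) - (t s)\<^sup>2 * (2 * t s * et' s + 0)) / (((t s)\<^sup>2 + rh\<^sup>2) * ((t s)\<^sup>2 + rh\<^sup>2))) (at s)"
   unfolding th_def .
  moreover have "2 * t s * et' s * ((t s)\<^sup>2 + rh\<^sup>2) - (t s)\<^sup>2 * (2 * t s * et' s + 0) = 2 * t s * et' s * rh\<^sup>2"
   by (simp add: algebra_simps)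
  ultimately show ?thesis unfolding th'_def power2_eq_square[of "(t s)\<^sup>2 + rh\<^sup>2"] by simp
 qed
 have db: "(b has_real_derivative b' s) (at s)" for s
 proof -
  have "((%s. (f1 s)\<^sup>2) has_real_derivative 2 * f1 s * f2 s) (at s)"
   using DERIV_power[OF f(2), of 2 s] by (simp add: mult_ac)
  from DERIV_divide[OF f(2) DERIV_add[OF this DERIV_const[of h]] pos(2)[of s, THEN less_imp_neq, THEN not_sym]]
  have "(b has_real_derivative (f2 s * ((f1 s)\<^sup>2 + h) - f1 s * (2 * f1 s * f2 s + 0)) / (((f1 s)\<^sup>2 + h) * ((f1 s)\<^sup>2 + h))) (at s)"
   unfolding b_def .
  moreover have "f2 s * ((f1 s)\<^sup>2 + h) - f1 s * (2 * f1 s * f2 s + 0) = f2 s * (h - (f1 s)\<^sup>2)"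
   by (simp add: algebra_simps power2_eq_square)
  ultimately show ?thesis unfolding b'_def power2_eq_square[of "(f1 s)\<^sup>2 + h"] by simp
 qed
 have dq: "(q has_real_derivative q1 s) (at s)" for s
  unfolding q_def q1_def using DERIV_mult[OF dth db, of s] by (simp add: mult.commute add.commute)
 have cont: "continuous_on UNIV ga" "continuous_on UNIV ga'" "continuous_on UNIV f1" "continuous_on UNIV t" "continuous_on UNIV q"
  using has_vector_derivative_continuous[OF ga(1)] has_vector_derivative_continuous[OF ga(2)]
   DERIV_isCont[OF f(2)] DERIV_isCont[OF dt] DERIV_isCont[OF dq]
  by (blast intro: continuous_at_imp_continuous_on)+
 have cet': "continuous_on UNIV et'" unfolding et'_def by (intro continuous_intros cont)
 have cq1: "continuous_on UNIV q1"
 proof -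
  have ne: "(t s)\<^sup>2 + rh\<^sup>2 ~= 0" "(f1 s)\<^sup>2 + h ~= 0" for s using pos[of s] by auto
  show ?thesis unfolding q1_def th_def th'_def b_def b'_def using ne by (intro continuous_intros cont f cet') auto
 qed
 note meas [measurable] = cont(1-5)[THEN borel_measurable_continuous_onI] cq1[THEN borel_measurable_continuous_onI]
 define A where "A = (%s. \<bar>1 - f1 s * q s\<bar> + h * ka * \<bar>q s\<bar> + h * \<bar>q1 s\<bar>)"
 have A0: "0 <= A s" for s using h ka by (simp add: A_def)
 define fiA where "fiA = (%s. en (A s) * ind {aa..be} s)"
 define fiB where "fiB = (%s. en (h * \<bar>q s\<bar>) * ind {aa..be} s)"
 have [measurable]: "fiA \<in> bmeas" "fiB \<in> bmeas"
  unfolding fiA_def fiB_def A_def by measurable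
 define K where "K = (%x s. en (1 / cmod (Complex x y - ga s)))"
 define K2 where "K2 = (%x s. en (1 / (cmod (Complex x y - ga s))\<^sup>2))"
 have CR: "Complex x y = cr x + \<i> * cr y" for x by (simp add: complex_eq_iff)
 have [measurable]: "case_prod K \<in> borel_measurable (borel \<Otimes>\<^sub>M borel)" "case_prod K2 \<in> borel_measurable (borel \<Otimes>\<^sub>M borel)"
  unfolding K_def K2_def CR by measurable
 have [measurable]: "(%x. K x s) \<in> bmeas" for s unfolding K_def CR by measurable
 define NA where "NA = (%s. en (sqrt pi * \<bar>t s\<bar> powr (-1/2)))"
 define NB where "NB = (%s. en (sqrt pi * \<bar>t s\<bar> powr (-3/2)))"
 have [measurable]: "NA \<in> bmeas" "NB \<in> bmeas" unfolding NA_def NB_def by measurable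
 have mono: "et r < et s" if "r \<in> {aa..be}" "s \<in> {aa..be}" "r < s" for r s
 proof -
  from MVT2[OF that(3), of et et'] det obtain z where z: "r < z" "z < s" "et s - et r = (s - r) * et' z" by blast
  have "0 < et' z" unfolding et'_def using im[of z] z that by auto
  then show ?thesis using z that(3) by (metis diff_gt_0_iff_gt mult_pos_pos)
 qed
 have inj: "r = s" if "r \<in> {aa..be}" "s \<in> {aa..be}" "et r = et s" for r s
  using mono[of r s] mono[of s r] that by (cases r s rule: linorder_cases) auto
 \<comment> \<open>Height is strictly increasing on the arc, so at most one parameter lies on the
   given line. It is a null set for the integrals in s, and outside x = Re (ga s1) the line avoids
   the arc.\<close>
 obtain s1 where s1: "!!s. s \<in> {aa..be} ==> s ~= s1 ==> t s ~= 0"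
  by (metis inj eq_iff_diff_eq_0 t_def)
 \<comment> \<open>Unit speed gives |et s - y0| <= |s - s0|, so the lower bound for |f1| in terms of
   the parameter becomes one in terms of the height.\<close>
 have lip: "\<bar>et s - y0\<bar> <= \<bar>s - s0\<bar>" for s
 proof -
  have "\<bar>et' s\<bar> <= 1" for s using abs_Im_le_cmod[of "ga' s"] unit[of s] by (simp add: et'_def)
  then have "norm (et s - et s0) <= 1 * norm (s - s0)"
   by (intro field_differentiable_bound[OF convex_UNIV, of et et']) (auto intro: has_field_derivative_at_within det)
  then show ?thesis by (simp add: y0_def)
 qed
 have bounds: "A s * \<bar>t s\<bar> powr (-1/2) <= \<bar>t s\<bar> powr (-1/2) * (rh\<^sup>2 / (\<bar>t s\<bar>\<^sup>2 + rh\<^sup>2)) + (1 + M) / c\<^sup>2 * (\<bar>t s\<bar> powr (-1/2) * (h / (\<bar>et s - y0\<bar>\<^sup>2 + h))) + 4 * ka / c * S + 4 / c * osc_amplitude h y y0 (et s)"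
   "h * \<bar>q s\<bar> * \<bar>t s\<bar> powr (-3/2) <= 2 / c * osc_amplitude h y y0 (et s)"
   "h * \<bar>q s\<bar> * \<bar>t s\<bar> powr (-1/2) <= 4 / c * S"
  if s: "s \<in> {aa..be}" "t s ~= 0" for s
 proof -
  have 1: "0 < \<bar>t s\<bar>" "0 <= \<bar>et s - y0\<bar>" using s by auto
  have 2: "H <= \<bar>t s\<bar> + \<bar>et s - y0\<bar> + sqrt h" unfolding H_def t_def using real_sqrt_gt_zero[OF h] by linarith
  have 3: "\<bar>et' s\<bar> <= 1" using abs_Im_le_cmod[of "ga' s"] unit[of s] by (simp add: et'_def)
  have 4: "c * \<bar>et s - y0\<bar> <= \<bar>f1 s\<bar>"
   by (rule order_trans[OF mult_left_mono[OF lip[of s]] s0(2)[OF s(1)]]) (use c in simp)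
  note ab = amplitude_bounds[OF h 1 Hpos(2) 2 c refl 3 4 f(4) ka]
  have o: "osc_amplitude h y y0 (et s) = 2 * (h / H) * (\<bar>t s\<bar> powr (1/2) / (\<bar>t s\<bar>\<^sup>2 + (h / H)\<^sup>2)) + (if \<bar>et s - y0\<bar> <= H / 2 then sqrt h * (H / 2) powr (- 3/2) else 0)"
   unfolding osc_amplitude_def H_def[symmetric] t_def ..
  show "A s * \<bar>t s\<bar> powr (-1/2) <= \<bar>t s\<bar> powr (-1/2) * (rh\<^sup>2 / (\<bar>t s\<bar>\<^sup>2 + rh\<^sup>2)) + (1 + M) / c\<^sup>2 * (\<bar>t s\<bar> powr (-1/2) * (h / (\<bar>et s - y0\<bar>\<^sup>2 + h))) + 4 * ka / c * S + 4 / c * osc_amplitude h y y0 (et s)"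
   unfolding A_def q_def q1_def th_def th'_def b_def b'_def rh_def o S_def by (rule ab(1))
  show "h * \<bar>q s\<bar> * \<bar>t s\<bar> powr (-3/2) <= 2 / c * osc_amplitude h y y0 (et s)"
   unfolding q_def th_def b_def rh_def o by (rule ab(2))
  show "h * \<bar>q s\<bar> * \<bar>t s\<bar> powr (-1/2) <= 4 / c * S"
   unfolding q_def th_def b_def rh_def S_def by (rule ab(3))
 qed
 have sqp: "(sqrt pi * X)\<^sup>2 = pi * X\<^sup>2" for X by (simp add: power_mult_distrib)
 \<comment> \<open>The constants 6, 12 and 15 of the integrals over heights, each doubled by the
   change of variables; 15 also carries 4/c. The term 4 ka / c is integrated over an arc of length
   at most 1.\<close>
 define WA where "WA = 12 + 24 * (1 + M) / c\<^sup>2 + 4 * ka / c + 120 / c"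
 define G where "G = (%v. en (\<bar>v - y\<bar> powr (-1/2) * (rh\<^sup>2 / ((v - y)\<^sup>2 + rh\<^sup>2))) + en ((1 + M) / c\<^sup>2) * en (\<bar>v - y\<bar> powr (-1/2) * (h / ((v - y0)\<^sup>2 + h))) + en (4 / c) * en (osc_amplitude h y y0 v))"
 have [measurable]: "G \<in> bmeas" unfolding G_def by measurable
 have [measurable]: "et \<in> bmeas" unfolding et_def by measurable
 have AE1: "AE s in lborel. s ~= s1" by (rule AE_lborel_ne)
 have S': "S = sqrt rh" by (simp add: S_def rh_def)
 have intG: "(II v. G v) <= en ((6 + (1 + M) / c\<^sup>2 * 12 + 4 / c * 15) * S)"
 proof -
  have lin: "(II v. a v + k * a' v + l * a'' v) = (II v. a v) + k * (II v. a' v) + l * (II v. a'' v)"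
   if [measurable]: "a \<in> bmeas" "a' \<in> bmeas" "a'' \<in> bmeas" for a a' a'' :: "real => ennreal" and k l
   by (simp add: nn_integral_add nn_integral_cmult)
  have "(II v. G v) = (II v. en (\<bar>v - y\<bar> powr (-1/2) * (rh\<^sup>2 / ((v - y)\<^sup>2 + rh\<^sup>2)))) + en ((1 + M) / c\<^sup>2) * (II v. en (\<bar>v - y\<bar> powr (-1/2) * (h / ((v - y0)\<^sup>2 + h)))) + en (4 / c) * (II v. en (osc_amplitude h y y0 v))"
   unfolding G_def by (rule lin) measurable
  also have "... <= en (6 * S) + en ((1 + M) / c\<^sup>2) * en (12 * S) + en (4 / c) * en (15 * S)"
   unfolding S'
  proof (intro add_mono mult_left_mono)
   show "(II v. en (\<bar>v - y\<bar> powr (-1/2) * (rh\<^sup>2 / ((v - y)\<^sup>2 + rh\<^sup>2)))) <= en (6 * sqrt rh)" by (rule kernel_integral_1[OF rh])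
   show "(II v. en (\<bar>v - y\<bar> powr (-1/2) * (h / ((v - y0)\<^sup>2 + h)))) <= en (12 * sqrt rh)" unfolding rh_def by (rule kernel_integral_3[OF h H_def])
   show "(II v. en (osc_amplitude h y y0 v)) <= en (15 * sqrt rh)" unfolding rh_def H_def by (rule nn_integral_osc_amplitude[OF h])
  qed auto
  also have "... = en (6 * S + (1 + M) / c\<^sup>2 * (12 * S) + 4 / c * (15 * S))"
  proof -
   have "0 <= (1 + M) / c\<^sup>2" "0 <= 4 / c" using M c by auto
   then show ?thesis using S(1) by (simp only: ennreal_mult[symmetric] ennreal_plus[symmetric] mult_nonneg_nonneg add_nonneg_nonneg zero_le_numeral)
  qed
  also have "6 * S + (1 + M) / c\<^sup>2 * (12 * S) + 4 / c * (15 * S) = (6 + (1 + M) / c\<^sup>2 * 12 + 4 / c * 15) * S" by (simp only: distrib_right mult.assoc)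
  finally show ?thesis .
 qed
 have NA: "(II s. fiA s * NA s) <= en (sqrt pi * (WA * S))"
 proof -
  have "(II s. fiA s * NA s) <= (II s. en (sqrt pi) * (G (et s) * ind {aa..be} s + en (4 * ka / c * S) * ind {aa..be} s))"
  proof (rule nn_integral_mono_AE, use AE1 in eventually_elim)
   fix s assume ne: "s ~= s1"
   show "fiA s * NA s <= en (sqrt pi) * (G (et s) * ind {aa..be} s + en (4 * ka / c * S) * ind {aa..be} s)"
   proof (cases "s \<in> {aa..be}")
    case True
    define X where "X = \<bar>t s\<bar> powr (-1/2) * (rh\<^sup>2 / (\<bar>t s\<bar>\<^sup>2 + rh\<^sup>2))"
    define Y where "Y = \<bar>t s\<bar> powr (-1/2) * (h / (\<bar>et s - y0\<bar>\<^sup>2 + h))"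
    define Z where "Z = osc_amplitude h y y0 (et s)"
    have nn: "0 <= X" "0 <= Y" "0 <= Z" "0 <= (1 + M) / c\<^sup>2" "0 <= 4 / c" "0 <= 4 * ka / c * S"
     using h c M ka S osc_amplitude_nonneg[OF h] by (auto simp: X_def Y_def Z_def)
    have GX: "G (et s) = en X + en ((1 + M) / c\<^sup>2) * en Y + en (4 / c) * en Z"
     unfolding G_def X_def Y_def Z_def t_def power2_abs ..
    have "fiA s * NA s = en (sqrt pi) * en (A s * \<bar>t s\<bar> powr (-1/2))"
     using True A0 by (simp add: fiA_def NA_def ennreal_mult mult_ac)
    also have "... <= en (sqrt pi) * en (X + (1 + M) / c\<^sup>2 * Y + 4 * ka / c * S + 4 / c * Z)"
     using bounds(1)[OF True s1[OF True ne]] unfolding X_def Y_def Z_def by (intro mult_left_mono ennreal_leI) auto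
    also have "en (X + (1 + M) / c\<^sup>2 * Y + 4 * ka / c * S + 4 / c * Z) = en X + en ((1 + M) / c\<^sup>2) * en Y + en (4 * ka / c * S) + en (4 / c) * en Z"
     using nn by (simp only: ennreal_mult ennreal_plus mult_nonneg_nonneg add_nonneg_nonneg)
    also have "... = G (et s) + en (4 * ka / c * S)" unfolding GX by (simp only: ac_simps)
    finally show ?thesis using True by simp
   qed (simp add: fiA_def)
  qed
  also have "... = en (sqrt pi) * ((II s. G (et s) * ind {aa..be} s) + en (4 * ka / c * S) * en (be - aa))"
   using ab by (simp add: nn_integral_cmult nn_integral_add nn_integral_cmult_indicator)
  also have "... <= en (sqrt pi) * (2 * en ((6 + (1 + M) / c\<^sup>2 * 12 + 4 / c * 15) * S) + en (4 * ka / c * S) * en 1)"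
  proof (intro mult_left_mono add_mono)
   have "(II s. G (et s) * ind {aa..be} s) <= 2 * (II v. G v)"
    by (rule nn_integral_compose_le[OF ab(1) _ det cet']) (use im in \<open>auto simp: et'_def\<close>)
   also have "... <= 2 * en ((6 + (1 + M) / c\<^sup>2 * 12 + 4 / c * 15) * S)" by (rule mult_left_mono[OF intG]) simp
   finally show "(II s. G (et s) * ind {aa..be} s) <= 2 * en ((6 + (1 + M) / c\<^sup>2 * 12 + 4 / c * 15) * S)" .
  qed (use ab in \<open>auto intro: ennreal_leI\<close>)
  also have "... = en (sqrt pi * (WA * S))"
  proof -
   have nn: "0 <= (6 + (1 + M) / c\<^sup>2 * 12 + 4 / c * 15) * S" "0 <= 4 * ka / c * S" using S c M ka by auto
   have "2 * en ((6 + (1 + M) / c\<^sup>2 * 12 + 4 / c * 15) * S) + en (4 * ka / c * S) * en 1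
     = en (2 * ((6 + (1 + M) / c\<^sup>2 * 12 + 4 / c * 15) * S) + 4 * ka / c * S)"
    using nn by (simp add: ennreal_mult)
   also have "2 * ((6 + (1 + M) / c\<^sup>2 * 12 + 4 / c * 15) * S) + 4 * ka / c * S = WA * S"
    unfolding WA_def by (simp add: distrib_right distrib_left)
   finally show ?thesis by (simp add: ennreal_mult')
  qed
  finally show ?thesis .
 qed
 have NB: "(II s. fiB s * NB s) <= en (sqrt pi * (60 / c * S))"
 proof -
  have "(II s. fiB s * NB s) <= (II s. en (sqrt pi * (2 / c)) * (en (osc_amplitude h y y0 (et s)) * ind {aa..be} s))"
  proof (rule nn_integral_mono_AE, use AE1 in eventually_elim)
   fix s assume ne: "s ~= s1"
   show "fiB s * NB s <= en (sqrt pi * (2 / c)) * (en (osc_amplitude h y y0 (et s)) * ind {aa..be} s)"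
   proof (cases "s \<in> {aa..be}")
    case True
    have "fiB s * NB s = en (sqrt pi) * en (h * \<bar>q s\<bar> * \<bar>t s\<bar> powr (-3/2))"
     using True h by (simp add: fiB_def NB_def ennreal_mult mult_ac)
    also have "... <= en (sqrt pi) * en (2 / c * osc_amplitude h y y0 (et s))"
     using bounds(2)[OF True s1[OF True ne]] by (intro mult_left_mono ennreal_leI) auto
    also have "... = en (sqrt pi * (2 / c)) * en (osc_amplitude h y y0 (et s))"
     using c osc_amplitude_nonneg[OF h] by (simp add: ennreal_mult[symmetric] mult_ac)
    finally show ?thesis using True by simp
   qed (simp add: fiB_def)
  qed
  also have "... = en (sqrt pi * (2 / c)) * (II s. en (osc_amplitude h y y0 (et s)) * ind {aa..be} s)"
   by (rule nn_integral_cmult) measurable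
  also have "... <= en (sqrt pi * (2 / c)) * (2 * en (15 * S))"
  proof (rule mult_left_mono)
   have "(II s. en (osc_amplitude h y y0 (et s)) * ind {aa..be} s) <= 2 * (II v. en (osc_amplitude h y y0 v))"
    by (rule nn_integral_compose_le[OF ab(1) _ det cet']) (use im in \<open>auto simp: et'_def\<close>)
   also have "... <= 2 * en (15 * S)" unfolding S_def H_def by (intro mult_left_mono nn_integral_osc_amplitude[OF h]) simp
   finally show "(II s. en (osc_amplitude h y y0 (et s)) * ind {aa..be} s) <= 2 * en (15 * S)" .
  qed simp
  also have "... = en (sqrt pi * (60 / c * S))"
  proof -
   have "2 * en (15 * S) = en (30 * S)" using ennreal_mult'[of 2 "15 * S"] S by simp
   moreover have "sqrt pi * (2 / c) * (30 * S) = sqrt pi * (60 / c * S)" by simp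
   ultimately show ?thesis using S c by (simp only: ennreal_mult'[symmetric] mult_nonneg_nonneg real_sqrt_ge_zero pi_ge_zero divide_nonneg_pos zero_le_numeral)
  qed
  finally show ?thesis .
 qed
 \<comment> \<open>If an end point of the arc lies on the line, the norm of the kernel is infinite,
   but \<open>q\<close> vanishes there by the choice of \<open>th\<close>.\<close>
 have TC: "(II x. (en (h * \<bar>q s\<bar> * (1 / cmod (Complex x y - ga s))))\<^sup>2) <= en (pi * (4 / c * S)\<^sup>2)" if s: "s \<in> {aa..be}" for s
 proof (cases "t s = 0")
  case True
  then have "q s = 0" by (simp add: q_def th_def)
  then show ?thesis by simp
 next
  case False
  then have ne: "Im (ga s) ~= y" by (simp add: t_def et_def)
  have K2: "(K x s)\<^sup>2 = (en (1 / cmod (Complex x y - ga s)))\<^sup>2" for x by (simp add: K_def)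
  have "(II x. (en (h * \<bar>q s\<bar> * (1 / cmod (Complex x y - ga s))))\<^sup>2) = (II x. (en (h * \<bar>q s\<bar>))\<^sup>2 * (K x s)\<^sup>2)"
   using h by (intro nn_integral_cong) (simp add: K_def ennreal_mult'[symmetric] power_mult_distrib[symmetric])
  also have "... = (en (h * \<bar>q s\<bar>))\<^sup>2 * (II x. (K x s)\<^sup>2)"
   by (rule nn_integral_cmult) measurable
  also have "... = (en (h * \<bar>q s\<bar>) * en (sqrt pi * \<bar>t s\<bar> powr (-1/2)))\<^sup>2"
   unfolding K2 nn_integral_Cauchy_kernel_row(1)[OF ne] by (simp add: t_def et_def power_mult_distrib)
  also have "en (h * \<bar>q s\<bar>) * en (sqrt pi * \<bar>t s\<bar> powr (-1/2)) = en (sqrt pi * (h * \<bar>q s\<bar> * \<bar>t s\<bar> powr (-1/2)))"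
   using h by (simp add: ennreal_mult[symmetric] mult_ac)
  also have "(en (sqrt pi * (h * \<bar>q s\<bar> * \<bar>t s\<bar> powr (-1/2))))\<^sup>2 <= (en (sqrt pi * (4 / c * S)))\<^sup>2"
   by (intro power_mono ennreal_leI mult_left_mono bounds(3)[OF s False]) auto
  also have "... = en (pi * (4 / c * S)\<^sup>2)"
   using c S by (subst ennreal_power, simp) (simp only: sqp)
  finally show ?thesis .
 qed
 define TA where "TA = (%x. II s. fiA s * K x s)"
 define TB where "TB = (%x. II s. fiB s * K2 x s)"
 define T where "T = (%s x. en (h * \<bar>q s\<bar> * (1 / cmod (Complex x y - ga s))))"
 have [measurable]: "TA \<in> bmeas" "TB \<in> bmeas" "T s \<in> bmeas" for s
  unfolding TA_def TB_def T_def CR by measurable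
 have ITA: "(II x. (TA x)\<^sup>2) <= en (pi * WA\<^sup>2 * S\<^sup>2)"
 proof -
  have "(II x. (TA x)\<^sup>2) <= (II s. fiA s * NA s)\<^sup>2"
   unfolding TA_def
  proof (rule nn_integral_Minkowski)
   show "AE s in lborel. fiA s ~= 0 --> (II x. (K x s)\<^sup>2) <= (NA s)\<^sup>2"
    using AE1
   proof eventually_elim
    case (elim s)
    show ?case
    proof
     assume "fiA s ~= 0"
     then have "s \<in> {aa..be}" by (auto simp: fiA_def indicator_def split: if_splits)
     from s1[OF this elim] show "(II x. (K x s)\<^sup>2) <= (NA s)\<^sup>2"
      unfolding K_def NA_def t_def et_def by (subst nn_integral_Cauchy_kernel_row(1)) auto
    qed
   qed
  qed measurable
  also have "... <= (en (sqrt pi * (WA * S)))\<^sup>2" by (intro power_mono NA) simp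
  also have "... = en (pi * WA\<^sup>2 * S\<^sup>2)"
   using c S M ka by (subst ennreal_power) (auto simp: power_mult_distrib WA_def mult.assoc intro!: add_nonneg_nonneg)
  finally show ?thesis .
 qed
 have ITB: "(II x. (TB x)\<^sup>2) <= en (pi * (60 / c)\<^sup>2 * S\<^sup>2)"
 proof -
  have "(II x. (TB x)\<^sup>2) <= (II s. fiB s * NB s)\<^sup>2"
   unfolding TB_def
  proof (rule nn_integral_Minkowski)
   show "AE s in lborel. fiB s ~= 0 --> (II x. (K2 x s)\<^sup>2) <= (NB s)\<^sup>2"
    using AE1
   proof eventually_elim
    case (elim s)
    show ?case
    proof
     assume "fiB s ~= 0"
     then have "s \<in> {aa..be}" by (auto simp: fiB_def indicator_def split: if_splits)
     from s1[OF this elim] show "(II x. (K2 x s)\<^sup>2) <= (NB s)\<^sup>2"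
      unfolding K2_def NB_def t_def et_def by (intro nn_integral_Cauchy_kernel_row(2)) auto
    qed
   qed
  qed measurable
  also have "... <= (en (sqrt pi * (60 / c * S)))\<^sup>2" by (intro power_mono NB) simp
  also have "... = en (pi * (60 / c)\<^sup>2 * S\<^sup>2)"
   using c S(1) by (subst ennreal_power, simp) (simp only: sqp power_mult_distrib[of _ S] mult.assoc)
  finally show ?thesis .
 qed
 define I where "I = (%x. osc_cauchy aa be ga ga' (%s. f s / h) (Complex x y))"
 have "(II x. (en (cmod (I x)))\<^sup>2) <= (II x. 4 * ((TA x)\<^sup>2 + (TB x)\<^sup>2 + (T aa x)\<^sup>2 + (T be x)\<^sup>2))"
 proof (rule nn_integral_mono_AE, use AE_lborel_ne[of "Re (ga s1)"] in eventually_elim)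
  fix x assume x: "x ~= Re (ga s1)"
  have ne: "ga s ~= Complex x y" if "s \<in> {aa..be}" for s
  proof
   assume eq: "ga s = Complex x y"
   then have "t s = 0" by (simp add: t_def et_def)
   then have "s = s1" using s1[OF that] by blast
   then show False using x eq by simp
  qed
  have "en (cmod (I x)) <= TA x + TB x + T aa x + T be x"
  proof -
   have 1: "en (A s * (1 / cmod (Complex x y - ga s))) * ind {aa..be} s = fiA s * K x s" for s
    using A0 by (cases "s \<in> {aa..be}") (simp_all add: fiA_def K_def ennreal_mult[symmetric])
   have 2: "en (h * \<bar>q s\<bar> * (1 / (cmod (Complex x y - ga s))\<^sup>2)) * ind {aa..be} s = fiB s * K2 x s" for s
    using h by (cases "s \<in> {aa..be}") (simp_all add: fiB_def K2_def ennreal_mult[symmetric])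
   have cf: "continuous_on {aa..be} (%s. f s / h)"
    using h by (intro continuous_intros continuous_at_imp_continuous_on ballI DERIV_isCont[OF f(1)]) auto
   have 3: "I x = integral {aa..be} (%s. exp (\<i> * cr (f s / h)) * (ga' s / (Complex x y - ga s)))"
    unfolding I_def by (rule osc_cauchy_integral(1)[OF continuous_on_subset[OF cont(1)] continuous_on_subset[OF cont(2)] cf ne]) auto
   show ?thesis
    unfolding 3 TA_def TB_def T_def 1[symmetric] 2[symmetric] unfolding A_def
    by (rule oscillatory_cauchy_by_parts[OF ab(1) h ga(1) ga(2) continuous_on_subset[OF ga''(1)] ga''(2) unit f(1) continuous_on_subset[OF cont(3)] dq continuous_on_subset[OF cq1] ne]) auto
  qed
  then have "(en (cmod (I x)))\<^sup>2 <= (TA x + TB x + T aa x + T be x)\<^sup>2" by (rule power_mono) simp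
  then show "(en (cmod (I x)))\<^sup>2 <= 4 * ((TA x)\<^sup>2 + (TB x)\<^sup>2 + (T aa x)\<^sup>2 + (T be x)\<^sup>2)"
   using ennreal_sum4_power2 order_trans by blast
 qed
 also have "... = 4 * ((II x. (TA x)\<^sup>2) + (II x. (TB x)\<^sup>2) + (II x. (T aa x)\<^sup>2) + (II x. (T be x)\<^sup>2))"
  by (simp add: nn_integral_cmult nn_integral_add)
 also have "... <= 4 * (en (pi * WA\<^sup>2 * S\<^sup>2) + en (pi * (60 / c)\<^sup>2 * S\<^sup>2) + en (pi * (4 / c * S)\<^sup>2) + en (pi * (4 / c * S)\<^sup>2))"
  using ab unfolding T_def by (intro mult_left_mono add_mono ITA ITB TC) auto
 also have "... = en (4 * (pi * WA\<^sup>2 * S\<^sup>2 + pi * (60 / c)\<^sup>2 * S\<^sup>2 + pi * (4 / c * S)\<^sup>2 + pi * (4 / c * S)\<^sup>2))"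
  by (subst ennreal_mult) (auto simp: ennreal_plus[symmetric] simp del: ennreal_plus)
 also have "4 * (pi * WA\<^sup>2 * S\<^sup>2 + pi * (60 / c)\<^sup>2 * S\<^sup>2 + pi * (4 / c * S)\<^sup>2 + pi * (4 / c * S)\<^sup>2) = osc_const c ka M * S\<^sup>2"
  unfolding osc_const_def WA_def[symmetric] power_mult_distrib[of _ S] by algebra
 also have "S\<^sup>2 = h / max \<bar>y - Im (ga s0)\<bar> (sqrt h)" by (simp add: S(2) H_def y0_def et_def)
 finally show ?thesis unfolding I_def .
qed

section \<open>From horizontal lines to the weighted norm\<close>

lemma jap_mult_ii [simp]: "jap (\<i> * z) = jap z"
 by (simp add: jap_def norm_mult)

lemma wN_mult_ii:
 assumes [measurable]: "F \<in> bmeas"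
 shows "wN ep (%z. F (\<i> * z)) = wN ep F"
proof -
 have "wN ep F = (II z. en (jap (\<i> * z) powr (- 2 * ep) * (cmod (F (\<i> * z)))\<^sup>2))"
  unfolding wN_def by (rule nn_integral_complex_mult_ii[symmetric]) measurable
 then show ?thesis by (simp add: wN_def)
qed

lemma wN_cong_AE: "AE z in lborel. f z = g z ==> wN ep f = wN ep g"
 unfolding wN_def by (rule nn_integral_cong_AE) (auto elim!: eventually_mono)

lemma wN_add_le:
 assumes [measurable]: "a \<in> bmeas" "b \<in> bmeas"
 shows "wN ep (%z. a z + b z) <= 2 * wN ep a + 2 * wN ep b"
proof -
 have "wN ep (%z. a z + b z) <= (II z. 2 * en (jap z powr (- 2 * ep) * (cmod (a z))\<^sup>2) + 2 * en (jap z powr (- 2 * ep) * (cmod (b z))\<^sup>2))"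
  unfolding wN_def
 proof (rule nn_integral_mono)
  fix z
  have "(cmod (a z + b z))\<^sup>2 <= (cmod (a z) + cmod (b z))\<^sup>2" by (intro power_mono norm_triangle_ineq) simp
  also have "... <= 2 * (cmod (a z))\<^sup>2 + 2 * (cmod (b z))\<^sup>2"
   using sum_squares_bound[of "cmod (a z)" "cmod (b z)"] by (simp add: power2_sum)
  finally have "jap z powr (- 2 * ep) * (cmod (a z + b z))\<^sup>2 <= jap z powr (- 2 * ep) * (2 * (cmod (a z))\<^sup>2 + 2 * (cmod (b z))\<^sup>2)"
   by (rule mult_left_mono) simp
  then have "en (jap z powr (- 2 * ep) * (cmod (a z + b z))\<^sup>2) <= en (2 * (jap z powr (- 2 * ep) * (cmod (a z))\<^sup>2) + 2 * (jap z powr (- 2 * ep) * (cmod (b z))\<^sup>2))"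
   by (intro ennreal_leI) (simp add: distrib_left mult_ac)
  then show "en (jap z powr (- 2 * ep) * (cmod (a z + b z))\<^sup>2) <= 2 * en (jap z powr (- 2 * ep) * (cmod (a z))\<^sup>2) + 2 * en (jap z powr (- 2 * ep) * (cmod (b z))\<^sup>2)"
   by (simp add: ennreal_mult)
 qed
 also have "... = 2 * wN ep a + 2 * wN ep b" unfolding wN_def by (simp add: nn_integral_add nn_integral_cmult)
 finally show ?thesis .
qed

lemma nn_integral_inverse_max:
 assumes s: "0 < s" "s <= R"
 shows "(II t. en (1 / max \<bar>t\<bar> s) * ind {-R..R} t) <= en (2 + 2 * ln R - 2 * ln s)"
proof -
 have "(II t. en (1 / max \<bar>t\<bar> s) * ind {-R..R} t) = 2 * (II t. en (1 / max \<bar>t\<bar> s) * ind {-R..R} t * ind {0..} t)"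
  by (rule nn_integral_even) (auto simp: indicator_def)
 also have "... <= 2 * (II t. en (1 / s) * ind {0..s} t + en (1 / t) * ind {s..R} t)"
 proof (intro mult_left_mono nn_integral_mono)
  fix t
  show "en (1 / max \<bar>t\<bar> s) * ind {-R..R} t * ind {0..} t <= en (1 / s) * ind {0..s} t + en (1 / t) * ind {s..R} t"
  proof (cases "0 <= t \<and> t <= R")
   case True
   show ?thesis
   proof (cases "t <= s")
    case True
    then have "max \<bar>t\<bar> s = s" "t \<in> {0..s}" using \<open>0 <= t \<and> t <= R\<close> by auto
    then show ?thesis using \<open>0 <= t \<and> t <= R\<close> by (simp add: add_increasing2)
   next
    case False
    then have "max \<bar>t\<bar> s = t" "t \<in> {s..R}" using \<open>0 <= t \<and> t <= R\<close> s by auto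
    then show ?thesis using \<open>0 <= t \<and> t <= R\<close> by (simp add: add_increasing)
   qed
  next
   case False
   then have "t \<notin> {-R..R} \<or> t \<notin> {0..}" by auto
   then show ?thesis by auto
  qed
 qed simp
 also have "(II t. en (1 / s) * ind {0..s} t + en (1 / t) * ind {s..R} t)
   = en (1 / s) * en s + (II t. en (1 / t) * ind {s..R} t)"
  using s by (subst nn_integral_add) (auto simp: nn_integral_cmult_indicator)
 also have "(II t. en (1 / t) * ind {s..R} t) = en (ln R - ln s)"
  by (rule nn_integral_FTC_Icc) (use s in \<open>auto intro!: derivative_eq_intros\<close>)
 also have "en (1 / s) * en s = en 1" using s by (simp flip: ennreal_mult)
 also have "2 * (en 1 + en (ln R - ln s)) = en (2 + 2 * ln R - 2 * ln s)"
 proof -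
  have l: "0 <= ln R - ln s" using s by simp
  have "2 + 2 * ln R - 2 * ln s = 2 * (1 + (ln R - ln s))" by simp
  then show ?thesis using l by (simp only: ennreal_mult[of 2] ennreal_plus ennreal_numeral zero_le_numeral zero_le_one add_nonneg_nonneg)
 qed
 finally show ?thesis .
qed

text \<open>Near y0 the integral of 1 / max (|y - y0|) (sqrt h) produces the logarithm. Farther than
  R + 1 from y0 one has sqrt (1 + y^2) <= 2 |y - y0|, and the remaining power 1 + 2 ep of the weight
  is integrable.\<close>

lemma nn_integral_row_weight:
 assumes ep: "0 < ep" and R: "0 <= R"
 obtains C where "0 <= C" "!!h y0. 0 < h ==> h <= 1/2 ==> \<bar>y0\<bar> <= R ==>
  (II y. en (sqrt (1 + y\<^sup>2) powr (- 2 * ep) * (1 / max \<bar>y - y0\<bar> (sqrt h)))) <= en (C * ln (1 / h))"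
proof -
 define J where "J = (II y. en (sqrt (1 + y\<^sup>2) powr (- (1 + 2 * ep))))"
 have "J < \<infinity>" unfolding J_def by (rule nn_integral_one_plus_square_powr) (use ep in simp)
 then obtain j where j: "J = en j" "0 <= j" by (cases J) auto
 define R1 where "R1 = R + 1"
 have R1: "1 <= R1" using R by (simp add: R1_def)
 define C where "C = 2 * (2 * j) + 2 * (2 + 2 * ln R1) + 1"
 have C: "0 <= C" unfolding C_def using j R1 by simp
 have "(II y. en (sqrt (1 + y\<^sup>2) powr (- 2 * ep) * (1 / max \<bar>y - y0\<bar> (sqrt h)))) <= en (C * ln (1 / h))"
  if h: "0 < h" "h <= 1/2" and y0: "\<bar>y0\<bar> <= R" for h y0
 proof -
  have l: "1/2 <= ln (1 / h)"
  proof -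
   have "ln 2 <= ln (1 / h)" using h by (subst ln_le_cancel_iff) (auto simp: field_simps)
   moreover have "1/2 <= ln (2::real)" using ln_le_minus_one[of "1/2 :: real"] by (simp add: ln_div)
   ultimately show ?thesis by linarith
  qed
  have sh: "0 < sqrt h" "sqrt h <= R1" using h R1 by (auto intro: order_trans[of _ 1])
  have "(II y. en (sqrt (1 + y\<^sup>2) powr (- 2 * ep) * (1 / max \<bar>y - y0\<bar> (sqrt h))))
   <= (II y. en (1 / max \<bar>y - y0\<bar> (sqrt h)) * ind {-R1..R1} (y - y0) + 2 * en (sqrt (1 + y\<^sup>2) powr (- (1 + 2 * ep))))"
  proof (rule nn_integral_mono)
   fix y
   have s1: "1 <= sqrt (1 + y\<^sup>2)" by simp
   have mx: "0 < max \<bar>y - y0\<bar> (sqrt h)" using sh by (simp add: less_max_iff_disj)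
   show "en (sqrt (1 + y\<^sup>2) powr (- 2 * ep) * (1 / max \<bar>y - y0\<bar> (sqrt h))) <= en (1 / max \<bar>y - y0\<bar> (sqrt h)) * ind {-R1..R1} (y - y0) + 2 * en (sqrt (1 + y\<^sup>2) powr (- (1 + 2 * ep)))"
   proof (cases "\<bar>y - y0\<bar> <= R1")
    case True
    then have i: "y - y0 \<in> {-R1..R1}" unfolding abs_le_iff atLeastAtMost_iff by linarith
    have "sqrt (1 + y\<^sup>2) powr (- 2 * ep) <= 1" using powr_mono[of "- 2 * ep" 0 "sqrt (1 + y\<^sup>2)"] s1 ep by (simp split: if_splits)
    then have "sqrt (1 + y\<^sup>2) powr (- 2 * ep) * (1 / max \<bar>y - y0\<bar> (sqrt h)) <= 1 * (1 / max \<bar>y - y0\<bar> (sqrt h))"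
     using mx by (intro mult_right_mono) auto
    then have "en (sqrt (1 + y\<^sup>2) powr (- 2 * ep) * (1 / max \<bar>y - y0\<bar> (sqrt h))) <= en (1 / max \<bar>y - y0\<bar> (sqrt h))" by (intro ennreal_leI) simp
    then show ?thesis using i by (simp add: add_increasing2)
   next
    case False
    have "sqrt (1 + y\<^sup>2) <= 1 + \<bar>y\<bar>" by (rule real_le_lsqrt) (auto simp: power2_sum)
    also have "... <= 2 * \<bar>y - y0\<bar>"
    proof -
     have "\<bar>y\<bar> <= \<bar>y - y0\<bar> + \<bar>y0\<bar>" using abs_triangle_ineq[of "y - y0" y0] by simp
     moreover have "R1 < \<bar>y - y0\<bar>" using False by simp
     moreover have "1 + a <= 2 * t" if "a <= t + b" "R1 < t" "b <= R" for a b t :: real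
      using that unfolding R1_def by linarith
     ultimately show ?thesis using y0 by blast
    qed
    also have "... <= 2 * max \<bar>y - y0\<bar> (sqrt h)" by simp
    finally have le: "sqrt (1 + y\<^sup>2) <= 2 * max \<bar>y - y0\<bar> (sqrt h)" .
    have frac: "1 / m <= 2 / q" if "0 < m" "0 < q" "q <= 2 * m" for m q :: real using that by (simp add: field_simps)
    have "1 / max \<bar>y - y0\<bar> (sqrt h) <= 2 / sqrt (1 + y\<^sup>2)" by (rule frac[OF mx _ le]) (use s1 in linarith)
    then have "sqrt (1 + y\<^sup>2) powr (- 2 * ep) * (1 / max \<bar>y - y0\<bar> (sqrt h)) <= sqrt (1 + y\<^sup>2) powr (- 2 * ep) * (2 / sqrt (1 + y\<^sup>2))"
     by (intro mult_left_mono) auto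
    also have "... = 2 * sqrt (1 + y\<^sup>2) powr (- (1 + 2 * ep))"
    proof -
     have "sqrt (1 + y\<^sup>2) powr (- 2 * ep) * sqrt (1 + y\<^sup>2) powr (-1) = sqrt (1 + y\<^sup>2) powr (- 2 * ep + -1)" by (rule powr_add[symmetric])
     moreover have "sqrt (1 + y\<^sup>2) powr (-1) = 1 / sqrt (1 + y\<^sup>2)" using s1 by (simp add: powr_minus_divide)
     moreover have "- 2 * ep + -1 = - (1 + 2 * ep)" by simp
     ultimately have "sqrt (1 + y\<^sup>2) powr (- (1 + 2 * ep)) = sqrt (1 + y\<^sup>2) powr (- 2 * ep) * (1 / sqrt (1 + y\<^sup>2))" by (simp only:)
     then show ?thesis by (simp only: times_divide_eq_right mult_1_right mult.commute[of _ "2::real"] mult.assoc)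
    qed
    finally have "en (sqrt (1 + y\<^sup>2) powr (- 2 * ep) * (1 / max \<bar>y - y0\<bar> (sqrt h))) <= 2 * en (sqrt (1 + y\<^sup>2) powr (- (1 + 2 * ep)))"
     using ennreal_leI by (fastforce simp: ennreal_mult)
    then show ?thesis by (simp add: add_increasing)
   qed
  qed
  also have "... = (II y. en (1 / max \<bar>y - y0\<bar> (sqrt h)) * ind {-R1..R1} (y - y0)) + 2 * J"
   unfolding J_def by (subst nn_integral_add) (auto simp: nn_integral_cmult)
  also have "(II y. en (1 / max \<bar>y - y0\<bar> (sqrt h)) * ind {-R1..R1} (y - y0)) = (II t. en (1 / max \<bar>t\<bar> (sqrt h)) * ind {-R1..R1} t)"
   by (rule nn_integral_real_translate[where F="%t. en (1 / max \<bar>t\<bar> (sqrt h)) * ind {-R1..R1} t"]) measurable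
  also have "... + 2 * J <= en (2 + 2 * ln R1 - 2 * ln (sqrt h)) + 2 * J"
   by (intro add_right_mono nn_integral_inverse_max sh)
  also have "... = en ((2 + 2 * ln R1 + ln (1 / h)) + 2 * j)"
  proof -
   have "2 * ln (sqrt h) = - ln (1 / h)" using h by (simp add: ln_sqrt ln_div)
   moreover have "0 <= 2 + 2 * ln R1 + ln (1 / h)" using R1 l by simp
   ultimately show ?thesis using j by (simp add: ennreal_mult ennreal_plus)
  qed
  also have "... <= en (C * ln (1 / h))"
  proof (rule ennreal_leI)
   define Q where "Q = 2 * (2 * j) + 2 * (2 + 2 * ln R1)"
   have "Q * (1/2) <= Q * ln (1 / h)" unfolding Q_def using l j R1 by (intro mult_left_mono) auto
   moreover have "(2 + 2 * ln R1 + ln (1 / h)) + 2 * j = Q * (1/2) + ln (1 / h)" by (simp add: Q_def)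
   moreover have "C * ln (1 / h) = Q * ln (1 / h) + ln (1 / h)" by (simp add: C_def Q_def distrib_right)
   ultimately show "(2 + 2 * ln R1 + ln (1 / h)) + 2 * j <= C * ln (1 / h)" by linarith
  qed
  finally show ?thesis .
 qed
 then show ?thesis using that[OF C] by blast
qed

text \<open>On the line at height y the weight is at most its value at x = 0, so it leaves the inner
  integral. The bounds on the lines are then summed with \<open>nn_integral_row_weight\<close>,
  uniformly in \<open>F\<close>, h and the critical height.\<close>

lemma wN_le_of_rows:
 assumes ep: "0 < ep" and R: "0 <= R"
 obtains C where "0 <= C" "!!F h y0 K. F \<in> bmeas ==> 0 < h ==> h <= 1/2 ==> \<bar>y0\<bar> <= R ==> 0 <= K ==>
  (!!y. (II x. (en (cmod (F (Complex x y))))\<^sup>2) <= en (K * (h / max \<bar>y - y0\<bar> (sqrt h)))) ==>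
  wN ep F <= en (K * C * (h * ln (1 / h)))"
proof -
 show ?thesis
 proof (rule nn_integral_row_weight[OF ep R])
 fix C assume C: "0 <= C" "!!h y0. 0 < h ==> h <= 1/2 ==> \<bar>y0\<bar> <= R ==>
  (II y. en (sqrt (1 + y\<^sup>2) powr (- 2 * ep) * (1 / max \<bar>y - y0\<bar> (sqrt h)))) <= en (C * ln (1 / h))"
 have "wN ep F <= en (K * C * (h * ln (1 / h)))"
  if F [measurable]: "F \<in> bmeas" and h: "0 < h" "h <= 1/2" and y0: "\<bar>y0\<bar> <= R" and K: "0 <= K"
   and row: "!!y. (II x. (en (cmod (F (Complex x y))))\<^sup>2) <= en (K * (h / max \<bar>y - y0\<bar> (sqrt h)))"
  for F h y0 K
 proof -
  have CR: "Complex x y = cr x + \<i> * cr y" for x y by (simp add: complex_eq_iff)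
  have [measurable]: "(%x. F (Complex x y)) \<in> bmeas" for y unfolding CR by measurable
  have "wN ep F = (II y. II x. en (jap (Complex x y) powr (- 2 * ep) * (cmod (F (Complex x y)))\<^sup>2))"
   unfolding wN_def by (rule nn_integral_complex(1)) measurable
  also have "... <= (II y. en (K * h) * en (sqrt (1 + y\<^sup>2) powr (- 2 * ep) * (1 / max \<bar>y - y0\<bar> (sqrt h))))"
  proof (rule nn_integral_mono)
   fix y
   have mx: "0 < max \<bar>y - y0\<bar> (sqrt h)" using h by (simp add: less_max_iff_disj)
   have "(II x. en (jap (Complex x y) powr (- 2 * ep) * (cmod (F (Complex x y)))\<^sup>2))
    <= (II x. en (sqrt (1 + y\<^sup>2) powr (- 2 * ep)) * (en (cmod (F (Complex x y))))\<^sup>2)"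
   proof (rule nn_integral_mono)
    fix x
    have "sqrt (1 + y\<^sup>2) <= jap (Complex x y)" unfolding jap_def by (simp add: cmod_power2)
    then have "jap (Complex x y) powr (- 2 * ep) <= sqrt (1 + y\<^sup>2) powr (- 2 * ep)"
     using ep by (intro powr_mono2') (auto simp: add_pos_nonneg)
    then have "jap (Complex x y) powr (- 2 * ep) * (cmod (F (Complex x y)))\<^sup>2 <= sqrt (1 + y\<^sup>2) powr (- 2 * ep) * (cmod (F (Complex x y)))\<^sup>2"
     by (rule mult_right_mono) simp
    then have "en (jap (Complex x y) powr (- 2 * ep) * (cmod (F (Complex x y)))\<^sup>2) <= en (sqrt (1 + y\<^sup>2) powr (- 2 * ep) * (cmod (F (Complex x y)))\<^sup>2)" by (rule ennreal_leI)
    then show "en (jap (Complex x y) powr (- 2 * ep) * (cmod (F (Complex x y)))\<^sup>2) <= en (sqrt (1 + y\<^sup>2) powr (- 2 * ep)) * (en (cmod (F (Complex x y))))\<^sup>2"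
     by (simp add: ennreal_mult ennreal_power)
   qed
   also have "... = en (sqrt (1 + y\<^sup>2) powr (- 2 * ep)) * (II x. (en (cmod (F (Complex x y))))\<^sup>2)"
    by (rule nn_integral_cmult) measurable
   also have "... <= en (sqrt (1 + y\<^sup>2) powr (- 2 * ep)) * en (K * (h / max \<bar>y - y0\<bar> (sqrt h)))"
    by (rule mult_left_mono[OF row]) simp
   also have "... = en (K * h) * en (sqrt (1 + y\<^sup>2) powr (- 2 * ep) * (1 / max \<bar>y - y0\<bar> (sqrt h)))"
    using K h mx by (simp add: ennreal_mult[symmetric] mult_ac)
   finally show "(II x. en (jap (Complex x y) powr (- 2 * ep) * (cmod (F (Complex x y)))\<^sup>2)) <= en (K * h) * en (sqrt (1 + y\<^sup>2) powr (- 2 * ep) * (1 / max \<bar>y - y0\<bar> (sqrt h)))" .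
  qed
  also have "... = en (K * h) * (II y. en (sqrt (1 + y\<^sup>2) powr (- 2 * ep) * (1 / max \<bar>y - y0\<bar> (sqrt h))))"
   by (rule nn_integral_cmult) measurable
  also have "... <= en (K * h) * en (C * ln (1 / h))"
   by (rule mult_left_mono[OF C(2)[OF h y0]]) simp
  also have "... = en (K * h * (C * ln (1 / h)))" using K h by (simp add: ennreal_mult')
  finally show ?thesis by (simp add: mult_ac)
 qed
 then show ?thesis using that[OF C(1)] by blast
 qed
qed

text \<open>\<open>s0\<close> minimises |f1| and need not be a zero, so arcs without a critical
  point are covered as well. If the minimum is at least 1/2, the claim follows from |s - s0| <= 1.
  Otherwise |f1| <= 1 on the whole short interval, so |f2| is bounded below there, and |f1 s - f1
  s0| <= 2 |f1 s| finishes by the mean value theorem.\<close>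

lemma almost_stationary_point:
 fixes f1 f2 :: "real => real"
 assumes ab: "aa <= be" "be <= aa + 1" and ka: "0 < ka" "M * (be - aa) <= 1/2"
  and f1: "!!s. (f1 has_real_derivative f2 s) (at s)" "!!s. \<bar>f2 s\<bar> <= M"
  and f2: "!!s. \<bar>f1 s\<bar> <= 1 ==> ka <= \<bar>f2 s\<bar>"
 obtains s0 where "s0 \<in> {aa..be}" "!!s. s \<in> {aa..be} ==> min (1/2) (ka / 2) * \<bar>s - s0\<bar> <= \<bar>f1 s\<bar>"
proof -
 have mvt: "\<exists>z. min r s <= z \<and> z <= max r s \<and> f1 s - f1 r = (s - r) * f2 z" for r s
 proof (cases r s rule: linorder_cases)
  case less
  from MVT2[OF less, of f1 f2] f1(1) obtain z where "r < z" "z < s" "f1 s - f1 r = (s - r) * f2 z" by blast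
  then show ?thesis using less by (intro exI[of _ z]) auto
 next
  case greater
  from MVT2[OF greater, of f1 f2] f1(1) obtain z where z: "s < z" "z < r" "f1 r - f1 s = (r - s) * f2 z" by blast
  then have "f1 s - f1 r = (s - r) * f2 z" by (simp add: algebra_simps)
  then show ?thesis using greater z by (intro exI[of _ z]) auto
 qed auto
 have "continuous_on {aa..be} (%s. \<bar>f1 s\<bar>)"
  by (intro continuous_intros continuous_at_imp_continuous_on ballI DERIV_isCont[OF f1(1)])
 from continuous_attains_inf[OF compact_Icc _ this] ab obtain s0 where s0: "s0 \<in> {aa..be}" "!!s. s \<in> {aa..be} ==> \<bar>f1 s0\<bar> <= \<bar>f1 s\<bar>"
  by fastforce
 have "min (1/2) (ka / 2) * \<bar>s - s0\<bar> <= \<bar>f1 s\<bar>" if s: "s \<in> {aa..be}" for s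
 proof (cases "1/2 <= \<bar>f1 s0\<bar>")
  case True
  have "\<bar>s - s0\<bar> <= 1" using s s0(1) ab by auto
  then have "min (1/2) (ka / 2) * \<bar>s - s0\<bar> <= 1/2 * 1" using ka by (intro mult_mono) auto
  then show ?thesis using True s0(2)[OF s] by linarith
 next
  case False
  have M0: "0 <= M" using order_trans[OF abs_ge_zero f1(2)] .
  obtain z where z: "min s0 s <= z" "z <= max s0 s" "f1 s - f1 s0 = (s - s0) * f2 z" using mvt[of s0 s] by blast
  have zJ: "z \<in> {aa..be}" using z(1,2) s s0(1) by (auto simp: min_def max_def split: if_splits)
  obtain w where w: "f1 z - f1 s0 = (z - s0) * f2 w" using mvt[of s0 z] by blast
  have "\<bar>f1 z - f1 s0\<bar> <= (be - aa) * M"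
  proof -
   have "\<bar>z - s0\<bar> <= be - aa" using zJ s0(1) by auto
   then show ?thesis unfolding w abs_mult using f1(2)[of w] ab by (intro mult_mono) auto
  qed
  then have "\<bar>f1 z\<bar> <= 1" using False ka(2) by (simp add: mult.commute)
  from f2[OF this] have "ka * \<bar>s - s0\<bar> <= \<bar>f1 s - f1 s0\<bar>" unfolding z(3) abs_mult
   by (subst mult.commute) (rule mult_left_mono, auto)
  also have "... <= 2 * \<bar>f1 s\<bar>" using s0(2)[OF s] by linarith
  finally have "ka / 2 * \<bar>s - s0\<bar> <= \<bar>f1 s\<bar>" by simp
  moreover have "min (1/2) (ka / 2) * \<bar>s - s0\<bar> <= ka / 2 * \<bar>s - s0\<bar>" by (intro mult_right_mono) auto
  ultimately show ?thesis by linarith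
 qed
 then show ?thesis using that s0(1) by blast
qed

text \<open>On a short arc the tangent turns by at most 1/5. A quarter turn of the plane gives the
  initial tangent an imaginary part of at least 7/10, which leaves 1/2 along the arc; the weighted
  norm is invariant under quarter turns. The constant depends only on ep, the radius and the
  curvature bounds.\<close>

lemma osc_cauchy_piece_wN:
 assumes ep: "0 < ep" and R: "0 <= R" and ka: "0 < ka0" "0 < ka1"
 obtains C where "0 <= C" "!!aa be ga ga' ga'' k h. aa <= be ==> be <= aa + 1 ==> 5 * ka1 * (be - aa) <= 1 ==>
   (!!s. (ga has_vector_derivative ga' s) (at s)) ==> (!!s. (ga' has_vector_derivative ga'' s) (at s)) ==>
   continuous_on UNIV ga'' ==> (!!s. cmod (ga'' s) <= ka1) ==> (!!s. \<exists>r\<ge>ka0. ga'' s = cr r * (\<i> * ga' s)) ==>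
   (!!s. cmod (ga' s) = 1) ==> (!!s. cmod (ga s) <= R) ==> 0 < h ==> h <= 1/2 ==> cmod k = 1 / h ==>
   wN ep (osc_cauchy aa be ga ga' (%s. - 2 * Im (k * ga s))) <= en (C * (h * ln (1 / h)))"
proof -
 obtain C where C: "0 <= C" "!!F h y0 K. F \<in> bmeas ==> 0 < h ==> h <= 1/2 ==> \<bar>y0\<bar> <= R ==> 0 <= K ==>
  (!!y. (II x. (en (cmod (F (Complex x y))))\<^sup>2) <= en (K * (h / max \<bar>y - y0\<bar> (sqrt h)))) ==>
  wN ep F <= en (K * C * (h * ln (1 / h)))" using wN_le_of_rows[OF ep R] by metis
 define c where "c = min (1/2) (ka0 / 2)"
 have c: "0 < c" "c <= 1" using ka by (auto simp: c_def)
 define K where "K = osc_const c ka1 (2 * ka1)"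
 have K: "0 <= K" unfolding K_def by (rule osc_const_nonneg)
 have main: "wN ep (osc_cauchy aa be ga ga' (%s. - 2 * Im (k * ga s))) <= en (K * C * (h * ln (1 / h)))"
  if ab: "aa <= be" "be <= aa + 1" "5 * ka1 * (be - aa) <= 1"
   and dga: "!!s. (ga has_vector_derivative ga' s) (at s)" and dga': "!!s. (ga' has_vector_derivative ga'' s) (at s)"
   and cga'': "continuous_on UNIV ga''" and bga'': "!!s. cmod (ga'' s) <= ka1"
   and curv: "!!s. \<exists>r\<ge>ka0. ga'' s = cr r * (\<i> * ga' s)"
   and unit: "!!s. cmod (ga' s) = 1" and bd: "!!s. cmod (ga s) <= R" and h: "0 < h" "h <= 1/2" and k: "cmod k = 1 / h"
  for aa be ga ga' ga'' k h
 proof -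
  have cont: "continuous_on UNIV ga" "continuous_on UNIV ga'"
   using has_vector_derivative_continuous[OF dga] has_vector_derivative_continuous[OF dga']
   by (blast intro: continuous_at_imp_continuous_on)+
  define f where "f = (%s. - 2 * Im (cr h * k * ga s))"
  define f1 where "f1 = (%s. - 2 * Im (cr h * k * ga' s))"
  define f2 where "f2 = (%s. - 2 * Im (cr h * k * ga'' s))"
  have hk: "cmod (cr h * k) = 1" using h k by (simp add: norm_mult)
  have dIm: "((%s. - 2 * Im (cr h * k * u s)) has_real_derivative - 2 * Im (cr h * k * u')) (at s)"
   if "(u has_vector_derivative u') (at s)" for u u' s
  proof -
   have "((%s. cr h * k * u s) has_vector_derivative cr h * k * u') (at s)"
    by (rule has_vector_derivative_mult_right[OF that])
   then have "((%s. Im (cr h * k * u s)) has_real_derivative Im (cr h * k * u')) (at s)"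
    unfolding has_vector_derivative_complex_iff by blast
   from DERIV_cmult[OF this, of "-2"] show ?thesis by simp
  qed
  have df: "(f has_real_derivative f1 s) (at s)" "(f1 has_real_derivative f2 s) (at s)" for s
   unfolding f_def f1_def f2_def by (intro dIm dga dga')+
  have cf2: "continuous_on UNIV f2" unfolding f2_def by (intro continuous_intros cga'')
  have f2M: "\<bar>f2 s\<bar> <= 2 * ka1" for s
   using abs_Im_le_cmod[of "cr h * k * ga'' s"] bga''[of s] unfolding f2_def norm_mult[of "cr h * k"] hk by simp
  \<comment> \<open>With the unit vector u = h k ga' one has f1 = - 2 Im u and f2 = - 2 r Re u, r
    being the curvature. Hence |f1| <= 1 forces |Re u| >= 1/2, and positive curvature makes the
    critical point nondegenerate.\<close>
  have f2ka: "ka0 <= \<bar>f2 s\<bar>" if "\<bar>f1 s\<bar> <= 1" for s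
  proof -
   obtain r where r: "r \<ge> ka0" "ga'' s = cr r * (\<i> * ga' s)" using curv by blast
   define u where "u = cr h * k * ga' s"
   have u: "(Re u)\<^sup>2 + (Im u)\<^sup>2 = 1" unfolding cmod_power2[symmetric] by (simp add: u_def norm_mult[of "cr h * k"] hk unit)
   have "cr h * k * ga'' s = cr r * (\<i> * u)" unfolding r(2) u_def by (simp add: mult_ac)
   then have f2: "f2 s = - 2 * r * Re u" unfolding f2_def by simp
   have "\<bar>Im u\<bar> <= 1/2" using that unfolding f1_def u_def[symmetric] by simp
   then have "(Im u)\<^sup>2 <= (1/2)\<^sup>2" by (metis abs_ge_zero power2_abs power_mono)
   then have "(1/2)\<^sup>2 <= \<bar>Re u\<bar>\<^sup>2" using u by (simp add: power2_eq_square)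
   then have "1/2 <= \<bar>Re u\<bar>" by (rule power2_le_imp_le) simp
   then have "ka0 * 1 <= r * (2 * \<bar>Re u\<bar>)" using r ka by (intro mult_mono) auto
   then show ?thesis unfolding f2 using r ka by (simp add: abs_mult)
  qed
  have small: "2 * ka1 * (be - aa) <= 1/2" using ab ka by simp
  obtain s0 where s0: "s0 \<in> {aa..be}" "!!s. s \<in> {aa..be} ==> c * \<bar>s - s0\<bar> <= \<bar>f1 s\<bar>"
   unfolding c_def using almost_stationary_point[OF ab(1,2) ka(1) small df(2) f2M f2ka] by metis
  have fh: "f s / h = - 2 * Im (k * ga s)" for s using h by (simp add: f_def mult.assoc)
  have cfh: "continuous_on UNIV (%s. f s / h)" unfolding fh by (intro continuous_intros cont)
  have dir: "wN ep (osc_cauchy aa be (%s. j * ga s) (%s. j * ga' s) (%s. f s / h)) <= en (K * C * (h * ln (1 / h)))"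
   if j: "cmod j = 1" "7/10 <= Im (j * ga' aa)" for j
  proof (rule C(2))
   show "osc_cauchy aa be (%s. j * ga s) (%s. j * ga' s) (%s. f s / h) \<in> bmeas"
    by (rule osc_cauchy_measurable) (intro continuous_intros cont cfh)+
   show "\<bar>Im (j * ga s0)\<bar> <= R" using abs_Im_le_cmod[of "j * ga s0"] bd[of s0] j by (simp add: norm_mult)
   show "(II x. (en (cmod (osc_cauchy aa be (%s. j * ga s) (%s. j * ga' s) (%s. f s / h) (Complex x y))))\<^sup>2)
     <= en (K * (h / max \<bar>y - Im (j * ga s0)\<bar> (sqrt h)))" for y
    unfolding K_def
   proof (rule oscillatory_cauchy_piece[OF ab(1,2) h(1) c, where ga''="%s. j * ga'' s" and ?f1.0=f1 and ?f2.0=f2])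
    fix s assume s: "s \<in> {aa..be}"
    have "cmod (ga' s - ga' aa) <= ka1 * (s - aa)"
    proof -
     have "norm (ga' s - ga' aa) <= ka1 * norm (s - aa)"
     proof (rule differentiable_bound[OF convex_UNIV])
      show "(ga' has_derivative (%x. x *\<^sub>R ga'' s)) (at s within UNIV)" for s
       using dga'[of s] by (simp add: has_vector_derivative_def)
      show "onorm (%x. x *\<^sub>R ga'' s) <= ka1" for s
       by (rule onorm_le) (simp add: mult.commute[of ka1] mult_left_mono bga'')
     qed auto
     then show ?thesis using s by simp
    qed
    also have "... <= ka1 * (be - aa)" using s ka by (intro mult_left_mono) auto
    also have "... <= 1/5" using ab(3) by simp
    finally have "cmod (j * ga' s - j * ga' aa) <= 1/5" using j by (simp add: norm_mult flip: right_diff_distrib)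
    then have "\<bar>Im (j * ga' s) - Im (j * ga' aa)\<bar> <= 1/5" using abs_Im_le_cmod[of "j * ga' s - j * ga' aa"] by (simp only: minus_complex.sel)
    then show "1/2 <= Im (j * ga' s)" using j(2) unfolding abs_le_iff by linarith
   next
    show "cmod (j * ga'' s) <= ka1" "cmod (j * ga' s) = 1" for s using bga''[of s] unit[of s] j by (simp_all add: norm_mult)
    show "continuous_on UNIV (%s. j * ga'' s)" by (intro continuous_intros cga'')
   qed (use df cf2 f2M s0 has_vector_derivative_mult_right[OF dga, of j] has_vector_derivative_mult_right[OF dga', of j] in \<open>simp_all\<close>)
  qed (use h K in auto)
  \<comment> \<open>Turning curve and evaluation point together leaves the integral unchanged, while
    the phase is kept as a function of the parameter. Iteration reaches the four factors 1, i, -1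
    and -i.\<close>
  have rot: "wN ep (osc_cauchy aa be (%s. j * ga s) (%s. j * ga' s) (%s. f s / h)) = wN ep (osc_cauchy aa be (%s. \<i> * (j * ga s)) (%s. \<i> * (j * ga' s)) (%s. f s / h))" for j
  proof -
   have "osc_cauchy aa be (%s. \<i> * (j * ga s)) (%s. \<i> * (j * ga' s)) (%s. f s / h) \<in> bmeas"
    by (rule osc_cauchy_measurable) (intro continuous_intros cont cfh)+
   from wN_mult_ii[OF this, of ep] show ?thesis by (simp add: osc_cauchy_mult_ii)
  qed
  have r1: "wN ep (osc_cauchy aa be ga ga' (%s. f s / h)) = wN ep (osc_cauchy aa be (%s. \<i> * ga s) (%s. \<i> * ga' s) (%s. f s / h))" using rot[of 1] by simp
  have r2: "wN ep (osc_cauchy aa be ga ga' (%s. f s / h)) = wN ep (osc_cauchy aa be (%s. (-1) * ga s) (%s. (-1) * ga' s) (%s. f s / h))" using r1 rot[of "\<i>"] by (simp add: mult.assoc[symmetric])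
  have r3: "wN ep (osc_cauchy aa be ga ga' (%s. f s / h)) = wN ep (osc_cauchy aa be (%s. (-\<i>) * ga s) (%s. (-\<i>) * ga' s) (%s. f s / h))" using r2 rot[of "-1"] by simp
  have "(Re (ga' aa))\<^sup>2 + (Im (ga' aa))\<^sup>2 = 1" unfolding cmod_power2[symmetric] by (simp add: unit)
  \<comment> \<open>For a unit vector both coordinates cannot be below 7/10 in modulus, because 2
    (7/10)^2 < 1.\<close>
  then have "7/10 <= \<bar>Re (ga' aa)\<bar> \<or> 7/10 <= \<bar>Im (ga' aa)\<bar>"
  proof -
   have "a\<^sup>2 <= (7/10)\<^sup>2" if "\<not> 7/10 <= \<bar>a\<bar>" for a :: real
    using power_mono[of "\<bar>a\<bar>" "7/10" 2] that by simp
   note sq = this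
   show ?thesis
   proof (rule ccontr)
    assume "\<not> ?thesis"
    then have "(Re (ga' aa))\<^sup>2 <= (7/10)\<^sup>2" "(Im (ga' aa))\<^sup>2 <= (7/10)\<^sup>2" using sq by blast+
    then show False using \<open>(Re (ga' aa))\<^sup>2 + (Im (ga' aa))\<^sup>2 = 1\<close> by (simp add: power2_eq_square)
   qed
  qed
  then consider "7/10 <= Im (ga' aa)" | "7/10 <= Re (ga' aa)" | "7/10 <= - Im (ga' aa)" | "7/10 <= - Re (ga' aa)" by linarith
  then have "wN ep (osc_cauchy aa be ga ga' (%s. f s / h)) <= en (K * C * (h * ln (1 / h)))"
  proof cases
   case 1 then show ?thesis using dir[of 1] by simp
  next
   case 2 then show ?thesis unfolding r1 by (intro dir) auto
  next
   case 3 then show ?thesis unfolding r2 by (intro dir) auto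
  next
   case 4 then show ?thesis unfolding r3 by (intro dir) auto
  qed
  then show ?thesis unfolding fh .
 qed
 have "0 <= K * C" using K C by simp
 then show ?thesis
 proof (rule that)
  fix aa be ga ga' ga'' k h
  assume a: "aa <= be" "be <= aa + 1" "5 * ka1 * (be - aa) <= 1" "!!s. (ga has_vector_derivative ga' s) (at s)" "!!s. (ga' has_vector_derivative ga'' s) (at s)"
   "continuous_on UNIV ga''" "!!s. cmod (ga'' s) <= ka1" "!!s. \<exists>r\<ge>ka0. ga'' s = cr r * (\<i> * ga' s)"
   "!!s. cmod (ga' s) = 1" "!!s. cmod (ga s) <= R" "0 < h" "h <= 1/2" "cmod k = 1 / h"
  show "wN ep (osc_cauchy aa be ga ga' (%s. - 2 * Im (k * ga s))) <= en (K * C * (h * ln (1 / h)))"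
   by (rule main[OF a])
 qed
qed

lemma frontier_null_sets: "convex (Om :: complex set) ==> frontier Om \<in> null_sets lborel"
 using negligible_convex_frontier[of Om] by (simp add: negligible_iff_null_sets null_sets_completion_iff)

context convex_curve
begin

text \<open>The closed curve is cut into N equal arcs short enough for
  \<open>osc_cauchy_piece_wN\<close>. Adding an arc doubles the constant, but N depends only on the
  length and the curvature bound, so the result stays uniform in h and k.\<close>

lemma oscillatory_boundary_bound:
 assumes ep: "0 < ep" and ka0: "0 < ka0"
  and dga': "!!s. (ga' has_vector_derivative ga'' s) (at s)" and cga'': "continuous_on UNIV ga''" and bga'': "!!s. cmod (ga'' s) <= ka1"
  and curv: "!!s. \<exists>r\<ge>ka0. ga'' s = cr r * (\<i> * ga' s)"
 obtains C where "0 <= C" "!!h k. 0 < h ==> h <= 1/2 ==> cmod k = 1 / h ==>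
   wN ep (osc_cauchy 0 L ga ga' (%s. - 2 * Im (k * ga s))) <= en (C * (h * ln (1 / h)))"
proof -
 have "bounded (closure Om)" using bdd by (rule bounded_closure)
 then obtain R where R: "!!w. w \<in> closure Om ==> cmod w <= R" unfolding bounded_iff by blast
 have Rga: "cmod (ga s) <= R" for s using R[OF ga_closure] .
 have R0: "0 <= R" using order_trans[OF norm_ge_zero Rga] .
 have ka1: "0 < ka1"
 proof -
  obtain r where "r \<ge> ka0" "ga'' 0 = cr r * (\<i> * ga' 0)" using curv by blast
  then have "cmod (ga'' 0) = r" using ka0 unit[of 0] by (simp add: norm_mult)
  then show ?thesis using bga''[of 0] ka0 \<open>r \<ge> ka0\<close> by linarith
 qed
 show ?thesis
 proof (rule osc_cauchy_piece_wN[OF ep R0 ka0 ka1])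
 fix C assume C: "0 <= C" "!!aa be ga ga' ga'' k h. aa <= be ==> be <= aa + 1 ==> 5 * ka1 * (be - aa) <= 1 ==>
   (!!s. (ga has_vector_derivative ga' s) (at s)) ==> (!!s. (ga' has_vector_derivative ga'' s) (at s)) ==>
   continuous_on UNIV ga'' ==> (!!s. cmod (ga'' s) <= ka1) ==> (!!s. \<exists>r\<ge>ka0. ga'' s = cr r * (\<i> * ga' s)) ==>
   (!!s. cmod (ga' s) = 1) ==> (!!s. cmod (ga s) <= R) ==> 0 < h ==> h <= 1/2 ==> cmod k = 1 / h ==>
   wN ep (osc_cauchy aa be ga ga' (%s. - 2 * Im (k * ga s))) <= en (C * (h * ln (1 / h)))"
 define l where "l = min 1 (1 / (5 * ka1))"
 have l: "0 < l" "l <= 1" "5 * ka1 * l <= 1"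
 proof -
  show "0 < l" "l <= 1" using ka1 by (auto simp: l_def)
  have "5 * ka1 * l <= 5 * ka1 * (1 / (5 * ka1))" using ka1 by (intro mult_left_mono) (auto simp: l_def)
  then show "5 * ka1 * l <= 1" using ka1 by simp
 qed
 obtain N :: nat where N: "0 < N" "L / real N <= l"
 proof -
  obtain n :: nat where n: "L / l < real n" using reals_Archimedean2 by blast
  have "0 < L / l" using L l by simp
  then have "0 < real n" using n by linarith
  then have "0 < n" "L / real n <= l" using n l by (auto simp: field_simps)
  then show ?thesis using that by blast
 qed
 define m where "m = L / real N"
 have m: "0 < m" "m <= 1" "5 * ka1 * m <= 1"
 proof -
  show "0 < m" using N L by (simp add: m_def)
  show "m <= 1" unfolding m_def by (rule order_trans[OF N(2) l(2)])
  have "5 * ka1 * m <= 5 * ka1 * l" using ka1 N by (intro mult_left_mono) (auto simp: m_def)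
  then show "5 * ka1 * m <= 1" using l by linarith
 qed
 have "\<exists>D\<ge>0. \<forall>h k. 0 < h --> h <= 1/2 --> cmod k = 1 / h -->
   wN ep (osc_cauchy 0 (real n * m) ga ga' (%s. - 2 * Im (k * ga s))) <= en (D * (h * ln (1 / h)))" for n
 proof (induction n)
  case 0
  have "wN ep (osc_cauchy 0 0 ga ga' (%s. - 2 * Im (k * ga s))) <= en (C * (h * ln (1 / h)))"
   if "0 < h" "h <= 1/2" "cmod k = 1 / h" for h k
   by (rule C(2)[OF _ _ _ der dga' cga'' bga'' curv unit Rga that]) auto
  then show ?case using C(1) by auto
 next
  case (Suc n)
  then obtain D where D: "0 <= D" "!!h k. 0 < h ==> h <= 1/2 ==> cmod k = 1 / h ==>
   wN ep (osc_cauchy 0 (real n * m) ga ga' (%s. - 2 * Im (k * ga s))) <= en (D * (h * ln (1 / h)))" by blast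
  have "wN ep (osc_cauchy 0 (real (Suc n) * m) ga ga' (%s. - 2 * Im (k * ga s))) <= en ((2 * D + 2 * C) * (h * ln (1 / h)))"
   if hk: "0 < h" "h <= 1/2" "cmod k = 1 / h" for h k
  proof -
   define f where "f = (%s. - 2 * Im (k * ga s))"
   have cf: "continuous_on UNIV f" unfolding f_def by (intro continuous_intros cont)
   define p where "p = real n * m"
   have p: "0 <= p" using m by (simp add: p_def)
   have pS: "real (Suc n) * m = p + m" by (simp add: p_def algebra_simps)
   have lh: "0 <= h * ln (1 / h)" using hk by (intro mult_nonneg_nonneg) auto
   \<comment> \<open>Additivity over the arcs is used only off the frontier, where the integrands
     are continuous; the frontier of a convex set is null.\<close>
   have "wN ep (osc_cauchy 0 (p + m) ga ga' f) = wN ep (%z. osc_cauchy 0 p ga ga' f z + osc_cauchy p (p + m) ga ga' f z)"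
   proof (rule wN_cong_AE, rule AE_mp[OF AE_not_in[OF frontier_null_sets[OF cvx]]], rule AE_I2, rule impI)
    fix z assume z: "z \<notin> frontier Om"
    have ne: "ga s ~= z" for s using z ga_frontier[of s] by auto
    note oi = osc_cauchy_integral[OF continuous_on_subset[OF cont] continuous_on_subset[OF cont'] continuous_on_subset[OF cf] ne, OF subset_UNIV subset_UNIV subset_UNIV]
    show "osc_cauchy 0 (p + m) ga ga' f z = osc_cauchy 0 p ga ga' f z + osc_cauchy p (p + m) ga ga' f z"
     unfolding oi(1) by (rule Henstock_Kurzweil_Integration.integral_combine[symmetric]) (use p m oi(2) in auto)
   qed
   also have "... <= 2 * wN ep (osc_cauchy 0 p ga ga' f) + 2 * wN ep (osc_cauchy p (p + m) ga ga' f)"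
    by (rule wN_add_le) (intro osc_cauchy_measurable cont cont' cf)+
   also have "... <= 2 * en (D * (h * ln (1 / h))) + 2 * en (C * (h * ln (1 / h)))"
   proof (intro add_mono mult_left_mono)
    show "wN ep (osc_cauchy 0 p ga ga' f) <= en (D * (h * ln (1 / h)))" unfolding p_def f_def by (rule D(2)[OF hk])
    show "wN ep (osc_cauchy p (p + m) ga ga' f) <= en (C * (h * ln (1 / h)))"
     unfolding f_def by (rule C(2)[OF _ _ _ der dga' cga'' bga'' curv unit Rga hk]) (use m in auto)
   qed auto
   also have "... = en ((2 * D + 2 * C) * (h * ln (1 / h)))"
   proof -
    have "0 <= D * (h * ln (1 / h))" "0 <= C * (h * ln (1 / h))" using D C lh by auto
    moreover have "(2 * D + 2 * C) * (h * ln (1 / h)) = 2 * (D * (h * ln (1 / h))) + 2 * (C * (h * ln (1 / h)))" by (simp only: distrib_right mult.assoc)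
    ultimately show ?thesis by (simp only: ennreal_mult[of 2] ennreal_plus ennreal_numeral zero_le_numeral mult_nonneg_nonneg)
   qed
   finally show ?thesis unfolding pS f_def .
  qed
  then show ?case using D(1) C(1) by (intro exI[of _ "2 * D + 2 * C"]) auto
 qed
 from this[of N] obtain D where D: "0 <= D" "!!h k. 0 < h ==> h <= 1/2 ==> cmod k = 1 / h ==>
   wN ep (osc_cauchy 0 (real N * m) ga ga' (%s. - 2 * Im (k * ga s))) <= en (D * (h * ln (1 / h)))" by blast
 have "real N * m = L" using N by (simp add: m_def)
 then show ?thesis using that D by simp
 qed
qed

end

section \<open>Real analytic curves\<close>

text \<open>Termwise differentiation of the local power series. The conclusion has the form of the
  hypothesis, so the step can be repeated to reach the derivatives of higher order.\<close>

lemma real_analytic_velocity: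
 assumes "real_analytic ga"
 shows "(ga has_vector_derivative velocity ga t) (at t)" and "real_analytic (velocity ga)"
proof -
 have local: "\<exists>a r. 0 < r \<and> (\<forall>t. \<bar>t - t0\<bar> < r --> (ga has_vector_derivative velocity ga t) (at t) \<and> (%n. a n * cr (t - t0) ^ n) sums velocity ga t)" for t0
 proof -
  obtain a r where r: "0 < r" and a: "!!t. \<bar>t - t0\<bar> < r ==> (%n. a n * cr (t - t0) ^ n) sums ga t"
   using assms unfolding real_analytic_def by blast
  \<comment> \<open>The series is known to converge only at real increments; convergence at the real
    point s > |x| gives it in a complex disc containing x.\<close>
  have sm: "summable (%n. a n * x ^ n)" if "norm x < r" for x :: complex
  proof -
   define s where "s = (norm x + r) / 2"
   have s: "norm x < s" "s < r" using that by (auto simp: s_def)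
   have "0 <= s" using s(1) norm_ge_zero[of x] by linarith
   have "summable (%n. a n * cr s ^ n)"
    using a[of "t0 + s"] \<open>0 <= s\<close> s(2) by (auto simp: sums_iff)
   then show ?thesis by (rule powser_inside) (use s \<open>0 <= s\<close> in simp)
  qed
  have der: "(ga has_vector_derivative (\<Sum>n. diffs a n * cr (t - t0) ^ n)) (at t)" if t: "\<bar>t - t0\<bar> < r" for t
  proof -
   have tr: "norm (cr (t - t0)) < r" using t by (simp only: norm_of_real)
   have "((%z. \<Sum>n. a n * z ^ n) has_field_derivative (\<Sum>n. diffs a n * cr (t - t0) ^ n)) (at (cr (t - t0)))"
    by (rule termdiffs_strong'[OF sm tr])
   moreover have "((%t. cr (t - t0)) has_vector_derivative 1) (at t)"
    by (auto intro!: derivative_eq_intros has_vector_derivative_real_field simp: has_vector_derivative_complex_iff)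
   ultimately have "(((%z. \<Sum>n. a n * z ^ n) \<circ> (%t. cr (t - t0))) has_vector_derivative 1 * (\<Sum>n. diffs a n * cr (t - t0) ^ n)) (at t)"
    by (intro field_vector_diff_chain_at)
   then have "((%t. \<Sum>n. a n * cr (t - t0) ^ n) has_vector_derivative (\<Sum>n. diffs a n * cr (t - t0) ^ n)) (at t)"
    by (simp only: o_def mult_1_left)
   then show ?thesis
   proof (rule has_vector_derivative_transform_within_open)
    show "open (ball t0 r)" "t \<in> ball t0 r" using t by (auto simp: dist_real_def abs_minus_commute)
    show "(\<Sum>n. a n * cr (u - t0) ^ n) = ga u" if "u \<in> ball t0 r" for u
     using a[of u] that by (simp only: sums_iff mem_ball dist_real_def abs_minus_commute)
   qed
  qed
  have v: "velocity ga t = (\<Sum>n. diffs a n * cr (t - t0) ^ n)" if "\<bar>t - t0\<bar> < r" for t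
   using der[OF that] by (rule vector_derivative_at)
  show ?thesis
  proof (intro exI[of _ "diffs a"] exI[of _ r] conjI allI impI r)
   fix t assume t: "\<bar>t - t0\<bar> < r"
   show "(ga has_vector_derivative velocity ga t) (at t)" using der[OF t] v[OF t] by simp
   have "summable (%n. diffs a n * cr (t - t0) ^ n)"
    by (rule termdiff_converges[OF _ sm]) (use t in \<open>simp only: norm_of_real\<close>)
   then show "(%n. diffs a n * cr (t - t0) ^ n) sums velocity ga t"
    unfolding v[OF t] by (rule summable_sums)
  qed
 qed
 show "(ga has_vector_derivative velocity ga t) (at t)" using local[of t] by force
 show "real_analytic (velocity ga)" unfolding real_analytic_def using local by blast
qed

lemma periodic_reduce:
 fixes g :: "real => 'a"
 assumes L: "0 < L" and per: "!!t. g (t + L) = g t"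
 shows "\<exists>s\<in>{0..L}. g t = g s"
proof -
 have nat: "g (t + of_nat m * L) = g t" for t m
 proof (induction m)
  case (Suc m)
  have "t + of_nat (Suc m) * L = (t + of_nat m * L) + L" by (simp add: algebra_simps)
  then show ?case using per[of "t + of_nat m * L"] Suc by (simp only:)
 qed simp
 have int: "g (t + of_int n * L) = g t" for t n
 proof (cases "0 <= n")
  case True then show ?thesis using nat[of t "nat n"] by simp
 next
  case False
  then show ?thesis using nat[of "t + of_int n * L" "nat (- n)"] by (simp add: algebra_simps)
 qed
 define s where "s = t - of_int \<lfloor>t / L\<rfloor> * L"
 have "of_int \<lfloor>t / L\<rfloor> * L <= t / L * L" "t / L * L <= (of_int \<lfloor>t / L\<rfloor> + 1) * L"
  using L floor_correct[of "t / L"] by (intro mult_right_mono; simp)+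
 then have "s \<in> {0..L}" using L by (simp add: s_def distrib_right)
 moreover have "g t = g s" using int[of s "\<lfloor>t / L\<rfloor>"] by (simp add: s_def)
 ultimately show ?thesis by blast
qed

text \<open>At unit speed |ga''| is the curvature. Its minimum and maximum over one period turn
  pointwise positivity into uniform bounds \<open>ka0\<close> and \<open>ka1\<close>.\<close>

lemma analytic_domain_curve:
 assumes "strictly_convex_analytic_domain Om"
 obtains L ga ga' ga'' ka0 ka1 where "convex_curve Om L ga ga'" "0 < ka0"
  "!!s. (ga' has_vector_derivative ga'' s) (at s)" "continuous_on UNIV ga''" "!!s. cmod (ga'' s) <= ka1"
  "!!s. \<exists>r\<ge>ka0. ga'' s = cr r * (\<i> * ga' s)"
proof -
 obtain L ga where O: "open Om" "bounded Om" "Om ~= {}" "convex Om" and p: "arclength_boundary_param Om L ga" and an: "real_analytic ga"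
  and ka: "!!t. \<exists>ka>0. vector_derivative (velocity ga) (at t) = cr ka * (\<i> * velocity ga t)"
  using assms unfolding strictly_convex_analytic_domain_def by metis
 define ga' where "ga' = velocity ga"
 define ga'' where "ga'' = velocity ga'"
 have d: "(ga has_vector_derivative ga' t) (at t)" "(ga' has_vector_derivative ga'' t) (at t)" "(ga'' has_vector_derivative velocity ga'' t) (at t)" for t
  unfolding ga''_def ga'_def by (intro real_analytic_velocity an)+
 have c: "continuous_on UNIV ga'" "continuous_on UNIV ga''"
  using has_vector_derivative_continuous[OF d(2)] has_vector_derivative_continuous[OF d(3)]
  by (blast intro: continuous_at_imp_continuous_on)+
 have L: "0 < L" and per: "!!t. ga (t + L) = ga t" and u: "!!t. cmod (ga' t) = 1"
  using p by (auto simp: arclength_boundary_param_def ga'_def)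
 have C: "convex_curve Om L ga ga'"
  using O p d c by unfold_locales (auto simp: arclength_boundary_param_def ga'_def)
 have shift: "g' (t + L) = g' t" if "!!t. g (t + L) = g t" "!!t. (g has_vector_derivative g' t) (at t)" for g g' :: "real => complex" and t
 proof -
  have "((g \<circ> (%t. t + L)) has_vector_derivative 1 *\<^sub>R g' (t + L)) (at t)"
   by (rule vector_diff_chain_at) (use that(2) in \<open>auto intro!: derivative_eq_intros\<close>)
  moreover have "g \<circ> (%t. t + L) = g" using that(1) by (simp add: fun_eq_iff)
  ultimately show ?thesis using that(2)[of t] by (metis scaleR_one vector_derivative_unique_at)
 qed
 have per': "ga' (t + L) = ga' t" for t by (rule shift[OF per d(1)])
 have per'': "ga'' (t + L) = ga'' t" for t by (rule shift[OF per' d(2)])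
 have cn: "continuous_on {0..L} (%s. cmod (ga'' s))"
  by (intro continuous_intros continuous_on_subset[OF c(2)]) auto
 have ne: "{0..L} ~= {}" using L by auto
 obtain s0 where s0: "!!s. s \<in> {0..L} ==> cmod (ga'' s0) <= cmod (ga'' s)"
  using continuous_attains_inf[OF compact_Icc ne cn] by blast
 obtain s1 where s1: "!!s. s \<in> {0..L} ==> cmod (ga'' s) <= cmod (ga'' s1)"
  using continuous_attains_sup[OF compact_Icc ne cn] by blast
 have red: "cmod (ga'' s0) <= cmod (ga'' t) \<and> cmod (ga'' t) <= cmod (ga'' s1)" for t
 proof -
  obtain s where "s \<in> {0..L}" "ga'' t = ga'' s" using periodic_reduce[of L ga'' t, OF L per''] by blast
  then show ?thesis using s0 s1 by simp
 qed
 have curv: "\<exists>r>0. ga'' t = cr r * (\<i> * ga' t) \<and> cmod (ga'' t) = r" for t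
 proof -
  obtain r where r: "r > 0" "ga'' t = cr r * (\<i> * ga' t)" using ka[of t] unfolding ga''_def ga'_def by blast
  then have "cmod (ga'' t) = r" using u[of t] by (simp add: norm_mult)
  then show ?thesis using r by blast
 qed
 show ?thesis
 proof (rule that[OF C _ d(2) c(2)])
  show "0 < cmod (ga'' s0)" using curv[of s0] by auto
  show "cmod (ga'' s) <= cmod (ga'' s1)" for s using red by blast
  show "\<exists>r\<ge>cmod (ga'' s0). ga'' s = cr r * (\<i> * ga' s)" for s
   using curv[of s] red[of s] by auto
 qed
qed

section \<open>The Cauchy transform of an exponential on the domain\<close>

definition osc_exp :: "complex => complex => complex" where
 "osc_exp k w = exp (cnj (k * w) - k * w)"

lemma osc_exp_eq: "osc_exp k w = exp (\<i> * cr (- 2 * Im (k * w)))"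
proof -
 have "cnj (k * w) - k * w = \<i> * cr (- 2 * Im (k * w))" by (simp add: complex_eq_iff)
 then show ?thesis by (simp only: osc_exp_def)
qed

lemma norm_osc_exp [simp]: "cmod (osc_exp k w) = 1"
 unfolding osc_exp_eq by (simp only: norm_exp_i_times)

lemma osc_exp_has_derivative:
 "((%w. c * osc_exp k w) has_derivative (%h. c * ((cnj (k * h) - k * h) * osc_exp k w))) (at w)"
proof -
 have 1: "((%w. cnj (k * w) - k * w) has_derivative (%h. cnj (k * h) - k * h)) (at w)"
  by (auto intro!: derivative_eq_intros)
 have "(exp has_derivative (%h. exp (cnj (k * w) - k * w) * h)) (at (cnj (k * w) - k * w))"
  using DERIV_exp[of "cnj (k * w) - k * w"] unfolding has_field_derivative_def .
 from has_derivative_compose[OF 1 this]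
 have "((%w. osc_exp k w) has_derivative (%h. osc_exp k w * (cnj (k * h) - k * h))) (at w)" unfolding osc_exp_def .
 from has_derivative_mult_right[OF this, of c] show ?thesis by (simp only: mult.commute[of "osc_exp k w"])
qed

text \<open>The free constant closes the induction: each partial derivative only multiplies the
  exponential by another constant.\<close>

lemma C_k_osc_exp: "C_k n (%w. c * osc_exp k w)"
proof (induction n arbitrary: c)
 case 0
 have "isCont (%w. c * osc_exp k w) w" for w using has_derivative_continuous[OF osc_exp_has_derivative] .
 then show ?case by (simp add: continuous_at_imp_continuous_on)
next
 case (Suc n)
 have "partial_x (%w. c * osc_exp k w) = (%w. (c * (cnj k - k)) * osc_exp k w)"
  "partial_y (%w. c * osc_exp k w) = (%w. (c * (cnj (k * \<i>) - k * \<i>)) * osc_exp k w)"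
  by (auto simp: fun_eq_iff partial_eq[OF osc_exp_has_derivative] mult.assoc)
 moreover have "(%w. c * osc_exp k w) differentiable_on UNIV"
  unfolding differentiable_on_def differentiable_def using osc_exp_has_derivative by blast
 ultimately show ?case using Suc by simp
qed

lemma osc_exp_continuous: "continuous_on UNIV (osc_exp k)"
 using C_k_osc_exp[of 0 1 k] by simp

lemma osc_exp_measurable [measurable]: "osc_exp k \<in> bmeas"
 by (rule borel_measurable_continuous_onI[OF osc_exp_continuous])

lemma wirtinger_bar_osc_exp: "wirtinger_bar (osc_exp k) w = cnj k * osc_exp k w"
 using wirtinger_bar_eq(1)[OF osc_exp_has_derivative[of 1 k w]] by (simp add: algebra_simps)

lemma integrable_indicator_bounded:
 fixes g :: "complex => complex"
 assumes Om: "open Om" "bounded Om" and [measurable]: "g \<in> bmeas" and B: "!!w. cmod (g w) <= B"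
 shows "integrable lborel (%w. ind Om w * g w)"
proof -
 have [measurable]: "Om \<in> sets borel" using Om(1) by simp
 have fin: "emeasure lborel Om < \<infinity>" using Om(2) by (rule emeasure_bounded_finite)
 have "integrable lborel (%w. B * ind Om w :: real)"
  using fin by (intro integrable_mult_right integrable_real_indicator) auto
 then show ?thesis
  by (rule Bochner_Integration.integrable_bound) (use B order_trans[OF norm_ge_zero B] in \<open>auto simp: norm_mult indicator_def\<close>)
qed

lemma integrable_indicator_inverse:
 assumes Om: "open Om" "bounded Om"
 shows "integrable lborel (%w. ind Om w * (1 / cmod (z - w)) :: real)"
proof (rule integrableI_nonneg)
 have [measurable]: "Om \<in> sets borel" using Om(1) by simp
 show "(%w. ind Om w * (1 / cmod (z - w)) :: real) \<in> borel_measurable lborel" by measurable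
 have "(II w. en (ind Om w * (1 / cmod (z - w))))
  <= (II w. ind Om w + en (cmod (z - w) powr (- 1)) * ind (cball 0 1) (z - w))"
 proof (rule nn_integral_mono)
  fix w
  show "en (ind Om w * (1 / cmod (z - w))) <= ind Om w + en (cmod (z - w) powr (- 1)) * ind (cball 0 1) (z - w)"
  proof (cases "w \<in> Om")
   case True
   show ?thesis
   proof (cases "cmod (z - w) <= 1")
    case True
    have "en (1 / cmod (z - w)) = en (cmod (z - w) powr (- 1))" by (cases "z = w") (simp_all add: powr_minus_divide)
    then show ?thesis using True \<open>w \<in> Om\<close> by (simp add: add_increasing)
   next
    case False
    then have "en (1 / cmod (z - w)) <= en 1" by (intro ennreal_leI) (simp add: divide_le_eq)
    then show ?thesis using \<open>w \<in> Om\<close> by (simp add: add_increasing2)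
   qed
  qed simp
 qed
 also have "... = emeasure lborel Om + (II w. en (cmod (z - w) powr (- 1)) * ind (cball 0 1) (z - w))"
  by (subst nn_integral_add) auto
 also have "(II w. en (cmod (z - w) powr (- 1)) * ind (cball 0 1) (z - w)) = (II w. en (cmod w powr (- 1)) * ind (cball 0 1) w)"
  by (rule nn_integral_translate_reflect(1)[where f="%w. en (cmod w powr (- 1)) * ind (cball 0 1) w"]) measurable
 also have "emeasure lborel Om + ... < \<infinity>"
  using emeasure_bounded_finite[OF Om(2)] cmod_powr_integrable_cball[of 1] by (auto simp: ennreal_add_less_top)
 finally show "(II w. en (ind Om w * (1 / cmod (z - w)))) < \<infinity>" .
qed (auto simp: indicator_def)

context convex_curve
begin

text \<open>The Cauchy-Pompeiu formula for the exponential, an eigenfunction of the conj-z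
  derivative with eigenvalue conj k. Green's formula is applied to the exponential times
  \<open>Kreg\<close> and the regularisation is removed: \<open>Dreg\<close> produces the interior
  value, for which z must avoid the frontier, and the curve integral converges since z is off the
  curve.\<close>

lemma cauchyT_osc_exp:
 assumes z: "z \<notin> frontier Om" and k: "k ~= 0"
 shows "cnj k * cauchyT (%w. ind Om w * osc_exp k w) z
  = ind Om z * osc_exp k z - \<i> / (2 * cr pi) * osc_cauchy 0 L ga ga' (%s. - 2 * Im (k * ga s)) z"
proof -
 define dl where "dl = (%n. inverse (real (Suc n)))"
 have dl: "0 < dl n" "dl n ~= 0" for n by (auto simp: dl_def)
 have [measurable]: "Om \<in> sets borel" using opn by simp
 define F where "F = (%w. ind Om w * osc_exp k w)"
 have [measurable]: "F \<in> bmeas" unfolding F_def by measurable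
 define A where "A = (%n. LINT w|lborel. ind Om w * (osc_exp k w * Kreg (dl n) (z - w)))"
 define D where "D = (%n. LINT w|lborel. cr (Dreg (dl n) (z - w)) * F w)"
 define B where "B = (%n. LINT s|lborel. ind {0..L} s *\<^sub>R (osc_exp k (ga s) * Kreg (dl n) (z - ga s) * ga' s))"
 have eq: "cnj k * A n - D n = - (\<i> / 2) * B n" for n
 proof -
  have C1: "C_k (Suc 0) (osc_exp k)" using C_k_osc_exp[of "Suc 0" 1 k] by simp
  have C2: "C_k (Suc 0) (%w. Kreg (dl n) (z - w))" by (rule C_k_Kreg[OF dl(2)])
  have CG: "C_k (Suc 0) (%w. osc_exp k w * Kreg (dl n) (z - w))" by (rule C_k_mult[OF C1 C2])
  have wb: "wirtinger_bar (%w. osc_exp k w * Kreg (dl n) (z - w)) w = cnj k * (osc_exp k w * Kreg (dl n) (z - w)) - osc_exp k w * cr (Dreg (dl n) (z - w))" for w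
   unfolding wirtinger_bar_mult[OF C_k_differentiable[OF C1] C_k_differentiable[OF C2]] wirtinger_bar_Kreg[OF dl(2)] wirtinger_bar_osc_exp
   by (simp add: mult_ac)
  have i1: "integrable lborel (%w. ind Om w * (osc_exp k w * Kreg (dl n) (z - w)))"
   by (rule integrable_indicator_bounded[OF opn bdd, where B="1 / dl n"]) (use Kreg_bounds(3)[OF dl(1)] in \<open>auto simp: norm_mult\<close>)
  have Db: "Dreg (dl n) ze <= 1 / (dl n)\<^sup>2" for ze
  proof -
   have "(dl n)\<^sup>2 * (dl n)\<^sup>2 <= ((cmod ze)\<^sup>2 + (dl n)\<^sup>2) * ((cmod ze)\<^sup>2 + (dl n)\<^sup>2)" by (intro mult_mono) auto
   moreover have "0 < (cmod ze)\<^sup>2 + (dl n)\<^sup>2" using dl(1)[of n] by (simp add: add_nonneg_pos)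
   ultimately show ?thesis using dl(1)[of n] unfolding Dreg_def power2_eq_square[of "(cmod ze)\<^sup>2 + (dl n)\<^sup>2"]
    by (subst frac_le_eq) (auto simp: divide_le_0_iff mult_ac)
  qed
  have i2: "integrable lborel (%w. ind Om w * (osc_exp k w * cr (Dreg (dl n) (z - w))))"
   by (rule integrable_indicator_bounded[OF opn bdd, where B="1 / (dl n)\<^sup>2"]) (use Db in \<open>auto simp: norm_mult\<close>)
  have "cnj k * A n - D n = (LINT w|lborel. cnj k * (ind Om w * (osc_exp k w * Kreg (dl n) (z - w))) - ind Om w * (osc_exp k w * cr (Dreg (dl n) (z - w))))"
  proof -
   have "D n = (LINT w|lborel. ind Om w * (osc_exp k w * cr (Dreg (dl n) (z - w))))"
    unfolding D_def F_def by (simp add: mult_ac)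
   then show ?thesis unfolding A_def using i1 i2 by simp
  qed
  also have "... = (LINT w|lborel. ind Om w * wirtinger_bar (%w. osc_exp k w * Kreg (dl n) (z - w)) w)"
   unfolding wb by (rule Bochner_Integration.integral_cong) (auto simp: right_diff_distrib mult.left_commute)
  also have "... = - (\<i> / 2) * integral {0..L} (%s. osc_exp k (ga s) * Kreg (dl n) (z - ga s) * ga' s)"
   by (rule green_bar[OF CG])
  also have "integral {0..L} (%s. osc_exp k (ga s) * Kreg (dl n) (z - ga s) * ga' s) = B n"
  proof -
   have cG: "continuous_on UNIV (%w. osc_exp k w * Kreg (dl n) (z - w))" using C_k_Suc_imp[OF CG] by simp
   have "continuous_on {0..L} (%s. osc_exp k (ga s) * Kreg (dl n) (z - ga s) * ga' s)"
    by (intro continuous_on_mult continuous_on_compose2[OF cG] continuous_on_subset[OF cont'] continuous_on_subset[OF cont]) auto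
   then have "set_integrable lborel {0..L} (%s. osc_exp k (ga s) * Kreg (dl n) (z - ga s) * ga' s)"
    unfolding set_integrable_def by (intro borel_integrable_compact) auto
   from set_borel_integral_eq_integral(2)[OF this] show ?thesis unfolding B_def set_lebesgue_integral_def by simp
  qed
  finally show ?thesis .
 qed
 have limA: "A \<longlonglongrightarrow> cr pi * cauchyT F z"
 proof -
  have "A \<longlonglongrightarrow> (LINT w|lborel. F w / (z - w))"
   unfolding A_def
  proof (rule integral_dominated_convergence[where w="%w. ind Om w * (1 / cmod (z - w))"])
   show "AE w in lborel. (%n. ind Om w * (osc_exp k w * Kreg (dl n) (z - w))) \<longlonglongrightarrow> F w / (z - w)"
   proof (rule AE_I2)
    fix w
    have "(%n. ind Om w * (osc_exp k w * Kreg (dl n) (z - w))) \<longlonglongrightarrow> ind Om w * (osc_exp k w * (1 / (z - w)))"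
     unfolding dl_def by (intro tendsto_intros Kreg_tendsto)
    then show "(%n. ind Om w * (osc_exp k w * Kreg (dl n) (z - w))) \<longlonglongrightarrow> F w / (z - w)" by (simp add: F_def)
   qed
   show "AE w in lborel. cmod (ind Om w * (osc_exp k w * Kreg (dl n) (z - w))) <= ind Om w * (1 / cmod (z - w))" for n
    using Kreg_bounds(4)[OF dl(1)] by (auto simp: norm_mult indicator_def)
  qed (use integrable_indicator_inverse[OF opn bdd] in auto)
  then show ?thesis by (simp add: cauchyT_def)
 qed
 have limD: "D \<longlonglongrightarrow> cr pi * F z"
  unfolding D_def dl_def
 proof (rule Dreg_approx_identity)
  show "cmod (F w) <= 1" for w by (simp add: F_def norm_mult indicator_def)
  show "isCont F z" unfolding F_def
   using isCont_indicator_open[OF opn z] osc_exp_continuous[of k] by (intro continuous_mult) (auto simp: continuous_on_eq_continuous_at)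
 qed measurable
 have limB: "B \<longlonglongrightarrow> osc_cauchy 0 L ga ga' (%s. - 2 * Im (k * ga s)) z"
 proof -
  have ne: "z - ga s ~= 0" for s using z ga_frontier[of s] by auto
  note [measurable] = cont[THEN borel_measurable_continuous_onI] cont'[THEN borel_measurable_continuous_onI]
  have c: "continuous_on {0..L} (%s. 1 / cmod (z - ga s))" using ne by (intro continuous_intros continuous_on_subset[OF cont]) auto
  have "B \<longlonglongrightarrow> (LINT s|lborel. ind {0..L} s *\<^sub>R (osc_exp k (ga s) * (ga' s / (z - ga s))))"
   unfolding B_def
  proof (rule integral_dominated_convergence[where w="%s. ind {0..L} s *\<^sub>R (1 / cmod (z - ga s))"])
   show "integrable lborel (%s. ind {0..L} s *\<^sub>R (1 / cmod (z - ga s)))"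
    by (rule borel_integrable_compact) (use c in auto)
   show "AE s in lborel. (%n. ind {0..L} s *\<^sub>R (osc_exp k (ga s) * Kreg (dl n) (z - ga s) * ga' s)) \<longlonglongrightarrow> ind {0..L} s *\<^sub>R (osc_exp k (ga s) * (ga' s / (z - ga s)))"
   proof (rule AE_I2)
    fix s
    have "(%n. ind {0..L} s *\<^sub>R (osc_exp k (ga s) * Kreg (dl n) (z - ga s) * ga' s)) \<longlonglongrightarrow> ind {0..L} s *\<^sub>R (osc_exp k (ga s) * (1 / (z - ga s)) * ga' s)"
     unfolding dl_def by (intro tendsto_intros Kreg_tendsto)
    then show "(%n. ind {0..L} s *\<^sub>R (osc_exp k (ga s) * Kreg (dl n) (z - ga s) * ga' s)) \<longlonglongrightarrow> ind {0..L} s *\<^sub>R (osc_exp k (ga s) * (ga' s / (z - ga s)))" by (simp add: mult.assoc)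
   qed
   show "AE s in lborel. norm (ind {0..L} s *\<^sub>R (osc_exp k (ga s) * Kreg (dl n) (z - ga s) * ga' s)) <= ind {0..L} s *\<^sub>R (1 / cmod (z - ga s))" for n
    using Kreg_bounds(4)[OF dl(1)] by (auto simp: norm_mult unit indicator_def)
  qed measurable
  then show ?thesis unfolding osc_cauchy_def set_lebesgue_integral_def osc_exp_eq .
 qed
 have "(%n. cnj k * A n - D n) \<longlonglongrightarrow> cnj k * (cr pi * cauchyT F z) - cr pi * F z"
  by (intro tendsto_intros limA limD)
 moreover have "(%n. cnj k * A n - D n) \<longlonglongrightarrow> - (\<i> / 2) * osc_cauchy 0 L ga ga' (%s. - 2 * Im (k * ga s)) z"
  unfolding eq by (intro tendsto_intros limB)
 ultimately have "cnj k * (cr pi * cauchyT F z) - cr pi * F z = - (\<i> / 2) * osc_cauchy 0 L ga ga' (%s. - 2 * Im (k * ga s)) z"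
  by (rule LIMSEQ_unique)
 then have "cnj k * cauchyT F z = F z - \<i> / (2 * cr pi) * osc_cauchy 0 L ga ga' (%s. - 2 * Im (k * ga s)) z"
  by (simp add: field_simps)
 then show ?thesis unfolding F_def .
qed

end

section \<open>Weak derivatives and representatives\<close>

lemma lebesgue_measurable_of_borel: "f \<in> bmeas ==> f \<in> borel_measurable lebesgue"
 for f :: "complex => 'a::topological_space"
 by (rule measurable_completion) simp

lemma completion_ex_borel_measurable_complex:
 fixes u :: "complex => complex"
 assumes "u \<in> borel_measurable lebesgue"
 obtains u' where "u' \<in> bmeas" "AE z in lborel. u z = u' z"
proof -
 have "(%z. Re (u z)) \<in> borel_measurable lebesgue" "(%z. Im (u z)) \<in> borel_measurable lebesgue"
  using assms by measurable
 then obtain a b where [measurable]: "a \<in> borel_measurable lborel" "b \<in> borel_measurable lborel"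
  and ab: "AE z in lborel. Re (u z) = a z" "AE z in lborel. Im (u z) = b z"
  using completion_ex_borel_measurable_real by metis
 have "(%z. cr (a z) + \<i> * cr (b z)) \<in> bmeas" by measurable
 moreover have "AE z in lborel. u z = cr (a z) + \<i> * cr (b z)"
  using ab by eventually_elim (simp add: complex_eq_iff)
 ultimately show ?thesis by (rule that)
qed

lemma test_function_support:
 assumes "test_function ps" "z \<notin> closure {z. ps z ~= 0}"
 shows "ps z = 0" "partial_x ps z = 0" "partial_y ps z = 0" "wirtinger_bar ps z = 0"
proof -
 show "ps z = 0" using assms(2) closure_subset[of "{z. ps z ~= 0}"] by blast
 have "(ps has_derivative (%_. 0)) (at z)"
 proof (rule has_derivative_transform_within_open[OF has_derivative_const])
  show "open (- closure {z. ps z ~= 0})" "z \<in> - closure {z. ps z ~= 0}" using assms(2) by auto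
  show "0 = ps w" if "w \<in> - closure {z. ps z ~= 0}" for w using that closure_subset[of "{z. ps z ~= 0}"] by auto
 qed
 from partial_eq[OF this] show "partial_x ps z = 0" "partial_y ps z = 0" by auto
 then show "wirtinger_bar ps z = 0" by (simp add: wirtinger_bar_def)
qed

lemma lebesgue_integral_derivative_compact_support:
 fixes fi fi' :: "real => complex"
 assumes d: "!!t. (fi has_vector_derivative fi' t) (at t)" and c: "continuous_on UNIV fi'"
  and z: "!!t. R < \<bar>t\<bar> ==> fi t = 0" "!!t. R < \<bar>t\<bar> ==> fi' t = 0" and R: "0 <= R"
 shows "(LINT t|lborel. fi' t) = 0"
proof -
 define S where "S = R + 1"
 have "set_integrable lborel {-S..S} fi'"
  unfolding set_integrable_def using continuous_on_subset[OF c] by (intro borel_integrable_compact) auto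
 from set_borel_integral_eq_integral(2)[OF this]
 have "(LINT t:{-S..S}|lborel. fi' t) = integral {-S..S} fi'" .
 also have "... = fi S - fi (-S)"
  by (rule integral_unique, rule fundamental_theorem_of_calculus) (use R d in \<open>auto simp: S_def intro: has_vector_derivative_at_within\<close>)
 also have "... = 0" using z(1)[of S] z(1)[of "-S"] R by (simp add: S_def)
 also have "(LINT t:{-S..S}|lborel. fi' t) = (LINT t|lborel. fi' t)"
  unfolding set_lebesgue_integral_def
 proof (rule Bochner_Integration.integral_cong)
  fix t
  show "ind {-S..S} t *\<^sub>R fi' t = fi' t"
  proof (cases "R < \<bar>t\<bar>")
   case False
   then have "t \<in> {-S..S}" unfolding S_def atLeastAtMost_iff by linarith
   then show ?thesis by simp
  qed (simp add: z)
 qed simp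
 finally show ?thesis .
qed

text \<open>The integral of each partial derivative vanishes by the fundamental theorem on lines.
  This is what makes constants weakly holomorphic.\<close>

lemma integral_wirtinger_bar_test:
 assumes ps: "test_function ps"
 shows "integrable lborel (wirtinger_bar ps)" "(LINT z|lborel. wirtinger_bar ps z) = 0"
proof -
 define K where "K = closure {z. ps z ~= 0}"
 have K: "compact K" and C: "!!n. C_k n ps" using ps by (auto simp: test_function_def K_def)
 have c: "continuous_on UNIV (partial_x ps)" "continuous_on UNIV (partial_y ps)" using C[of "Suc 0"] by auto
 obtain R where R: "0 < R" "!!z. z \<in> K ==> cmod z <= R"
  using compact_imp_bounded[OF K] unfolding bounded_pos by blast
 have out: "ps z = 0 \<and> partial_x ps z = 0 \<and> partial_y ps z = 0" if "R < cmod z" for z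
  using test_function_support[OF ps, of z] R(2)[of z] that unfolding K_def by auto
 have outC: "ps (Complex x y) = 0 \<and> partial_x ps (Complex x y) = 0 \<and> partial_y ps (Complex x y) = 0" if "R < \<bar>x\<bar> \<or> R < \<bar>y\<bar>" for x y
  using out[of "Complex x y"] abs_Re_le_cmod[of "Complex x y"] abs_Im_le_cmod[of "Complex x y"] that by fastforce
 have int: "integrable lborel g" if g: "continuous_on UNIV g" "!!z. z \<notin> K ==> g z = 0" for g :: "complex => complex"
 proof -
  have "integrable lborel (%z. ind K z *\<^sub>R g z)"
   by (rule borel_integrable_compact[OF K continuous_on_subset[OF g(1)]]) simp
  moreover have "(%z. ind K z *\<^sub>R g z) = g" using g(2) by (auto simp: fun_eq_iff indicator_def)
  ultimately show ?thesis by simp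
 qed
 have ix: "integrable lborel (partial_x ps)"
  by (rule int[OF c(1)]) (rule test_function_support(2)[OF ps], simp add: K_def)
 have iy: "integrable lborel (partial_y ps)"
  by (rule int[OF c(2)]) (rule test_function_support(3)[OF ps], simp add: K_def)
 have D: "(ps has_derivative frechet_derivative ps (at z)) (at z)" for z
  using C_k_differentiable[OF C] by (simp add: frechet_derivative_works)
 have "(LINT z|lborel. partial_x ps z) = (LINT y|lborel. LINT x|lborel. partial_x ps (Complex x y))"
  by (rule lborel_integral_complex(1)[OF ix])
 also have "... = 0"
 proof -
  have CR: "Complex x y = cr x + \<i> * cr y" for x y by (simp add: complex_eq_iff)
  have "(LINT x|lborel. partial_x ps (Complex x y)) = 0" for y
  proof (rule lebesgue_integral_derivative_compact_support[where R=R and fi="%x. ps (Complex x y)"])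
   show "((%x. ps (Complex x y)) has_vector_derivative partial_x ps (Complex x y)) (at x)" for x
   proof -
    have "((%x. Complex x y) has_vector_derivative 1) (at x)"
     unfolding has_vector_derivative_complex_iff by (auto intro!: derivative_eq_intros)
    from vector_derivative_diff_chain_within[OF this D[THEN has_derivative_at_withinI]]
    show ?thesis by (simp add: o_def partial_x_def)
   qed
   show "continuous_on UNIV (%x. partial_x ps (Complex x y))"
    unfolding CR by (intro continuous_on_compose2[OF c(1)] continuous_intros) auto
  qed (use outC R in auto)
  then show ?thesis by simp
 qed
 finally have x: "(LINT z|lborel. partial_x ps z) = 0" .
 have "(LINT z|lborel. partial_y ps z) = (LINT x|lborel. LINT y|lborel. partial_y ps (Complex x y))"
  by (rule lborel_integral_complex(2)[OF iy])
 also have "... = 0"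
 proof -
  have CR: "Complex x y = cr x + \<i> * cr y" for x y by (simp add: complex_eq_iff)
  have "(LINT y|lborel. partial_y ps (Complex x y)) = 0" for x
  proof (rule lebesgue_integral_derivative_compact_support[where R=R and fi="%y. ps (Complex x y)"])
   show "((%y. ps (Complex x y)) has_vector_derivative partial_y ps (Complex x y)) (at y)" for y
   proof -
    have "((%y. Complex x y) has_vector_derivative \<i>) (at y)"
     unfolding has_vector_derivative_complex_iff by (auto intro!: derivative_eq_intros)
    from vector_derivative_diff_chain_within[OF this D[THEN has_derivative_at_withinI]]
    show ?thesis by (simp add: o_def partial_y_def)
   qed
   show "continuous_on UNIV (%y. partial_y ps (Complex x y))"
    unfolding CR by (intro continuous_on_compose2[OF c(2)] continuous_intros) auto
  qed (use outC R in auto)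
  then show ?thesis by simp
 qed
 finally have y: "(LINT z|lborel. partial_y ps z) = 0" .
 show "integrable lborel (wirtinger_bar ps)" unfolding wirtinger_bar_def[abs_def] using ix iy by simp
 show "(LINT z|lborel. wirtinger_bar ps z) = 0" unfolding wirtinger_bar_def using ix iy x y by simp
qed

lemma locally_integrable_mult_compact_support:
 fixes g :: "complex => complex"
 assumes u: "locally_integrable u" and g: "continuous_on UNIV g" and K: "compact K" "!!z. z \<notin> K ==> g z = 0"
 shows "integrable lebesgue (%z. u z * g z)"
proof -
 have iu: "integrable lebesgue (%z. ind K z *\<^sub>R u z)" using u K(1) by (simp add: locally_integrable_def set_integrable_def)
 have "compact (g ` K)" by (rule compact_continuous_image[OF continuous_on_subset[OF g] K(1)]) simp
 from compact_imp_bounded[OF this] obtain B where B: "!!z. z \<in> K ==> cmod (g z) <= B" unfolding bounded_iff by blast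
 have eq: "u z * g z = (ind K z *\<^sub>R u z) * g z" for z using K(2)[of z] by (auto simp: indicator_def)
 have [measurable]: "g \<in> borel_measurable lebesgue" by (rule lebesgue_measurable_of_borel[OF borel_measurable_continuous_onI[OF g]])
 have [measurable]: "(%z. ind K z *\<^sub>R u z) \<in> borel_measurable lebesgue" using iu by auto
 show ?thesis
 proof (rule Bochner_Integration.integrable_bound)
  show "integrable lebesgue (%z. B *\<^sub>R (ind K z *\<^sub>R u z))" by (intro integrable_scaleR_right iu)
  show "(%z. u z * g z) \<in> borel_measurable lebesgue" unfolding eq by measurable
  show "AE z in lebesgue. norm (u z * g z) <= norm (B *\<^sub>R (ind K z *\<^sub>R u z))"
  proof (rule AE_I2)
   fix z
   show "norm (u z * g z) <= norm (B *\<^sub>R (ind K z *\<^sub>R u z))"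
   proof (cases "z \<in> K")
    case True
    have "cmod (u z) * cmod (g z) <= cmod (u z) * \<bar>B\<bar>" using B[OF True] by (intro mult_left_mono) auto
    then show ?thesis using True by (simp add: norm_mult mult.commute)
   qed (simp add: K(2))
  qed
 qed
qed

lemma test_function_wirtinger_bar:
 assumes "test_function ps"
 shows "continuous_on UNIV (wirtinger_bar ps)" "compact (closure {z. ps z ~= 0})"
proof -
 have "C_k (Suc 0) ps" "compact (closure {z. ps z ~= 0})" using assms by (auto simp: test_function_def)
 then show "continuous_on UNIV (wirtinger_bar ps)" "compact (closure {z. ps z ~= 0})"
  unfolding wirtinger_bar_def[abs_def] by (auto intro!: continuous_intros)
qed

text \<open>Passes from 1 + u, which is not covered by the representation formula, to its decaying
  part u.\<close>

lemma has_weak_wirtinger_bar_drop_const: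
 assumes "has_weak_wirtinger_bar (%z. c + u z) f"
 shows "has_weak_wirtinger_bar u f"
proof -
 have L: "locally_integrable (%z. c + u z)" and f: "locally_integrable f"
  and eq: "!!ps. test_function ps ==> (LINT z|lebesgue. (c + u z) * wirtinger_bar ps z) = - (LINT z|lebesgue. f z * ps z)"
  using assms by (auto simp: has_weak_wirtinger_bar_def)
 have u: "locally_integrable u"
  unfolding locally_integrable_def
 proof (intro allI impI)
  fix K :: "complex set" assume K: "compact K"
  have 1: "integrable lebesgue (%z. ind K z *\<^sub>R (c + u z))" using L K by (simp add: locally_integrable_def set_integrable_def)
  have "integrable lborel (%z. ind K z *\<^sub>R c)" by (rule borel_integrable_compact[OF K]) simp
  then have 2: "integrable lebesgue (%z. ind K z *\<^sub>R c)" by (subst integrable_completion) auto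
  from Bochner_Integration.integrable_diff[OF 1 2] show "set_integrable lebesgue K u" by (simp add: set_integrable_def scaleR_add_right)
 qed
 have "(LINT z|lebesgue. u z * wirtinger_bar ps z) = - (LINT z|lebesgue. f z * ps z)" if ps: "test_function ps" for ps
 proof -
  note wb = integral_wirtinger_bar_test[OF ps]
  have [measurable]: "wirtinger_bar ps \<in> borel_measurable lborel" using wb(1) by auto
  have 1: "integrable lebesgue (%z. u z * wirtinger_bar ps z)"
   by (rule locally_integrable_mult_compact_support[OF u test_function_wirtinger_bar[OF ps]]) (rule test_function_support(4)[OF ps])
  have 2: "integrable lebesgue (%z. c * wirtinger_bar ps z)"
   using wb(1) by (subst integrable_completion) auto
  have 3: "(LINT z|lebesgue. c * wirtinger_bar ps z) = 0"
   using wb by (subst integral_completion) auto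
  have "(LINT z|lebesgue. (c + u z) * wirtinger_bar ps z) = (LINT z|lebesgue. c * wirtinger_bar ps z) + (LINT z|lebesgue. u z * wirtinger_bar ps z)"
   unfolding distrib_right by (rule Bochner_Integration.integral_add[OF 2 1])
  then show ?thesis using eq[OF ps] 3 by simp
 qed
 then show ?thesis using u f by (simp add: has_weak_wirtinger_bar_def)
qed

text \<open>Testing with the conjugate of a test function conjugates the equation, so that the
  second equation of the system can be solved by \<open>cauchyT\<close> as well.\<close>

lemma has_weak_wirtinger_cnj:
 assumes "has_weak_wirtinger v g"
 shows "has_weak_wirtinger_bar (%z. cnj (v z)) (%z. cnj (g z))"
proof -
 have li: "locally_integrable (%z. cnj (w z))" if "locally_integrable w" for w
 proof -
  have "integrable lebesgue (%z. cnj (ind K z *\<^sub>R w z))" if "compact K" for K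
  proof -
   have "integrable lebesgue (%z. ind K z *\<^sub>R w z)"
    using \<open>locally_integrable w\<close> that by (simp add: locally_integrable_def set_integrable_def)
   then show ?thesis by (rule integrable_bounded_linear[OF bounded_linear_cnj])
  qed
  then show ?thesis by (simp add: locally_integrable_def set_integrable_def)
 qed
 have "(LINT z|lebesgue. cnj (v z) * wirtinger_bar ps z) = - (LINT z|lebesgue. cnj (g z) * ps z)" if ps: "test_function ps" for ps
 proof -
  have pd: "partial_x (%z. cnj (f z)) = (%z. cnj (partial_x f z))" "partial_y (%z. cnj (f z)) = (%z. cnj (partial_y f z))"
   "(%z. cnj (f z)) differentiable_on UNIV" if "f differentiable_on UNIV" for f :: "complex => complex"
  proof -
   have D: "(f has_derivative frechet_derivative f (at z)) (at z)" for z
    using that by (simp add: differentiable_on_def frechet_derivative_works)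
   have Dc: "((%z. cnj (f z)) has_derivative (%h. cnj (frechet_derivative f (at z) h))) (at z)" for z
    using has_derivative_cnj[OF D[of z]] .
   show "partial_x (%z. cnj (f z)) = (%z. cnj (partial_x f z))" "partial_y (%z. cnj (f z)) = (%z. cnj (partial_y f z))"
    by (auto simp: fun_eq_iff partial_eq[OF Dc] partial_eq[OF D])
   show "(%z. cnj (f z)) differentiable_on UNIV" using Dc unfolding differentiable_on_def differentiable_def by blast
  qed
  have Cc: "C_k n (%z. cnj (f z))" if "C_k n f" for n f using that
  proof (induction n arbitrary: f)
   case 0 then show ?case by (auto intro: continuous_intros)
  next
   case (Suc n) then show ?case by (simp add: pd)
  qed
  have dif: "ps differentiable_on UNIV" and C: "!!n. C_k n ps"
   using ps C_k.simps(2)[of 0 ps] unfolding test_function_def by blast+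
  have T: "test_function (%z. cnj (ps z))" using ps Cc C by (simp add: test_function_def)
  have w: "wirtinger (%z. cnj (ps z)) z = cnj (wirtinger_bar ps z)" for z
   by (simp add: wirtinger_def wirtinger_bar_def pd[OF dif])
  have "(LINT z|lebesgue. v z * wirtinger (%z. cnj (ps z)) z) = - (LINT z|lebesgue. g z * cnj (ps z))"
   using assms T by (simp add: has_weak_wirtinger_def)
  then have "cnj (LINT z|lebesgue. v z * cnj (wirtinger_bar ps z)) = - cnj (LINT z|lebesgue. g z * cnj (ps z))" unfolding w by simp
  moreover have "cnj (LINT z|lebesgue. a z * cnj (b z)) = (LINT z|lebesgue. cnj (a z) * b z)" for a b :: "complex => complex"
  proof -
   have "(LINT z|lebesgue. cnj (a z * cnj (b z))) = cnj (LINT z|lebesgue. a z * cnj (b z))" by (rule Bochner_Integration.integral_cnj)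
   then show ?thesis by (simp only: complex_cnj_mult complex_cnj_cnj)
  qed
  ultimately show ?thesis by (simp only:)
 qed
 then show ?thesis using assms li by (simp add: has_weak_wirtinger_bar_def has_weak_wirtinger_def)
qed

text \<open>Elements of \<open>weighted_L2\<close> are Lebesgue measurable, while the estimates are
  proved for Borel functions. The weak equation passes to Borel representatives because it only
  involves integrals.\<close>

lemma has_weak_wirtinger_bar_cong_AE:
 assumes w: "has_weak_wirtinger_bar u f" and m: "u \<in> borel_measurable lebesgue" "f \<in> borel_measurable lebesgue"
  and m': "u' \<in> bmeas" "f' \<in> bmeas"
  and ae: "AE z in lborel. u z = u' z" "AE z in lborel. f z = f' z"
 shows "has_weak_wirtinger_bar u' f'"
proof -
 have ae': "AE z in lebesgue. u z = u' z" "AE z in lebesgue. f z = f' z" using ae by (auto simp: AE_completion_iff)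
 note [measurable] = m lebesgue_measurable_of_borel[OF m'(1)] lebesgue_measurable_of_borel[OF m'(2)]
 have li: "locally_integrable b" if "locally_integrable a" "AE z in lebesgue. a z = b z" and [measurable]: "a \<in> borel_measurable lebesgue" "b \<in> borel_measurable lebesgue" for a b
  unfolding locally_integrable_def set_integrable_def
 proof (intro allI impI)
  fix K :: "complex set" assume K: "compact K"
  have [measurable]: "K \<in> sets lebesgue" using K by (simp add: compact_imp_closed borel_closed)
  have "integrable lebesgue (%z. ind K z *\<^sub>R a z)" using that(1) K by (simp add: locally_integrable_def set_integrable_def)
  then show "integrable lebesgue (%z. ind K z *\<^sub>R b z)"
   by (rule integrable_cong_AE_imp) (use that(2) in \<open>auto elim!: eventually_mono\<close>)
 qed
 have cong: "(LINT z|lebesgue. a z * g z) = (LINT z|lebesgue. b z * g z)"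
  if "AE z in lebesgue. a z = b z" and [measurable]: "a \<in> borel_measurable lebesgue" "b \<in> borel_measurable lebesgue" "g \<in> bmeas" for a b g :: "complex => complex"
 proof -
  have [measurable]: "g \<in> borel_measurable lebesgue" by (rule lebesgue_measurable_of_borel[OF that(4)])
  show ?thesis by (rule integral_cong_AE) (use that(1) in \<open>auto elim!: eventually_mono\<close>)
 qed
 show ?thesis
  unfolding has_weak_wirtinger_bar_def
 proof (intro conjI allI impI)
  show "locally_integrable u'" "locally_integrable f'" using w by (auto simp: has_weak_wirtinger_bar_def intro: li ae')
  fix ps assume ps: "test_function ps"
  have "(LINT z|lebesgue. u z * wirtinger_bar ps z) = - (LINT z|lebesgue. f z * ps z)" using w ps by (simp add: has_weak_wirtinger_bar_def)
  then show "(LINT z|lebesgue. u' z * wirtinger_bar ps z) = - (LINT z|lebesgue. f' z * ps z)"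
   using cong[OF ae'(1) _ _ test_function_measurable(2)[OF ps]] cong[OF ae'(2) _ _ test_function_measurable(1)[OF ps]] by simp
 qed
qed

lemma jap_powr_measurable [measurable]: "(%z. jap z powr a) \<in> borel_measurable lebesgue"
 by (rule lebesgue_measurable_of_borel) measurable

lemma weighted_L2_measurable:
 assumes "v \<in> weighted_L2 ep"
 shows "v \<in> borel_measurable lebesgue" and "(II z. en (jap z powr (- 2 * ep) * (cmod (v z))\<^sup>2)) < \<infinity>"
proof -
 obtain u where u: "u \<in> borel_measurable lebesgue" "integrable lebesgue (%z. (cmod (u z))\<^sup>2)"
  and v: "v = (%z. cr (jap z powr ep) * u z)"
  using assms by (auto simp: weighted_L2_def L2_def)
 note [measurable] = u(1)
 show "v \<in> borel_measurable lebesgue" unfolding v by measurable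
 have "jap z powr (- 2 * ep) * (cmod (v z))\<^sup>2 = (cmod (u z))\<^sup>2" for z
 proof -
  have "jap z powr (- 2 * ep) * (jap z powr ep)\<^sup>2 = 1"
   using jap_pos[of z] by (simp add: power2_eq_square powr_add[symmetric])
  then show ?thesis unfolding v by (simp add: norm_mult power_mult_distrib flip: mult.assoc)
 qed
 then have "(II z. en (jap z powr (- 2 * ep) * (cmod (v z))\<^sup>2)) = (\<integral>\<^sup>+z. en ((cmod (u z))\<^sup>2) \<partial>lebesgue)"
  by (simp add: nn_integral_completion)
 also have "... < \<infinity>" using integrableD(2)[OF u(2)] by (simp add: top.not_eq_extremum)
 finally show "(II z. en (jap z powr (- 2 * ep) * (cmod (v z))\<^sup>2)) < \<infinity>" .
qed

text \<open>The return from \<open>wN\<close> of a Borel representative to membership and norm in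
  \<open>weighted_L2\<close>; the square root appears because \<open>wN\<close> is a squared
  norm.\<close>

lemma weighted_L2_bound:
 assumes v [measurable]: "v \<in> borel_measurable lebesgue" and ae: "AE z in lborel. v z = v' z" and le: "wN ep v' <= en B" and B: "0 <= B"
 shows "v \<in> weighted_L2 ep" and "weighted_L2_norm ep v <= sqrt B"
proof -
 define u where "u = (%z. cr (jap z powr (- ep)) * v z)"
 have [measurable]: "u \<in> borel_measurable lebesgue" unfolding u_def by measurable
 have sq: "(cmod (u z))\<^sup>2 = jap z powr (- 2 * ep) * (cmod (v z))\<^sup>2" for z
 proof -
  have "(jap z powr (- ep))\<^sup>2 = jap z powr (- ep + - ep)" by (simp only: power2_eq_square powr_add)
  then show ?thesis unfolding u_def by (simp add: norm_mult power_mult_distrib)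
 qed
 have nn: "(\<integral>\<^sup>+z. en ((cmod (u z))\<^sup>2) \<partial>lebesgue) <= en B"
 proof -
  have "(\<integral>\<^sup>+z. en ((cmod (u z))\<^sup>2) \<partial>lebesgue) = wN ep v'"
   unfolding sq nn_integral_completion wN_def by (rule nn_integral_cong_AE) (use ae in \<open>auto elim!: eventually_mono\<close>)
  then show ?thesis using le by simp
 qed
 have i: "integrable lebesgue (%z. (cmod (u z))\<^sup>2)"
  by (rule integrableI_nonneg) (use nn in \<open>auto intro: le_less_trans\<close>)
 have u: "u \<in> L2" using i by (simp add: L2_def)
 have vu: "v = (%z. cr (jap z powr ep) * u z)"
 proof
  fix z
  have "jap z powr ep * jap z powr (- ep) = 1" using jap_pos[of z] by (simp add: powr_add[symmetric])
  then show "v z = cr (jap z powr ep) * u z"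
   unfolding u_def mult.assoc[symmetric] of_real_mult[symmetric] by simp
 qed
 show "v \<in> weighted_L2 ep" unfolding weighted_L2_def using vu u by blast
 have "(LINT z|lebesgue. (cmod (u z))\<^sup>2) <= B"
 proof -
  have "en (LINT z|lebesgue. (cmod (u z))\<^sup>2) <= en B"
   using nn nn_integral_eq_integral[OF i] by simp
  then show ?thesis using B by (simp add: ennreal_le_iff)
 qed
 then show "weighted_L2_norm ep v <= sqrt B" unfolding weighted_L2_norm_def L2_norm_def u_def[symmetric] by (rule real_sqrt_le_mono)
qed

lemma cauchyT_cong_AE:
 assumes [measurable]: "F \<in> bmeas" "G \<in> bmeas" and "AE w in lborel. F w = G w"
 shows "cauchyT F z = cauchyT G z"
proof -
 have "(LINT w|lborel. F w / (z - w)) = (LINT w|lborel. G w / (z - w))"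
  by (rule integral_cong_AE) (use assms(3) in \<open>auto elim!: eventually_mono\<close>)
 then show ?thesis by (simp add: cauchyT_def)
qed

lemma cauchyT_mult: "cauchyT (%w. c * F w) z = c * cauchyT F z"
 by (simp add: cauchyT_def flip: times_divide_eq_right)

text \<open>Needed for additivity of \<open>cauchyT\<close>, which can fail where one integral takes
  the default value 0. The weighted bound with ep = 1 shows that the absolute integral is finite
  almost everywhere.\<close>

lemma cauchy_kernel_integrable_AE:
 assumes [measurable]: "F \<in> bmeas" and supp: "!!w. R < cmod w ==> F w = 0" and R: "0 <= R"
  and fin: "(II w. en ((cmod (F w))\<^sup>2)) < \<infinity>"
 shows "AE z in lborel. integrable lborel (%w. F w / (z - w))"
proof -
 define I where "I = (%z. II w. en (cmod (F w)) * en (cmod (z - w) powr (- 1)))"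
 have [measurable]: "I \<in> bmeas"
  unfolding I_def using lborel.borel_measurable_nn_integral[of "%z w. en (cmod (F w)) * en (cmod (z - w) powr (- 1))" borel] by simp
 obtain C where "(II z. en (jap z powr (- 2 * 1)) * (I z)\<^sup>2) <= en C * (II w. (en (cmod (F w)))\<^sup>2)"
  using weighted_riesz_bound[of 1 1 R] R supp unfolding I_def
  by (auto dest!: bspec[of _ _ "%w. en (cmod (F w))"])
 also have "... < \<infinity>" using fin by (simp add: ennreal_power ennreal_mult_less_top)
 finally have "AE z in lborel. en (jap z powr (- 2 * 1)) * (I z)\<^sup>2 ~= \<infinity>"
  by (intro nn_integral_PInf_AE) auto
 then show ?thesis
 proof eventually_elim
  case (elim z)
  have "I z ~= top"
  proof
   assume "I z = top"
   then have "en (jap z powr (- 2 * 1)) * (I z)\<^sup>2 = top"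
    using jap_pos[of z] by (simp add: power2_eq_square ennreal_mult_top)
   then show False using elim by simp
  qed
  then have "I z < \<infinity>" by (simp add: top.not_eq_extremum)
  then show ?case unfolding I_def cauchy_kernel_norm[symmetric] by (intro integrableI_bounded) auto
 qed
qed

section \<open>Estimates for the Dirac system\<close>

lemma borel_measurable_cnj [measurable (raw)]:
 assumes "f \<in> borel_measurable M" shows "(%x. cnj (f x)) \<in> borel_measurable M"
 by (rule measurable_compose[OF assms borel_measurable_continuous_onI[OF linear_continuous_on[OF bounded_linear_cnj]]])

text \<open>The translation adds i pi/2 to k z and thus changes the phase - 2 Im (k z) by - pi. It
  supplies the shift for \<open>oscillating_composition_bound\<close>.\<close>

lemma osc_exp_shift:
 assumes "k ~= 0"
 shows "osc_exp k (z + \<i> * cr pi / (2 * k)) = - osc_exp k z"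
proof -
 have "k * (z + \<i> * cr pi / (2 * k)) = k * z + \<i> * cr (pi / 2)" using assms by (simp add: field_simps)
 then have "Im (k * (z + \<i> * cr pi / (2 * k))) = Im (k * z) + pi / 2" by simp
 then have "osc_exp k (z + \<i> * cr pi / (2 * k)) = exp (\<i> * cr (- 2 * Im (k * z)) + - (cr pi * \<i>))"
  unfolding osc_exp_eq by (simp add: algebra_simps)
 also have "... = osc_exp k z * exp (- (cr pi * \<i>))" unfolding osc_exp_eq by (rule exp_add)
 also have "exp (- (cr pi * \<i>)) = - 1" by (simp only: exp_minus exp_pi_i) simp
 finally show ?thesis by simp
qed

lemma osc_exp_cnj: "osc_exp k w * cnj (osc_exp k w) = 1"
 using complex_norm_square[of "osc_exp k w"] by simp

lemma wN_cmult:
 assumes [measurable]: "f \<in> bmeas"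
 shows "wN ep (%z. c * f z) = en ((cmod c)\<^sup>2) * wN ep f"
proof -
 have "en (jap z powr (- 2 * ep) * (cmod (c * f z))\<^sup>2) = en ((cmod c)\<^sup>2) * en (jap z powr (- 2 * ep) * (cmod (f z))\<^sup>2)" for z
  by (simp add: norm_mult power_mult_distrib ennreal_mult[symmetric] mult.left_commute)
 then show ?thesis unfolding wN_def by (simp add: nn_integral_cmult)
qed

lemma wN_cnj: "wN ep (%z. cnj (f z)) = wN ep f"
 by (simp add: wN_def)

text \<open>On a bounded domain the weight is bounded below; all data of the integral equations are
  supported there.\<close>

lemma nn_integral_domain_le_wN:
 assumes Om: "open Om" "Om \<subseteq> ball 0 R" and ep: "0 < ep" and [measurable]: "f \<in> bmeas"
 shows "(II z. en ((cmod (ind Om z * f z))\<^sup>2)) <= en ((1 + R) powr (2 * ep)) * wN ep f"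
proof -
 have "(II z. en ((cmod (ind Om z * f z))\<^sup>2)) <= (II z. en ((1 + R) powr (2 * ep)) * en (jap z powr (- 2 * ep) * (cmod (f z))\<^sup>2))"
 proof (rule nn_integral_mono)
  fix z
  show "en ((cmod (ind Om z * f z))\<^sup>2) <= en ((1 + R) powr (2 * ep)) * en (jap z powr (- 2 * ep) * (cmod (f z))\<^sup>2)"
  proof (cases "z \<in> Om")
   case True
   have "jap z <= 1 + R" using jap_le[of z] Om(2) True by (auto simp: subset_eq)
   then have "jap z powr (2 * ep) <= (1 + R) powr (2 * ep)" using ep jap_pos[of z] by (intro powr_mono2) auto
   then have "jap z powr (2 * ep) * jap z powr (- 2 * ep) <= (1 + R) powr (2 * ep) * jap z powr (- 2 * ep)" by (rule mult_right_mono) simp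
   moreover have "jap z powr (2 * ep) * jap z powr (- 2 * ep) = 1" using jap_pos[of z] by (simp add: powr_add[symmetric])
   ultimately have "1 * (cmod (f z))\<^sup>2 <= ((1 + R) powr (2 * ep) * jap z powr (- 2 * ep)) * (cmod (f z))\<^sup>2" by (intro mult_right_mono) auto
   then show ?thesis using True by (simp add: ennreal_mult[symmetric] mult.assoc ennreal_leI)
  qed simp
 qed
 also have "... = en ((1 + R) powr (2 * ep)) * wN ep f" unfolding wN_def by (rule nn_integral_cmult) measurable
 finally show ?thesis .
qed

lemma nn_integral_power2_add_le:
 fixes a b :: "complex => complex"
 assumes [measurable]: "a \<in> bmeas" "b \<in> bmeas"
 shows "(II z. en ((cmod (a z + b z))\<^sup>2)) <= 2 * (II z. en ((cmod (a z))\<^sup>2)) + 2 * (II z. en ((cmod (b z))\<^sup>2))"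
 using wN_add_le[OF assms, of 0] jap_pos by (simp add: wN_def less_imp_neq[THEN not_sym])

lemma h_ln_le:
 fixes h :: real assumes "0 < h" shows "h * ln (1 / h) <= 2 * sqrt h"
proof -
 have "ln (sqrt (1 / h)) <= sqrt (1 / h)" using assms by (intro ln_bound) auto
 then have "ln (1 / h) <= 2 * sqrt (1 / h)" using assms by (simp add: ln_sqrt)
 then have "h * ln (1 / h) <= h * (2 * sqrt (1 / h))" using assms by (intro mult_left_mono) auto
 also have "h * (2 * sqrt (1 / h)) = 2 * sqrt h"
 proof -
  have "(a * a) * (2 * (1 / a)) = 2 * a" if "a > 0" for a :: real using that by simp
  from this[of "sqrt h"] show ?thesis using assms by (simp add: real_sqrt_divide)
 qed
 finally show ?thesis .
qed

text \<open>X occurs on the right with coefficient q J <= 1/2 and is moved to the left. This needs X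
  to be finite, and the subtraction is carried out in the reals.\<close>

lemma ennreal_absorb:
 assumes "X <= en p + en q * (en J * X + en r)" "X < \<infinity>"
  and "0 <= p" "0 <= q" "0 <= J" "0 <= r" "q * J <= 1/2"
 shows "X <= en (2 * (p + q * r))"
proof -
 obtain x where x: "X = en x" "0 <= x" using assms(2) by (cases X) auto
 have "en x <= en (p + q * (J * x + r))"
  using assms(1) assms(3-6) x by (simp add: ennreal_mult ennreal_plus)
 moreover have "0 <= p + q * (J * x + r)" using assms(3-6) x(2) by (intro add_nonneg_nonneg mult_nonneg_nonneg) auto
 ultimately have "x <= p + q * (J * x + r)" by (simp only: ennreal_le_iff)
 moreover have "q * J * x <= 1/2 * x" using assms x by (intro mult_right_mono) auto
 ultimately have "x <= 2 * (p + q * r)" by (simp add: algebra_simps)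
 then show ?thesis unfolding x by (rule ennreal_leI)
qed

text \<open>Let R2 be the error of the second component. Its conjugate is sg/2 times a boundary term
  of squared size h^3 ln (1/h) plus the oscillating composition applied to \<open>f1\<close>, the
  source of the first equation. In turn \<open>f1\<close> consists of R2 and an explicit term of
  size h, so the inequality for the norm of R2 contains that norm with a small factor, which is
  absorbed. For the first component boundedness of \<open>cauchyT\<close> suffices once R2 is
  known.\<close>

lemma dirac_estimates:
 assumes dom: "strictly_convex_analytic_domain Om" and ep: "0 < ep" "ep <= 1"
 shows "\<exists>C h0. 0 <= C \<and> 0 < h0 \<and> h0 <= 1/2 \<and> (\<forall>sg k h u v. sg \<in> {1, -1::complex} --> k ~= 0 --> h = 1 / cmod k --> h < h0 -->
   u \<in> bmeas --> v \<in> bmeas --> wN ep u < \<infinity> --> wN ep v < \<infinity> -->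
   has_weak_wirtinger_bar u (%z. 1/2 * (ind Om z * (osc_exp k z * v z))) -->
   has_weak_wirtinger_bar (%z. cnj (v z)) (%z. sg / 2 * (ind Om z * (osc_exp k z * (1 + cnj (u z))))) -->
   wN ep (%z. v z - sg / (2 * k) * (ind Om z * cnj (osc_exp k z))) <= en (C * (h ^ 3 * ln (1 / h))) \<and>
   wN ep (%z. u z - sg / (4 * k) * cauchyT (ind Om) z) <= en (C * (h ^ 3 * ln (1 / h))))"
proof (rule analytic_domain_curve[OF dom])
 fix L ga ga' ga'' ka0 ka1
 assume curve: "convex_curve Om L ga ga'" and ka0: "0 < ka0" and dga': "!!s. (ga' has_vector_derivative ga'' s) (at s)"
  and cga'': "continuous_on UNIV ga''" and bga'': "!!s. cmod (ga'' s) <= ka1"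
  and curv: "!!s. \<exists>r\<ge>ka0. ga'' s = cr r * (\<i> * ga' s)"
 interpret convex_curve Om L ga ga' by (rule curve)
 show ?thesis
 proof (rule oscillatory_boundary_bound[OF ep(1) ka0 dga' cga'' bga'' curv])
  fix C1 assume C1: "0 <= C1" "!!h k. 0 < h ==> h <= 1/2 ==> cmod k = 1 / h ==>
    wN ep (osc_cauchy 0 L ga ga' (%s. - 2 * Im (k * ga s))) <= en (C1 * (h * ln (1 / h)))"
  obtain R0 where R0: "!!w. w \<in> Om ==> cmod w <= R0" using bdd unfolding bounded_iff by blast
  define R where "R = max R0 0 + 1"
  have R: "1 <= R" "Om \<subseteq> ball 0 R" using R0 by (auto simp: R_def less_max_iff_disj intro: le_less_trans) (metis R0 less_add_one max.strict_coboundedI1 max.cobounded1 order_le_less_trans)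
  have [measurable]: "Om \<in> sets borel" using opn by simp
  obtain C2 where C2: "C2 \<ge> 0" "!!h ta e F W. 0 < h \<and> h <= 1/2 \<and> cmod ta <= 2 * h \<and> e \<in> bmeas \<and>
    (\<forall>z. cmod (e z) <= 1) \<and> (\<forall>z. e (z + ta) = - e z) \<and> F \<in> bmeas \<and>
    (\<forall>w. R < cmod w --> F w = 0) \<and> (II w. en ((cmod (F w))\<^sup>2)) < \<infinity> \<and>
    (W = cauchyT F \<or> W = (%z. cnj (cauchyT F z))) ==>
    wN ep (cauchyT (%y. e y * (ind Om y * W y))) <= en (C2 * (h * ln (1 / h))) * (II w. en ((cmod (F w))\<^sup>2))"
   using oscillating_composition_bound[OF cvx opn R(2,1) ep(1)] by blast
  have R00: "0 <= R" using R by simp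
  obtain C3 where C3: "C3 \<ge> 0" "!!F. F \<in> bmeas ==> (\<forall>w. R < cmod w --> F w = 0) ==>
    wN ep (cauchyT F) <= en C3 * (II w. en ((cmod (F w))\<^sup>2))"
   using cauchyT_weighted_bound[OF ep(1) R00] by blast
  define J where "J = (1 + R) powr (2 * ep)"
  have J: "0 <= J" by (simp add: J_def)
  have dw: "(II z. en ((cmod (ind Om z * f z))\<^sup>2)) <= en J * wN ep f" if "f \<in> bmeas" for f
   unfolding J_def by (rule nn_integral_domain_le_wN[OF opn R(2) ep(1) that])
  obtain a where a: "emeasure lborel Om = en a" "0 <= a"
   using emeasure_bounded_finite[OF bdd] by (cases "emeasure lborel Om") auto
  have Na: "(II z. en ((cmod (ind Om z * E z))\<^sup>2)) = en a" if "!!z. cmod (E z) = 1" for E :: "complex => complex"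
  proof -
   have "en ((cmod (ind Om z * E z))\<^sup>2) = ind Om z" for z using that by (simp add: norm_mult indicator_def)
   then show ?thesis using a by simp
  qed
  have out: "ind Om w = (0::complex)" if "R < cmod w" for w using that R(2) by (auto simp: indicator_def)
  define C where "C = 2 * (C1 + C2 * a) * (1 + C3 * J)"
  \<comment> \<open>By h ln (1/h) <= 2 sqrt h this choice gives C2 h ln (1/h) J <= 1/2, the
    smallness required for the absorption.\<close>
  define h0 where "h0 = min (1/2) ((1 / (4 * (C2 * J + 1)))\<^sup>2)"
  have cj: "0 <= C2 * J" using C2(1) J by simp
  have C: "0 <= C" unfolding C_def using C1(1) C2(1) C3(1) J a by simp
  have h0: "0 < h0" "h0 <= 1/2" using cj by (auto simp: h0_def)
  have main: "wN ep (%z. v z - sg / (2 * k) * (ind Om z * cnj (osc_exp k z))) <= en (C * (h ^ 3 * ln (1 / h))) \<and>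
   wN ep (%z. u z - sg / (4 * k) * cauchyT (ind Om) z) <= en (C * (h ^ 3 * ln (1 / h)))"
   if sg: "sg \<in> {1, -1::complex}" and k: "k ~= 0" and hk: "h = 1 / cmod k" and hh: "h < h0"
    and u [measurable]: "u \<in> bmeas" and v [measurable]: "v \<in> bmeas" and fu: "wN ep u < \<infinity>" and fv: "wN ep v < \<infinity>"
    and e1: "has_weak_wirtinger_bar u (%z. 1/2 * (ind Om z * (osc_exp k z * v z)))"
    and e2: "has_weak_wirtinger_bar (%z. cnj (v z)) (%z. sg / 2 * (ind Om z * (osc_exp k z * (1 + cnj (u z)))))"
   for sg k h u v
  proof -
   have h: "0 < h" "h <= 1/2"
   proof -
    show "0 < h" using k unfolding hk by simp
    show "h <= 1/2" using hh h0(2) by linarith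
   qed
   have kh: "cmod k = 1 / h" using hk k by simp
   have lh: "0 <= ln (1 / h)" using h by simp
   have sg': "cnj sg = sg" "cmod sg = 1" using sg by auto
   have small: "C2 * (h * ln (1 / h)) * J <= 1/2"
   proof -
    have "sqrt h <= 1 / (4 * (C2 * J + 1))" using hh cj unfolding h0_def by (intro real_le_lsqrt) auto
    then have "h * ln (1 / h) <= 2 * (1 / (4 * (C2 * J + 1)))" using h_ln_le[OF h(1)] by linarith
    then have "C2 * J * (h * ln (1 / h)) <= C2 * J * (2 * (1 / (4 * (C2 * J + 1))))" using cj by (rule mult_left_mono)
    also have "... <= 1/2" using cj by (simp add: field_simps)
    finally show ?thesis by (simp add: mult_ac)
   qed
   define E where "E = osc_exp k"
   have [measurable]: "E \<in> bmeas" unfolding E_def by measurable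
   have nE: "cmod (E z) = 1" "cmod (cnj (E z)) = 1" for z by (simp_all add: E_def)
   define f1 where "f1 = (%z. 1/2 * (ind Om z * (E z * v z)))"
   define f2 where "f2 = (%z. sg / 2 * (ind Om z * (E z * (1 + cnj (u z)))))"
   have [measurable]: "f1 \<in> bmeas" "f2 \<in> bmeas" unfolding f1_def f2_def by measurable
   have N1: "(II z. en ((cmod (f1 z))\<^sup>2)) <= (II z. en ((cmod (ind Om z * v z))\<^sup>2))"
    by (rule nn_integral_mono, rule ennreal_leI, rule power_mono) (simp_all add: f1_def norm_mult nE)
   have N1fin: "(II z. en ((cmod (f1 z))\<^sup>2)) < \<infinity>"
    by (rule le_less_trans[OF order_trans[OF N1 dw[OF v]]]) (use fv in \<open>simp add: ennreal_mult_less_top\<close>)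
   have N2fin: "(II z. en ((cmod (f2 z))\<^sup>2)) < \<infinity>"
   proof -
    have "(II z. en ((cmod (f2 z))\<^sup>2)) <= (II z. en ((cmod (ind Om z * 1 + ind Om z * cnj (u z)))\<^sup>2))"
    proof (rule nn_integral_mono, rule ennreal_leI, rule power_mono)
     fix z show "cmod (f2 z) <= cmod (ind Om z * 1 + ind Om z * cnj (u z))"
     proof (cases "z \<in> Om")
      case True
      then have "cmod (f2 z) = cmod (1 + cnj (u z)) / 2" by (simp add: f2_def norm_mult norm_divide nE sg')
      moreover have "cmod (ind Om z * 1 + ind Om z * cnj (u z)) = cmod (1 + cnj (u z))" using True by simp
      ultimately show ?thesis using norm_ge_zero[of "1 + cnj (u z)"] by linarith
     qed (simp add: f2_def)
    qed simp
    also have "... <= 2 * (II z. en ((cmod (ind Om z * 1))\<^sup>2)) + 2 * (II z. en ((cmod (ind Om z * cnj (u z)))\<^sup>2))"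
     by (rule nn_integral_power2_add_le) measurable
    also have "... <= 2 * en a + 2 * (en J * wN ep (%z. cnj (u z)))"
     by (intro add_mono mult_left_mono dw order_eq_refl[OF Na]) auto
    also have "... < \<infinity>" using fu unfolding wN_cnj by (simp add: ennreal_mult_less_top)
    finally show ?thesis .
   qed
   have s1: "\<forall>w. R < cmod w --> f1 w = 0" and s2: "\<forall>w. R < cmod w --> f2 w = 0" using out by (auto simp: f1_def f2_def)
   have u1: "AE z in lborel. u z = cauchyT f1 z"
    by (rule cauchy_representation[OF e1[folded E_def, folded f1_def] u _ ep fu s1 R00 N1fin]) measurable
   have v1: "AE z in lborel. cnj (v z) = cauchyT f2 z"
   proof (rule cauchy_representation[OF e2[folded E_def, folded f2_def] _ _ ep _ s2 R00 N2fin])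
    show "wN ep (%z. cnj (v z)) < \<infinity>" unfolding wN_cnj by (rule fv)
   qed measurable
   define W where "W = cauchyT f1"
   have [measurable]: "W \<in> bmeas" unfolding W_def by measurable
   define P where "P = (%w. ind Om w * E w)"
   define G where "G = (%y. E y * (ind Om y * cnj (W y)))"
   have [measurable]: "P \<in> bmeas" "G \<in> bmeas" unfolding P_def G_def by measurable
   have NP: "(II z. en ((cmod (P z))\<^sup>2)) < \<infinity>" unfolding P_def by (subst Na) (simp_all add: nE)
   have NG: "(II z. en ((cmod (G z))\<^sup>2)) < \<infinity>"
   proof -
    have "(II z. en ((cmod (G z))\<^sup>2)) = (II z. en ((cmod (ind Om z * W z))\<^sup>2))"
     by (simp add: G_def norm_mult nE)
    also have "... <= en J * wN ep W" by (rule dw) measurable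
    also have "wN ep W = wN ep u" unfolding W_def by (rule wN_cong_AE) (use u1 in \<open>auto elim!: eventually_mono\<close>)
    also have "en J * wN ep u < \<infinity>" using fu by (simp add: ennreal_mult_less_top)
    finally show ?thesis .
   qed
   have sP: "P w = 0" "G w = 0" if "R < cmod w" for w using out[OF that] by (simp_all add: P_def G_def)
   have f2PG: "cauchyT f2 z = sg / 2 * cauchyT (%w. P w + G w) z" for z
   proof -
    have "cauchyT f2 z = cauchyT (%w. sg / 2 * (P w + G w)) z"
    proof (rule cauchyT_cong_AE)
     show "AE w in lborel. f2 w = sg / 2 * (P w + G w)"
      using u1 by eventually_elim (simp add: f2_def P_def G_def W_def algebra_simps)
    qed measurable
    then show ?thesis by (simp only: cauchyT_mult)
   qed
   have addAE: "AE z in lborel. cauchyT (%w. A w + B w) z = cauchyT A z + cauchyT B z"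
    if A: "A \<in> bmeas" "!!w. R < cmod w ==> A w = 0" "(II w. en ((cmod (A w))\<^sup>2)) < \<infinity>"
     and B: "B \<in> bmeas" "!!w. R < cmod w ==> B w = 0" "(II w. en ((cmod (B w))\<^sup>2)) < \<infinity>" for A B
   proof -
    have "AE z in lborel. integrable lborel (%w. A w / (z - w))"
     by (rule cauchy_kernel_integrable_AE[of A R]) (rule A(1), rule A(2), assumption, rule R00, rule A(3))
    moreover have "AE z in lborel. integrable lborel (%w. B w / (z - w))"
     by (rule cauchy_kernel_integrable_AE[of B R]) (rule B(1), rule B(2), assumption, rule R00, rule B(3))
    ultimately show ?thesis
     by eventually_elim (simp add: cauchyT_def add_divide_distrib)
   qed
   \<comment> \<open>The transform of the bare exponential minus its interior value divided by conj
     k. Only the curve integral divided by conj k remains, hence h^2 times h ln (1/h) in squared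
     norm.\<close>
   define S where "S = (%z. cauchyT P z - 1 / cnj k * P z)"
   have [measurable]: "S \<in> bmeas" unfolding S_def by measurable
   define T where "T = osc_cauchy 0 L ga ga' (%s. - 2 * Im (k * ga s))"
   have [measurable]: "T \<in> bmeas" unfolding T_def by (rule osc_cauchy_measurable) (intro continuous_intros cont cont')+
   have SN: "wN ep S <= en (C1 * (h ^ 3 * ln (1 / h)))"
   proof -
    have "wN ep S = wN ep (%z. - (\<i> / (2 * cr pi)) / cnj k * T z)"
    proof (rule wN_cong_AE, rule AE_mp[OF AE_not_in[OF frontier_null_sets[OF cvx]]], rule AE_I2, rule impI)
     fix z assume z: "z \<notin> frontier Om"
     have "cnj k * cauchyT P z = P z - \<i> / (2 * cr pi) * T z"
      using cauchyT_osc_exp[OF z k] unfolding P_def E_def T_def .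
     moreover have "x - 1 / c * p = - b / c * t" if "c ~= 0" "c * x = p - b * t" for b c x p t :: complex
     proof -
      have "x = (p - b * t) / c" using that by (simp add: eq_divide_eq mult.commute)
      then show ?thesis by (simp add: diff_divide_distrib)
     qed
     moreover have "cnj k ~= 0" using k by simp
     ultimately show "S z = - (\<i> / (2 * cr pi)) / cnj k * T z" unfolding S_def by blast
    qed
    also have "... = en ((cmod (- (\<i> / (2 * cr pi)) / cnj k))\<^sup>2) * wN ep T" by (rule wN_cmult) measurable
    also have "cmod (- (\<i> / (2 * cr pi)) / cnj k) = 1 / (2 * pi) * h"
     using kh h by (simp add: norm_divide norm_mult)
    also have "en ((1 / (2 * pi) * h)\<^sup>2) * wN ep T <= en (h\<^sup>2) * en (C1 * (h * ln (1 / h)))"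
    proof (intro mult_mono ennreal_leI)
     have "1 / (2 * pi) * h <= 1 * h" using h pi_ge_two by (intro mult_right_mono) (auto simp: divide_le_eq)
     then show "(1 / (2 * pi) * h)\<^sup>2 <= h\<^sup>2" using h by (intro power_mono) auto
     show "wN ep T <= en (C1 * (h * ln (1 / h)))" unfolding T_def by (rule C1(2)[OF h kh])
    qed auto
    also have "... = en (C1 * (h ^ 3 * ln (1 / h)))"
     by (simp add: ennreal_mult'[symmetric] power3_eq_cube power2_eq_square mult_ac)
    finally show ?thesis .
   qed
   define n1 where "n1 = (II z. en ((cmod (f1 z))\<^sup>2))"
   \<comment> \<open>The factor W is itself a Cauchy transform of a function on \<open>Om\<close>,
     so the composition bound applies and the size of the data enters only through
     \<open>n1\<close>.\<close>
   have GN: "wN ep (cauchyT G) <= en (C2 * (h * ln (1 / h))) * n1"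
    unfolding G_def n1_def
   proof (rule C2(2)[where ta="\<i> * cr pi / (2 * k)"], intro conjI allI)
    have "cmod (\<i> * cr pi / (2 * k)) = pi / 2 * h" using kh h by (simp add: norm_divide norm_mult)
    also have "... <= 2 * h" using h pi_less_4 by (intro mult_right_mono) auto
    finally show "cmod (\<i> * cr pi / (2 * k)) <= 2 * h" .
    show "E (z + \<i> * cr pi / (2 * k)) = - E z" for z unfolding E_def by (rule osc_exp_shift[OF k])
    show "(%y. cnj (W y)) = cauchyT f1 \<or> (%y. cnj (W y)) = (%z. cnj (cauchyT f1 z))" by (simp add: W_def)
    show "R < cmod w --> f1 w = 0" for w using s1 by blast
   qed (use h nE N1fin in auto)
   define R2 where "R2 = (%z. v z - sg / (2 * k) * (ind Om z * cnj (E z)))"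
   have [measurable]: "R2 \<in> bmeas" unfolding R2_def by measurable
   \<comment> \<open>The leading term of the second component is exactly what is subtracted in
     \<open>S\<close>, up to conjugation, which leaves \<open>sg\<close> unchanged because it is
     real. The splitting holds almost everywhere, where both transforms are given by convergent
     integrals.\<close>
   have R2eq: "AE z in lborel. cnj (R2 z) = sg / 2 * (S z + cauchyT G z)"
   proof -
    have "AE z in lborel. cauchyT (%w. P w + G w) z = cauchyT P z + cauchyT G z"
     by (rule addAE) (use sP NP NG in simp_all)
    with v1 show ?thesis
    proof eventually_elim
     case (elim z)
     have "cnj (R2 z) = cnj (v z) - sg / 2 * (1 / cnj k * P z)" by (cases "z \<in> Om") (simp_all add: R2_def P_def sg')
     also have "... = sg / 2 * (S z + cauchyT G z)" unfolding elim(1) f2PG elim(2) S_def by (simp only: right_diff_distrib[symmetric]) (simp add: algebra_simps)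
     finally show ?case .
    qed
   qed
   define X where "X = wN ep R2"
   have XS: "X <= wN ep S + wN ep (cauchyT G)"
   proof -
    have "X = wN ep (%z. sg / 2 * (S z + cauchyT G z))" unfolding X_def wN_cnj[of ep R2, symmetric] by (rule wN_cong_AE[OF R2eq])
    also have "... = en ((cmod (sg / 2))\<^sup>2) * wN ep (%z. S z + cauchyT G z)" by (rule wN_cmult) measurable
    also have "... <= en (1/2) * (2 * wN ep S + 2 * wN ep (cauchyT G))"
     by (intro mult_mono ennreal_leI wN_add_le) (auto simp: norm_divide sg' power2_eq_square)
    also have "... = wN ep S + wN ep (cauchyT G)"
    proof -
     have "en (1/2) * 2 = 1" using ennreal_mult[of "1/2" 2] by simp
     then show ?thesis by (simp only: distrib_left mult.assoc[symmetric] mult_1_left)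
    qed
    finally show ?thesis .
   qed
   have DR: "(II z. en ((cmod (ind Om z * R2 z))\<^sup>2)) <= en J * X" unfolding X_def by (rule dw) measurable
   \<comment> \<open>Substituting v = R2 + leading term into \<open>f1\<close> cancels the
     exponential in the second summand and leaves sg / (4 k) on \<open>Om\<close>. Thus the data are
     bounded by the unknown norm X and a known quantity of order h^2.\<close>
   have n1X: "n1 <= en J * X + en (h\<^sup>2 * a)"
   proof -
    have eq: "f1 z = 1/2 * (ind Om z * (E z * R2 z)) + sg / (4 * k) * (ind Om z * 1)" for z
     using osc_exp_cnj[of k z] k unfolding f1_def R2_def E_def[symmetric] by (cases "z \<in> Om") (simp_all add: field_simps)
    have "n1 <= 2 * (II z. en ((cmod (1/2 * (ind Om z * (E z * R2 z))))\<^sup>2)) + 2 * (II z. en ((cmod (sg / (4 * k) * (ind Om z * 1)))\<^sup>2))"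
     unfolding n1_def eq by (rule nn_integral_power2_add_le) measurable
    also have "(II z. en ((cmod (1/2 * (ind Om z * (E z * R2 z))))\<^sup>2)) = en (1/4) * (II z. en ((cmod (ind Om z * R2 z))\<^sup>2))"
     by (subst nn_integral_cmult[symmetric]) (auto simp: norm_mult nE power_mult_distrib power2_eq_square ennreal_mult[symmetric] intro!: nn_integral_cong)
    also have "(II z. en ((cmod (sg / (4 * k) * (ind Om z * 1)))\<^sup>2)) = en (h\<^sup>2 / 16) * (II z. en ((cmod (ind Om z * 1))\<^sup>2))"
    proof (subst nn_integral_cmult[symmetric])
     have "(cmod (sg / (4 * k) * (ind Om z * 1)))\<^sup>2 = h\<^sup>2 / 16 * (cmod (ind Om z * 1))\<^sup>2" for z
      unfolding norm_mult norm_divide sg' kh using h by (simp add: power_mult_distrib power_divide)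
     then show "(II z. en ((cmod (sg / (4 * k) * (ind Om z * 1)))\<^sup>2)) = (II z. en (h\<^sup>2 / 16) * en ((cmod (ind Om z * 1))\<^sup>2))"
      by (simp only: ennreal_mult zero_le_power2 divide_nonneg_nonneg zero_le_numeral)
    qed measurable
    also have "(II z. en ((cmod (ind Om z * 1))\<^sup>2)) = en a" by (rule Na) simp
    also have "2 * (en (1/4) * (II z. en ((cmod (ind Om z * R2 z))\<^sup>2))) + 2 * (en (h\<^sup>2 / 16) * en a)
      <= 1 * (en J * X) + en (h\<^sup>2 * a)"
    proof (rule add_mono)
     have "2 * en (1/4) = en 2 * en (1/4)" by simp
     also have "... = en (2 * (1/4))" by (rule ennreal_mult[symmetric]) simp_all
     also have "... <= en 1" by (rule ennreal_leI) simp
     finally have "2 * en (1/4) <= 1" by (simp only: ennreal_1)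
     then show "2 * (en (1/4) * (II z. en ((cmod (ind Om z * R2 z))\<^sup>2))) <= 1 * (en J * X)"
      unfolding mult.assoc[symmetric, of 2] by (intro mult_mono DR) auto
     have m1: "en (h\<^sup>2 / 16 * a) = en (h\<^sup>2 / 16) * en a" by (rule ennreal_mult) (simp_all add: a)
     have m2: "en (2 * (h\<^sup>2 / 16 * a)) = en 2 * en (h\<^sup>2 / 16 * a)" by (rule ennreal_mult) (simp_all add: a)
     have "2 * (en (h\<^sup>2 / 16) * en a) = en (2 * (h\<^sup>2 / 16 * a))" by (simp only: m1 m2 ennreal_numeral)
     also have "... <= en (h\<^sup>2 * a)" using a by (intro ennreal_leI) simp
     finally show "2 * (en (h\<^sup>2 / 16) * en a) <= en (h\<^sup>2 * a)" .
    qed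
    finally show ?thesis by simp
   qed
   have Xle: "X <= en (C1 * (h ^ 3 * ln (1 / h))) + en (C2 * (h * ln (1 / h))) * n1"
    by (rule order_trans[OF XS add_mono[OF SN GN]])
   \<comment> \<open>Finiteness is secured before the absorption, from the finiteness of the data
     alone.\<close>
   have Xfin: "X < \<infinity>"
    by (rule le_less_trans[OF Xle]) (use N1fin in \<open>simp add: n1_def ennreal_mult_less_top\<close>)
   have Xb: "X <= en (2 * (C1 + C2 * a) * (h ^ 3 * ln (1 / h)))"
   proof -
    have "X <= en (C1 * (h ^ 3 * ln (1 / h))) + en (C2 * (h * ln (1 / h))) * (en J * X + en (h\<^sup>2 * a))"
     by (rule order_trans[OF Xle]) (intro add_left_mono mult_left_mono n1X, simp)
    then have "X <= en (2 * (C1 * (h ^ 3 * ln (1 / h)) + C2 * (h * ln (1 / h)) * (h\<^sup>2 * a)))"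
     by (rule ennreal_absorb) (use Xfin C1(1) C2(1) h lh J a small in auto)
    also have "2 * (C1 * (h ^ 3 * ln (1 / h)) + C2 * (h * ln (1 / h)) * (h\<^sup>2 * a)) = 2 * (C1 + C2 * a) * (h ^ 3 * ln (1 / h))"
     by (simp add: power3_eq_cube power2_eq_square algebra_simps)
    finally show ?thesis .
   qed
   have hl: "0 <= h ^ 3 * ln (1 / h)" using h lh by simp
   have c12: "0 <= 2 * (C1 + C2 * a)" "0 <= C3 * J" using C1(1) C2(1) C3(1) a J by auto
   have R2b: "X <= en (C * (h ^ 3 * ln (1 / h)))"
   proof (rule order_trans[OF Xb], rule ennreal_leI, rule mult_right_mono[OF _ hl])
    show "2 * (C1 + C2 * a) <= C" unfolding C_def using c12 by (simp add: mult_le_cancel_left1)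
   qed
   have R1b: "wN ep (%z. u z - sg / (4 * k) * cauchyT (ind Om) z) <= en (C * (h ^ 3 * ln (1 / h)))"
   proof -
    \<comment> \<open>The part of \<open>f1\<close> that comes from the error R2. The other part
      \<open>Q\<close> is nonoscillating, since the exponential times its conjugate is 1, and its
      transform is the leading term of the first component.\<close>
    define H where "H = (%z. 1/2 * (ind Om z * (E z * R2 z)))"
    have [measurable]: "H \<in> bmeas" unfolding H_def by measurable
    have NH: "(II z. en ((cmod (H z))\<^sup>2)) <= en J * X"
    proof (rule order_trans[OF _ DR], rule nn_integral_mono, rule ennreal_leI, rule power_mono)
     show "cmod (H z) <= cmod (ind Om z * R2 z)" for z by (simp add: H_def norm_mult nE)
    qed simp
    have NHfin: "(II z. en ((cmod (H z))\<^sup>2)) < \<infinity>"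
     by (rule le_less_trans[OF NH]) (use Xfin in \<open>simp add: ennreal_mult_less_top\<close>)
    define Q where "Q = (%z. sg / (4 * k) * (ind Om z :: complex))"
    have [measurable]: "Q \<in> bmeas" unfolding Q_def by measurable
    have NQ: "(II z. en ((cmod (Q z))\<^sup>2)) < \<infinity>"
    proof -
     have "(II z. en ((cmod (Q z))\<^sup>2)) = (II z. en ((cmod (sg / (4 * k)))\<^sup>2) * ind Om z)"
      by (intro nn_integral_cong) (simp add: Q_def norm_mult indicator_def)
     also have "... = en ((cmod (sg / (4 * k)))\<^sup>2) * en a" using a by (simp add: nn_integral_cmult_indicator)
     also have "... < \<infinity>" by (simp add: ennreal_mult_less_top)
     finally show ?thesis .
    qed
    have f1HQ: "f1 = (%z. H z + Q z)"
    proof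
     fix z show "f1 z = H z + Q z"
      using osc_exp_cnj[of k z] k unfolding f1_def H_def Q_def R2_def E_def[symmetric] by (cases "z \<in> Om") (simp_all add: field_simps)
    qed
    have "AE z in lborel. cauchyT (%w. H w + Q w) z = cauchyT H z + cauchyT Q z"
     by (rule addAE) (use out NHfin NQ in \<open>simp_all add: H_def Q_def\<close>)
    note HQ = this
    have Qm: "cauchyT Q z = sg / (4 * k) * cauchyT (ind Om) z" for z unfolding Q_def by (rule cauchyT_mult)
    from HQ u1 have "AE z in lborel. u z - sg / (4 * k) * cauchyT (ind Om) z = cauchyT H z"
     unfolding f1HQ by eventually_elim (simp add: Qm)
    then have "wN ep (%z. u z - sg / (4 * k) * cauchyT (ind Om) z) = wN ep (cauchyT H)" by (rule wN_cong_AE)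
    also have "... <= en C3 * (II z. en ((cmod (H z))\<^sup>2))"
     by (rule C3(2)) (use out in \<open>simp_all add: H_def\<close>)
    also have "... <= en C3 * (en J * en (2 * (C1 + C2 * a) * (h ^ 3 * ln (1 / h))))"
     by (rule mult_left_mono[OF order_trans[OF NH mult_left_mono[OF Xb]]]) simp_all
    also have "... = en (C3 * J * (2 * (C1 + C2 * a)) * (h ^ 3 * ln (1 / h)))"
     using C3(1) J c12 hl by (simp only: ennreal_mult[symmetric] mult_nonneg_nonneg) (simp only: mult_ac)
    also have "... <= en (C * (h ^ 3 * ln (1 / h)))"
    proof (rule ennreal_leI, rule mult_right_mono[OF _ hl])
     show "C3 * J * (2 * (C1 + C2 * a)) <= C" 
     proof -
      have "C = 2 * (C1 + C2 * a) + C3 * J * (2 * (C1 + C2 * a))" by (simp add: C_def algebra_simps)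
      then show ?thesis using c12(1) by linarith
     qed
    qed
    finally show ?thesis .
   qed
   show ?thesis using R2b R1b unfolding X_def R2_def E_def by blast
  qed
  show ?thesis
   by (rule exI[of _ C], rule exI[of _ h0], intro conjI C h0, intro allI impI, (rule main; assumption))
 qed
qed

section \<open>Transfer to the notation of the theorem\<close>

lemma E_op_indicator:
 assumes "open Om" "h ~= 0"
 shows "cr h * E_op h (ind Om) z = cauchyT (ind Om) z"
proof -
 have [measurable]: "Om \<in> sets borel" using assms(1) by simp
 have "(LINT w|lebesgue. (ind Om w :: complex) / (z - w)) = (LINT w|lborel. ind Om w / (z - w))"
  by (rule integral_completion) measurable
 then show ?thesis using assms(2) by (simp add: E_op_def cauchyT_def)
qed

text \<open>From |k| z conj omega = - 2 i k z the real part is 2 Im (k z), which is minus the phase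
  of \<open>osc_exp\<close>.\<close>

lemma osc_phase:
 assumes "k ~= 0" "om = 2 * \<i> * cnj k / cr (cmod k)"
 shows "exp (\<i> * cr (cmod k * Re (z * cnj om))) = cnj (osc_exp k z)"
proof -
 have gen: "c * (z * (- 2 * \<i> * k / c)) = - 2 * \<i> * (k * z)" if "c ~= 0" for c :: complex using that by (simp add: field_simps)
 have "cnj om = - 2 * \<i> * k / cr (cmod k)" unfolding assms(2) by simp
 then have "cr (cmod k) * (z * cnj om) = - 2 * \<i> * (k * z)" using gen[of "cr (cmod k)"] assms(1) by (simp only: of_real_eq_0_iff norm_eq_zero not_False_eq_True)
 note eq = this
 have "cmod k * Re (z * cnj om) = Re (cr (cmod k) * (z * cnj om))" by simp
 also have "... = 2 * Im (k * z)" unfolding eq by simp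
 finally have "cmod k * Re (z * cnj om) = 2 * Im (k * z)" .
 note ph = this
 have cn: "cnj (exp (\<i> * cr t)) = exp (\<i> * cr (- t))" for t by (simp add: exp_cnj)
 have mm: "- (- 2 * t) = 2 * t" for t :: real by simp
 show ?thesis unfolding ph osc_exp_eq cn mm ..
qed

text \<open>The constants are fixed before the sign, k and the solution, so the estimate is uniform
  in k. It is asserted for every solution in the weighted space and thus applies to the unique one.
  The constant is the square root of the one for the squared norms, and h^3 ln (1/h) becomes the
  stated rate.\<close>

theorem mainTheorem8:
  fixes \<Omega> :: "complex set" and \<epsilon> :: real
  assumes "strictly_convex_analytic_domain \<Omega>"
    and "0 < \<epsilon>" and "\<epsilon> \<le> 1"
  shows "\<exists>C h\<^sub>0. 0 < h\<^sub>0 \<and>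
    (\<forall>\<sigma>\<in>{1, -1}. \<forall>k \<phi>\<^sub>1\<^sub>1 \<phi>\<^sub>2\<^sub>1 h \<omega> R\<^sub>1 R\<^sub>2.
       k \<noteq> 0 \<and> h = 1 / cmod k \<and> h < h\<^sub>0 \<and>
       \<omega> = 2 * \<i> * cnj k / complex_of_real (cmod k) \<and>
       \<phi>\<^sub>1\<^sub>1 \<in> weighted_L2 \<epsilon> \<and> \<phi>\<^sub>2\<^sub>1 \<in> weighted_L2 \<epsilon> \<and>
       dirac_system \<sigma> (indicator \<Omega>) k (\<lambda>z. 1 + \<phi>\<^sub>1\<^sub>1 z) \<phi>\<^sub>2\<^sub>1 \<and>
       R\<^sub>2 = (\<lambda>z. \<phi>\<^sub>2\<^sub>1 z - \<sigma> / (2 * k)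
                * exp (\<i> * complex_of_real (cmod k * Re (z * cnj \<omega>))) * indicator \<Omega> z) \<and>
       R\<^sub>1 = (\<lambda>z. \<phi>\<^sub>1\<^sub>1 z - \<sigma> * complex_of_real h / (4 * k) * E_op h (indicator \<Omega>) z)
       \<longrightarrow>
       R\<^sub>2 \<in> weighted_L2 \<epsilon> \<and>
       weighted_L2_norm \<epsilon> R\<^sub>2 \<le> C * (h powr (3/2) * sqrt (ln (1 / h))) \<and>
       R\<^sub>1 \<in> weighted_L2 \<epsilon> \<and>
       weighted_L2_norm \<epsilon> R\<^sub>1 \<le> C * (h powr (3/2) * sqrt (ln (1 / h))))"
proof -
  have \<Omega>: "open \<Omega>" using assms(1) by (simp add: strictly_convex_analytic_domain_def)
  have [measurable]: "\<Omega> \<in> sets borel" using \<Omega> by simp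
  from dirac_estimates[OF assms] obtain C h0 where C: "0 \<le> C" and h0: "0 < h0" "h0 \<le> 1/2" and est0: "\<forall>\<sigma> k h u v. \<sigma> \<in> {1, -1::complex} \<longrightarrow> k \<noteq> 0 \<longrightarrow> h = 1 / cmod k \<longrightarrow> h < h0 \<longrightarrow>
     u \<in> borel_measurable borel \<longrightarrow> v \<in> borel_measurable borel \<longrightarrow> wN \<epsilon> u < \<infinity> \<longrightarrow> wN \<epsilon> v < \<infinity> \<longrightarrow>
     has_weak_wirtinger_bar u (\<lambda>z. 1/2 * (indicator \<Omega> z * (osc_exp k z * v z))) \<longrightarrow>
     has_weak_wirtinger_bar (\<lambda>z. cnj (v z)) (\<lambda>z. \<sigma> / 2 * (indicator \<Omega> z * (osc_exp k z * (1 + cnj (u z))))) \<longrightarrow>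
     wN \<epsilon> (\<lambda>z. v z - \<sigma> / (2 * k) * (indicator \<Omega> z * cnj (osc_exp k z))) \<le> ennreal (C * (h ^ 3 * ln (1 / h))) \<and>
     wN \<epsilon> (\<lambda>z. u z - \<sigma> / (4 * k) * cauchyT (indicator \<Omega>) z) \<le> ennreal (C * (h ^ 3 * ln (1 / h)))"
    by (elim exE conjE) (rule that)
  note est = est0[rule_format]
  have main: "R2 \<in> weighted_L2 \<epsilon> \<and> weighted_L2_norm \<epsilon> R2 \<le> sqrt C * (h powr (3/2) * sqrt (ln (1 / h))) \<and>
       R1 \<in> weighted_L2 \<epsilon> \<and> weighted_L2_norm \<epsilon> R1 \<le> sqrt C * (h powr (3/2) * sqrt (ln (1 / h)))"
    if \<sigma>: "\<sigma> \<in> {1, -1::complex}" and k: "k \<noteq> 0" and h: "h = 1 / cmod k" "h < h0"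
      and \<omega>: "\<omega> = 2 * \<i> * cnj k / complex_of_real (cmod k)"
      and p1: "p1 \<in> weighted_L2 \<epsilon>" and p2: "p2 \<in> weighted_L2 \<epsilon>"
      and sys: "dirac_system \<sigma> (indicator \<Omega>) k (\<lambda>z. 1 + p1 z) p2"
      and R2: "R2 = (\<lambda>z. p2 z - \<sigma> / (2 * k) * exp (\<i> * complex_of_real (cmod k * Re (z * cnj \<omega>))) * indicator \<Omega> z)"
      and R1: "R1 = (\<lambda>z. p1 z - \<sigma> * complex_of_real h / (4 * k) * E_op h (indicator \<Omega>) z)"
    for \<sigma> k p1 p2 h \<omega> R1 R2
  proof -
    have hpos: "0 < h" "h < 1"
    proof -
      show "0 < h" using k unfolding h(1) by simp
      show "h < 1" using h(2) h0(2) by linarith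
    qed
    have \<sigma>': "cnj \<sigma> = \<sigma>" using \<sigma> by auto
    note m = weighted_L2_measurable(1)[OF p1] weighted_L2_measurable(1)[OF p2]
    \<comment> \<open>Borel representatives of the two components, to which the weak equations are
      transferred before the estimates are applied.\<close>
    obtain u where u [measurable]: "u \<in> borel_measurable borel" and ue: "AE z in lborel. p1 z = u z"
      using completion_ex_borel_measurable_complex[OF m(1)] .
    obtain v where v [measurable]: "v \<in> borel_measurable borel" and ve: "AE z in lborel. p2 z = v z"
      using completion_ex_borel_measurable_complex[OF m(2)] .
    have fu: "wN \<epsilon> u < \<infinity>" using weighted_L2_measurable(2)[OF p1] wN_cong_AE[OF ue, of \<epsilon>] by (simp add: wN_def)
    have fv: "wN \<epsilon> v < \<infinity>" using weighted_L2_measurable(2)[OF p2] wN_cong_AE[OF ve, of \<epsilon>] by (simp add: wN_def)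
    have [measurable]: "(indicator \<Omega> :: complex \<Rightarrow> complex) \<in> borel_measurable lebesgue" "osc_exp k \<in> borel_measurable lebesgue"
      by (rule lebesgue_measurable_of_borel, measurable)+
    note [measurable] = m
    have w1: "has_weak_wirtinger_bar p1 (\<lambda>z. 1/2 * (indicator \<Omega> z * (osc_exp k z * p2 z)))"
      using has_weak_wirtinger_bar_drop_const[of 1 p1] sys unfolding dirac_system_def osc_exp_def by (simp only: mult.assoc)
    have w2: "has_weak_wirtinger_bar (\<lambda>z. cnj (p2 z)) (\<lambda>z. \<sigma> / 2 * (indicator \<Omega> z * (osc_exp k z * (1 + cnj (p1 z)))))"
    proof -
      have "has_weak_wirtinger_bar (\<lambda>z. cnj (p2 z)) (\<lambda>z. cnj (\<sigma> / 2 * cnj (indicator \<Omega> z) * exp (k * z - cnj (k * z)) * (1 + p1 z)))"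
        using sys unfolding dirac_system_def by (intro has_weak_wirtinger_cnj) blast
      moreover have "cnj (\<sigma> / 2 * cnj (indicator \<Omega> z) * exp (k * z - cnj (k * z)) * (1 + p1 z)) = \<sigma> / 2 * (indicator \<Omega> z * (osc_exp k z * (1 + cnj (p1 z))))" for z
        by (simp add: \<sigma>' osc_exp_def exp_cnj mult.assoc)
      ultimately show ?thesis by (simp only:)
    qed
    have w1': "has_weak_wirtinger_bar u (\<lambda>z. 1/2 * (indicator \<Omega> z * (osc_exp k z * v z)))"
    proof (rule has_weak_wirtinger_bar_cong_AE[OF w1 _ _ _ _ ue])
      show "AE z in lborel. 1/2 * (indicator \<Omega> z * (osc_exp k z * p2 z)) = 1/2 * (indicator \<Omega> z * (osc_exp k z * v z))"
        using ve by eventually_elim simp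
    qed measurable
    have w2': "has_weak_wirtinger_bar (\<lambda>z. cnj (v z)) (\<lambda>z. \<sigma> / 2 * (indicator \<Omega> z * (osc_exp k z * (1 + cnj (u z)))))"
    proof (rule has_weak_wirtinger_bar_cong_AE[OF w2])
      show "AE z in lborel. cnj (p2 z) = cnj (v z)" using ve by eventually_elim simp
      show "AE z in lborel. \<sigma> / 2 * (indicator \<Omega> z * (osc_exp k z * (1 + cnj (p1 z)))) = \<sigma> / 2 * (indicator \<Omega> z * (osc_exp k z * (1 + cnj (u z))))"
        using ue by eventually_elim simp
    qed measurable
    note e = est[OF \<sigma> k h u v fu fv w1' w2']
    have B: "0 \<le> C * (h ^ 3 * ln (1 / h))" using C hpos by simp
    have sB: "sqrt (C * (h ^ 3 * ln (1 / h))) = sqrt C * (h powr (3/2) * sqrt (ln (1 / h)))"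
    proof -
      have "sqrt (h ^ 3) = h powr (3/2)" using hpos by (simp add: powr_half_sqrt[symmetric] powr_powr flip: powr_numeral)
      then show ?thesis by (simp only: real_sqrt_mult)
    qed
    have R2eq: "R2 = (\<lambda>z. p2 z - \<sigma> / (2 * k) * (indicator \<Omega> z * cnj (osc_exp k z)))"
      unfolding R2 osc_phase[OF k \<omega>] by (simp add: mult_ac)
    have R1eq: "R1 = (\<lambda>z. p1 z - \<sigma> / (4 * k) * cauchyT (indicator \<Omega>) z)"
      unfolding R1 using E_op_indicator[OF \<Omega>, of h] hpos by (simp flip: times_divide_eq_left add: mult.assoc)
    have cT [measurable]: "cauchyT (indicator \<Omega>) \<in> borel_measurable lebesgue"
      by (rule lebesgue_measurable_of_borel) measurable
    have mR: "R2 \<in> borel_measurable lebesgue" "R1 \<in> borel_measurable lebesgue" unfolding R2eq R1eq by measurable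
    have a2: "AE z in lborel. R2 z = v z - \<sigma> / (2 * k) * (indicator \<Omega> z * cnj (osc_exp k z))" unfolding R2eq using ve by eventually_elim simp
    have a1: "AE z in lborel. R1 z = u z - \<sigma> / (4 * k) * cauchyT (indicator \<Omega>) z" unfolding R1eq using ue by eventually_elim simp
    show ?thesis
      using weighted_L2_bound[OF mR(1) a2 conjunct1[OF e] B] weighted_L2_bound[OF mR(2) a1 conjunct2[OF e] B] unfolding sB by blast
  qed
  show ?thesis
    by (rule exI[of _ "sqrt C"], rule exI[of _ h0], rule conjI, rule h0(1), intro ballI allI impI, elim conjE, (rule main; assumption))
qed

end
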